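(* Let $X = G/K$ be a symmetric space of non-compact type. Any generalized Satake compactification of $X$ is isomorphic to the horofunction compactification of $X$ with respect to some polyhedral $G$-invariant Finsler metric on $X$. More precisely, let $\tau : G \to \mathrm{PSL}(n,\mathbb{C})$ be a faithful projective representation (not necessarily irreducible) with weights $\mu_1,\dots,\mu_k \in \mathfrak{a}^*$, let $D = \mathrm{conv}(\mu_1,\dots,\mu_k)\subset \mathfrak{a}^*$, and let $B = -D^\circ = (-D)^\circ \subset \mathfrak{a}$ be the polytope dual to $-D$. Let $d$ be the distance of the $G$-invariant Finsler metric on $X$ whose unit ball in $\mathfrak{a}$ is $B$. Then the generalized Satake compactification $\overline{X}^S_\tau$ is $G$-equivariantly isomorphic to the horofunction compactification $\overline{X}^{hor}_d$ of $(X,d)$.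
   Context: Setting: $G$ is a real semisimple Lie group with finite center, $K<G$ a maximal compact subgroup, $X=G/K$ the associated symmetric space of non-compact type, $p_0=eK$. $\mathfrak{g}=\mathfrak{k}\oplus\mathfrak{p}$ is the Cartan decomposition (with Cartan involution $\vartheta$), $\mathfrak{a}\subset\mathfrak{p}$ a maximal abelian subalgebra, $A=\exp(\mathfrak{a})$, and $W=N_K(\mathfrak{a})/C_K(\mathfrak{a})$ the Weyl group. Finsler metrics: A Finsler metric is a continuous function on the tangent bundle whose restriction to each tangent space is a (possibly asymmetric) norm; its (forward) distance $d(p,q)$ is the infimum of the lengths of piecewise $C^1$ curves from $p$ to $q$. $G$-invariant Finsler metrics on $X$ are in bijection with $W$-invariant convex closed balls $B\subset\mathfrak{a}$ (compact convex sets with $0$ in the interior): identifying $T_{p_0}X\cong\mathfrak{p}$, the unit ball of the metric at $p_0$ is the convex set $\mathrm{Ad}(K)B$, whose intersection with $\mathfrak a$ is $B$. The metric is polyhedral if $B$ is a finite-sided polytope. Horofunction compactification: Let $C_{p_0}(X)$ be the space of continuous functions on $X$ vanishing at $p_0$, with the topology of uniform convergence on bounded sets (bounded with respect to $d_{sym}(x,y)=d(x,y)+d(y,x)$). Let $\psi:X\to C_{p_0}(X)$, $\psi_z(x)=d(x,z)-d(p_0,z)$. Then $\overline{X}^{hor}_d$ is the closure of $\psi(X)$, with $G$ acting by $(g\cdot f)(x)=f(g^{-1}x)-f(g^{-1}p_0)$. Polar duality: for a convex set $C$ in a finite-dimensional real vector space, $C^\circ=\{y : \langle y|x\rangle\ge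 -1\ \forall x\in C\}$ in the dual space. Generalized Satake compactification: let $\tau:G\to \mathrm{PSL}(n,\mathbb{C})$ be a faithful projective representation with $\tau(\vartheta(g))=(\tau(g)^* )^{-1}$ for all $g\in G$, where $*$ is conjugate transpose. Let $\mathcal{H}_n$ be the real vector space of Hermitian $n\times n$ matrices and $\mathrm{P}(\mathcal{H}_n)$ its projective space. The map $X\to \mathrm{P}(\mathcal{H}_n)$, $gK\mapsto[\tau(g)\tau(g)^*]$, is an embedding, and $\overline{X}^S_\tau$ is the closure of its image; $G$ acts by $g\cdot [M]=[\tau(g)M\tau(g)^*]$. The weights of $\tau$ are the (restricted) weights: the linear functionals $\mu\in\mathfrak{a}^*$ which occur as simultaneous eigenvalues of $d\tau(\mathfrak{a})\subset\mathfrak{sl}(n,\mathbb{C})$ acting on $\mathbb{C}^n$. $G$-equivariantly isomorphic means that there is a $G$-equivariant homeomorphism between the two compactifications restricting to the identity on $X$. *)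

theory Defs
  imports "HOL-Analysis.Analysis" "HOL-Algebra.Left_Coset"
begin

section \<open>Quotient topologies\<close>

definition quotient_topology :: "'a topology \<Rightarrow> ('a \<Rightarrow> 'b) \<Rightarrow> 'b topology" where
  "quotient_topology T q =
     topology (\<lambda>U. U \<subseteq> q ` topspace T \<and> openin T {x \<in> topspace T. q x \<in> U})"

lemma openin_quotient_topology:
  "openin (quotient_topology T q) U \<longleftrightarrow>
     U \<subseteq> q ` topspace T \<and> openin T {x \<in> topspace T. q x \<in> U}"
proof -
  have "istopology (\<lambda>U. U \<subseteq> q ` topspace T \<and> openin T {x \<in> topspace T. q x \<in> U})"
    unfolding istopology_def
  proof (intro conjI allI impI)
    fix S U assume "S \<subseteq> q ` topspace T \<and> openin T {x \<in> topspace T. q x \<in> S}"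
      and "U \<subseteq> q ` topspace T \<and> openin T {x \<in> topspace T. q x \<in> U}"
    moreover have "{x \<in> topspace T. q x \<in> S \<inter> U} =
        {x \<in> topspace T. q x \<in> S} \<inter> {x \<in> topspace T. q x \<in> U}" by auto
    ultimately show "S \<inter> U \<subseteq> q ` topspace T" and "openin T {x \<in> topspace T. q x \<in> S \<inter> U}"
      by (auto intro: openin_Int)
  next
    fix \<K> assume *: "\<forall>S\<in>\<K>. S \<subseteq> q ` topspace T \<and> openin T {x \<in> topspace T. q x \<in> S}"
    then show "\<Union>\<K> \<subseteq> q ` topspace T" by blast
    have "{x \<in> topspace T. q x \<in> \<Union>\<K>} = \<Union>((\<lambda>S. {x \<in> topspace T. q x \<in> S}) ` \<K>)" by auto
    with * show "openin T {x \<in> topspace T. q x \<in> \<Union>\<K>}" by auto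
  qed
  then show ?thesis
    by (simp add: quotient_topology_def topology_inverse')
qed

section \<open>Lie groups\<close>

text \<open>The two notions below are meant for open \<open>S\<close>.\<close>

primrec Ck_on :: "nat \<Rightarrow> 'a::euclidean_space set \<Rightarrow> ('a \<Rightarrow> 'b::real_normed_vector) \<Rightarrow> bool" where
  "Ck_on 0 S f = continuous_on S f"
| "Ck_on (Suc k) S f =
     (f differentiable_on S \<and> (\<forall>v. Ck_on k S (\<lambda>x. frechet_derivative f (at x) v)))"

definition smooth_on :: "'a::euclidean_space set \<Rightarrow> ('a \<Rightarrow> 'b::real_normed_vector) \<Rightarrow> bool" where
  "smooth_on S f \<longleftrightarrow> (\<forall>k. Ck_on k S f)"

text \<open>A group together with a topology and a smooth atlas modelled on the Euclidean space \<open>'e\<close>.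
  A chart is a pair of its domain and its coordinate map.\<close>

record ('g, 'e) lie_struct = "'g monoid" +
  lie_top :: "'g topology"
  lie_atlas :: "('g set \<times> ('g \<Rightarrow> 'e)) set"

definition smooth_manifold :: "'g topology \<Rightarrow> ('g set \<times> ('g \<Rightarrow> 'e::euclidean_space)) set \<Rightarrow> bool" where
  "smooth_manifold T \<A> \<longleftrightarrow>
     Hausdorff_space T \<and>
     second_countable T \<and>
     (\<Union>(fst ` \<A>) = topspace T) \<and>
     (\<forall>(U, \<phi>)\<in>\<A>. openin T U \<and> open (\<phi> ` U) \<and>
        homeomorphic_map (subtopology T U) (top_of_set (\<phi> ` U)) \<phi>) \<and>
     (\<forall>(U, \<phi>)\<in>\<A>. \<forall>(V, \<psi>)\<in>\<A>. smooth_on (\<phi> ` (U \<inter> V)) (\<lambda>x. \<psi> (inv_into U \<phi> x)))"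

definition lie_group :: "('g, 'e::euclidean_space) lie_struct \<Rightarrow> bool" where
  "lie_group G \<longleftrightarrow>
     group G \<and> topspace (lie_top G) = carrier G \<and> smooth_manifold (lie_top G) (lie_atlas G) \<and>
     continuous_map (prod_topology (lie_top G) (lie_top G)) (lie_top G) (\<lambda>(g, h). g \<otimes>\<^bsub>G\<^esub> h) \<and>
     (\<forall>(U, \<phi>)\<in>lie_atlas G. \<forall>(V, \<psi>)\<in>lie_atlas G. \<forall>(W, \<eta>)\<in>lie_atlas G.
        smooth_on {(x, y). x \<in> \<phi> ` U \<and> y \<in> \<psi> ` V \<and> inv_into U \<phi> x \<otimes>\<^bsub>G\<^esub> inv_into V \<psi> y \<in> W}
          (\<lambda>(x, y). \<eta> (inv_into U \<phi> x \<otimes>\<^bsub>G\<^esub> inv_into V \<psi> y))) \<and>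
     continuous_map (lie_top G) (lie_top G) (\<lambda>g. inv\<^bsub>G\<^esub> g) \<and>
     (\<forall>(U, \<phi>)\<in>lie_atlas G. \<forall>(W, \<eta>)\<in>lie_atlas G.
        smooth_on {x \<in> \<phi> ` U. inv\<^bsub>G\<^esub> (inv_into U \<phi> x) \<in> W} (\<lambda>x. \<eta> (inv\<^bsub>G\<^esub> (inv_into U \<phi> x))))"

section \<open>The Lie algebra\<close>

text \<open>The tangent space at the identity is identified with \<open>'e\<close> by the differential of a fixed
  chart around the identity, shifted so that the identity has coordinate \<open>0\<close>. Hence \<open>'e\<close>, with the
  bracket below, is the Lie algebra of \<open>G\<close>.\<close>

definition id_chart :: "('g, 'e::euclidean_space) lie_struct \<Rightarrow> 'g set \<times> ('g \<Rightarrow> 'e)" where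
  "id_chart G = (SOME c. c \<in> lie_atlas G \<and> \<one>\<^bsub>G\<^esub> \<in> fst c)"

definition coord :: "('g, 'e::euclidean_space) lie_struct \<Rightarrow> 'g \<Rightarrow> 'e" where
  "coord G g = snd (id_chart G) g - snd (id_chart G) \<one>\<^bsub>G\<^esub>"

definition from_coord :: "('g, 'e::euclidean_space) lie_struct \<Rightarrow> 'e \<Rightarrow> 'g" where
  "from_coord G Z =
     inv_into (fst (id_chart G)) (snd (id_chart G)) (snd (id_chart G) \<one>\<^bsub>G\<^esub> + Z)"

definition diff_at_one :: "('g, 'e::euclidean_space) lie_struct \<Rightarrow> ('g \<Rightarrow> 'g) \<Rightarrow> 'e \<Rightarrow> 'e" where
  "diff_at_one G f = frechet_derivative (\<lambda>Z. coord G (f (from_coord G Z))) (at 0)"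

definition Ad :: "('g, 'e::euclidean_space) lie_struct \<Rightarrow> 'g \<Rightarrow> 'e \<Rightarrow> 'e" where
  "Ad G g = diff_at_one G (\<lambda>h. g \<otimes>\<^bsub>G\<^esub> h \<otimes>\<^bsub>G\<^esub> inv\<^bsub>G\<^esub> g)"

text \<open>\<open>[X, Y]\<close> is the derivative at the identity of \<open>g \<mapsto> Ad(g) Y\<close> in the direction \<open>X\<close>.\<close>

definition lie_bracket :: "('g, 'e::euclidean_space) lie_struct \<Rightarrow> 'e \<Rightarrow> 'e \<Rightarrow> 'e" where
  "lie_bracket G X Y = frechet_derivative (\<lambda>Z. Ad G (from_coord G Z) Y) (at 0) X"

definition killing_form :: "('g, 'e::euclidean_space) lie_struct \<Rightarrow> 'e \<Rightarrow> 'e \<Rightarrow> real" where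
  "killing_form G X Y = (\<Sum>b\<in>Basis. lie_bracket G X (lie_bracket G Y b) \<bullet> b)"

definition semisimple :: "('g, 'e::euclidean_space) lie_struct \<Rightarrow> bool" where
  "semisimple G \<longleftrightarrow> (\<forall>X. (\<forall>Y. killing_form G X Y = 0) \<longrightarrow> X = 0)"

definition group_center :: "('g, 'm) monoid_scheme \<Rightarrow> 'g set" where
  "group_center G = {z \<in> carrier G. \<forall>g\<in>carrier G. z \<otimes>\<^bsub>G\<^esub> g = g \<otimes>\<^bsub>G\<^esub> z}"

definition maximal_compact_subgroup :: "('g, 'e::euclidean_space) lie_struct \<Rightarrow> 'g set \<Rightarrow> bool" where
  "maximal_compact_subgroup G K \<longleftrightarrow>
     subgroup K G \<and> compactin (lie_top G) K \<and>
     (\<forall>L. subgroup L G \<and> compactin (lie_top G) L \<and> K \<subseteq> L \<longrightarrow> L = K)"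

text \<open>A global Cartan involution with fixed point group \<open>K\<close>: an involutive automorphism \<open>\<theta>\<close> of
  \<open>G\<close> such that \<open>(X, Y) \<mapsto> - killing_form X (d\<theta> Y)\<close> is positive definite. (A continuous
  automorphism of a Lie group is smooth.)\<close>

definition cartan_involution ::
    "('g, 'e::euclidean_space) lie_struct \<Rightarrow> 'g set \<Rightarrow> ('g \<Rightarrow> 'g) \<Rightarrow> bool" where
  "cartan_involution G K \<theta> \<longleftrightarrow>
     \<theta> \<in> hom G G \<and> continuous_map (lie_top G) (lie_top G) \<theta> \<and>
     (\<forall>g\<in>carrier G. \<theta> (\<theta> g) = g) \<and>
     {g \<in> carrier G. \<theta> g = g} = K \<and>
     (\<forall>X. X \<noteq> 0 \<longrightarrow> - killing_form G X (diff_at_one G \<theta> X) > 0)"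

definition cartan_p :: "('g, 'e::euclidean_space) lie_struct \<Rightarrow> ('g \<Rightarrow> 'g) \<Rightarrow> 'e set" where
  "cartan_p G \<theta> = {X. diff_at_one G \<theta> X = - X}"

definition abelian_subspace_in :: "('g, 'e::euclidean_space) lie_struct \<Rightarrow> 'e set \<Rightarrow> 'e set \<Rightarrow> bool" where
  "abelian_subspace_in G P \<aa> \<longleftrightarrow>
     subspace \<aa> \<and> \<aa> \<subseteq> P \<and> (\<forall>X\<in>\<aa>. \<forall>Y\<in>\<aa>. lie_bracket G X Y = 0)"

definition maximal_abelian_in :: "('g, 'e::euclidean_space) lie_struct \<Rightarrow> 'e set \<Rightarrow> 'e set \<Rightarrow> bool" where
  "maximal_abelian_in G P \<aa> \<longleftrightarrow>
     abelian_subspace_in G P \<aa> \<and> (\<forall>\<bb>. abelian_subspace_in G P \<bb> \<and> \<aa> \<subseteq> \<bb> \<longrightarrow> \<bb> = \<aa>)"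

section \<open>The symmetric space\<close>

text \<open>The points of \<open>X = G/K\<close> are the left cosets of \<open>K\<close>; the base point is \<open>K\<close> itself and
  \<open>G\<close> acts by \<open>g <# x\<close>.\<close>

definition sym_top :: "('g, 'e::euclidean_space) lie_struct \<Rightarrow> 'g set \<Rightarrow> 'g set topology" where
  "sym_top G K = quotient_topology (lie_top G) (\<lambda>g. g <#\<^bsub>G\<^esub> K)"

text \<open>The global Cartan involution on \<open>G\<close> and connectedness of \<open>X\<close> are automatic when \<open>G\<close> is
  connected.\<close>

definition noncompact_symmetric_space ::
    "('g, 'e::euclidean_space) lie_struct \<Rightarrow> 'g set \<Rightarrow> ('g \<Rightarrow> 'g) \<Rightarrow> 'e set \<Rightarrow> bool" where
  "noncompact_symmetric_space G K \<theta> \<aa> \<longleftrightarrow>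
     lie_group G \<and> semisimple G \<and> finite (group_center G) \<and>
     maximal_compact_subgroup G K \<and> connected_space (sym_top G K) \<and>
     cartan_involution G K \<theta> \<and> maximal_abelian_in G (cartan_p G \<theta>) \<aa>"

text \<open>The smooth structure of \<open>G/K\<close> is the quotient one: a function on \<open>G/K\<close> is smooth iff its
  pullback to \<open>G\<close> is.\<close>

definition smooth_fun :: "('g, 'e::euclidean_space) lie_struct \<Rightarrow> 'g set \<Rightarrow> ('g set \<Rightarrow> real) \<Rightarrow> bool" where
  "smooth_fun G K f \<longleftrightarrow>
     (\<forall>(U, \<phi>)\<in>lie_atlas G. smooth_on (\<phi> ` U) (\<lambda>x. f (inv_into U \<phi> x <#\<^bsub>G\<^esub> K)))"

text \<open>Tangent vectors of \<open>G/K\<close> are derivations of smooth functions, extended by \<open>0\<close> to the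
  functions that are not smooth. The tangent vector \<open>tvec G K g Y\<close> at \<open>g <# K\<close> is the image of
  \<open>Y\<close> in the Lie algebra under the differential of \<open>h \<mapsto> (g \<otimes> h) <# K\<close> at the identity. Every
  tangent vector at \<open>g <# K\<close> has this form.\<close>

type_synonym 'x tangent = "('x \<Rightarrow> real) \<Rightarrow> real"

definition tvec :: "('g, 'e::euclidean_space) lie_struct \<Rightarrow> 'g set \<Rightarrow> 'g \<Rightarrow> 'e \<Rightarrow> 'g set tangent" where
  "tvec G K g Y f =
     (if smooth_fun G K f
      then frechet_derivative (\<lambda>Z. f ((g \<otimes>\<^bsub>G\<^esub> from_coord G Z) <#\<^bsub>G\<^esub> K)) (at 0) Y else 0)"

definition tangent_space :: "('g, 'e::euclidean_space) lie_struct \<Rightarrow> 'g set \<Rightarrow> 'g set \<Rightarrow> 'g set tangent set" where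
  "tangent_space G K p = {tvec G K g Y |g Y. g \<in> carrier G \<and> g <#\<^bsub>G\<^esub> K = p}"

section \<open>Invariant Finsler metrics\<close>

text \<open>\<open>F p v\<close> is the norm of the tangent vector \<open>v\<close> at \<open>p\<close>. Continuity on the tangent bundle is
  expressed on \<open>G \<times> 'e\<close>, the left trivialisation of \<open>TG\<close>, of which \<open>T(G/K)\<close> is a topological
  quotient through \<open>tvec\<close>.\<close>

definition finsler_metric ::
    "('g, 'e::euclidean_space) lie_struct \<Rightarrow> 'g set \<Rightarrow> ('g set \<Rightarrow> 'g set tangent \<Rightarrow> real) \<Rightarrow> bool" where
  "finsler_metric G K F \<longleftrightarrow>
     continuous_map (prod_topology (lie_top G) euclidean) euclideanreal
       (\<lambda>(g, Y). F (g <#\<^bsub>G\<^esub> K) (tvec G K g Y)) \<and>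
     (\<forall>p\<in>lcosets\<^bsub>G\<^esub> K. \<forall>v\<in>tangent_space G K p.
        F p v \<ge> 0 \<and> (F p v = 0 \<longleftrightarrow> v = (\<lambda>f. 0)) \<and>
        (\<forall>r\<ge>0. F p (\<lambda>f. r * v f) = r * F p v) \<and>
        (\<forall>w\<in>tangent_space G K p. F p (\<lambda>f. v f + w f) \<le> F p v + F p w))"

definition invariant_finsler_metric ::
    "('g, 'e::euclidean_space) lie_struct \<Rightarrow> 'g set \<Rightarrow> ('g set \<Rightarrow> 'g set tangent \<Rightarrow> real) \<Rightarrow> bool" where
  "invariant_finsler_metric G K F \<longleftrightarrow>
     finsler_metric G K F \<and>
     (\<forall>g\<in>carrier G. \<forall>p\<in>lcosets\<^bsub>G\<^esub> K. \<forall>v\<in>tangent_space G K p.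
        F (g <#\<^bsub>G\<^esub> p) (\<lambda>f. v (\<lambda>x. f (g <#\<^bsub>G\<^esub> x))) = F p v)"

definition finsler_unit_ball ::
    "('g, 'e::euclidean_space) lie_struct \<Rightarrow> 'g set \<Rightarrow> 'e set \<Rightarrow> ('g set \<Rightarrow> 'g set tangent \<Rightarrow> real) \<Rightarrow> 'e set" where
  "finsler_unit_ball G K S F = {Y \<in> S. F K (tvec G K \<one>\<^bsub>G\<^esub> Y) \<le> 1}"

definition C1_curve_on ::
    "('g, 'e::euclidean_space) lie_struct \<Rightarrow> 'g set \<Rightarrow> real \<Rightarrow> real \<Rightarrow> (real \<Rightarrow> 'g set) \<Rightarrow> bool" where
  "C1_curve_on G K a b c \<longleftrightarrow>
     (\<forall>f. smooth_fun G K f \<longrightarrow>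
        (\<exists>f'. continuous_on {a..b} f' \<and>
           (\<forall>t\<in>{a..b}. ((\<lambda>s. f (c s)) has_real_derivative f' t) (at t within {a..b}))))"

text \<open>The curve is \<open>C\<^sup>1\<close> up to the end points of each piece, so the integral defining the length
  exists.\<close>

definition piecewise_C1_curve ::
    "('g, 'e::euclidean_space) lie_struct \<Rightarrow> 'g set \<Rightarrow> (real \<Rightarrow> 'g set) \<Rightarrow> bool" where
  "piecewise_C1_curve G K c \<longleftrightarrow>
     c ` {0..1} \<subseteq> lcosets\<^bsub>G\<^esub> K \<and>
     (\<exists>P. finite P \<and> {0, 1} \<subseteq> P \<and> P \<subseteq> {0..1} \<and>
        (\<forall>a\<in>P. \<forall>b\<in>P. a < b \<and> {a<..<b} \<inter> P = {} \<longrightarrow> C1_curve_on G K a b c))"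

definition velocity ::
    "('g, 'e::euclidean_space) lie_struct \<Rightarrow> 'g set \<Rightarrow> (real \<Rightarrow> 'g set) \<Rightarrow> real \<Rightarrow> 'g set tangent" where
  "velocity G K c t f = (if smooth_fun G K f then deriv (\<lambda>s. f (c s)) t else 0)"

definition curve_length ::
    "('g, 'e::euclidean_space) lie_struct \<Rightarrow> 'g set \<Rightarrow> ('g set \<Rightarrow> 'g set tangent \<Rightarrow> real) \<Rightarrow> (real \<Rightarrow> 'g set) \<Rightarrow> real" where
  "curve_length G K F c = integral {0..1} (\<lambda>t. F (c t) (velocity G K c t))"

definition finsler_dist ::
    "('g, 'e::euclidean_space) lie_struct \<Rightarrow> 'g set \<Rightarrow> ('g set \<Rightarrow> 'g set tangent \<Rightarrow> real) \<Rightarrow> 'g set \<Rightarrow> 'g set \<Rightarrow> real" where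
  "finsler_dist G K F p q =
     (INF c \<in> {c. piecewise_C1_curve G K c \<and> c 0 = p \<and> c 1 = q}. curve_length G K F c)"

section \<open>The horofunction compactification\<close>

text \<open>For a set \<open>X\<close> with base point \<open>p\<close>, functions on \<open>X\<close> are made \<open>undefined\<close> outside \<open>X\<close>.\<close>

definition pointed_functions :: "'x topology \<Rightarrow> 'x \<Rightarrow> ('x \<Rightarrow> real) set" where
  "pointed_functions T p =
     {f \<in> extensional (topspace T). continuous_map T euclideanreal f \<and> f p = 0}"

definition sym_bounded :: "('x \<Rightarrow> 'x \<Rightarrow> real) \<Rightarrow> 'x \<Rightarrow> 'x set \<Rightarrow> bool" where
  "sym_bounded d p S \<longleftrightarrow> (\<exists>r. \<forall>x\<in>S. d p x + d x p \<le> r)"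

definition bounded_convergence_topology ::
    "'x topology \<Rightarrow> ('x \<Rightarrow> 'x \<Rightarrow> real) \<Rightarrow> 'x \<Rightarrow> ('x \<Rightarrow> real) topology" where
  "bounded_convergence_topology T d p =
     topology (\<lambda>U. U \<subseteq> pointed_functions T p \<and>
       (\<forall>f\<in>U. \<exists>S \<epsilon>. S \<subseteq> topspace T \<and> sym_bounded d p S \<and> \<epsilon> > 0 \<and>
          {h \<in> pointed_functions T p. \<forall>x\<in>S. \<bar>h x - f x\<bar> < \<epsilon>} \<subseteq> U))"

lemma openin_bounded_convergence_topology:
  "openin (bounded_convergence_topology T d p) U \<longleftrightarrow>
     U \<subseteq> pointed_functions T p \<and>
       (\<forall>f\<in>U. \<exists>S \<epsilon>. S \<subseteq> topspace T \<and> sym_bounded d p S \<and> \<epsilon> > 0 \<and>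
          {h \<in> pointed_functions T p. \<forall>x\<in>S. \<bar>h x - f x\<bar> < \<epsilon>} \<subseteq> U)"
proof -
  let ?N = "\<lambda>S \<epsilon> f. {h \<in> pointed_functions T p. \<forall>x\<in>S. \<bar>h x - f x\<bar> < (\<epsilon>::real)}"
  let ?Q = "\<lambda>U f. \<exists>S \<epsilon>. S \<subseteq> topspace T \<and> sym_bounded d p S \<and> \<epsilon> > 0 \<and> ?N S \<epsilon> f \<subseteq> U"
  have "istopology (\<lambda>U. U \<subseteq> pointed_functions T p \<and> (\<forall>f\<in>U. ?Q U f))"
    unfolding istopology_def
  proof (intro conjI allI impI ballI)
    fix U V f
    assume U: "U \<subseteq> pointed_functions T p \<and> (\<forall>f\<in>U. ?Q U f)"
      and V: "V \<subseteq> pointed_functions T p \<and> (\<forall>f\<in>V. ?Q V f)"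
    then show "U \<inter> V \<subseteq> pointed_functions T p" by blast
    assume f: "f \<in> U \<inter> V"
    obtain S e where S: "S \<subseteq> topspace T" "sym_bounded d p S" "e > 0" "?N S e f \<subseteq> U"
      using U f by blast
    obtain S' e' where S': "S' \<subseteq> topspace T" "sym_bounded d p S'" "e' > 0" "?N S' e' f \<subseteq> V"
      using V f by blast
    obtain r r' where "\<forall>x\<in>S. d p x + d x p \<le> r" "\<forall>x\<in>S'. d p x + d x p \<le> r'"
      using S(2) S'(2) by (auto simp: sym_bounded_def)
    then have "\<forall>x\<in>S \<union> S'. d p x + d x p \<le> max r r'" by (auto simp: le_max_iff_disj)
    then have "sym_bounded d p (S \<union> S')" unfolding sym_bounded_def by blast
    moreover have "?N (S \<union> S') (min e e') f \<subseteq> ?N S e f \<inter> ?N S' e' f" by auto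
    then have "?N (S \<union> S') (min e e') f \<subseteq> U \<inter> V" using S(4) S'(4) by blast
    moreover have "min e e' > 0" using S(3) S'(3) by simp
    moreover have "S \<union> S' \<subseteq> topspace T" using S(1) S'(1) by blast
    ultimately show "?Q (U \<inter> V) f" by blast
  next
    fix \<K> assume *: "\<forall>U\<in>\<K>. U \<subseteq> pointed_functions T p \<and> (\<forall>f\<in>U. ?Q U f)"
    then show "\<Union>\<K> \<subseteq> pointed_functions T p" by blast
    fix f assume "f \<in> \<Union>\<K>"
    then obtain U where U: "U \<in> \<K>" "f \<in> U" by blast
    then have "?Q U f" using * by blast
    then show "?Q (\<Union>\<K>) f" using U(1) by (meson Union_upper order_trans)
  qed
  then show ?thesis
    by (simp add: bounded_convergence_topology_def topology_inverse')
qed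

definition horo_embedding ::
    "('g, 'e::euclidean_space) lie_struct \<Rightarrow> 'g set \<Rightarrow> ('g set \<Rightarrow> 'g set \<Rightarrow> real) \<Rightarrow> 'g set \<Rightarrow> 'g set \<Rightarrow> real" where
  "horo_embedding G K d z = (\<lambda>x\<in>lcosets\<^bsub>G\<^esub> K. d x z - d K z)"

definition horo_compactification ::
    "('g, 'e::euclidean_space) lie_struct \<Rightarrow> 'g set \<Rightarrow> ('g set \<Rightarrow> 'g set \<Rightarrow> real) \<Rightarrow> ('g set \<Rightarrow> real) topology" where
  "horo_compactification G K d =
     (let T = bounded_convergence_topology (sym_top G K) d K
      in subtopology T (T closure_of (horo_embedding G K d ` (lcosets\<^bsub>G\<^esub> K))))"

definition horo_action ::
    "('g, 'e::euclidean_space) lie_struct \<Rightarrow> 'g set \<Rightarrow> 'g \<Rightarrow> ('g set \<Rightarrow> real) \<Rightarrow> 'g set \<Rightarrow> real" where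
  "horo_action G K g f =
     (\<lambda>x\<in>lcosets\<^bsub>G\<^esub> K. f (inv\<^bsub>G\<^esub> g <#\<^bsub>G\<^esub> x) - f (inv\<^bsub>G\<^esub> g <#\<^bsub>G\<^esub> K))"

section \<open>Projective representations and generalized Satake compactifications\<close>

type_synonym 'n cmat = "complex^'n^'n"

definition ctransp :: "'n::finite cmat \<Rightarrow> 'n cmat" where
  "ctransp M = (\<chi> i j. cnj (M $ j $ i))"

definition SL :: "'n::finite cmat monoid" where
  "SL = \<lparr>carrier = {M. det M = 1}, mult = (**), one = mat 1\<rparr>"

text \<open>Elements of \<open>PSL(n, \<complex>)\<close> are cosets, hence sets of matrices.\<close>

definition PSL :: "'n::finite cmat set monoid" where
  "PSL = SL Mod (group_center SL)"

definition PSL_top :: "'n::finite cmat set topology" where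
  "PSL_top = quotient_topology (top_of_set (carrier SL)) (\<lambda>M. group_center SL #>\<^bsub>SL\<^esub> M)"

definition faithful_projective_rep ::
    "('g, 'e::euclidean_space) lie_struct \<Rightarrow> ('g \<Rightarrow> 'n::finite cmat set) \<Rightarrow> bool" where
  "faithful_projective_rep G \<tau> \<longleftrightarrow>
     \<tau> \<in> hom G PSL \<and> continuous_map (lie_top G) PSL_top \<tau> \<and> inj_on \<tau> (carrier G)"

definition cartan_compatible ::
    "('g, 'e::euclidean_space) lie_struct \<Rightarrow> ('g \<Rightarrow> 'g) \<Rightarrow> ('g \<Rightarrow> 'n::finite cmat set) \<Rightarrow> bool" where
  "cartan_compatible G \<theta> \<tau> \<longleftrightarrow> (\<forall>g\<in>carrier G. \<tau> (\<theta> g) = inv\<^bsub>PSL\<^esub> (ctransp ` \<tau> g))"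

text \<open>\<open>has_differential G \<tau> Y M\<close> means \<open>d\<tau>(Y) = M\<close>. The curve \<open>\<gamma>\<close> is the lift through the identity
  to \<open>SL(n, \<complex>)\<close> of the image under \<open>\<tau>\<close> of a curve in \<open>G\<close> with initial velocity \<open>Y\<close>.\<close>

definition has_differential ::
    "('g, 'e::euclidean_space) lie_struct \<Rightarrow> ('g \<Rightarrow> 'n::finite cmat set) \<Rightarrow> 'e \<Rightarrow> 'n cmat \<Rightarrow> bool" where
  "has_differential G \<tau> Y M \<longleftrightarrow>
     (\<exists>\<gamma>. \<gamma> 0 = mat 1 \<and> (\<forall>\<^sub>F t in nhds (0::real). \<gamma> t \<in> \<tau> (from_coord G (t *\<^sub>R Y))) \<and>
        (\<gamma> has_vector_derivative M) (at 0))"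

text \<open>Linear functionals on a subspace \<open>\<aa>\<close> are functions that are \<open>undefined\<close> outside \<open>\<aa>\<close>.\<close>

definition dual_space :: "'e::real_vector set \<Rightarrow> ('e \<Rightarrow> real) set" where
  "dual_space \<aa> = {\<mu> \<in> extensional \<aa>. \<forall>X\<in>\<aa>. \<forall>Y\<in>\<aa>. \<forall>r s. \<mu> (r *\<^sub>R X + s *\<^sub>R Y) = r * \<mu> X + s * \<mu> Y}"

definition weights ::
    "('g, 'e::euclidean_space) lie_struct \<Rightarrow> 'e set \<Rightarrow> ('g \<Rightarrow> 'n::finite cmat set) \<Rightarrow> ('e \<Rightarrow> real) set" where
  "weights G \<aa> \<tau> = {\<mu> \<in> dual_space \<aa>.
     \<exists>v. v \<noteq> 0 \<and> (\<forall>Y\<in>\<aa>. \<exists>M. has_differential G \<tau> Y M \<and> M *v v = complex_of_real (\<mu> Y) *s v)}"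

definition dual_convex_hull :: "'e::real_vector set \<Rightarrow> ('e \<Rightarrow> real) set \<Rightarrow> ('e \<Rightarrow> real) set" where
  "dual_convex_hull \<aa> W =
     {\<lambda>Y\<in>\<aa>. \<Sum>\<mu>\<in>S. u \<mu> * \<mu> Y |S u.
        finite S \<and> S \<subseteq> W \<and> (\<forall>\<mu>\<in>S. 0 \<le> u \<mu>) \<and> (\<Sum>\<mu>\<in>S. u \<mu>) = (1::real)}"

text \<open>The polar in \<open>\<aa>\<close> of a subset of its dual space.\<close>

definition polar :: "'e::real_vector set \<Rightarrow> ('e \<Rightarrow> real) set \<Rightarrow> 'e set" where
  "polar \<aa> C = {Y \<in> \<aa>. \<forall>\<mu>\<in>C. \<mu> Y \<ge> -1}"

text \<open>Points of the projective space of Hermitian matrices are the real lines through the origin.\<close>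

definition proj_class :: "'n::finite cmat \<Rightarrow> 'n cmat set" where
  "proj_class M = span {M}"

definition proj_hermitian_top :: "'n::finite cmat set topology" where
  "proj_hermitian_top = quotient_topology (top_of_set ({M. ctransp M = M} - {0})) proj_class"

text \<open>\<open>N ** ctransp N\<close> depends neither on the representative \<open>g\<close> of the point \<open>x\<close> of \<open>G/K\<close> nor on
  the matrix \<open>N\<close> representing \<open>\<tau> g\<close>, so \<open>the_elem\<close> is applied to a singleton.\<close>

definition satake_embedding :: "('g \<Rightarrow> 'n::finite cmat set) \<Rightarrow> 'g set \<Rightarrow> 'n cmat set" where
  "satake_embedding \<tau> x = the_elem (\<Union>g\<in>x. (\<lambda>N. proj_class (N ** ctransp N)) ` \<tau> g)"

definition satake_compactification ::
    "('g, 'e::euclidean_space) lie_struct \<Rightarrow> 'g set \<Rightarrow> ('g \<Rightarrow> 'n::finite cmat set) \<Rightarrow> 'n cmat set topology" where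
  "satake_compactification G K \<tau> =
     subtopology proj_hermitian_top
       (proj_hermitian_top closure_of (satake_embedding \<tau> ` (lcosets\<^bsub>G\<^esub> K)))"

text \<open>All representatives \<open>N\<close> of \<open>\<tau> g\<close> give the same image of the line \<open>L\<close>.\<close>

definition satake_action :: "('g \<Rightarrow> 'n::finite cmat set) \<Rightarrow> 'g \<Rightarrow> 'n cmat set \<Rightarrow> 'n cmat set" where
  "satake_action \<tau> g L = (\<Union>N\<in>\<tau> g. (\<lambda>M. N ** M ** ctransp N) ` L)"

section \<open>Equivariant isomorphism of compactifications\<close>

text \<open>\<open>i\<close> and \<open>i'\<close> are the embeddings of \<open>X\<close>, and \<open>act\<close> and \<open>act'\<close> the actions of \<open>G\<close>.\<close>

definition equivariantly_isomorphic ::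
    "('g, 'm) monoid_scheme \<Rightarrow> 'x set \<Rightarrow>
     'c topology \<Rightarrow> ('x \<Rightarrow> 'c) \<Rightarrow> ('g \<Rightarrow> 'c \<Rightarrow> 'c) \<Rightarrow>
     'd topology \<Rightarrow> ('x \<Rightarrow> 'd) \<Rightarrow> ('g \<Rightarrow> 'd \<Rightarrow> 'd) \<Rightarrow> bool" where
  "equivariantly_isomorphic G X C i act C' i' act' \<longleftrightarrow>
     (\<exists>\<Phi>. homeomorphic_map C C' \<Phi> \<and> (\<forall>x\<in>X. \<Phi> (i x) = i' x) \<and>
        (\<forall>g\<in>carrier G. \<forall>c\<in>topspace C. \<Phi> (act g c) = act' g (\<Phi> c)))"

end

theory Submission
 imports Defs
begin

text \<open>
  Write \<open>N\<close> for a matrix representing \<open>\<tau> g\<close>, and let \<open>M x = N N\<^sup>*\<close> for the point \<open>x = gK\<close>. The weights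
  of \<open>\<tau>\<close> are the joint eigenvalues of \<open>d\<tau>(\<aa>)\<close>, so the dual ball consists of the \<open>Y\<close> in \<open>\<aa>\<close> for which
  the largest eigenvalue of \<open>d\<tau>(Y)\<close> is at most 1, and the invariant metric with this ball measures a
  tangent vector by half of the largest eigenvalue of \<open>dM\<close> relative to \<open>M\<close>. Integrating this along
  curves, and along the geodesics \<open>g exp(tY) K\<close>, gives \<open>d(gK, hK) = ln \<parallel>N\<^sub>g\<inverse> N\<^sub>h\<parallel>\<close>. Hence the function
  \<open>x \<mapsto> 1/2 ln (\<parallel>N\<^sub>x\<inverse> A N\<^sub>x\<^sup>-\<^sup>*\<parallel> / \<parallel>A\<parallel>)\<close> is defined for every line of Hermitian matrices \<open>A\<close>, depends
  continuously on it, and is the horofunction embedding of \<open>y\<close> for \<open>A = M y\<close>. It remains to show that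
  it is injective on the closure of the points \<open>M y\<close>: a limit of rescaled points is conjugate to the
  exponential of an element of \<open>\<aa>\<close> restricted to the top eigenspace of another one, and the norms
  \<open>\<parallel>N A N\<^sup>*\<parallel>\<close> first recover the kernel of \<open>A\<close> and then \<open>A\<close>.

  The Lie theory needed for this is obtained from \<open>\<tau>\<close> itself: near the identity \<open>\<tau>\<close> lifts to a local
  homomorphism into matrices, which is shown to be differentiable, and it transports exponentials,
  brackets and the Cartan involution to the algebra of real endomorphisms of \<open>\<complex>\<^sup>n\<close>.\<close>

section \<open>The algebra of endomorphisms of a Euclidean space\<close>

text \<open>Neither smoothness of \<open>\<tau>\<close> nor a global lift to SL is given. All
  statements therefore quantify over the finite set \<open>H g\<close> of lifts of
  \<open>\<tau> g\<close>, and differentiability is obtained as for any continuous homomorphism, by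
  comparing small elements with their powers. Real endomorphisms are used because conjugate
  transposition becomes the real adjoint and the Euclidean spectral theorem applies. Since
  \<open>N * adj N\<close> is quadratic in \<open>N\<close>, moving by \<open>Y\<close> changes it
  at the rate \<open>2 T Y\<close>; this is the origin of every factor 1/2. Only \<open>X\<close>,
  not \<open>G\<close>, is assumed connected, so the Cartan decomposition comes from an open-closed
  argument on \<open>X\<close>. The metric is asymmetric; it is definite because \<open>T Y\<close>
  has trace zero. Tangent vectors and curves are accessible only through smooth functions, and the
  matrix coefficients of \<open>N * adj N\<close> provide enough of them. As \<open>\<tau>\<close>
  may be reducible there is no highest weight to organise the boundary. A boundary point is instead
  described by a pair \<open>Z\<close>, \<open>l\<close> selecting the weights that take their
  maximum \<open>l\<close> at \<open>Z\<close>.\<close>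

typedef (overloaded) ('v::euclidean_space) endo = "UNIV :: ('v \<Rightarrow>\<^sub>L 'v) set"
 morphisms blinfun_of_endo endo_of_blinfun by simp

setup_lifting type_definition_endo

text \<open>With composition as multiplication the generic \<open>exp\<close>, powers and product
  rules of Banach algebras apply to operators.\<close>

instantiation endo :: (euclidean_space) real_normed_algebra_1
begin

lift_definition zero_endo :: "'a endo" is 0 .
lift_definition one_endo :: "'a endo" is id_blinfun .
lift_definition plus_endo :: "'a endo \<Rightarrow> 'a endo \<Rightarrow> 'a endo" is "(+)" .
lift_definition minus_endo :: "'a endo \<Rightarrow> 'a endo \<Rightarrow> 'a endo" is "(-)" .
lift_definition uminus_endo :: "'a endo \<Rightarrow> 'a endo" is uminus .
lift_definition times_endo :: "'a endo \<Rightarrow> 'a endo \<Rightarrow> 'a endo" is "(o\<^sub>L)" .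
lift_definition scaleR_endo :: "real \<Rightarrow> 'a endo \<Rightarrow> 'a endo" is scaleR .
lift_definition norm_endo :: "'a endo \<Rightarrow> real" is norm .

definition dist_endo :: "'a endo \<Rightarrow> 'a endo \<Rightarrow> real" where
 "dist_endo A B = norm (A - B)"
definition sgn_endo :: "'a endo \<Rightarrow> 'a endo" where
 "sgn_endo A = scaleR (inverse (norm A)) A"
definition uniformity_endo :: "('a endo \<times> 'a endo) filter" where
 "uniformity_endo = (INF e\<in>{0<..}. principal {(x, y). dist x y < e})"
definition open_endo :: "'a endo set \<Rightarrow> bool" where
 "open_endo U \<longleftrightarrow> (\<forall>x\<in>U. \<forall>\<^sub>F (x', y) in uniformity. x' = x \<longrightarrow> y \<in> U)"

instance
proof
 fix A B C :: "'a endo" and r s :: real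
 show "dist A B = norm (A - B)" by (simp add: dist_endo_def)
 show "sgn A = inverse (norm A) *\<^sub>R A" by (simp add: sgn_endo_def)
 show "(uniformity :: ('a endo \<times> 'a endo) filter) = (INF e\<in>{0<..}. principal {(x, y). dist x y < e})"
  by (simp add: uniformity_endo_def)
 show "open U \<longleftrightarrow> (\<forall>x\<in>U. \<forall>\<^sub>F (x', y) in uniformity. x' = x \<longrightarrow> y \<in> U)" for U :: "'a endo set" by (simp add: open_endo_def)
 show "norm (A + B) \<le> norm A + norm B" by transfer (rule norm_triangle_ineq)
 show "norm (A * B) \<le> norm A * norm B" by transfer (rule norm_blinfun_compose)
 show "0 \<noteq> (1 :: 'a endo)" by transfer (metis norm_blinfun_id norm_zero zero_neq_one)
 show "norm A = 0 \<longleftrightarrow> A = 0" by transfer simp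
 show "norm (r *\<^sub>R A) = \<bar>r\<bar> * norm A" by transfer simp
 show "norm (1 :: 'a endo) = 1" by transfer simp
 show "A + B + C = A + (B + C)" "A + B = B + A" "0 + A = A" "- A + A = 0" "A - B = A + - B"
  "r *\<^sub>R (A + B) = r *\<^sub>R A + r *\<^sub>R B" "(r + s) *\<^sub>R A = r *\<^sub>R A + s *\<^sub>R A"
  "r *\<^sub>R s *\<^sub>R A = (r * s) *\<^sub>R A" "1 *\<^sub>R A = A" by (transfer; simp add: algebra_simps)+
 show "A * B * C = A * (B * C)" "1 * A = A" "A * 1 = A" "(A + B) * C = A * C + B * C"
  "A * (B + C) = A * B + A * C" "r *\<^sub>R A * B = r *\<^sub>R (A * B)" "A * r *\<^sub>R B = r *\<^sub>R (A * B)"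
  by (transfer; rule blinfun_eqI; simp add: blinfun.bilinear_simps)+
qed

end

lemma dist_endo: "dist A B = dist (blinfun_of_endo A) (blinfun_of_endo B)" unfolding dist_norm by transfer simp

lemma tendsto_endo_iff:
 "((\<lambda>x. endo_of_blinfun (f x)) \<longlongrightarrow> endo_of_blinfun l) F \<longleftrightarrow> (f \<longlongrightarrow> l) F"
 by (simp add: tendsto_iff dist_endo endo_of_blinfun_inverse)

instance endo :: (euclidean_space) banach
proof
 fix X :: "nat \<Rightarrow> 'a endo" assume "Cauchy X"
 then have "Cauchy (\<lambda>n. blinfun_of_endo (X n))" by (simp add: Cauchy_def dist_endo)
 then obtain L where "(\<lambda>n. blinfun_of_endo (X n)) \<longlonglongrightarrow> L" using Cauchy_convergent_iff convergent_def by blast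
 then have "(\<lambda>n. endo_of_blinfun (blinfun_of_endo (X n))) \<longlonglongrightarrow> endo_of_blinfun L" by (simp only: tendsto_endo_iff)
 then show "convergent X" by (auto simp: blinfun_of_endo_inverse convergent_def)
qed

instance endo :: (euclidean_space) heine_borel
proof
 fix X :: "nat \<Rightarrow> 'a endo" assume "bounded (range X)"
 then have "bounded (range (\<lambda>n. blinfun_of_endo (X n)))" unfolding bounded_iff by (auto simp: norm_endo.rep_eq)
 from bounded_imp_convergent_subsequence[OF this] obtain L r
  where r: "strict_mono r" "((\<lambda>n. blinfun_of_endo (X n)) \<circ> r) \<longlonglongrightarrow> L" by blast
 then have "(\<lambda>n. endo_of_blinfun (((\<lambda>n. blinfun_of_endo (X n)) \<circ> r) n)) \<longlonglongrightarrow> endo_of_blinfun L"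
  by (simp only: tendsto_endo_iff)
 then show "\<exists>l r. strict_mono r \<and> (X \<circ> r) \<longlonglongrightarrow> l" using r(1) by (auto simp: blinfun_of_endo_inverse comp_def)
qed

lift_definition app :: "'v::euclidean_space endo \<Rightarrow> 'v \<Rightarrow> 'v" is blinfun_apply .

definition endo_of :: "('v::euclidean_space \<Rightarrow> 'v) \<Rightarrow> 'v endo" where
 "endo_of f = endo_of_blinfun (Blinfun f)"

lemma app_endo_of: "linear f \<Longrightarrow> app (endo_of f) v = f v"
 by (simp add: endo_of_def app.rep_eq endo_of_blinfun_inverse bounded_linear_Blinfun_apply
   linear_conv_bounded_linear)

lemma endo_eqI: "(\<And>v. app A v = app B v) \<Longrightarrow> A = B" by transfer (rule blinfun_eqI)

lemma app_simps [simp]: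
 "app (A + B) v = app A v + app B v" "app (A - B) v = app A v - app B v"
 "app (- A) v = - app A v" "app (A * B) v = app A (app B v)" "app 1 v = v" "app 0 v = 0"
 "app (r *\<^sub>R A) v = r *\<^sub>R app A v" by (transfer; simp add: blinfun.bilinear_simps)+

lemma norm_app: "norm (app A v) \<le> norm A * norm v" by transfer (rule norm_blinfun)

lemma bounded_bilinear_app: "bounded_bilinear (app :: 'a::euclidean_space endo \<Rightarrow> _)"
proof
 show "\<exists>K. \<forall>A v. norm (app (A :: 'a endo) v) \<le> norm A * norm v * K" by (rule exI[of _ 1]) (simp add: norm_app)
qed (transfer; simp add: blinfun.bilinear_simps)+

lemmas app_right_simps [simp] = bounded_bilinear.add_right[OF bounded_bilinear_app]
 bounded_bilinear.diff_right[OF bounded_bilinear_app]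
 bounded_bilinear.minus_right[OF bounded_bilinear_app]
 bounded_bilinear.zero_right[OF bounded_bilinear_app]
 bounded_bilinear.scaleR_right[OF bounded_bilinear_app]

lemmas app_sum_left = bounded_bilinear.sum_left[OF bounded_bilinear_app]
lemmas app_sum_right = bounded_bilinear.sum_right[OF bounded_bilinear_app]
lemmas tendsto_app [tendsto_intros] = bounded_bilinear.tendsto[OF bounded_bilinear_app]
lemmas continuous_on_app [continuous_intros] = bounded_bilinear.continuous_on[OF bounded_bilinear_app]

lemma linear_app: "linear (app A)" by (rule linearI) simp_all

lemma norm_endo_le: "(\<And>v. norm (app A v) \<le> b * norm v) \<Longrightarrow> 0 \<le> b \<Longrightarrow> norm A \<le> b" by transfer (rule norm_blinfun_bound)

section \<open>Adjoints and the C*-identity\<close>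

definition adj :: "'v::euclidean_space endo \<Rightarrow> 'v endo" where
 "adj A = endo_of (adjoint (app A))"

lemma app_adj: "app (adj A) v \<bullet> w = v \<bullet> app A w"
 by (simp add: adj_def app_endo_of adjoint_linear linear_app inner_commute[of _ w]
   adjoint_works[OF linear_app] inner_commute)

lemma inner_app: "app A v \<bullet> w = v \<bullet> app (adj A) w" by (metis app_adj inner_commute)

lemma adjI: "(\<And>v w. app A v \<bullet> w = v \<bullet> app B w) \<Longrightarrow> adj B = A" by (intro endo_eqI) (metis app_adj vector_eq_rdot)

lemma adj_simps [simp]:
 "adj (A + B) = adj A + adj B" "adj (A - B) = adj A - adj B" "adj (- A) = - adj A"
 "adj (A * B) = adj B * adj A" "adj 1 = 1" "adj 0 = 0" "adj (r *\<^sub>R A) = r *\<^sub>R adj A"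
 "adj (adj A) = A" by (rule adjI; simp add: app_adj inner_simps flip: inner_app)+

lemma norm_adj_le: "norm (adj A) \<le> norm A"
proof (rule norm_endo_le)
 fix v
 have "norm (app (adj A) v) * norm (app (adj A) v) = v \<bullet> app A (app (adj A) v)"
  by (simp add: app_adj flip: power2_eq_square dot_square_norm)
 also have "\<dots> \<le> norm v * (norm A * norm (app (adj A) v))"
  by (meson Cauchy_Schwarz_ineq2 abs_le_D1 mult_left_mono norm_app norm_ge_zero order_trans)
 finally show "norm (app (adj A) v) \<le> norm A * norm v" by (cases "app (adj A) v = 0") (auto simp: mult_ac)
qed simp

lemma norm_adj [simp]: "norm (adj A) = norm A" using norm_adj_le[of A] norm_adj_le[of "adj A"] by simp

text \<open>The C*-identity. It converts the distance \<open>ln (norm N)\<close> into half of the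
  logarithm of the norm of \<open>N * adj N\<close>.\<close>

lemma norm_adj_mult: "norm (adj A * A) = (norm A)\<^sup>2"
proof (rule antisym)
 show "norm (adj A * A) \<le> (norm A)\<^sup>2" using norm_mult_ineq[of "adj A" A] by (simp add: power2_eq_square)
 have "norm A \<le> sqrt (norm (adj A * A))"
 proof (rule norm_endo_le)
  fix v
  have "(norm (app A v))\<^sup>2 = app (adj A * A) v \<bullet> v" by (simp add: app_adj dot_square_norm)
  also have "\<dots> \<le> norm (adj A * A) * norm v * norm v"
   by (meson Cauchy_Schwarz_ineq2 abs_le_D1 mult_right_mono norm_app norm_ge_zero order_trans)
  finally have "norm (app A v) \<le> sqrt (norm (adj A * A) * (norm v)\<^sup>2)"
   by (intro real_le_rsqrt) (simp add: power2_eq_square mult.assoc)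
  then show "norm (app A v) \<le> sqrt (norm (adj A * A)) * norm v" by (simp add: real_sqrt_mult)
 qed simp
 then show "(norm A)\<^sup>2 \<le> norm (adj A * A)"
  using real_le_lsqrt power_mono[of "norm A" "sqrt (norm (adj A * A))" 2] by simp
qed

lemma norm_mult_adj: "norm (A * adj A) = (norm A)\<^sup>2" using norm_adj_mult[of "adj A"] by simp

lemma bounded_linear_adj: "bounded_linear (adj :: 'v::euclidean_space endo \<Rightarrow> _)"
 by (rule bounded_linear_intro[where K = 1]) simp_all

lemmas tendsto_adj [tendsto_intros] = bounded_linear.tendsto[OF bounded_linear_adj]
lemmas continuous_on_adj [continuous_intros] = bounded_linear.continuous_on[OF bounded_linear_adj]

lemma adj_power: "adj (A ^ n) = adj A ^ n" by (induction n) (auto simp: power_commutes)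

section \<open>The exponential in a Banach algebra\<close>

text \<open>A bounded linear map can be applied to the series term by term, so only its effect on
  powers matters. Multiplicativity would be too much to ask: taking adjoints reverses products but
  respects powers.\<close>

lemma exp_bounded_linear:
 fixes x :: "'a::{real_normed_algebra_1,banach}" and y :: "'b::{real_normed_algebra_1,banach}"
 assumes "bounded_linear f" "\<And>n. f (x ^ n) = y ^ n"
 shows "f (exp x) = exp y"
proof -
 have "(\<lambda>n. f (x ^ n /\<^sub>R fact n)) sums f (exp x)" by (rule bounded_linear.sums[OF assms(1) exp_converges])
 then have "(\<lambda>n. y ^ n /\<^sub>R fact n) sums f (exp x)" by (simp add: linear_simps(5)[OF assms(1)] assms(2))
 then show ?thesis using exp_converges sums_unique2 by blast
qed

lemma adj_exp: "adj (exp A) = exp (adj A)" by (rule exp_bounded_linear[OF bounded_linear_adj adj_power])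

lemma exp_conj:
 fixes a u v :: "'a::{real_normed_algebra_1,banach}"
 assumes "v * u = 1" "u * v = 1"
 shows "u * exp a * v = exp (u * a * v)"
proof (rule exp_bounded_linear[where f = "\<lambda>x. u * x * v"])
 show "bounded_linear (\<lambda>x. u * x * v)"
  using bounded_linear_compose[OF bounded_linear_mult_left[of v] bounded_linear_mult_right[of u]] by simp
 show "u * a ^ n * v = (u * a * v) ^ n" for n
 proof (induction n)
  case (Suc n)
  have "u * a ^ Suc n * v = u * a * (v * u) * a ^ n * v" by (simp add: assms mult.assoc)
  also have "\<dots> = (u * a * v) * (u * a ^ n * v)" by (simp add: mult.assoc)
  finally show ?case by (simp only: Suc power_Suc)
 qed (simp add: assms)
qed

lemma exp_eigenvector:
 assumes "app A v = r *\<^sub>R v"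
 shows "app (exp A) v = exp r *\<^sub>R v"
proof -
 have pw: "app (A ^ n) v = r ^ n *\<^sub>R v" for n by (induction n) (auto simp: assms)
 have "(\<lambda>n. app (A ^ n /\<^sub>R fact n) v) sums app (exp A) v"
  by (rule bounded_linear.sums[OF bounded_bilinear.bounded_linear_left[OF bounded_bilinear_app] exp_converges])
 moreover have "(\<lambda>n. (r ^ n /\<^sub>R fact n) *\<^sub>R v) sums (exp r *\<^sub>R v)"
  by (rule bounded_linear.sums[OF bounded_linear_scaleR_left exp_converges])
 ultimately show ?thesis using sums_unique2 by (fastforce simp: pw)
qed

lemma exp_second_order:
 fixes x :: "'a::{real_normed_algebra_1,banach}"
 assumes "norm x \<le> 1"
 shows "norm (exp x - 1 - x) \<le> (norm x)\<^sup>2"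
proof -
 let ?f = "\<lambda>n. x ^ n /\<^sub>R fact n" and ?g = "\<lambda>n. norm x ^ n /\<^sub>R fact n"
 have f: "(\<lambda>n. ?f (n + 2)) sums (exp x - 1 - x)" using sums_split_initial_segment[OF exp_converges[of x], of 2]
  by (simp add: numeral_2_eq_2 algebra_simps)
 have g: "(\<lambda>n. ?g (n + 2)) sums (exp (norm x) - 1 - norm x)"
  using sums_split_initial_segment[OF exp_converges[of "norm x"], of 2] by (simp add: numeral_2_eq_2 algebra_simps)
 have le: "norm (?f n) \<le> ?g n" for n by (simp add: norm_power_ineq mult_left_mono)
 have "norm (exp x - 1 - x) \<le> exp (norm x) - 1 - norm x" unfolding sums_unique[OF f] sums_unique[OF g]
  by (rule norm_suminf_le[OF le sums_summable[OF g]])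
 also have "\<dots> \<le> (norm x)\<^sup>2" using exp_bound[of "norm x"] assms by simp
 finally show ?thesis .
qed

lemma norm_power_diff_le:
 fixes x y :: "'a::real_normed_algebra_1"
 assumes "norm x \<le> r" "norm y \<le> r"
 shows "norm (x ^ n - y ^ n) \<le> of_nat n * r ^ (n - 1) * norm (x - y)"
proof (induction n)
 case (Suc n)
 have r: "0 \<le> r" using assms(1) norm_ge_zero order_trans by blast
 have "x ^ Suc n - y ^ Suc n = x * (x ^ n - y ^ n) + (x - y) * y ^ n" by (simp add: algebra_simps)
 also have "norm \<dots> \<le> norm x * norm (x ^ n - y ^ n) + norm (x - y) * norm y ^ n"
  by (intro norm_triangle_mono norm_mult_ineq[THEN order_trans] mult_left_mono norm_power_ineq) auto
 also have "\<dots> \<le> r * (of_nat n * r ^ (n - 1) * norm (x - y)) + norm (x - y) * r ^ n"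
  using assms r by (intro add_mono mult_mono Suc power_mono) auto
 also have "\<dots> = of_nat (Suc n) * r ^ n * norm (x - y)" by (cases n) (auto simp: algebra_simps)
 finally show ?case by simp
qed simp

text \<open>The exponential series differentiated termwise; its terms are Lipschitz constants of the
  maps \<open>x ^ n / n!\<close> on the ball of radius \<open>r\<close>.\<close>

lemma sums_exp_derivative: "(\<lambda>n. real n * r ^ (n - 1) / fact n) sums exp (r :: real)"
proof -
 have "(\<lambda>n. real (Suc n) * r ^ n / fact (Suc n)) sums exp r"
  using exp_converges[of r] by (simp add: field_simps del: of_nat_Suc)
 then show ?thesis using sums_Suc_iff[of "\<lambda>n. real n * r ^ (n - 1) / fact n"] by simp
qed

lemma norm_exp_term_diff_le:
 fixes x y :: "'a::real_normed_algebra_1"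
 assumes "norm x \<le> r" "norm y \<le> r"
 shows "norm (x ^ n /\<^sub>R fact n - y ^ n /\<^sub>R fact n) \<le> (real n * r ^ (n - 1) / fact n) * norm (x - y)"
proof -
 have "norm (x ^ n /\<^sub>R fact n - y ^ n /\<^sub>R fact n) = norm (x ^ n - y ^ n) / fact n"
  by (simp add: divide_inverse mult.commute flip: scaleR_diff_right)
 also have "\<dots> \<le> (real n * r ^ (n - 1) * norm (x - y)) / fact n"
  using norm_power_diff_le[OF assms, of n] by (intro divide_right_mono) auto
 finally show ?thesis by simp
qed

lemma norm_exp_diff_le:
 fixes x y :: "'a::{real_normed_algebra_1,banach}"
 assumes "norm x \<le> r" "norm y \<le> r"
 shows "norm (exp x - exp y) \<le> exp r * norm (x - y)"
proof -
 let ?g = "\<lambda>n. (real n * r ^ (n - 1) / fact n) * norm (x - y)"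
 have g: "?g sums (exp r * norm (x - y))" by (rule sums_mult2[OF sums_exp_derivative])
 have f: "(\<lambda>n. x ^ n /\<^sub>R fact n - y ^ n /\<^sub>R fact n) sums (exp x - exp y)" by (intro sums_diff exp_converges)
 show ?thesis unfolding sums_unique[OF f] sums_unique[OF g]
  by (rule norm_suminf_le[OF norm_exp_term_diff_le[OF assms] sums_summable[OF g]])
qed

lemma continuous_on_exp_algebra [continuous_intros]:
 fixes f :: "_ \<Rightarrow> 'a::{real_normed_algebra_1,banach}"
 assumes "continuous_on S f"
 shows "continuous_on S (\<lambda>x. exp (f x))"
proof -
 have "isCont exp (a :: 'a)" for a
 proof -
  have "(exp (norm a + 1))-lipschitz_on (ball 0 (norm a + 1)) (exp :: 'a \<Rightarrow> 'a)"
   by (rule lipschitz_onI) (auto simp: dist_norm intro!: norm_exp_diff_le)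
  then have "continuous_on (ball 0 (norm a + 1)) (exp :: 'a \<Rightarrow> 'a)" by (rule lipschitz_on_continuous_on)
  then show ?thesis by (simp add: continuous_on_eq_continuous_at)
 qed
 then have "continuous_on UNIV (exp :: 'a \<Rightarrow> 'a)" by (simp add: continuous_at_imp_continuous_on)
 then show ?thesis by (rule continuous_on_compose2[OF _ assms]) simp
qed

lemma exp_of_nat_mult_algebra:
 fixes x :: "'a::{real_normed_algebra_1,banach}"
 shows "exp (of_nat n * x) = exp x ^ n"
proof (induction n)
 case (Suc n)
 have "exp (x + of_nat n * x) = exp x * exp (of_nat n * x)"
  by (rule exp_add_commuting) (metis mult.assoc mult_of_nat_commute)
 then show ?case by (simp add: Suc distrib_right)
qed simp

text \<open>\<open>X k\<close> is compared with \<open>exp (a / m)\<close>, whose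
  \<open>m\<close>-th power is exactly \<open>exp a\<close>. The two differ by O(1/m^2), and taking
  \<open>m\<close>-th powers multiplies this by at most \<open>m\<close> times a bounded
  factor.\<close>

lemma power_limit_exp:
 fixes X :: "nat \<Rightarrow> 'a::{real_normed_algebra_1,banach}"
 assumes X: "\<And>k. norm (X k - 1 - a /\<^sub>R real (m k)) \<le> C / (real (m k))\<^sup>2"
  and m: "filterlim m at_top sequentially"
 shows "(\<lambda>k. X k ^ m k) \<longlonglongrightarrow> exp a"
proof -
 have C: "C \<ge> 0 \<or> m k = 0" for k using order_trans[OF norm_ge_zero X[of k]] by (auto simp: zero_le_divide_iff)
 \<comment> \<open>\<open>C\<close> is the given second-order error of \<open>X k\<close>, and
   \<open>(norm a)^2\<close> that of \<open>exp (a / m)\<close>. The latter needs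
   \<open>norm a \<le> m\<close>; together with \<open>m \<ge> C\<close> and
   \<open>m \<ge> 1\<close> this is secured next.\<close>
 let ?K = "C + (norm a)\<^sup>2"
 have "\<forall>\<^sub>F k in sequentially. m k \<ge> nat \<lceil>max 1 (max (norm a) C)\<rceil>" using m unfolding filterlim_at_top by blast
 then have "\<forall>\<^sub>F k in sequentially. real (m k) \<ge> 1 \<and> real (m k) \<ge> norm a \<and> real (m k) \<ge> C" by eventually_elim linarith
 then have "\<forall>\<^sub>F k in sequentially. norm (X k ^ m k - exp a) \<le> exp (norm a + 1) * ?K / real (m k)"
 proof eventually_elim
  case (elim k)
  define n where "n = real (m k)"
  have n: "n > 0" "n \<ge> norm a" "n \<ge> C" using elim by (auto simp: n_def)
  define Y where "Y = exp (a /\<^sub>R n)"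
  define r where "r = 1 + (norm a + 1) / n"
  have na: "norm (a /\<^sub>R n) = norm a / n" using n(1) by (simp add: divide_inverse)
  have "of_nat (m k) * (a /\<^sub>R n) = (real (m k) *\<^sub>R 1) * (a /\<^sub>R n)"
   by (simp only: scaleR_conv_of_real of_real_of_nat_eq mult_1_right)
  also have "\<dots> = a" using n(1) by (simp add: n_def)
  finally have "of_nat (m k) * (a /\<^sub>R n) = a" .
  then have Ym: "Y ^ m k = exp a" by (simp only: Y_def exp_of_nat_mult_algebra[symmetric])
  have "norm Y \<le> exp (norm a / n)" unfolding Y_def using norm_exp[of "a /\<^sub>R n"] na by simp
  have "norm (X k - Y) \<le> norm (X k - 1 - a /\<^sub>R n) + norm (Y - 1 - a /\<^sub>R n)"
   using norm_triangle_ineq4[of "X k - 1 - a /\<^sub>R n" "Y - 1 - a /\<^sub>R n"] by simp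
  also have "\<dots> \<le> C / n\<^sup>2 + (norm a / n)\<^sup>2"
   using X[of k] exp_second_order[of "a /\<^sub>R n"] na n by (auto simp: n_def Y_def intro!: add_mono)
  finally have d: "norm (X k - Y) \<le> ?K / n\<^sup>2" by (simp add: power_divide add_divide_distrib)
  have "norm (X k) \<le> norm (X k - 1 - a /\<^sub>R n) + norm (1 + a /\<^sub>R n)"
   using norm_triangle_ineq[of "X k - 1 - a /\<^sub>R n" "1 + a /\<^sub>R n"] by (simp add: algebra_simps)
  also have "\<dots> \<le> C / n\<^sup>2 + (1 + norm a / n)"
   using X[of k] norm_triangle_ineq[of 1 "a /\<^sub>R n"] na by (intro add_mono) (auto simp: n_def)
  also have "C / n\<^sup>2 \<le> 1 / n" using n by (simp add: power2_eq_square field_simps)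
  finally have Xr: "norm (X k) \<le> r" by (simp add: r_def add_divide_distrib)
  also have "r \<le> exp ((norm a + 1) / n)" unfolding r_def by (rule exp_ge_add_one_self)
  finally have Xe: "norm (X k) \<le> exp ((norm a + 1) / n)" .
  have Ye: "norm Y \<le> exp ((norm a + 1) / n)"
   by (rule order_trans[OF \<open>norm Y \<le> _\<close>]) (simp add: divide_right_mono n(1) less_imp_le)
  have "norm (X k ^ m k - exp a) \<le> n * exp ((norm a + 1) / n) ^ (m k - 1) * norm (X k - Y)"
   using norm_power_diff_le[OF Xe Ye, of "m k"] by (simp add: n_def Ym)
  also have "\<dots> \<le> n * exp ((norm a + 1) / n) ^ m k * (?K / n\<^sup>2)" using n d by (intro mult_mono power_increasing) auto
  also have "exp ((norm a + 1) / n) ^ m k = exp (norm a + 1)" using n by (simp add: n_def flip: exp_of_nat_mult)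
  also have "n * exp (norm a + 1) * (?K / n\<^sup>2) = exp (norm a + 1) * ?K / n" using n(1) by (simp add: power2_eq_square)
  finally show ?case by (simp add: n_def)
 qed
 moreover have "(\<lambda>k. exp (norm a + 1) * ?K / real (m k)) \<longlonglongrightarrow> 0"
  by (rule tendsto_divide_0[OF tendsto_const filterlim_at_top_imp_at_infinity
     [OF filterlim_compose[OF filterlim_real_sequentially m]]])
 ultimately have "(\<lambda>k. X k ^ m k - exp a) \<longlonglongrightarrow> 0" by (rule Lim_null_comparison)
 then show ?thesis by (rule LIM_zero_cancel)
qed

section \<open>Spectral theory of symmetric endomorphisms\<close>

lemma quadratic_nonneg_linear_coeff_zero:
 fixes b c :: real
 assumes "\<And>t. 0 \<le> 2 * t * b + t\<^sup>2 * c"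
 shows "b = 0"
proof (rule ccontr)
 assume "b \<noteq> 0"
 \<comment> \<open>Any positive \<open>d\<close> above \<open>c\<close> serves: at
   \<open>t = - b / d\<close> the quadratic takes the value \<open>b^2 (c - 2 d) / d^2\<close>,
   which is negative.\<close>
 define d where "d = \<bar>c\<bar> + 1"
 have d: "d > 0" "c < d" by (auto simp: d_def)
 have "0 \<le> 2 * (- b / d) * b + (- b / d)\<^sup>2 * c" by (rule assms)
 also have "\<dots> = b\<^sup>2 * (c - 2 * d) / d\<^sup>2" using d by (simp add: field_simps power2_eq_square)
 also have "\<dots> < 0" using d \<open>b \<noteq> 0\<close> by (intro divide_neg_pos mult_pos_neg) auto
 finally show False by simp
qed

text \<open>Along \<open>v + t w\<close> the form is a quadratic polynomial in \<open>t\<close>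
  without constant term; being nonnegative for both signs of \<open>t\<close> forces its linear
  coefficient to vanish. The version on a subspace is what invariant subspaces need.\<close>

lemma psd_null_vector:
 assumes "adj Q = Q" "subspace W" "\<And>w. w \<in> W \<Longrightarrow> w \<bullet> app Q w \<ge> 0"
  and "v \<in> W" "v \<bullet> app Q v = 0" "w \<in> W"
 shows "app Q v \<bullet> w = 0"
proof (rule quadratic_nonneg_linear_coeff_zero[where c = "w \<bullet> app Q w"])
 fix t
 have "v + t *\<^sub>R w \<in> W" using assms by (simp add: subspace_add subspace_scale)
 then have "0 \<le> (v + t *\<^sub>R w) \<bullet> app Q (v + t *\<^sub>R w)" by (rule assms(3))
 also have "\<dots> = v \<bullet> app Q v + 2 * t * (app Q v \<bullet> w) + t\<^sup>2 * (w \<bullet> app Q w)" using inner_app[of Q v w] assms(1)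
  by (simp add: inner_simps power2_eq_square inner_commute[of w "app Q v"] algebra_simps)
 finally show "0 \<le> 2 * t * (app Q v \<bullet> w) + t\<^sup>2 * (w \<bullet> app Q w)" using assms(5) by simp
qed

text \<open>The Rayleigh quotient attains its maximum \<open>r\<close> on the unit sphere of
  \<open>W\<close>. Then \<open>r 1 - A\<close> is nonnegative on \<open>W\<close> and vanishes at
  the maximiser, so \<open>psd_null_vector\<close> makes the residue orthogonal to \<open>W\<close>,
  and invariance places the residue in \<open>W\<close>.\<close>

lemma symmetric_max_eigenvector_on:
 assumes A: "adj A = A" and W: "subspace W" "W \<noteq> {0}" and inv: "\<And>w. w \<in> W \<Longrightarrow> app A w \<in> W"
 obtains v r where "v \<in> W" "norm v = 1" "app A v = r *\<^sub>R v" "\<And>w. w \<in> W \<Longrightarrow> w \<bullet> app A w \<le> r * (w \<bullet> w)"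
proof -
 obtain u where u: "u \<in> W" "u \<noteq> 0" using W subspace_0 by blast
 let ?S = "sphere 0 1 \<inter> W"
 have "u /\<^sub>R norm u \<in> ?S" using u W(1) by (simp add: subspace_scale)
 then have "?S \<noteq> {}" by blast
 moreover have "compact ?S" by (intro compact_Int_closed closed_subspace W) simp
 moreover have "continuous_on ?S (\<lambda>v. v \<bullet> app A v)" by (intro continuous_intros)
 ultimately obtain v where v: "v \<in> ?S" and mx: "\<And>w. w \<in> ?S \<Longrightarrow> w \<bullet> app A w \<le> v \<bullet> app A v"
  using continuous_attains_sup[of ?S "\<lambda>v. v \<bullet> app A v"] by blast
 define r where "r = v \<bullet> app A v"
 have le: "w \<bullet> app A w \<le> r * (w \<bullet> w)" if "w \<in> W" for w
 proof (cases "w = 0")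
  case False
  have "w /\<^sub>R norm w \<in> ?S" using False that W(1) by (simp add: subspace_scale)
  from mx[OF this] have "(w \<bullet> app A w) / (norm w)\<^sup>2 \<le> r" by (simp add: r_def divide_inverse power2_eq_square mult_ac)
  then show ?thesis using False by (simp add: divide_le_eq dot_square_norm)
 qed simp
 let ?Q = "r *\<^sub>R 1 - A"
 have vv: "v \<bullet> v = 1" using v by (simp add: dot_square_norm)
 have "app ?Q v \<bullet> w = 0" if "w \<in> W" for w by (rule psd_null_vector[OF _ W(1) _ _ _ that])
   (use A v vv le in \<open>auto simp: inner_diff_right r_def\<close>)
 moreover have "app ?Q v \<in> W" using v inv W(1) by (simp add: subspace_diff subspace_scale)
 ultimately have "app ?Q v \<bullet> app ?Q v = 0" by blast
 then have "app A v = r *\<^sub>R v" by simp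
 then show ?thesis using that[of v r] v le by auto
qed

text \<open>Either every operator acts on \<open>W\<close> as a scalar, and any unit vector will do,
  or one of them has an eigenspace properly inside \<open>W\<close>, which the others preserve
  because they commute with it.\<close>

lemma commuting_symmetric_joint_eigenvector:
 assumes "\<And>A. A \<in> \<F> \<Longrightarrow> adj A = A" "\<And>A B. A \<in> \<F> \<Longrightarrow> B \<in> \<F> \<Longrightarrow> A * B = B * A"
  and "subspace W" "W \<noteq> {0}" "\<And>A w. A \<in> \<F> \<Longrightarrow> w \<in> W \<Longrightarrow> app A w \<in> W"
 shows "\<exists>v\<in>W. norm v = 1 \<and> (\<forall>A\<in>\<F>. \<exists>r. app A v = r *\<^sub>R v)" using assms(3-5)
proof (induction "dim W" arbitrary: W rule: less_induct)
 case less
 show ?case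
 proof (cases "\<forall>A\<in>\<F>. \<exists>r. \<forall>w\<in>W. app A w = r *\<^sub>R w")
  case True
  obtain u where u: "u \<in> W" "u \<noteq> 0" using less.prems(1,2) subspace_0 by blast
  then have "u /\<^sub>R norm u \<in> W" "norm (u /\<^sub>R norm u) = 1" using less.prems(1) by (auto simp: subspace_scale)
  then show ?thesis using True by blast
 next
  case False
  then obtain A where A: "A \<in> \<F>" and nA: "\<And>r. \<exists>w\<in>W. app A w \<noteq> r *\<^sub>R w" by blast
  obtain v r where v: "v \<in> W" "norm v = 1" "app A v = r *\<^sub>R v"
   using symmetric_max_eigenvector_on[OF assms(1)[OF A] less.prems(1,2)] less.prems(3)[OF A] by metis
  define W' where "W' = {w \<in> W. app A w = r *\<^sub>R w}"
  have "subspace W'"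
  proof (rule subspaceI)
   show "0 \<in> W'" using less.prems(1) by (simp add: W'_def subspace_0)
   show "x + y \<in> W'" if "x \<in> W'" "y \<in> W'" for x y
    using that less.prems(1) by (simp add: W'_def subspace_add scaleR_right_distrib)
   show "c *\<^sub>R x \<in> W'" if "x \<in> W'" for c x using that less.prems(1) by (simp add: W'_def subspace_scale mult.commute)
  qed
  moreover have "W' \<noteq> {0}"
  proof -
   have "v \<in> W'" "v \<noteq> 0" using v by (simp add: W'_def, metis norm_zero zero_neq_one)
   then show ?thesis by blast
  qed
  moreover have inv: "app B w \<in> W'" if "B \<in> \<F>" "w \<in> W'" for B w
  proof -
   have "app A (app B w) = app B (app A w)" using assms(2)[OF A that(1)] by (metis app_simps(4))
   then show ?thesis using that less.prems(3) by (auto simp: W'_def)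
  qed
  moreover have "dim W' < dim W"
  proof (rule dim_psubset)
   have "W' \<subset> W" using nA by (auto simp: W'_def)
   then show "span W' \<subset> span W" using \<open>subspace W'\<close> less.prems(1) by (simp add: span_eq_iff[THEN iffD2])
  qed
  ultimately obtain v where "v \<in> W'" "norm v = 1" "\<forall>A\<in>\<F>. \<exists>r. app A v = r *\<^sub>R v" using less.hyps by blast
  then show ?thesis by (auto simp: W'_def)
 qed
qed

section \<open>Orthonormal bases and diagonal operators\<close>

definition onb :: "'v::euclidean_space set \<Rightarrow> bool" where
 "onb S \<longleftrightarrow> finite S \<and> (\<forall>b\<in>S. norm b = 1) \<and> pairwise orthogonal S \<and> span S = UNIV"

lemma onb_finite: "onb S \<Longrightarrow> finite S" by (simp add: onb_def)

lemma onb_inner: "onb S \<Longrightarrow> b \<in> S \<Longrightarrow> c \<in> S \<Longrightarrow> b \<bullet> c = (if b = c then 1 else 0)"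
 by (auto simp: onb_def dot_square_norm pairwise_def orthogonal_def)

lemma onb_zero: "onb S \<Longrightarrow> (\<And>b. b \<in> S \<Longrightarrow> v \<bullet> b = 0) \<Longrightarrow> v = 0"
 by (metis UNIV_I inner_eq_zero_iff onb_def orthogonal_def orthogonal_to_span)

lemma onb_eqI: "onb S \<Longrightarrow> (\<And>b. b \<in> S \<Longrightarrow> v \<bullet> b = w \<bullet> b) \<Longrightarrow> v = w"
 using onb_zero[of S "v - w"] by (simp add: inner_diff_left)

lemma onb_sum_inner:
 assumes "onb S" "b \<in> S"
 shows "(\<Sum>c\<in>S. g c * (c \<bullet> b)) = g b"
proof -
 have "(\<Sum>c\<in>S. g c * (c \<bullet> b)) = (\<Sum>c\<in>S. if c = b then g c else 0)"
  by (intro sum.cong) (auto simp: onb_inner[OF assms(1) _ assms(2)])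
 then show ?thesis using assms by (simp add: onb_finite)
qed

lemma onb_sum_inner': "onb S \<Longrightarrow> b \<in> S \<Longrightarrow> (\<Sum>c\<in>S. g c * (b \<bullet> c)) = g b"
 using onb_sum_inner[of S b g] by (simp add: inner_commute)

lemma onb_sum_scaleR:
 assumes "onb S" "b \<in> S"
 shows "(\<Sum>c\<in>S. (g c * (c \<bullet> b)) *\<^sub>R c) = g b *\<^sub>R b"
proof -
 have "(\<Sum>c\<in>S. (g c * (c \<bullet> b)) *\<^sub>R c) = (\<Sum>c\<in>S. if c = b then g c *\<^sub>R c else 0)"
  by (intro sum.cong) (auto simp: onb_inner[OF assms(1) _ assms(2)])
 then show ?thesis using assms by (simp add: onb_finite)
qed

lemma onb_expand: "onb S \<Longrightarrow> v = (\<Sum>b\<in>S. (b \<bullet> v) *\<^sub>R b)"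
 by (rule onb_eqI, assumption) (simp add: inner_sum_left onb_sum_inner inner_commute[of v])

lemma onb_norm: "onb S \<Longrightarrow> (norm v)\<^sup>2 = (\<Sum>b\<in>S. (b \<bullet> v)\<^sup>2)"
proof -
 assume S: "onb S"
 have "(norm v)\<^sup>2 = v \<bullet> (\<Sum>b\<in>S. (b \<bullet> v) *\<^sub>R b)" using onb_expand[OF S, of v] by (simp add: dot_square_norm)
 then show ?thesis by (simp add: inner_sum_right power2_eq_square inner_commute)
qed

lemma onb_nonempty: "onb S \<Longrightarrow> S \<noteq> {}" using onb_norm[of S "SOME b. b \<in> Basis"] by (auto simp: some_in_eq)

lemma endo_eq_onb: "onb S \<Longrightarrow> (\<And>b. b \<in> S \<Longrightarrow> app A b = app B b) \<Longrightarrow> A = B"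
proof (rule endo_eqI)
 fix v assume S: "onb S" and eq: "\<And>b. b \<in> S \<Longrightarrow> app A b = app B b"
 show "app A v = app B v" by (subst (1 2) onb_expand[OF S, of v]) (simp add: app_sum_right eq)
qed

text \<open>A joint eigenvector is split off; its orthogonal complement in \<open>W\<close> stays
  invariant because the operators are symmetric.\<close>

lemma commuting_symmetric_joint_eigenbasis:
 assumes "\<And>A. A \<in> \<F> \<Longrightarrow> adj A = A" "\<And>A B. A \<in> \<F> \<Longrightarrow> B \<in> \<F> \<Longrightarrow> A * B = B * A"
 obtains S where "onb S" "\<And>A b. A \<in> \<F> \<Longrightarrow> b \<in> S \<Longrightarrow> \<exists>r. app A b = r *\<^sub>R b"
proof -
 have "\<exists>S. finite S \<and> (\<forall>b\<in>S. norm b = 1) \<and> pairwise orthogonal S \<and> S \<subseteq> W \<and> W \<subseteq> span S \<and>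
   (\<forall>A\<in>\<F>. \<forall>b\<in>S. \<exists>r. app A b = r *\<^sub>R b)"
  if "subspace W" "\<And>A w. A \<in> \<F> \<Longrightarrow> w \<in> W \<Longrightarrow> app A w \<in> W" for W using that
 proof (induction "dim W" arbitrary: W rule: less_induct)
  case less
  show ?case
  proof (cases "W = {0}")
   case True
   then show ?thesis by (intro exI[of _ "{}"]) auto
  next
   case False
   have "\<exists>v\<in>W. norm v = 1 \<and> (\<forall>A\<in>\<F>. \<exists>r. app A v = r *\<^sub>R v)" by (rule commuting_symmetric_joint_eigenvector)
     (assumption | rule assms less.prems False)+
   then obtain v where v: "v \<in> W" "norm v = 1" and v_eig: "\<forall>A\<in>\<F>. \<exists>r. app A v = r *\<^sub>R v" by (elim bexE conjE)
   have vv: "v \<bullet> v = 1" using v(2) by (simp add: dot_square_norm)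
   define W' where "W' = {w \<in> W. v \<bullet> w = 0}"
   have sub: "subspace W'" using less.prems(1) by (auto simp: W'_def subspace_def inner_simps)
   have inv: "app A w \<in> W'" if A: "A \<in> \<F>" and w: "w \<in> W'" for A w
   proof -
    obtain r where "app A v = r *\<^sub>R v" using v_eig A by blast
    then have "v \<bullet> app A w = 0" using w assms(1)[OF A] inner_app[of A v w] by (simp add: W'_def)
    then show ?thesis using w less.prems(2)[OF A] by (simp add: W'_def)
   qed
   have "dim W' < dim W"
   proof (rule dim_psubset)
    have "v \<notin> W'" "W' \<subseteq> W" using vv by (auto simp: W'_def)
    then have "W' \<subset> W" using v(1) by blast
    then show "span W' \<subset> span W" using sub less.prems(1) by (simp add: span_eq_iff[THEN iffD2])
   qed
   from less.hyps[OF this sub inv] obtain S where S: "finite S" "\<forall>b\<in>S. norm b = 1"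
    "pairwise orthogonal S" "S \<subseteq> W'" "W' \<subseteq> span S" "\<forall>A\<in>\<F>. \<forall>b\<in>S. \<exists>r. app A b = r *\<^sub>R b" by blast
   have "w \<in> span (insert v S)" if "w \<in> W" for w
   proof -
    have "w - (v \<bullet> w) *\<^sub>R v \<in> W'"
     using that v vv less.prems(1) by (simp add: W'_def inner_simps subspace_diff subspace_scale)
    then show ?thesis using S(5) by (subst span_insert) blast
   qed
   moreover have "pairwise orthogonal (insert v S)"
    using S(3,4) by (auto simp: pairwise_insert orthogonal_def W'_def inner_commute)
   ultimately show ?thesis using S v v_eig by (intro exI[of _ "insert v S"]) (auto simp: W'_def)
  qed
 qed
 from this[of UNIV] show ?thesis using that unfolding onb_def by (metis UNIV_I subspace_UNIV top.extremum_uniqueI)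
qed

lemma symmetric_eigenbasis:
 assumes "adj A = A"
 obtains S r where "onb S" "\<And>b. b \<in> S \<Longrightarrow> app A b = r b *\<^sub>R b"
proof -
 obtain S where "onb S" "\<And>B b. B \<in> {A} \<Longrightarrow> b \<in> S \<Longrightarrow> \<exists>r. app B b = r *\<^sub>R b"
  by (rule commuting_symmetric_joint_eigenbasis[of "{A}"]) (use assms in auto)
 then show ?thesis using that by (metis singletonI)
qed

definition diag :: "'v::euclidean_space set \<Rightarrow> ('v \<Rightarrow> real) \<Rightarrow> 'v endo" where
 "diag S f = endo_of (\<lambda>v. \<Sum>b\<in>S. (f b * (b \<bullet> v)) *\<^sub>R b)"

lemma app_diag: "app (diag S f) v = (\<Sum>b\<in>S. (f b * (b \<bullet> v)) *\<^sub>R b)" unfolding diag_def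
 by (rule app_endo_of, rule linearI)
  (simp_all add: inner_simps algebra_simps sum.distrib scaleR_sum_right)

lemma app_diag_basis: "onb S \<Longrightarrow> b \<in> S \<Longrightarrow> app (diag S f) b = f b *\<^sub>R b" by (simp add: app_diag onb_sum_scaleR)

lemma diag_eq: "onb S \<Longrightarrow> (\<And>b. b \<in> S \<Longrightarrow> app A b = f b *\<^sub>R b) \<Longrightarrow> A = diag S f"
 by (rule endo_eq_onb) (auto simp: app_diag_basis)

lemma adj_diag: "adj (diag S f) = diag S f"
 by (rule adjI) (simp add: app_diag inner_sum_left inner_sum_right inner_commute mult_ac)

lemma norm_diag_le:
 assumes S: "onb S" and f: "\<And>b. b \<in> S \<Longrightarrow> \<bar>f b\<bar> \<le> c" and c: "0 \<le> c"
 shows "norm (diag S f) \<le> c"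
proof (rule norm_endo_le[OF _ c])
 fix v
 have "(norm (app (diag S f) v))\<^sup>2 = (\<Sum>b\<in>S. (f b * (b \<bullet> v))\<^sup>2)" unfolding onb_norm[OF S]
  by (intro sum.cong refl arg_cong[where f = "\<lambda>x. x\<^sup>2"])
   (simp add: app_diag inner_sum_right onb_sum_inner'[OF S])
 also have "\<dots> \<le> (\<Sum>b\<in>S. (c * (b \<bullet> v))\<^sup>2)"
  using f c by (intro sum_mono) (simp add: power_mult_distrib mult_right_mono abs_le_square_iff[THEN iffD1])
 also have "\<dots> = (c * norm v)\<^sup>2" by (simp add: power_mult_distrib onb_norm[OF S] sum_distrib_left)
 finally show "norm (app (diag S f) v) \<le> c * norm v" using c by (simp add: power2_le_iff_abs_le)
qed

lemma eigenvalue_le_norm: "app A v = r *\<^sub>R v \<Longrightarrow> norm v = 1 \<Longrightarrow> \<bar>r\<bar> \<le> norm A" using norm_app[of A v] by simp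

lemma norm_diag_attained:
 assumes S: "onb S"
 obtains b where "b \<in> S" "\<bar>f b\<bar> = norm (diag S f)"
proof -
 have fin: "finite ((\<lambda>b. \<bar>f b\<bar>) ` S)" "(\<lambda>b. \<bar>f b\<bar>) ` S \<noteq> {}" using onb_finite[OF S] onb_nonempty[OF S] by auto
 from Max_in[OF this] obtain b where b: "b \<in> S" "\<bar>f b\<bar> = Max ((\<lambda>b. \<bar>f b\<bar>) ` S)" by auto
 have "norm (diag S f) \<le> \<bar>f b\<bar>"
 proof (rule norm_diag_le[OF S])
  show "\<bar>f c\<bar> \<le> \<bar>f b\<bar>" if "c \<in> S" for c using that fin(1) by (simp add: b(2))
 qed simp
 moreover have "\<bar>f b\<bar> \<le> norm (diag S f)"
  using S b(1) by (intro eigenvalue_le_norm[of _ b]) (auto simp: app_diag_basis onb_def)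
 ultimately show ?thesis using that b(1) by (metis antisym)
qed

lemma diag_mult: "onb S \<Longrightarrow> diag S f * diag S g = diag S (\<lambda>b. f b * g b)"
 by (rule diag_eq) (auto simp: app_diag_basis mult.commute)

lemma diag_scaleR: "r *\<^sub>R diag S f = diag S (\<lambda>b. r * f b)"
 by (rule endo_eqI) (simp add: app_diag scaleR_sum_right mult.assoc)

lemma exp_diag: "onb S \<Longrightarrow> exp (diag S f) = diag S (\<lambda>b. exp (f b))"
 by (rule diag_eq) (auto intro: exp_eigenvector app_diag_basis)

lemma symmetric_norm_eigenvector:
 assumes "adj A = A"
 obtains v r where "norm v = 1" "app A v = r *\<^sub>R v" "\<bar>r\<bar> = norm A"
proof -
 obtain S r where S: "onb S" and r: "\<And>b. b \<in> S \<Longrightarrow> app A b = r b *\<^sub>R b" using symmetric_eigenbasis[OF assms] by blast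
 have A: "A = diag S r" by (rule diag_eq[OF S r])
 obtain b where "b \<in> S" "\<bar>r b\<bar> = norm A" using norm_diag_attained[OF S] A by metis
 then show ?thesis using that[of b "r b"] r S by (auto simp: onb_def)
qed

text \<open>In an eigenbasis of \<open>A\<close> the component of \<open>v\<close> along
  \<open>b\<close> can be nonzero only if \<open>exp (a b) = exp r\<close>, that is
  \<open>a b = r\<close>. Injectivity of \<open>exp\<close> on symmetric operators follows.\<close>

lemma symmetric_exp_eigenvector:
 assumes "adj A = A" "app (exp A) v = exp r *\<^sub>R v"
 shows "app A v = r *\<^sub>R v"
proof -
 obtain S a where S: "onb S" and a: "\<And>b. b \<in> S \<Longrightarrow> app A b = a b *\<^sub>R b" using symmetric_eigenbasis[OF assms(1)] by blast
 have "app A v \<bullet> b = (r *\<^sub>R v) \<bullet> b" if b: "b \<in> S" for b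
 proof -
  have "exp r * (v \<bullet> b) = app (exp A) v \<bullet> b" by (simp add: assms(2))
  also have "\<dots> = v \<bullet> app (exp A) b" using assms(1) by (simp add: inner_app adj_exp)
  also have "app (exp A) b = exp (a b) *\<^sub>R b" by (rule exp_eigenvector[OF a[OF b]])
  finally have "v \<bullet> b = 0 \<or> r = a b" by auto
  moreover have "app A v \<bullet> b = a b * (v \<bullet> b)" using assms(1) by (simp add: inner_app a[OF b])
  ultimately show ?thesis by auto
 qed
 then show ?thesis by (rule onb_eqI[OF S])
qed

lemma symmetric_exp_inj:
 assumes "adj A = A" "adj B = B" "exp A = exp B"
 shows "A = B"
proof -
 obtain S a where S: "onb S" and a: "\<And>b. b \<in> S \<Longrightarrow> app A b = a b *\<^sub>R b" using symmetric_eigenbasis[OF assms(1)] by blast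
 show ?thesis
 proof (rule endo_eq_onb[OF S])
  fix b assume b: "b \<in> S"
  have "app (exp B) b = exp (a b) *\<^sub>R b" using exp_eigenvector[OF a[OF b]] assms(3) by simp
  from symmetric_exp_eigenvector[OF assms(2) this] a[OF b] show "app A b = app B b" by simp
 qed
qed

lemma abs_le_exp_minus_one:
 assumes "\<bar>exp r - 1\<bar> \<le> 1 / 2"
 shows "\<bar>r\<bar> \<le> 2 * \<bar>exp r - (1::real)\<bar>"
proof (cases "r \<ge> 0")
 case True
 then show ?thesis using exp_ge_add_one_self[of r] by (smt (verit))
next
 case False
 define x where "x = - r"
 have x: "x > 0" using False by (simp add: x_def)
 have "exp r = 1 / exp x" by (simp add: x_def exp_minus divide_inverse)
 also have "\<dots> \<le> 1 / (1 + x)" using exp_ge_add_one_self[of x] x by (intro divide_left_mono) auto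
 finally have le: "1 - exp r \<ge> x / (1 + x)" using x by (simp add: field_simps)
 moreover have "\<bar>exp r - 1\<bar> = 1 - exp r" using False by simp
 ultimately have "x / (1 + x) \<le> 1 / 2" using assms by linarith
 then have "x \<le> 1" using x by (simp add: field_simps)
 then have "x / 2 \<le> x / (1 + x)" using x by (intro divide_left_mono) auto
 moreover have "\<bar>r\<bar> = x" using False by (simp add: x_def)
 ultimately show ?thesis using le \<open>\<bar>exp r - 1\<bar> = 1 - exp r\<close> by (smt (verit) field_sum_of_halves)
qed

text \<open>The eigenvalue of largest modulus is compared with its exponential. The bound controls
  the logarithm of a curve of positive operators near 1, which is needed to differentiate curves in
  \<open>X\<close>.\<close>

lemma symmetric_norm_le_exp_minus_one:
 assumes "adj A = A" "norm (exp A - 1) \<le> 1 / 2"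
 shows "norm A \<le> 2 * norm (exp A - 1)"
proof -
 obtain v r where v: "norm v = 1" "app A v = r *\<^sub>R v" "\<bar>r\<bar> = norm A"
  using symmetric_norm_eigenvector[OF assms(1)] by blast
 have "app (exp A - 1) v = (exp r - 1) *\<^sub>R v" by (simp add: exp_eigenvector[OF v(2)] algebra_simps)
 from eigenvalue_le_norm[OF this v(1)] have "\<bar>exp r - 1\<bar> \<le> norm (exp A - 1)" .
 then show ?thesis using abs_le_exp_minus_one[of r] v(3) assms(2) by (smt (verit))
qed

text \<open>Bounds on \<open>exp A\<close> and on its inverse confine the spectrum of
  \<open>A\<close> from above and from below.\<close>

lemma symmetric_norm_le_of_exp:
 assumes "adj A = A" "norm (exp A) \<le> c" "norm (exp (- A)) \<le> c"
 shows "exp (norm A) \<le> c"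
proof -
 obtain v r where v: "norm v = 1" "app A v = r *\<^sub>R v" "\<bar>r\<bar> = norm A"
  using symmetric_norm_eigenvector[OF assms(1)] by blast
 have "app (- A) v = (- r) *\<^sub>R v" using v(2) by simp
 from eigenvalue_le_norm[OF exp_eigenvector[OF this] v(1)]
  eigenvalue_le_norm[OF exp_eigenvector[OF v(2)] v(1)]
 show ?thesis using assms v(3) by (cases "r \<ge> 0") auto
qed

text \<open>The top of the numerical range: the largest eigenvalue of \<open>A\<close> if
  \<open>A\<close> is symmetric, and that of its symmetric part in general. It is sublinear but not
  even, which is why the resulting metric is asymmetric.\<close>

definition rmax :: "'v::euclidean_space endo \<Rightarrow> real" where
 "rmax A = (SUP v\<in>sphere 0 1. v \<bullet> app A v)"

lemma unit_sphere_nonempty: "sphere (0::'v::euclidean_space) 1 \<noteq> {}"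
proof -
 have "(SOME b. b \<in> Basis) \<in> sphere (0::'v) 1" by (simp add: some_in_eq)
 then show ?thesis by blast
qed

lemma norm_attained: obtains v where "norm v = 1" "norm (app A v) = norm A"
proof -
 have "continuous_on (sphere 0 1) (\<lambda>v. norm (app A v))" by (intro continuous_intros)
 then obtain v where v: "v \<in> sphere 0 1" and mx: "\<And>w. w \<in> sphere 0 1 \<Longrightarrow> norm (app A w) \<le> norm (app A v)"
  using continuous_attains_sup[of "sphere 0 1" "\<lambda>v. norm (app A v)"] unit_sphere_nonempty by auto
 have "norm A \<le> norm (app A v)"
 proof (rule norm_endo_le)
  fix w
  show "norm (app A w) \<le> norm (app A v) * norm w"
  proof (cases "w = 0")
   case False
   then have "norm (app A w) / norm w \<le> norm (app A v)"
    using mx[of "w /\<^sub>R norm w"] by (simp add: divide_inverse mult.commute)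
   then show ?thesis using False by (simp add: field_simps)
  qed simp
 qed simp
 then show ?thesis using that[of v] v norm_app[of A v] by simp
qed

lemma rayleigh_attained: obtains v where "norm v = 1" "v \<bullet> app A v = rmax A"
 and "\<And>w. w \<bullet> app A w \<le> rmax A * (w \<bullet> w)"
proof -
 have "continuous_on (sphere 0 1) (\<lambda>v. v \<bullet> app A v)" by (intro continuous_intros)
 then obtain v where v: "v \<in> sphere 0 1" and mx: "\<And>w. w \<in> sphere 0 1 \<Longrightarrow> w \<bullet> app A w \<le> v \<bullet> app A v"
  using continuous_attains_sup[of "sphere 0 1" "\<lambda>v. v \<bullet> app A v"] unit_sphere_nonempty by auto
 have eq: "rmax A = v \<bullet> app A v" unfolding rmax_def using v mx by (intro cSup_eq_maximum) auto
 have "w \<bullet> app A w \<le> rmax A * (w \<bullet> w)" for w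
 proof (cases "w = 0")
  case False
  then have "(w \<bullet> app A w) / (norm w)\<^sup>2 \<le> rmax A"
   using mx[of "w /\<^sub>R norm w"] by (simp add: eq divide_inverse power2_eq_square mult_ac)
  then show ?thesis using False by (simp add: divide_le_eq dot_square_norm)
 qed simp
 then show ?thesis using that v eq by auto
qed

lemma rayleigh_le: "w \<bullet> app A w \<le> rmax A * (w \<bullet> w)" using rayleigh_attained[of A] by metis

lemma rayleigh_le_unit: "norm w = 1 \<Longrightarrow> w \<bullet> app A w \<le> rmax A" using rayleigh_le[of w A] by (simp add: dot_square_norm)

lemma rmax_leI: "(\<And>w. norm w = 1 \<Longrightarrow> w \<bullet> app A w \<le> c) \<Longrightarrow> rmax A \<le> c" using rayleigh_attained[of A] by metis

lemma rmax_add: "rmax (A + B) \<le> rmax A + rmax B"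
 by (rule rmax_leI) (simp add: inner_add_right add_mono rayleigh_le_unit)

lemma rmax_scaleR: "0 \<le> r \<Longrightarrow> rmax (r *\<^sub>R A) = r * rmax A"
proof (rule antisym)
 assume r: "0 \<le> r"
 show "rmax (r *\<^sub>R A) \<le> r * rmax A" by (rule rmax_leI) (simp add: mult_left_mono r rayleigh_le_unit)
 obtain v where v: "norm v = 1" "v \<bullet> app A v = rmax A" using rayleigh_attained[of A] by metis
 show "r * rmax A \<le> rmax (r *\<^sub>R A)" using rayleigh_le_unit[OF v(1), of "r *\<^sub>R A"] v(2) by simp
qed

lemma rmax_le_norm: "rmax A \<le> norm A"
proof (rule rmax_leI)
 fix w :: 'a assume "norm w = 1"
 then show "w \<bullet> app A w \<le> norm A" using Cauchy_Schwarz_ineq2[of w "app A w"] norm_app[of A w] by simp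
qed

lemma rmax_lipschitz: "\<bar>rmax A - rmax B\<bar> \<le> norm (A - B)"
 using rmax_add[of "A - B" B] rmax_add[of "B - A" A] rmax_le_norm[of "A - B"] rmax_le_norm[of "B - A"]
 by (simp add: norm_minus_commute)

lemma continuous_on_rmax [continuous_intros]:
 assumes "continuous_on S f"
 shows "continuous_on S (\<lambda>x. rmax (f x))"
proof -
 have "1-lipschitz_on UNIV (rmax :: 'b endo \<Rightarrow> real)" by (rule lipschitz_onI) (simp_all add: dist_norm rmax_lipschitz)
 then show ?thesis using continuous_on_compose2[OF lipschitz_on_continuous_on assms] by auto
qed

lemma norm_app_isometry: "adj U * U = 1 \<Longrightarrow> norm (app U v) = norm v"
 by (metis app_adj app_simps(4,5) norm_eq_sqrt_inner inner_commute)

lemma norm_mult_isometry_left: "adj U * U = 1 \<Longrightarrow> norm (U * A) = norm A"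
proof (rule antisym)
 assume U: "adj U * U = 1"
 show "norm (U * A) \<le> norm A" by (rule norm_endo_le) (simp_all add: norm_app_isometry[OF U] norm_app)
 show "norm A \<le> norm (U * A)" by (rule norm_endo_le) (metis U app_simps(4) norm_app norm_app_isometry, simp)
qed

lemma norm_mult_isometry_right: "U * adj U = 1 \<Longrightarrow> norm (A * U) = norm A"
 using norm_mult_isometry_left[of "adj U" "adj A"] by (metis adj_simps(4,8) norm_adj)

lemma rmax_conj:
 assumes "U * adj U = 1" "adj U * U = 1"
 shows "rmax (U * A * adj U) = rmax A"
proof -
 have le: "rmax (V * B * adj V) \<le> rmax B" if V: "V * adj V = 1" for V B :: "'a endo"
 proof (rule rmax_leI)
  fix w :: 'a assume w: "norm w = 1"
  have "norm (app (adj V) w) = 1" using norm_app_isometry[of "adj V" w] V w by simp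
  then show "w \<bullet> app (V * B * adj V) w \<le> rmax B" using rayleigh_le_unit[of "app (adj V) w" B] by (simp add: app_adj)
 qed
 have "adj U * (U * A * adj U) * adj (adj U) = A"
  using assms by (metis adj_simps(8) mult.assoc mult.right_neutral mult.left_neutral)
 then show ?thesis using le[OF assms(1), of A] le[of "adj U" "U * A * adj U"] assms(2) by simp
qed

lemma symmetric_rmax_diag:
 assumes S: "onb S" and b: "b \<in> S" and mx: "\<And>c. c \<in> S \<Longrightarrow> f c \<le> f b"
 shows "rmax (diag S f) = f b"
proof (rule antisym)
 show "f b \<le> rmax (diag S f)"
  using rayleigh_le_unit[of b "diag S f"] S b by (simp add: app_diag_basis onb_inner onb_def dot_square_norm)
 show "rmax (diag S f) \<le> f b"
 proof (rule rmax_leI)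
  fix w :: 'a assume w: "norm w = 1"
  have "w \<bullet> app (diag S f) w = (\<Sum>c\<in>S. f c * (c \<bullet> w)\<^sup>2)"
   by (simp add: app_diag inner_sum_right power2_eq_square inner_commute mult_ac)
  also have "\<dots> \<le> (\<Sum>c\<in>S. f b * (c \<bullet> w)\<^sup>2)" by (intro sum_mono mult_right_mono mx) auto
  also have "\<dots> = f b" using onb_norm[OF S, of w] w by (simp flip: sum_distrib_left)
  finally show "w \<bullet> app (diag S f) w \<le> f b" .
 qed
qed

text \<open>The eigenvalues of \<open>exp A\<close> are positive, so the norm is the exponential of
  the largest eigenvalue of \<open>A\<close>. This links lengths, measured by \<open>rmax\<close>,
  with operator norms.\<close>

lemma norm_exp_symmetric:
 assumes "adj A = A"
 shows "norm (exp A) = exp (rmax A)"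
proof -
 obtain S a where S: "onb S" and a: "\<And>b. b \<in> S \<Longrightarrow> app A b = a b *\<^sub>R b" using symmetric_eigenbasis[OF assms] by blast
 have A: "A = diag S a" by (rule diag_eq[OF S a])
 have "finite (a ` S)" "a ` S \<noteq> {}" using onb_finite[OF S] onb_nonempty[OF S] by auto
 from Max_in[OF this] Max_ge[OF this(1)] obtain b where b: "b \<in> S" "\<And>c. c \<in> S \<Longrightarrow> a c \<le> a b" by force
 have "norm (exp A) = exp (a b)"
 proof (rule antisym)
  show "norm (exp A) \<le> exp (a b)" unfolding A exp_diag[OF S] by (rule norm_diag_le[OF S]) (auto simp: b(2))
  show "exp (a b) \<le> norm (exp A)"
   using eigenvalue_le_norm[OF exp_eigenvector[OF a[OF b(1)]]] S b(1) by (simp add: onb_def)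
 qed
 then show ?thesis using symmetric_rmax_diag[OF S b(1), of a] b(2) A by simp
qed

section \<open>The trace form\<close>

definition trc :: "'v::euclidean_space endo \<Rightarrow> real" where
 "trc A = (\<Sum>e\<in>Basis. app A e \<bullet> e)"

lemma bounded_linear_trc: "bounded_linear (trc :: 'v::euclidean_space endo \<Rightarrow> real)"
proof (rule bounded_linear_intro[where K = "real (card (Basis :: 'v set))"])
 fix A B :: "'v endo" and r
 show "trc (A + B) = trc A + trc B" by (simp add: trc_def inner_simps sum.distrib)
 show "trc (r *\<^sub>R A) = r *\<^sub>R trc A" by (simp add: trc_def sum_distrib_left)
 have "\<bar>app A e \<bullet> e\<bar> \<le> norm A" if "e \<in> Basis" for e
  using Cauchy_Schwarz_ineq2[of "app A e" e] norm_app[of A e] that by simp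
 then have "\<bar>trc A\<bar> \<le> (\<Sum>e\<in>(Basis :: 'v set). norm A)" unfolding trc_def by (intro order_trans[OF sum_abs sum_mono])
 then show "norm (trc A) \<le> norm A * real (card (Basis :: 'v set))" by (simp add: mult.commute)
qed

lemma trc_commute: "trc (A * B) = trc (B * A)"
proof -
 have ex: "trc (A * B) = (\<Sum>e\<in>Basis. \<Sum>f\<in>Basis. (app B e \<bullet> f) * (app A f \<bullet> e))" for A B :: "'v::euclidean_space endo"
 proof -
  have "app A (app B e) = (\<Sum>f\<in>Basis. (app B e \<bullet> f) *\<^sub>R app A f)" for e
   by (subst euclidean_representation[of "app B e", symmetric]) (simp only: app_sum_right app_right_simps)
  then show ?thesis by (simp add: trc_def inner_sum_left)
 qed
 show ?thesis unfolding ex by (subst sum.swap) (simp add: mult.commute)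
qed

text \<open>The trace of \<open>adj A * A\<close> is the sum of the squared lengths of the images of
  the basis vectors.\<close>

lemma trc_adj_mult_self: "trc (adj A * A) = 0 \<Longrightarrow> A = 0"
proof (rule endo_eqI)
 fix v assume "trc (adj A * A) = 0"
 then have "(\<Sum>e\<in>Basis. app A e \<bullet> app A e) = 0" by (simp add: trc_def app_adj)
 then have "app A e = 0" if "e \<in> Basis" for e using that by (subst (asm) sum_nonneg_eq_0_iff) auto
 then have "app A (\<Sum>e\<in>Basis. (v \<bullet> e) *\<^sub>R e) = 0" by (simp only: app_sum_right app_right_simps) simp
 then show "app A v = app 0 v" by (simp add: euclidean_representation)
qed

section \<open>Calculus of smooth maps\<close>

lemma Ck_on_differentiable:
 assumes "Ck_on (Suc k) S f" "open S" "x \<in> S"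
 shows "(f has_derivative frechet_derivative f (at x)) (at x)"
proof -
 have "f differentiable (at x within S)" using assms by (simp add: differentiable_on_def)
 then show ?thesis using assms(2,3) by (simp only: at_within_open frechet_derivative_works)
qed

lemma Ck_on_cong:
 assumes "open S" "\<And>x. x \<in> S \<Longrightarrow> f x = g x" "Ck_on k S f"
 shows "Ck_on k S g" using assms(2,3)
proof (induction k arbitrary: f g)
 case 0
 then show ?case by (simp cong: continuous_on_cong)
next
 case (Suc k)
 have der: "(g has_derivative frechet_derivative f (at x)) (at x)" if "x \<in> S" for x
  using has_derivative_transform_within_open[OF Ck_on_differentiable[OF Suc.prems(2) assms(1) that] assms(1) that]
   Suc.prems(1) by blast
 then have "g differentiable_on S" by (meson differentiableI differentiable_at_withinI differentiable_on_def)
 moreover have "Ck_on k S (\<lambda>x. frechet_derivative g (at x) v)" for v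
 proof (rule Suc.IH)
  show "frechet_derivative f (at x) v = frechet_derivative g (at x) v" if "x \<in> S" for x
   using frechet_derivative_at[OF der[OF that]] by simp
  show "Ck_on k S (\<lambda>x. frechet_derivative f (at x) v)" using Suc.prems(2) by simp
 qed
 ultimately show ?case by simp
qed

text \<open>Any formula \<open>f'\<close> for the derivative may be used; the closure properties
  below are inductions on \<open>k\<close> that mainly exhibit such a formula.\<close>

lemma Ck_on_SucI:
 assumes "open S" "\<And>x. x \<in> S \<Longrightarrow> (f has_derivative f' x) (at x)" "\<And>v. Ck_on k S (\<lambda>x. f' x v)"
 shows "Ck_on (Suc k) S f"
proof -
 have "f differentiable_on S"
  using assms(2) by (meson differentiableI differentiable_at_withinI differentiable_on_def)
 moreover have "Ck_on k S (\<lambda>x. frechet_derivative f (at x) v)" for v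
  by (rule Ck_on_cong[OF assms(1) _ assms(3)]) (simp flip: frechet_derivative_at[OF assms(2)])
 ultimately show ?thesis by simp
qed

lemma Ck_on_Suc_imp: "Ck_on (Suc k) S f \<Longrightarrow> Ck_on k S f"
proof (induction k arbitrary: f)
 case 0
 then show ?case by (auto intro: differentiable_imp_continuous_on)
next
 case (Suc k)
 then show ?case by (metis Ck_on.simps(2))
qed

lemma Ck_on_continuous: "Ck_on k S f \<Longrightarrow> continuous_on S f" by (induction k) (use Ck_on_Suc_imp in auto)

lemma Ck_on_local:
 assumes "\<And>x. x \<in> S \<Longrightarrow> \<exists>U. open U \<and> x \<in> U \<and> Ck_on k U f"
 shows "Ck_on k S f" using assms
proof (induction k arbitrary: f)
 case 0
 then show ?case by (metis Ck_on.simps(1) continuous_at_imp_continuous_on continuous_on_eq_continuous_at)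
next
 case (Suc k)
 have "f differentiable_on S" using Suc.prems unfolding differentiable_on_def Ck_on.simps(2)
  by (metis at_within_open differentiable_at_withinI)
 moreover have "Ck_on k S (\<lambda>x. frechet_derivative f (at x) v)" for v by (rule Suc.IH) (metis Suc.prems Ck_on.simps(2))
 ultimately show ?case by simp
qed

lemma Ck_on_const: "Ck_on k S (\<lambda>x. c)" by (induction k arbitrary: c) simp_all

lemma Ck_on_bounded_linear_compose:
 assumes "bounded_linear L" "open S" "Ck_on k S f"
 shows "Ck_on k S (\<lambda>x. L (f x))" using assms(3)
proof (induction k arbitrary: f)
 case 0
 then show ?case using bounded_linear.continuous_on[OF assms(1)] by simp
next
 case (Suc k)
 show ?case
 proof (rule Ck_on_SucI[OF assms(2)])
  show "((\<lambda>x. L (f x)) has_derivative (\<lambda>v. L (frechet_derivative f (at x) v))) (at x)" if "x \<in> S" for x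
   by (rule bounded_linear.has_derivative[OF assms(1) Ck_on_differentiable[OF Suc.prems assms(2) that]])
  show "Ck_on k S (\<lambda>x. L (frechet_derivative f (at x) v))" for v using Suc.prems by (intro Suc.IH) simp
 qed
qed

lemma Ck_on_bounded_linear:
 assumes "bounded_linear L" "open S"
 shows "Ck_on k S L"
proof -
 have "Ck_on k S (\<lambda>x. x)"
 proof (cases k)
  case (Suc n)
  show ?thesis unfolding Suc by (rule Ck_on_SucI[OF assms(2), of _ "\<lambda>x v. v"]) (auto intro: Ck_on_const)
 qed simp
 from Ck_on_bounded_linear_compose[OF assms this] show ?thesis .
qed

lemma Ck_on_add:
 assumes "open S" "Ck_on k S f" "Ck_on k S g"
 shows "Ck_on k S (\<lambda>x. f x + g x)" using assms(2,3)
proof (induction k arbitrary: f g)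
 case 0
 then show ?case by (auto intro: continuous_on_add)
next
 case (Suc k)
 show ?case by (rule Ck_on_SucI[OF assms(1) has_derivative_add[OF Ck_on_differentiable[OF Suc.prems(1) assms(1)]
      Ck_on_differentiable[OF Suc.prems(2) assms(1)]]]) (use Suc in auto)
qed

lemma Ck_on_sum:
 assumes "open S" "\<And>i. i \<in> I \<Longrightarrow> Ck_on k S (f i)"
 shows "Ck_on k S (\<lambda>x. \<Sum>i\<in>I. f i x)" using assms(2)
 by (induction I rule: infinite_finite_induct) (auto intro: Ck_on_const Ck_on_add assms(1))

lemma Ck_on_bounded_bilinear:
 assumes B: "bounded_bilinear B" and S: "open S" and "Ck_on k S f" "Ck_on k S g"
 shows "Ck_on k S (\<lambda>x. B (f x) (g x))" using assms(3,4)
proof (induction k arbitrary: f g)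
 case 0
 then show ?case using bounded_bilinear.continuous_on[OF B] by simp
next
 case (Suc k)
 show ?case by (rule Ck_on_SucI[OF S bounded_bilinear.FDERIV[OF B Ck_on_differentiable[OF Suc.prems(1) S]
      Ck_on_differentiable[OF Suc.prems(2) S]]])
   (use Suc Ck_on_Suc_imp[OF Suc.prems(1)] Ck_on_Suc_imp[OF Suc.prems(2)] in \<open>auto intro: Ck_on_add[OF S]\<close>)
qed

lemma Ck_on_Pair:
 assumes S: "open S" and "Ck_on k S f" "Ck_on k S g"
 shows "Ck_on k S (\<lambda>x. (f x, g x))" using assms(2,3)
proof (induction k arbitrary: f g)
 case 0
 then show ?case by (auto intro: continuous_on_Pair)
next
 case (Suc k)
 show ?case by (rule Ck_on_SucI[OF S has_derivative_Pair[OF Ck_on_differentiable[OF Suc.prems(1) S]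
      Ck_on_differentiable[OF Suc.prems(2) S]]]) (use Suc in auto)
qed

lemma linear_basis_sum: "linear L \<Longrightarrow> L v = (\<Sum>b\<in>Basis. (v \<bullet> b) *\<^sub>R L b)"
 by (subst euclidean_representation[of v, symmetric]) (simp add: linear_sum linear_cmul del: euclidean_representation)

lemma Ck_on_compose:
 fixes f :: "'b::euclidean_space \<Rightarrow> 'c::real_normed_vector" and g :: "'a::euclidean_space \<Rightarrow> 'b"
 assumes S: "open S" and T: "open T" and sub: "\<And>x. x \<in> S \<Longrightarrow> g x \<in> T"
  and "Ck_on k T f" "Ck_on k S g"
 shows "Ck_on k S (\<lambda>x. f (g x))" using assms(4,5)
proof (induction k arbitrary: f)
 case 0
 then show ?case using sub continuous_on_compose2[of T f S g] by (simp add: image_subset_iff)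
next
 case (Suc k)
 note f = Ck_on_differentiable[OF Suc.prems(1) T] and g = Ck_on_differentiable[OF Suc.prems(2) S]
 \<comment> \<open>The chain rule is expanded in a basis, so that the induction hypothesis is
   applied to the derivative of \<open>f\<close> in a fixed direction \<open>b\<close>.\<close>
 let ?f' = "\<lambda>x v. \<Sum>b\<in>Basis. (frechet_derivative g (at x) v \<bullet> b) *\<^sub>R frechet_derivative f (at (g x)) b"
 show ?case
 proof (rule Ck_on_SucI[OF S, of _ ?f'])
  fix x assume x: "x \<in> S"
  have "((\<lambda>x. f (g x)) has_derivative (\<lambda>v. frechet_derivative f (at (g x)) (frechet_derivative g (at x) v))) (at x)"
   by (rule has_derivative_compose[OF g[OF x] f[OF sub[OF x]]])
  moreover have "(\<lambda>v. frechet_derivative f (at (g x)) (frechet_derivative g (at x) v)) = ?f' x"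
   using linear_basis_sum[OF has_derivative_linear[OF f[OF sub[OF x]]]] by blast
  ultimately show "((\<lambda>x. f (g x)) has_derivative ?f' x) (at x)" by simp
 next
  fix v
  show "Ck_on k S (\<lambda>x. ?f' x v)"
  proof (intro Ck_on_sum[OF S] Ck_on_bounded_bilinear[OF bounded_bilinear_scaleR S])
   fix b :: 'b
   show "Ck_on k S (\<lambda>x. frechet_derivative g (at x) v \<bullet> b)"
    using Suc.prems(2) by (intro Ck_on_bounded_linear_compose[OF bounded_linear_inner_left S]) simp
   show "Ck_on k S (\<lambda>x. frechet_derivative f (at (g x)) b)"
    using Suc.prems(1) Ck_on_Suc_imp[OF Suc.prems(2)] by (intro Suc.IH) auto
  qed
 qed
qed

lemma smooth_on_differentiable:
 "smooth_on S f \<Longrightarrow> open S \<Longrightarrow> x \<in> S \<Longrightarrow> (f has_derivative frechet_derivative f (at x)) (at x)"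
 unfolding smooth_on_def by (rule Ck_on_differentiable[of 0]) auto

lemma smooth_on_derivative: "smooth_on S f \<Longrightarrow> smooth_on S (\<lambda>x. frechet_derivative f (at x) v)"
 unfolding smooth_on_def by (metis Ck_on.simps(2))

lemma smooth_on_continuous: "smooth_on S f \<Longrightarrow> continuous_on S f"
 unfolding smooth_on_def using Ck_on_continuous by blast

lemma smooth_on_cong: "open S \<Longrightarrow> (\<And>x. x \<in> S \<Longrightarrow> f x = g x) \<Longrightarrow> smooth_on S f \<Longrightarrow> smooth_on S g"
 unfolding smooth_on_def using Ck_on_cong by blast

lemma smooth_on_local: "(\<And>x. x \<in> S \<Longrightarrow> \<exists>U. open U \<and> x \<in> U \<and> smooth_on U f) \<Longrightarrow> smooth_on S f"
 unfolding smooth_on_def by (meson Ck_on_local)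

lemma smooth_on_compose:
 "open S \<Longrightarrow> open T \<Longrightarrow> (\<And>x. x \<in> S \<Longrightarrow> g x \<in> T) \<Longrightarrow> smooth_on T f \<Longrightarrow> smooth_on S g \<Longrightarrow>
  smooth_on S (\<lambda>x. f (g x))"
 unfolding smooth_on_def by (intro allI, rule Ck_on_compose[where T = T]) auto

lemma smooth_on_Pair: "open S \<Longrightarrow> smooth_on S f \<Longrightarrow> smooth_on S g \<Longrightarrow> smooth_on S (\<lambda>x. (f x, g x))"
 unfolding smooth_on_def by (intro allI Ck_on_Pair) auto

lemma smooth_on_const: "smooth_on S (\<lambda>x. c)" unfolding smooth_on_def by (simp add: Ck_on_const)

lemma smooth_on_bounded_linear: "bounded_linear L \<Longrightarrow> open S \<Longrightarrow> smooth_on S L"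
 unfolding smooth_on_def by (simp add: Ck_on_bounded_linear)

lemma smooth_on_add: "open S \<Longrightarrow> smooth_on S f \<Longrightarrow> smooth_on S g \<Longrightarrow> smooth_on S (\<lambda>x. f x + g x)"
 unfolding smooth_on_def by (intro allI Ck_on_add) auto

lemma smooth_on_bounded_linear_compose:
 "bounded_linear L \<Longrightarrow> open S \<Longrightarrow> smooth_on S f \<Longrightarrow> smooth_on S (\<lambda>x. L (f x))"
 unfolding smooth_on_def by (rule allI, rule Ck_on_bounded_linear_compose, assumption+, rule spec)

lemma smooth_on_lipschitz:
 fixes f :: "'a::euclidean_space \<Rightarrow> 'b::real_normed_vector"
 assumes f: "smooth_on W f" and W: "open W" and K: "compact K" "convex K" "K \<subseteq> W"
 obtains L where "L \<ge> 0" "\<And>p q. p \<in> K \<Longrightarrow> q \<in> K \<Longrightarrow> norm (f p - f q) \<le> L * norm (p - q)"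
proof -
 have "\<exists>B. \<forall>p\<in>K. norm (frechet_derivative f (at p) b) \<le> B" for b
 proof -
  have "continuous_on K (\<lambda>p. frechet_derivative f (at p) b)"
   using continuous_on_subset[OF smooth_on_continuous[OF smooth_on_derivative[OF f]] K(3)] .
  then have "bounded ((\<lambda>p. frechet_derivative f (at p) b) ` K)"
   using K(1) compact_continuous_image compact_imp_bounded by blast
  then show ?thesis unfolding bounded_iff by blast
 qed
 then obtain B where B: "\<And>b p. p \<in> K \<Longrightarrow> norm (frechet_derivative f (at p) b) \<le> B b" by metis
 define L where "L = (\<Sum>b\<in>(Basis :: 'a set). \<bar>B b\<bar>)"
 have der: "(f has_derivative frechet_derivative f (at p)) (at p)" if "p \<in> K" for p
  using smooth_on_differentiable[OF f W] K(3) that by blast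
 have on: "onorm (frechet_derivative f (at p)) \<le> L" if p: "p \<in> K" for p
 proof (rule onorm_le)
  fix v
  have "norm (frechet_derivative f (at p) v) =
    norm (\<Sum>b\<in>Basis. (v \<bullet> b) *\<^sub>R frechet_derivative f (at p) b)"
   using linear_basis_sum[OF has_derivative_linear[OF der[OF p]], of v] by simp
  also have "\<dots> \<le> (\<Sum>b\<in>Basis. \<bar>v \<bullet> b\<bar> * norm (frechet_derivative f (at p) b))" by (rule order_trans[OF norm_sum]) simp
  also have "\<dots> \<le> (\<Sum>b\<in>Basis. norm v * \<bar>B b\<bar>)"
   using order_trans[OF B[OF p] abs_ge_self] by (intro sum_mono mult_mono Basis_le_norm) auto
  finally show "norm (frechet_derivative f (at p) v) \<le> L * norm v" by (simp add: L_def sum_distrib_left mult.commute)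
 qed
 show ?thesis
 proof (rule that[of L])
  show "L \<ge> 0" by (simp add: L_def sum_nonneg)
  show "norm (f p - f q) \<le> L * norm (p - q)" if "p \<in> K" "q \<in> K" for p q
   by (rule differentiable_bound[OF K(2) has_derivative_at_withinI[OF der] on]) (use that in auto)
 qed
qed

text \<open>Differentiating in \<open>y\<close> only leaves the difference of two values of one
  partial derivative at points a distance \<open>norm x\<close> apart, and that derivative is
  Lipschitz. For a group law with neutral element 0 the left-hand side becomes
  \<open>m x y - x - y\<close>; the product form of the bound is what quasi-additivity
  requires.\<close>

lemma smooth_on_mixed_difference:
 fixes m :: "'a::euclidean_space \<times> 'b::euclidean_space \<Rightarrow> 'c::real_normed_vector"
 assumes m: "smooth_on W m" and W: "open W" "(0, 0) \<in> W"
 obtains r C where "r > 0" "C \<ge> 0" "cball 0 r \<times> cball 0 r \<subseteq> W"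
  "\<And>x y. norm x \<le> r \<Longrightarrow> norm y \<le> r \<Longrightarrow>
    norm (m (x, y) - m (x, 0) - m (0, y) + m (0, 0)) \<le> C * norm x * norm y"
proof -
 obtain A B where AB: "open A" "open B" "0 \<in> A" "0 \<in> B" "A \<times> B \<subseteq> W"
  using open_prod_elim[OF W] by (metis mem_Sigma_iff)
 obtain r1 r2 where r12: "r1 > 0" "r2 > 0" "cball 0 r1 \<subseteq> A" "cball 0 r2 \<subseteq> B" using AB open_contains_cball by metis
 define r where "r = min r1 r2"
 have r: "r > 0" and sub: "cball 0 r \<times> cball 0 r \<subseteq> W" using r12 AB(5) by (auto simp: r_def subset_iff)
 let ?K = "cball (0::'a) r \<times> cball (0::'b) r"
 let ?g = "\<lambda>b p. frechet_derivative m (at p) (0, b)"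
 have K: "compact ?K" "convex ?K" by (auto intro: compact_Times convex_Times)
 have "\<exists>L\<ge>0. \<forall>p\<in>?K. \<forall>q\<in>?K. norm (?g b p - ?g b q) \<le> L * norm (p - q)" for b
  by (rule smooth_on_lipschitz[OF smooth_on_derivative[OF m] W(1) K sub]) blast
 then obtain L where L: "\<And>b. L b \<ge> 0"
  "\<And>b p q. p \<in> ?K \<Longrightarrow> q \<in> ?K \<Longrightarrow> norm (?g b p - ?g b q) \<le> L b * norm (p - q)" by metis
 define C where "C = (\<Sum>b\<in>(Basis :: 'b set). L b)"
 have C: "C \<ge> 0" using L(1) by (simp add: C_def sum_nonneg)
 have "norm (m (x, y) - m (x, 0) - m (0, y) + m (0, 0)) \<le> C * norm x * norm y"
  if x: "norm x \<le> r" and y: "norm y \<le> r" for x y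
 proof -
  let ?k = "\<lambda>y. m (x, y) - m (0, y)"
  let ?k' = "\<lambda>y v. ?g v (x, y) - ?g v (0, y)"
  have der: "((\<lambda>y. m (u, y)) has_derivative (\<lambda>v. ?g v (u, y))) (at y)"
   if "norm u \<le> r" "norm y \<le> r" for u y
  proof -
   have "(u, y) \<in> W" using that sub by auto
   then have "(m has_derivative frechet_derivative m (at (u, y))) (at (u, y))"
    by (rule smooth_on_differentiable[OF m W(1)])
   moreover have "((\<lambda>y. (u, y)) has_derivative (\<lambda>v. (0, v))) (at y)" by (auto intro!: derivative_eq_intros)
   ultimately show ?thesis using has_derivative_compose[of "\<lambda>y. (u, y)" "\<lambda>v. (0, v)" y UNIV m] by simp
  qed
  have "norm (?k y - ?k 0) \<le> C * norm x * norm (y - 0)"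
  proof (rule differentiable_bound[where S = "cball 0 r" and f' = ?k'])
   show "(?k has_derivative ?k' z) (at z within cball 0 r)" if "z \<in> cball 0 r" for z
    by (rule has_derivative_at_withinI[OF has_derivative_diff[OF der der]]) (use that x r in auto)
   show "onorm (?k' z) \<le> C * norm x" if z: "z \<in> cball 0 r" for z
   proof (rule onorm_le)
    fix v
    have "norm z \<le> r" using z by simp
    note has_derivative_linear[OF der[OF x this]]
    moreover have "linear (\<lambda>v. ?g v (0, z))" by (rule has_derivative_linear[OF der]) (use z r in simp_all)
    ultimately have lin: "linear (?k' z)" by (rule linear_compose_sub)
    have "norm (?k' z v) \<le> (\<Sum>b\<in>Basis. \<bar>v \<bullet> b\<bar> * norm (?k' z b))"
     by (subst linear_basis_sum[OF lin]) (rule order_trans[OF norm_sum], simp)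
    also have "\<dots> \<le> (\<Sum>b\<in>Basis. norm v * (L b * norm x))"
    proof (intro sum_mono mult_mono Basis_le_norm)
     fix b :: 'b
     have "norm (?k' z b) \<le> L b * norm ((x, z) - (0, z))" by (rule L(2)) (use x z r in auto)
     then show "norm (?k' z b) \<le> L b * norm x" by (simp add: norm_Pair)
    qed auto
    also have "\<dots> = C * norm x * norm v" by (simp add: C_def sum_distrib_left sum_distrib_right mult_ac)
    finally show "norm (?k' z v) \<le> C * norm x * norm v" .
   qed
  qed (use y r in auto)
  then show ?thesis by (simp add: algebra_simps)
 qed
 then show ?thesis using that r C sub by blast
qed

section \<open>Differentiability of continuous local homomorphisms\<close>

text \<open>The defect \<open>D c\<close> of homogeneity is additive in \<open>c\<close> and
  vanishes at 1, hence at all integers. So \<open>D (n c)\<close> depends only on the fractional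
  part of \<open>n c\<close> and stays bounded, although it equals \<open>n D c\<close>.\<close>

lemma additive_bounded_imp_bounded_linear:
 fixes T :: "'a::real_normed_vector \<Rightarrow> 'b::real_normed_vector"
 assumes add: "\<And>x y. T (x + y) = T x + T y" and bd: "\<And>x. norm (T x) \<le> L * norm x"
 shows "bounded_linear T"
proof (rule bounded_linear_intro[where K = L])
 have T0: "T 0 = 0" using add[of 0 0] by simp
 have neg: "T (- x) = - T x" for x using add[of x "- x"] T0 by (simp add: add_eq_0_iff)
 show "T (c *\<^sub>R x) = c *\<^sub>R T x" for c x
 proof -
  define D where "D c = T (c *\<^sub>R x) - c *\<^sub>R T x" for c
  have Dadd: "D (a + b) = D a + D b" for a b by (simp add: D_def scaleR_left_distrib add)
  have D0: "D 0 = 0" by (simp add: D_def T0)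
  have Dn: "D (real n * a) = real n *\<^sub>R D a" for n a by (induction n) (simp_all add: D0 Dadd algebra_simps)
  have Dneg: "D (- a) = - D a" for a by (simp add: D_def neg)
  have D1: "D 1 = 0" by (simp add: D_def)
  have Dint: "D (of_int k) = 0" for k
  proof (cases k rule: int_cases2)
   case (nonneg n)
   then show ?thesis using Dn[of n 1] D1 by simp
  next
   case (nonpos n)
   then show ?thesis using Dn[of n 1] D1 Dneg[of "real n"] by simp
  qed
  have "real n * norm (D c) \<le> 2 * \<bar>L\<bar> * norm x" for n
  proof -
   have "real n * c = of_int \<lfloor>real n * c\<rfloor> + frac (real n * c)" by (simp add: frac_def)
   then have "D (real n * c) = D (frac (real n * c))" using Dadd Dint by (metis add_0)
   then have "real n * norm (D c) = norm (D (frac (real n * c)))" using Dn[of n c] by (metis abs_of_nat norm_scaleR)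
   also have "\<dots> \<le> \<bar>L\<bar> * norm x + \<bar>L\<bar> * norm x"
   proof -
    have f: "\<bar>frac (real n * c)\<bar> \<le> 1" using frac_lt_1[of "real n * c"] frac_ge_0[of "real n * c"] by simp
    have Lx: "norm (T y) \<le> \<bar>L\<bar> * norm y" for y
     by (rule order_trans[OF bd mult_right_mono[OF abs_ge_self norm_ge_zero]])
    have "norm (T (frac (real n * c) *\<^sub>R x)) \<le> \<bar>L\<bar> * (\<bar>frac (real n * c)\<bar> * norm x)"
     using Lx[of "frac (real n * c) *\<^sub>R x"] by simp
    also have "\<dots> \<le> \<bar>L\<bar> * (1 * norm x)" by (intro mult_left_mono mult_right_mono f) auto
    finally have 1: "norm (T (frac (real n * c) *\<^sub>R x)) \<le> \<bar>L\<bar> * norm x" by simp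
    have "norm (frac (real n * c) *\<^sub>R T x) \<le> 1 * norm (T x)" unfolding norm_scaleR by (intro mult_right_mono f) auto
    then have 2: "norm (frac (real n * c) *\<^sub>R T x) \<le> \<bar>L\<bar> * norm x" using Lx[of x] by simp
    show ?thesis unfolding D_def using norm_triangle_ineq4 1 2 by (meson add_mono order_trans)
   qed
   finally show ?thesis by simp
  qed
  then have "norm (D c) \<le> 0" using ex_less_of_nat_mult[of "norm (D c)" "2 * \<bar>L\<bar> * norm x"] by (meson not_less)
  then show ?thesis by (simp add: D_def)
 qed
qed (use add bd in \<open>auto simp: mult.commute\<close>)

lemma geometric_increments_limit:
 fixes s :: "nat \<Rightarrow> 'a::banach"
 assumes "\<And>k. norm (s (Suc k) - s k) \<le> D / 2 ^ k"
 obtains l where "s \<longlonglongrightarrow> l" "norm (l - s 0) \<le> 2 * D"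
proof -
 have "(\<lambda>k. (1 / 2) ^ k) sums (1 / (1 - 1 / 2 :: real))" by (rule geometric_sums) simp
 from sums_mult[OF this, of D] have sD: "(\<lambda>k. D / 2 ^ k) sums (2 * D)" by (simp add: power_divide mult.commute)
 have sm: "summable (\<lambda>k. s (Suc k) - s k)"
  by (rule summable_comparison_test'[OF sums_summable[OF sD]]) (use assms in auto)
 then have tel: "(\<lambda>n. \<Sum>k<n. s (Suc k) - s k) \<longlonglongrightarrow> (\<Sum>k. s (Suc k) - s k)" by (rule summable_LIMSEQ)
 then have "s \<longlonglongrightarrow> (\<Sum>k. s (Suc k) - s k) + s 0"
  using tendsto_add[OF tel tendsto_const[of "s 0"]] by (simp add: sum_lessThan_telescope)
 moreover have "norm (\<Sum>k. s (Suc k) - s k) \<le> 2 * D"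
  using norm_suminf_le[OF assms sums_summable[OF sD]] sums_unique[OF sD] by simp
 ultimately show ?thesis using that by force
qed

lemma eventually_norm_scaled_le:
 fixes x :: "'a::real_normed_vector"
 assumes "r > 0"
 shows "\<forall>\<^sub>F k in sequentially. norm (x /\<^sub>R 2 ^ k) \<le> r"
proof -
 have "(\<lambda>k. norm x * (1 / 2) ^ k) \<longlonglongrightarrow> norm x * 0" by (intro tendsto_mult tendsto_const LIMSEQ_realpow_zero) auto
 then have "\<forall>\<^sub>F k in sequentially. norm x * (1 / 2) ^ k < r" using assms by (simp add: order_tendsto_iff)
 then show ?thesis by eventually_elim (simp add: power_divide field_simps)
qed

text \<open>The linear part is the limit of \<open>2^k f (x / 2^k)\<close>: quasi-additivity at
  equal arguments makes the increments decay geometrically, and their sum bounds the distance from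
  \<open>f\<close>. Additivity holds in the limit because the error at scale \<open>2^-k\<close> is
  quadratic.\<close>

lemma quasi_additive_linear_part:
 fixes f :: "'a::real_normed_vector \<Rightarrow> 'b::banach"
 assumes r: "r > 0"
  and qa: "\<And>x y. norm x \<le> r \<Longrightarrow> norm y \<le> r \<Longrightarrow> norm (f (x + y) - f x - f y) \<le> C * norm x * norm y"
  and lip: "\<And>x. norm x \<le> r \<Longrightarrow> norm (f x) \<le> L * norm x"
 obtains T where "bounded_linear T" "\<And>x. norm x \<le> r \<Longrightarrow> norm (f x - T x) \<le> C * (norm x)\<^sup>2"
proof -
 define s where "s x k = 2 ^ k *\<^sub>R f (x /\<^sub>R 2 ^ k)" for x k
 have inball: "\<exists>l. s x \<longlonglongrightarrow> l \<and> norm (l - f x) \<le> C * (norm x)\<^sup>2" if x: "norm x \<le> r" for x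
 proof -
  have C: "0 \<le> C * (norm x)\<^sup>2"
   using order_trans[OF norm_ge_zero qa[OF x x]] by (simp add: power2_eq_square mult.assoc)
  have "norm (s x (Suc k) - s x k) \<le> (C * (norm x)\<^sup>2 / 4) / 2 ^ k" for k
  proof -
   define y where "y = x /\<^sub>R 2 ^ Suc k"
   have ny: "norm y = norm x / 2 ^ Suc k" unfolding y_def norm_scaleR divide_inverse by (subst mult.commute) simp
   have "norm x / 2 ^ Suc k \<le> norm x / 1" by (rule divide_left_mono[OF one_le_power]) simp_all
   then have y: "norm y \<le> r" using x ny by simp
   have xy: "x /\<^sub>R 2 ^ k = y + y" unfolding y_def by (simp add: scaleR_left_distrib[symmetric])
   have "s x (Suc k) = (2 ^ k + 2 ^ k) *\<^sub>R f y" by (simp only: s_def y_def power_Suc mult_2)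
   moreover have "s x k = 2 ^ k *\<^sub>R f (y + y)" by (simp only: s_def xy)
   ultimately have "s x (Suc k) - s x k = - (2 ^ k *\<^sub>R (f (y + y) - f y - f y))"
    by (simp only: scaleR_left_distrib scaleR_right_diff_distrib) simp
   then have "norm (s x (Suc k) - s x k) = 2 ^ k * norm (f (y + y) - f y - f y)" by simp
   also have "\<dots> \<le> 2 ^ k * (C * norm y * norm y)" by (intro mult_left_mono qa y) auto
   also have "\<dots> = (C * (norm x)\<^sup>2 / 4) / 2 ^ k" by (simp add: ny power2_eq_square field_simps)
   finally show ?thesis .
  qed
  from geometric_increments_limit[OF this] obtain l
   where "s x \<longlonglongrightarrow> l" "norm (l - s x 0) \<le> 2 * (C * (norm x)\<^sup>2 / 4)" by blast
  then show ?thesis using C by (intro exI[of _ l]) (simp add: s_def)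
 qed
 \<comment> \<open>Outside the ball the sequence is, up to a factor and an index shift, the one
   belonging to the point \<open>x / 2^N\<close> of the ball.\<close>
 have "\<exists>l. s x \<longlonglongrightarrow> l" for x
 proof -
  obtain N where "norm (x /\<^sub>R 2 ^ N) \<le> r"
   using eventually_norm_scaled_le[OF r, of x] by (auto simp: eventually_sequentially)
  then obtain l where "s (x /\<^sub>R 2 ^ N) \<longlonglongrightarrow> l" using inball by blast
  then have "(\<lambda>k. 2 ^ N *\<^sub>R s (x /\<^sub>R 2 ^ N) k) \<longlonglongrightarrow> 2 ^ N *\<^sub>R l" by (intro tendsto_intros)
  moreover have "2 ^ N *\<^sub>R s (x /\<^sub>R 2 ^ N) k = s x (k + N)" for k by (simp add: s_def power_add mult.commute)
  ultimately have "(\<lambda>k. s x (k + N)) \<longlonglongrightarrow> 2 ^ N *\<^sub>R l" by simp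
  then show ?thesis using LIMSEQ_offset by blast
 qed
 then obtain T where T: "\<And>x. s x \<longlonglongrightarrow> T x" by metis
 have "T (x + y) = T x + T y" for x y
 proof -
  have "(\<lambda>k. s (x + y) k - s x k - s y k) \<longlonglongrightarrow> T (x + y) - T x - T y" by (intro tendsto_intros T)
  moreover have "(\<lambda>k. s (x + y) k - s x k - s y k) \<longlonglongrightarrow> 0"
  proof (rule Lim_null_comparison)
   show "\<forall>\<^sub>F k in sequentially. norm (s (x + y) k - s x k - s y k) \<le> (C * norm x * norm y) * (1 / 2) ^ k"
    using eventually_norm_scaled_le[OF r, of x] eventually_norm_scaled_le[OF r, of y]
   proof eventually_elim
    case (elim k)
    have "s (x + y) k - s x k - s y k =
      2 ^ k *\<^sub>R (f (x /\<^sub>R 2 ^ k + y /\<^sub>R 2 ^ k) - f (x /\<^sub>R 2 ^ k) - f (y /\<^sub>R 2 ^ k))"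
     by (simp add: s_def scaleR_right_distrib scaleR_right_diff_distrib)
    also have "norm \<dots> \<le> 2 ^ k * (C * norm (x /\<^sub>R 2 ^ k) * norm (y /\<^sub>R 2 ^ k))" using qa[OF elim] by simp
    also have "\<dots> = (C * norm x * norm y) * (1 / 2) ^ k" by (simp add: field_simps power_divide)
    finally show ?case .
   qed
   have "(\<lambda>k. (C * norm x * norm y) * (1 / 2) ^ k) \<longlonglongrightarrow> (C * norm x * norm y) * 0"
    by (intro tendsto_mult tendsto_const LIMSEQ_realpow_zero) auto
   then show "(\<lambda>k. (C * norm x * norm y) * (1 / 2) ^ k) \<longlonglongrightarrow> 0" by simp
  qed
  ultimately have "T (x + y) - T x - T y = 0" by (rule LIMSEQ_unique)
  then show ?thesis by (simp add: algebra_simps)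
 qed
 moreover have "norm (T x) \<le> L * norm x" for x
 proof (rule tendsto_upperbound[OF tendsto_norm[OF T]])
  show "\<forall>\<^sub>F k in sequentially. norm (s x k) \<le> L * norm x" using eventually_norm_scaled_le[OF r, of x]
  proof eventually_elim
   case (elim k)
   have "norm (s x k) \<le> 2 ^ k * (L * norm (x /\<^sub>R 2 ^ k))" using lip[OF elim] by (simp add: s_def)
   then show ?case by (simp add: field_simps)
  qed
 qed simp
 ultimately have "bounded_linear T" by (rule additive_bounded_imp_bounded_linear)
 moreover have "norm (f x - T x) \<le> C * (norm x)\<^sup>2" if "norm x \<le> r" for x
  using inball[OF that] T[of x] LIMSEQ_unique by (metis norm_minus_commute)
 ultimately show ?thesis using that by blast
qed

text \<open>A local group in coordinates with a continuous injective representation. Division is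
  given by \<open>divide\<close>, which bounds the quotient \<open>e\<close> only by
  \<open>R\<close>; its true size is recovered from \<open>m_est\<close>.\<close>

locale local_hom =
 fixes m :: "'e::euclidean_space \<Rightarrow> 'e \<Rightarrow> 'e" and \<rho> :: "'e \<Rightarrow> 'a::{real_normed_algebra_1,banach}"
  and R C :: real
 assumes R: "R > 0" and C: "C \<ge> 0"
  and m_est: "\<And>x y. norm x \<le> R \<Longrightarrow> norm y \<le> R \<Longrightarrow> norm (m x y - x - y) \<le> C * norm x * norm y"
  and hom: "\<And>x y. norm x \<le> R \<Longrightarrow> norm y \<le> R \<Longrightarrow> \<rho> (m x y) = \<rho> x * \<rho> y"
  and cont: "continuous_on (cball 0 R) \<rho>"
  and inj: "inj_on \<rho> (cball 0 R)"
  and one: "\<rho> 0 = 1"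
  and divide: "\<exists>R1>0. \<forall>a b. norm a \<le> R1 \<longrightarrow> norm b \<le> R1 \<longrightarrow> (\<exists>e. norm e \<le> R \<and> m a e = b)"
begin

primrec pw :: "'e \<Rightarrow> nat \<Rightarrow> 'e" where
 "pw x 0 = 0"
| "pw x (Suc n) = m (pw x n) x"

text \<open>As long as \<open>n * norm x \<le> \<delta>\<close>, the \<open>n\<close>-th power of
  \<open>x\<close> stays in the ball of radius \<open>R\<close>, and its quadratic error does not
  exceed the linear term \<open>n * norm x\<close>.\<close>

definition \<delta> :: real where "\<delta> = min (R / 2) (1 / (C + 1))"

lemma \<delta>: "\<delta> > 0" "2 * \<delta> \<le> R" "C * \<delta> \<le> 1"
proof -
 show "\<delta> > 0" "2 * \<delta> \<le> R" using R C by (auto simp: \<delta>_def)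
 have "C * \<delta> \<le> C * (1 / (C + 1))" using C by (intro mult_left_mono) (auto simp: \<delta>_def)
 also have "\<dots> \<le> 1" using C by simp
 finally show "C * \<delta> \<le> 1" .
qed

text \<open>The three claims need each other: the bound \<open>2 n |x|\<close> keeps the power in
  the domain of \<open>m_est\<close> and \<open>hom\<close> and makes the error of the next step at
  most \<open>2 C n |x|^2\<close>, which fits into the growth from \<open>n^2\<close> to
  \<open>(n + 1)^2\<close>.\<close>

lemma pw_estimate:
 "real n * norm x \<le> \<delta> \<Longrightarrow> norm (pw x n - real n *\<^sub>R x) \<le> C * (real n * norm x)\<^sup>2 \<and>
   norm (pw x n) \<le> 2 * (real n * norm x) \<and> \<rho> (pw x n) = \<rho> x ^ n"
proof (induction n)
 case 0
 then show ?case by (simp add: one)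
next
 case (Suc n)
 have nx: "real n * norm x \<le> \<delta>" "norm x \<le> \<delta>"
  using Suc.prems by (auto simp: algebra_simps) (smt (verit) mult_nonneg_nonneg norm_ge_zero of_nat_0_le_iff)+
 note IH = Suc.IH[OF nx(1)]
 have pR: "norm (pw x n) \<le> R" and xR: "norm x \<le> R" using IH nx \<delta> by linarith+
 have step: "norm (m (pw x n) x - pw x n - x) \<le> C * (2 * (real n * norm x)) * norm x"
  using m_est[OF pR xR] IH C by (meson dual_order.trans mult_left_mono mult_right_mono norm_ge_zero)
 have "m (pw x n) x - real (Suc n) *\<^sub>R x = (m (pw x n) x - pw x n - x) + (pw x n - real n *\<^sub>R x)"
  by (simp add: algebra_simps)
 then have "norm (m (pw x n) x - real (Suc n) *\<^sub>R x) \<le>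
   C * (2 * (real n * norm x)) * norm x + C * (real n * norm x)\<^sup>2"
  using step IH by (metis add_mono norm_triangle_mono)
 also have "\<dots> \<le> C * (real (Suc n) * norm x)\<^sup>2" using C by (simp add: power2_eq_square algebra_simps)
 finally have 1: "norm (pw x (Suc n) - real (Suc n) *\<^sub>R x) \<le> C * (real (Suc n) * norm x)\<^sup>2" by simp
 have "C * (real (Suc n) * norm x) * (real (Suc n) * norm x) \<le> C * (real (Suc n) * norm x) * \<delta>"
  using Suc.prems C by (intro mult_left_mono mult_nonneg_nonneg) auto
 then have "C * (real (Suc n) * norm x)\<^sup>2 \<le> (C * \<delta>) * (real (Suc n) * norm x)"
  by (simp only: power2_eq_square mult_ac)
 also have "\<dots> \<le> 1 * (real (Suc n) * norm x)" using \<delta>(3) by (intro mult_right_mono) auto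
 finally have "norm (pw x (Suc n)) \<le> 2 * (real (Suc n) * norm x)"
  using 1 norm_triangle_ineq2[of "pw x (Suc n)" "real (Suc n) *\<^sub>R x"] by simp
 moreover have "\<rho> (pw x (Suc n)) = \<rho> x ^ Suc n" using hom[OF pR xR] IH by (simp add: power_commutes)
 ultimately show ?case using 1 by blast
qed

text \<open>The powers of a small \<open>x\<close> leave the unit ball only after about \<open>1 / norm x\<close> steps, and up to
 then \<open>\<rho> x ^ n - 1\<close> grows at least like \<open>n * (\<rho> x - 1) / 2\<close>.\<close>

lemma lipschitz_at_zero: obtains d L where "d > 0" "d \<le> R" "L \<ge> 0"
 "\<And>x. norm x \<le> d \<Longrightarrow> norm (\<rho> x - 1) \<le> 1 / 2" "\<And>x. norm x \<le> d \<Longrightarrow> norm (\<rho> x - 1) \<le> L * norm x"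
proof -
 have "(0::'e) \<in> cball 0 R" using R by simp
 then obtain e where e: "e > 0" "\<And>x. norm x \<le> R \<Longrightarrow> norm x < e \<Longrightarrow> norm (\<rho> x - 1) < 1 / 2"
  using cont one unfolding continuous_on_iff dist_norm by (metis diff_zero half_gt_zero_iff mem_cball_0 zero_less_one)
 define d where "d = min \<delta> (e / 3)"
 have d: "d > 0" "d \<le> \<delta>" "2 * d < e" using e(1) \<delta>(1) by (auto simp: d_def)
 have half: "norm (\<rho> x - 1) \<le> 1 / 2" if "norm x \<le> 2 * d" for x using e(2)[of x] that d \<delta>(2) by linarith
 have lip: "norm (\<rho> x - 1) \<le> (2 / d) * norm x" if x: "norm x \<le> d" for x
 proof (cases "x = 0")
  case False
  \<comment> \<open>The largest \<open>n\<close> with \<open>n * norm x \<le> d\<close>; all powers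
    up to \<open>n\<close> then have norm at most \<open>2 d\<close>, where \<open>\<rho>\<close> is
    within 1/2 of 1.\<close>
  define n where "n = nat \<lfloor>d / norm x\<rfloor>"
  have ge1: "d / norm x \<ge> 1" using x False by simp
  have fl: "1 \<le> \<lfloor>d / norm x\<rfloor>" using ge1 by (simp only: one_le_floor)
  then have "real n = of_int \<lfloor>d / norm x\<rfloor>" by (simp add: n_def)
  then have n: "real n \<le> d / norm x" "d / norm x < real n + 1" "real n \<ge> 1"
   using fl floor_correct[of "d / norm x"] by linarith+
  have nd: "real n * norm x \<le> d" using n(1) False by (simp add: field_simps)
  have jd: "norm (\<rho> x ^ j - 1) \<le> 1 / 2" if "j \<le> n" for j
  proof -
   have j: "real j * norm x \<le> d" using that nd by (meson mult_right_mono norm_ge_zero of_nat_mono order_trans)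
   then have "norm (pw x j) \<le> 2 * d" "\<rho> (pw x j) = \<rho> x ^ j" using pw_estimate[of j x] d(2) by auto
   then show ?thesis using half by metis
  qed
  have tel: "\<rho> x ^ k - 1 = (\<rho> x - 1) * (\<Sum>j<k. \<rho> x ^ j)" for k
  proof (induction k)
   case (Suc k)
   have "(\<rho> x - 1) * (\<Sum>j<Suc k. \<rho> x ^ j) = (\<rho> x ^ k - 1) + (\<rho> x - 1) * \<rho> x ^ k" by (simp add: Suc distrib_left)
   then show ?case by (simp add: left_diff_distrib)
  qed simp
  have "(\<rho> x - 1) * of_nat n = real n *\<^sub>R (\<rho> x - 1)"
   by (metis mult_of_nat_commute of_real_of_nat_eq scaleR_conv_of_real)
  then have "real n *\<^sub>R (\<rho> x - 1) = (\<rho> x ^ n - 1) - (\<rho> x - 1) * (\<Sum>j<n. \<rho> x ^ j - 1)"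
   unfolding tel[of n] by (simp add: sum_subtractf right_diff_distrib[of "\<rho> x - 1"])
  then have "real n * norm (\<rho> x - 1) = norm ((\<rho> x ^ n - 1) - (\<rho> x - 1) * (\<Sum>j<n. \<rho> x ^ j - 1))"
   by (metis abs_of_nat norm_scaleR)
  also have "\<dots> \<le> norm (\<rho> x ^ n - 1) + norm (\<rho> x - 1) * norm (\<Sum>j<n. \<rho> x ^ j - 1)"
   by (rule order_trans[OF norm_triangle_ineq4 add_left_mono[OF norm_mult_ineq]])
  also have "\<dots> \<le> 1 / 2 + norm (\<rho> x - 1) * (\<Sum>j<n. 1 / 2)"
   by (intro add_mono mult_left_mono order_trans[OF norm_sum] sum_mono jd) auto
  also have "\<dots> = 1 / 2 + (real n * norm (\<rho> x - 1)) / 2" by simp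
  finally have "real n * norm (\<rho> x - 1) \<le> 1" by linarith
  then have "norm (\<rho> x - 1) \<le> 1 / real n" using n(3) by (simp add: field_simps)
  also have "1 / real n \<le> 2 / (real n + 1)" using n(3) by (simp add: field_simps)
  also have "\<dots> \<le> 2 / (d / norm x)" using n(2) d(1) False by (intro divide_left_mono) auto
  finally show ?thesis by simp
 qed (simp add: one)
 show ?thesis by (rule that[of d "2 / d"]) (use d \<delta> half lip in auto)
qed

text \<open>Write \<open>x + y = m (m x y) e\<close>. Since \<open>m x y\<close> is close to
  \<open>x + y\<close>, the factor \<open>e\<close> is of order \<open>norm x * norm y\<close>, and
  \<open>\<rho> (x + y) = \<rho> x * \<rho> y * \<rho> e\<close> shows that
  \<open>\<rho> - 1\<close> is quasi-additive.\<close>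

lemma differential_exists: obtains T r K where "bounded_linear T" "r > 0" "K \<ge> 0"
 "\<And>x. norm x \<le> r \<Longrightarrow> norm (\<rho> x - 1 - T x) \<le> K * (norm x)\<^sup>2"
proof -
 obtain d L where d: "d > 0" "d \<le> R" "L \<ge> 0"
  and half: "\<And>x. norm x \<le> d \<Longrightarrow> norm (\<rho> x - 1) \<le> 1 / 2"
  and lip: "\<And>x. norm x \<le> d \<Longrightarrow> norm (\<rho> x - 1) \<le> L * norm x" by (rule lipschitz_at_zero) blast
 obtain R1 where R1: "R1 > 0" "\<And>a b. norm a \<le> R1 \<Longrightarrow> norm b \<le> R1 \<Longrightarrow> \<exists>e. norm e \<le> R \<and> m a e = b" using divide by blast
 \<comment> \<open>\<open>3 q\<close> bounds \<open>m x y\<close> and \<open>x + y\<close>, hence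
   must not exceed \<open>R1\<close> and \<open>R\<close>. \<open>C q \<le> 1/6\<close> lets the
   error \<open>C |a| |e|\<close> be absorbed into half of \<open>|e|\<close>, and
   \<open>2 C q \<le> d\<close> keeps \<open>e\<close> where the Lipschitz bound holds.\<close>
 define q where "q = Min {1, d, R1 / 3, R / 3, 1 / (6 * (C + 1)), d / (2 * (C + 1))}"
 have q0: "0 < q" unfolding q_def by (subst Min_gr_iff) (use d R1 R C in auto)
 have qle: "q \<le> v" if "v \<in> {1, d, R1 / 3, R / 3, 1 / (6 * (C + 1)), d / (2 * (C + 1))}" for v
  using that unfolding q_def by (intro Min_le) auto
 have q6: "q * (6 * (C + 1)) \<le> 1" "q * (2 * (C + 1)) \<le> d"
  using qle[of "1 / (6 * (C + 1))"] qle[of "d / (2 * (C + 1))"] C by (simp_all add: pos_le_divide_eq)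
 have q: "0 < q" "q \<le> 1" "q \<le> d" "3 * q \<le> R1" "3 * q \<le> R"
  using q0 qle[of 1] qle[of d] qle[of "R1 / 3"] qle[of "R / 3"] by auto
 have Cq: "C * q \<le> 1 / 6" "2 * (C * q) \<le> d" using q0 q6 by (simp_all add: algebra_simps)
 \<comment> \<open>The factors \<open>\<rho> x\<close> and \<open>\<rho> y\<close>, of norm at most
   3/2 each, times \<open>2 L C\<close> for \<open>\<rho> e - 1\<close>; the summand
   \<open>L * L\<close> comes from \<open>(\<rho> x - 1) * (\<rho> y - 1)\<close>.\<close>
 define K where "K = 9 * L * C / 2 + L * L"
 have K: "K \<ge> 0" using C d by (simp add: K_def)
 have qa: "norm ((\<rho> (x + y) - 1) - (\<rho> x - 1) - (\<rho> y - 1)) \<le> K * norm x * norm y"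
  if x: "norm x \<le> q" and y: "norm y \<le> q" for x y
 proof -
  define a where "a = m x y"
  have xy: "norm x * norm y \<le> q * norm x" "norm x * norm y \<le> q * q" "norm x * norm y \<le> norm x"
   using x y q mult_mono[of "norm x" q "norm y" q] mult_left_mono[of "norm y" q "norm x"]
    mult_left_mono[of "norm y" 1 "norm x"] by (auto simp: mult.commute)
  have est: "norm (a - (x + y)) \<le> C * (norm x * norm y)" using m_est[of x y] x y q by (simp add: a_def algebra_simps)
  have "C * (norm x * norm y) \<le> C * (q * q)" using C xy by (intro mult_left_mono)
  also have "\<dots> \<le> 1 * q" using Cq(1) q(1) unfolding mult.assoc[symmetric] by (intro mult_right_mono) auto
  finally have Cxy: "C * (norm x * norm y) \<le> q" by simp
  have a: "norm a \<le> 3 * q" using norm_triangle_ineq2[of a "x + y"] est Cxy norm_triangle_ineq[of x y] x y by linarith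
  moreover have b: "norm (x + y) \<le> 3 * q" using norm_triangle_ineq[of x y] x y q(1) by linarith
  ultimately obtain e where e: "norm e \<le> R" "m a e = x + y" using R1(2)[of a "x + y"] q by auto
  have "norm (x + y - a - e) \<le> C * norm a * norm e" using m_est[of a e] a q e by simp
  also have "\<dots> \<le> (1 / 2) * norm e"
  proof (rule mult_right_mono)
   have "C * norm a \<le> C * (3 * q)" using a C by (intro mult_left_mono)
   then show "C * norm a \<le> 1 / 2" using Cq(1) by simp
  qed simp
  finally have "norm e \<le> norm (x + y - a) + (1 / 2) * norm e"
   using norm_triangle_ineq4[of "x + y - a" "x + y - a - e"] by simp
  then have e2: "norm e \<le> 2 * (C * (norm x * norm y))" using est by (simp add: norm_minus_commute)
  also have "\<dots> \<le> 2 * (C * q)" using C xy q mult_left_mono[of "norm x * norm y" q C] x by simp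
  finally have ed: "norm e \<le> d" using Cq(2) by simp
  have aR: "norm a \<le> R" using a q by simp
  have "\<rho> (x + y) = \<rho> x * \<rho> y * \<rho> e" using hom[OF aR e(1)] hom[of x y] x y q e(2) by (simp add: a_def)
  then have "(\<rho> (x + y) - 1) - (\<rho> x - 1) - (\<rho> y - 1) = \<rho> x * \<rho> y * (\<rho> e - 1) + (\<rho> x - 1) * (\<rho> y - 1)"
   by (simp add: algebra_simps)
  also have "norm \<dots> \<le> (3 / 2 * (3 / 2)) * (L * (2 * (C * (norm x * norm y)))) + (L * norm x) * (L * norm y)"
  proof (intro norm_triangle_mono order_trans[OF norm_mult_ineq] mult_mono)
   have \<rho>: "norm (\<rho> z) \<le> 3 / 2" if "norm z \<le> q" for z using half[of z] that q norm_triangle_ineq2[of "\<rho> z" 1] by simp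
   show "norm (\<rho> x) \<le> 3 / 2" "norm (\<rho> y) \<le> 3 / 2" using \<rho> x y by auto
   show "norm (\<rho> e - 1) \<le> L * (2 * (C * (norm x * norm y)))"
    using lip[OF ed] e2 d(3) by (meson mult_left_mono order_trans)
   show "norm (\<rho> x - 1) \<le> L * norm x" "norm (\<rho> y - 1) \<le> L * norm y" using lip x y q by auto
  qed (use d in auto)
  also have "\<dots> = K * norm x * norm y" by (simp add: K_def algebra_simps)
  finally show ?thesis .
 qed
 have lq: "norm (\<rho> x - 1) \<le> L * norm x" if "norm x \<le> q" for x using lip[of x] that q(3) by simp
 obtain T where T: "bounded_linear T" "\<And>x. norm x \<le> q \<Longrightarrow> norm ((\<rho> x - 1) - T x) \<le> K * (norm x)\<^sup>2"
  using quasi_additive_linear_part[where f = "\<lambda>x. \<rho> x - 1", OF q(1) qa lq] by blast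
 show ?thesis by (rule that[OF T(1) q(1) K T(2)])
qed

text \<open>\<open>exp (T Y)\<close> is the limit of the \<open>2^k\<close>-th powers of
  \<open>\<rho> (Y / 2^k)\<close>. These are values of \<open>\<rho>\<close> at points of a compact
  set around \<open>Y\<close>, and \<open>a\<close> is a limit point of these. If
  \<open>T Y = 0\<close>, then \<open>\<rho> a = 1\<close>, hence \<open>a = 0\<close>, which for
  small nonzero \<open>Y\<close> contradicts the quadratic bound on \<open>a - Y\<close>.\<close>

theorem exponential: obtains T r K where "bounded_linear T" "inj T" "r > 0" "K \<ge> 0"
 "\<And>x. norm x \<le> r \<Longrightarrow> norm (\<rho> x - 1 - T x) \<le> K * (norm x)\<^sup>2"
 "\<And>Y. norm Y \<le> r \<Longrightarrow> \<exists>a. norm a \<le> R \<and> norm (a - Y) \<le> K * (norm Y)\<^sup>2 \<and> \<rho> a = exp (T Y)"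
proof -
 obtain T r K where T: "bounded_linear T" and r: "r > 0" "K \<ge> 0"
  and est: "\<And>x. norm x \<le> r \<Longrightarrow> norm (\<rho> x - 1 - T x) \<le> K * (norm x)\<^sup>2" by (rule differential_exists) blast
 define r' where "r' = min r \<delta>"
 have ex: "\<exists>a. norm a \<le> R \<and> norm (a - Y) \<le> C * (norm Y)\<^sup>2 \<and> \<rho> a = exp (T Y)" if Y: "norm Y \<le> r'" for Y
 proof -
  define p where "p k = pw (Y /\<^sub>R 2 ^ k) (2 ^ k)" for k
  have sc: "real (2 ^ k) * norm (Y /\<^sub>R 2 ^ k) = norm Y" for k by simp
  have p: "norm (p k - Y) \<le> C * (norm Y)\<^sup>2" "norm (p k) \<le> R" "\<rho> (p k) = \<rho> (Y /\<^sub>R 2 ^ k) ^ 2 ^ k" for k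
  proof -
   have "real (2 ^ k) * norm (Y /\<^sub>R 2 ^ k) \<le> \<delta>" unfolding sc using Y by (simp add: r'_def)
   note e = pw_estimate[OF this, unfolded sc]
   have "real (2 ^ k) *\<^sub>R (Y /\<^sub>R 2 ^ k) = Y" by simp
   then show "norm (p k - Y) \<le> C * (norm Y)\<^sup>2" using e by (simp only: p_def)
   have "norm (p k) \<le> 2 * norm Y" using e by (simp only: p_def)
   then show "norm (p k) \<le> R" using Y \<delta>(2) by (simp add: r'_def)
   show "\<rho> (p k) = \<rho> (Y /\<^sub>R 2 ^ k) ^ 2 ^ k" using e by (simp only: p_def)
  qed
  have "p k \<in> cball Y (C * (norm Y)\<^sup>2) \<inter> cball 0 R" for k using p[of k] by (simp add: dist_norm norm_minus_commute)
  moreover have "compact (cball Y (C * (norm Y)\<^sup>2) \<inter> cball 0 R)" by (intro compact_Int) auto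
  ultimately obtain a s where a: "a \<in> cball Y (C * (norm Y)\<^sup>2) \<inter> cball 0 R" "strict_mono s" "(p \<circ> s) \<longlonglongrightarrow> a"
   unfolding compact_def by metis
  have "(\<lambda>k. \<rho> ((p \<circ> s) k)) \<longlonglongrightarrow> \<rho> a" by (rule continuous_on_tendsto_compose[OF cont a(3)]) (use a(1) p in auto)
  moreover have "(\<lambda>k. \<rho> (Y /\<^sub>R 2 ^ k) ^ 2 ^ k) \<longlonglongrightarrow> exp (T Y)"
  proof (rule power_limit_exp[where C = "K * (norm Y)\<^sup>2"])
   show "norm (\<rho> (Y /\<^sub>R 2 ^ k) - 1 - T Y /\<^sub>R real (2 ^ k)) \<le> K * (norm Y)\<^sup>2 / (real (2 ^ k))\<^sup>2" for k
   proof -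
    have n: "norm (Y /\<^sub>R 2 ^ k) = norm Y / 2 ^ k" unfolding norm_scaleR divide_inverse by (subst mult.commute) simp
    have "norm Y / 2 ^ k \<le> norm Y / 1" by (rule divide_left_mono[OF one_le_power]) simp_all
    then have "norm (Y /\<^sub>R 2 ^ k) \<le> r" using n Y by (simp add: r'_def)
    from est[OF this] show ?thesis unfolding n by (simp add: linear_simps(5)[OF T] power_divide)
   qed
   show "filterlim (\<lambda>k. 2 ^ k :: nat) at_top sequentially"
    by (rule filterlim_at_top_mono[OF filterlim_ident]) (simp add: less_imp_le)
  qed
  then have "(\<lambda>k. \<rho> ((p \<circ> s) k)) \<longlonglongrightarrow> exp (T Y)" using LIMSEQ_subseq_LIMSEQ[OF _ a(2)] by (simp add: p(3) comp_def)
  ultimately have "\<rho> a = exp (T Y)" by (rule LIMSEQ_unique)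
  then show ?thesis using a(1) by (intro exI[of _ a]) (simp add: dist_norm norm_minus_commute)
 qed
 have r': "r' > 0" using r \<delta> by (simp add: r'_def)
 have "inj T"
 proof (rule linear_injective_0[THEN iffD2, OF bounded_linear.linear[OF T]], intro allI impI)
  fix Y assume TY: "T Y = 0"
  show "Y = 0"
  proof (rule ccontr)
   assume Y: "Y \<noteq> 0"
   define t where "t = min r' (1 / (2 * (C + 1)))"
   have t: "t > 0" "t \<le> r'" "C * t < 1" using r' C by (auto simp: t_def min_def field_simps)
   define Z where "Z = (t / norm Y) *\<^sub>R Y"
   have Z: "norm Z = t" using Y t(1) by (simp add: Z_def)
   have "T Z = 0" using TY by (simp add: Z_def linear_simps(5)[OF T])
   then obtain a where a: "norm a \<le> R" "norm (a - Z) \<le> C * (norm Z)\<^sup>2" "\<rho> a = 1" using ex[of Z] Z t(2) by auto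
   then have "a = 0" using inj_onD[OF inj, of a 0] one R by simp
   then have "t * 1 \<le> t * (C * t)" using a(2) Z by (simp add: power2_eq_square mult_ac)
   then show False using t by simp
  qed
 qed
 moreover have "norm (\<rho> x - 1 - T x) \<le> max K C * (norm x)\<^sup>2" if "norm x \<le> r'" for x
  using est[of x] that mult_right_mono[of K "max K C" "(norm x)\<^sup>2"] by (simp add: r'_def)
 moreover have "\<exists>a. norm a \<le> R \<and> norm (a - Y) \<le> max K C * (norm Y)\<^sup>2 \<and> \<rho> a = exp (T Y)"
  if "norm Y \<le> r'" for Y
  using ex[OF that] mult_right_mono[of C "max K C" "(norm Y)\<^sup>2"] by (meson max.cobounded2 order_trans zero_le_power2)
 ultimately show ?thesis using that[of T r' "max K C"] T r' r by auto
qed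

end

section \<open>Complex matrices as real endomorphisms\<close>

definition of_matrix :: "'n::finite cmat \<Rightarrow> (complex^'n) endo" where
 "of_matrix M = endo_of ((*v) M)"

text \<open>A linear left inverse of \<open>of_matrix\<close>, defined on all real endomorphisms by
  reading off the images of the complex basis vectors; it recovers an operator only if that operator
  is complex linear.\<close>

definition to_matrix :: "(complex^'n) endo \<Rightarrow> 'n::finite cmat" where
 "to_matrix A = (\<chi> i j. app A (axis j 1) $ i)"

lemma linear_matrix_vector: "linear ((*v) (M :: 'n::finite cmat))" by (rule linearI)
  (simp_all add: matrix_vector_right_distrib matrix_vector_mult_def vec_eq_iff scaleR_sum_right
   distrib_left sum.distrib)

lemma app_of_matrix: "app (of_matrix M) v = M *v v"
 unfolding of_matrix_def by (rule app_endo_of[OF linear_matrix_vector])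

lemma of_matrix_mult: "of_matrix (M ** N) = of_matrix M * of_matrix N"
 by (rule endo_eqI) (simp add: app_of_matrix matrix_vector_mul_assoc)

lemma of_matrix_one [simp]: "of_matrix (mat 1) = 1" by (rule endo_eqI) (simp add: app_of_matrix)

lemma linear_of_matrix: "linear of_matrix" by (rule linearI; rule endo_eqI)
  (simp_all add: app_of_matrix matrix_vector_mult_add_rdistrib matrix_vector_mult_def vec_eq_iff scaleR_sum_right
   distrib_right sum.distrib)

lemma bounded_linear_of_matrix: "bounded_linear of_matrix"
 using linear_of_matrix by (simp add: linear_conv_bounded_linear)

lemmas of_matrix_simps = linear_add[OF linear_of_matrix] linear_diff[OF linear_of_matrix]
 linear_cmul[OF linear_of_matrix] linear_0[OF linear_of_matrix]

lemma to_matrix_of_matrix [simp]: "to_matrix (of_matrix M) = M"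
proof -
 have "(M *v axis j 1) $ i = M $ i $ j" for i j
  by (simp add: matrix_vector_mult_def axis_def if_distrib cong: if_cong)
 then show ?thesis by (simp add: to_matrix_def app_of_matrix vec_eq_iff)
qed

lemma of_matrix_inject [simp]: "of_matrix M = of_matrix N \<longleftrightarrow> M = N" by (metis to_matrix_of_matrix)

lemma bounded_linear_to_matrix: "bounded_linear (to_matrix :: (complex^'n::finite) endo \<Rightarrow> _)"
proof (rule bounded_linear_intro[where K = "real (CARD('n) * CARD('n))"])
 fix A B :: "(complex^'n) endo" and r
 show "to_matrix (A + B) = to_matrix A + to_matrix B" by (simp add: to_matrix_def vec_eq_iff)
 show "to_matrix (r *\<^sub>R A) = r *\<^sub>R to_matrix A" by (simp add: to_matrix_def vec_eq_iff)
 have entry: "norm (to_matrix A $ i $ j) \<le> norm A" for i j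
 proof -
  have "norm (to_matrix A $ i $ j) \<le> norm (app A (axis j 1))"
   unfolding to_matrix_def by (simp add: Finite_Cartesian_Product.norm_nth_le)
  also have "\<dots> \<le> norm A * norm (axis j (1::complex))" by (rule norm_app)
  finally show ?thesis by (simp add: norm_axis_1)
 qed
 have "norm (to_matrix A) \<le> (\<Sum>i\<in>UNIV. norm (to_matrix A $ i))" unfolding norm_vec_def by (rule L2_set_le_sum) simp
 also have "\<dots> \<le> (\<Sum>i\<in>UNIV. \<Sum>j\<in>UNIV. norm (to_matrix A $ i $ j))"
 proof (rule sum_mono)
  fix i
  show "norm (to_matrix A $ i) \<le> (\<Sum>j\<in>UNIV. norm (to_matrix A $ i $ j))"
   unfolding norm_vec_def[of "to_matrix A $ i"] by (rule L2_set_le_sum) simp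
 qed
 also have "\<dots> \<le> (\<Sum>i\<in>(UNIV::'n set). \<Sum>j\<in>(UNIV::'n set). norm A)" by (intro sum_mono entry)
 finally show "norm (to_matrix A) \<le> norm A * real (CARD('n) * CARD('n))" by (simp add: mult_ac)
qed

text \<open>The real inner product is the real part of the Hermitian one, so the two notions of
  adjoint coincide.\<close>

lemma of_matrix_ctransp: "of_matrix (ctransp (M :: 'n::finite cmat)) = adj (of_matrix M)"
proof (rule adjI[symmetric])
 fix v w :: "complex^'n"
 have "app (of_matrix (ctransp M)) v \<bullet> w = (\<Sum>i\<in>UNIV. \<Sum>j\<in>UNIV. (cnj (M $ j $ i) * v $ j) \<bullet> w $ i)"
  by (simp add: app_of_matrix matrix_vector_mult_def ctransp_def inner_vec_def inner_sum_left)
 also have "\<dots> = (\<Sum>j\<in>UNIV. \<Sum>i\<in>UNIV. (cnj (M $ j $ i) * v $ j) \<bullet> w $ i)" by (rule sum.swap)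
 also have "\<dots> = (\<Sum>j\<in>UNIV. \<Sum>i\<in>UNIV. v $ j \<bullet> (M $ j $ i * w $ i))" by (simp add: inner_complex_def algebra_simps)
 also have "\<dots> = v \<bullet> app (of_matrix M) w"
  by (simp add: app_of_matrix matrix_vector_mult_def inner_vec_def inner_sum_right)
 finally show "app (of_matrix (ctransp M)) v \<bullet> w = v \<bullet> app (of_matrix M) w" .
qed

lemma of_matrix_hermitian_iff: "ctransp M = M \<longleftrightarrow> adj (of_matrix M) = of_matrix M"
 by (metis of_matrix_ctransp of_matrix_inject)

section \<open>The groups SL and PSL\<close>

lemma SL_simps [simp]: "carrier SL = {M. det M = 1}" "mult SL = (**)" "one SL = mat 1" by (simp_all add: SL_def)

lemma group_SL: "group (SL :: 'n::finite cmat monoid)"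
proof (rule groupI)
 fix M :: "'n cmat" assume "M \<in> carrier SL"
 then have d: "det M = 1" by simp
 then have "invertible M" by (simp add: invertible_det_nz)
 then obtain N where N: "N ** M = mat 1" unfolding invertible_def by blast
 then have "det N = 1" using d det_mul[of N M] by simp
 then show "\<exists>N\<in>carrier SL. N \<otimes>\<^bsub>SL\<^esub> M = \<one>\<^bsub>SL\<^esub>" using N by auto
qed (auto simp: det_mul matrix_mul_assoc)

text \<open>Commuting with the transvections \<open>1 + E_ij\<close>, which are row operations on
  the identity, kills the off-diagonal entries and makes the diagonal ones equal; the determinant
  makes the common entry a root of unity.\<close>

lemma center_SL_scalar:
 assumes "Z \<in> group_center (SL :: 'n::finite cmat monoid)"
 obtains c where "Z = mat c" "c ^ CARD('n) = 1"
proof -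
 have comm: "Z ** N = N ** Z" if "det N = 1" for N using assms that by (auto simp: group_center_def)
 have key: "Z $ a $ i = (if a = i then Z $ j $ j else 0)" if "i \<noteq> j" for a i j
 proof -
  define N where "N = (\<chi> k. if k = i then row i (mat 1) + 1 *s row j (mat 1) else row k (mat 1 :: 'n cmat))"
  have "det N = 1" unfolding N_def by (subst det_row_operation[OF that]) simp
  from comm[OF this] have "(Z ** N) $ a $ j = (N ** Z) $ a $ j" by simp
  moreover have Nent: "N $ k $ l = (if k = l then 1 else if k = i \<and> l = j then 1 else 0)" for k l
   using that by (auto simp: N_def row_def mat_def)
  have "(Z ** N) $ a $ j = (\<Sum>k\<in>UNIV. (if k = j then Z $ a $ k else 0) + (if k = i then Z $ a $ k else 0))"
   unfolding matrix_matrix_mult_def using that by (auto simp: Nent intro!: sum.cong)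
  then have "(Z ** N) $ a $ j = Z $ a $ j + Z $ a $ i" by (simp add: sum.distrib)
  moreover have "(N ** Z) $ a $ j = (\<Sum>k\<in>UNIV. (if k = a then Z $ k $ j else 0) + (if k = j then if a = i then Z $ k $ j else 0 else 0))"
   unfolding matrix_matrix_mult_def using that by (auto simp: Nent intro!: sum.cong)
  then have "(N ** Z) $ a $ j = Z $ a $ j + (if a = i then Z $ j $ j else 0)" by (simp add: sum.distrib)
  ultimately show ?thesis by simp
 qed
 define c where "c = Z $ undefined $ undefined"
 have "Z = mat c" unfolding vec_eq_iff mat_def c_def using key by (auto, metis, metis)
 moreover have "det (mat c :: 'n cmat) = c ^ CARD('n)" by (subst det_diagonal) (simp_all add: mat_def)
 ultimately show ?thesis using that[of c] assms by (auto simp: group_center_def)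
qed

lemma of_matrix_scalar: "app (of_matrix (mat c)) v = c *s v"
 by (simp add: app_of_matrix matrix_vector_mult_def mat_def vec_eq_iff if_distrib if_distribR cong: if_cong)

text \<open>The ambiguity of a lift from PSL: two lifts of the same element differ by a factor in
  this finite set.\<close>

definition cen :: "(complex^'n::finite) endo set" where
 "cen = of_matrix ` group_center SL"

lemma cenE:
 assumes "z \<in> (cen :: (complex^'n::finite) endo set)"
 obtains c where "\<And>v. app z v = c *s v" "cmod c = 1" "c ^ CARD('n) = 1" "z = of_matrix (mat c)"
proof -
 obtain c where "z = of_matrix (mat c)" "c ^ CARD('n) = 1" using assms center_SL_scalar unfolding cen_def by blast
 then show ?thesis using that[of c] of_matrix_scalar power_eq_1_iff[of c] by fastforce
qed

lemma cen_commute: "z \<in> cen \<Longrightarrow> z * of_matrix M = of_matrix M * z"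
proof (rule endo_eqI)
 fix v assume "z \<in> cen"
 then obtain c where "\<And>v. app z v = c *s v" by (rule cenE) blast
 then show "app (z * of_matrix M) v = app (of_matrix M * z) v"
  by (simp add: app_of_matrix matrix_vector_mult_def vec_eq_iff sum_distrib_left mult_ac)
qed

lemma cen_unitary:
 assumes "z \<in> cen" shows "adj z * z = 1" "z * adj z = 1"
proof -
 obtain c where c: "\<And>v. app z v = c *s v" "cmod c = 1" "z = of_matrix (mat c)" by (rule cenE[OF assms]) blast
 have n: "c * cnj c = 1" using c(2) by (simp add: complex_mult_cnj cmod_def flip: of_real_power)
 have "adj z = of_matrix (mat (cnj c))" unfolding c(3) of_matrix_ctransp[symmetric]
  by (auto simp: ctransp_def mat_def vec_eq_iff)
 then have "app (adj z) v = cnj c *s v" for v by (simp add: of_matrix_scalar)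
 then show "adj z * z = 1" "z * adj z = 1"
  using n by (auto intro!: endo_eqI simp: c(1) vec_eq_iff mult.assoc[symmetric] mult.commute[of "cnj c"])
qed

lemma finite_cen: "finite (cen :: (complex^'n::finite) endo set)"
proof (rule finite_subset)
 show "(cen :: (complex^'n) endo set) \<subseteq> (\<lambda>c. of_matrix (mat c)) ` {c. c ^ CARD('n) = 1}" by (auto elim!: cenE)
 show "finite ((\<lambda>c. of_matrix (mat c :: 'n cmat)) ` {c. c ^ CARD('n) = 1})"
  by (intro finite_imageI finite_roots_unity) simp
qed

text \<open>The identity is isolated in a finite set. The factor 4 is what two lifts within
  \<open>\<eta>\<close> of 1 may lose: their central quotient \<open>z\<close> satisfies
  \<open>norm (z - 1) < 4 * \<eta>\<close>, so there is at most one lift that close.\<close>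

lemma cen_separated: obtains \<eta> where "\<eta> > 0" "\<eta> \<le> 1 / 2"
 "\<And>z. z \<in> (cen :: (complex^'n::finite) endo set) \<Longrightarrow> norm (z - 1) < 4 * \<eta> \<Longrightarrow> z = 1"
proof -
 let ?D = "insert 2 ((\<lambda>z. norm (z - 1)) ` (cen - {1 :: (complex^'n) endo}))"
 have D: "finite ?D" "?D \<noteq> {}" using finite_cen by auto
 have pos: "Min ?D > 0" by (subst Min_gr_iff[OF D]) auto
 have le: "Min ?D \<le> 2" using D by (intro Min_le) auto
 have "z = 1" if "z \<in> cen" "norm (z - 1) < Min ?D" for z :: "(complex^'n) endo"
 proof (rule ccontr)
  assume "z \<noteq> 1"
  then have "norm (z - 1) \<in> ?D" using that(1) by blast
  then have "Min ?D \<le> norm (z - 1)" by (rule Min_le[OF D(1)])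
  then show False using that(2) by simp
 qed
 then show ?thesis using that[of "Min ?D / 4"] pos le by auto
qed

lemma subgroup_center_SL: "subgroup (group_center SL) (SL :: 'n::finite cmat monoid)"
proof -
 interpret group "SL :: 'n cmat monoid" by (rule group_SL)
 show ?thesis
 proof (rule subgroupI)
  show "group_center (SL :: 'n cmat monoid) \<noteq> {}"
   using one_closed by (force simp: group_center_def simp del: SL_simps)
  show "inv\<^bsub>SL\<^esub> a \<in> group_center SL" if "a \<in> group_center (SL :: 'n cmat monoid)" for a
  proof -
   have a: "a \<in> carrier SL" "\<And>g. g \<in> carrier SL \<Longrightarrow> a \<otimes>\<^bsub>SL\<^esub> g = g \<otimes>\<^bsub>SL\<^esub> a"
    using that unfolding group_center_def by blast+
   have "inv\<^bsub>SL\<^esub> a \<otimes>\<^bsub>SL\<^esub> g = g \<otimes>\<^bsub>SL\<^esub> inv\<^bsub>SL\<^esub> a" if g: "g \<in> carrier SL" for g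
    using a g by (metis inv_closed inv_solve_left inv_solve_right m_assoc m_closed)
   then show ?thesis using a(1) unfolding group_center_def by blast
  qed
  show "a \<otimes>\<^bsub>SL\<^esub> b \<in> group_center SL"
   if "a \<in> group_center SL" "b \<in> group_center (SL :: 'n cmat monoid)" for a b
  proof -
   have ab: "a \<in> carrier SL" "b \<in> carrier SL" "\<And>g. g \<in> carrier SL \<Longrightarrow> a ** g = g ** a"
    "\<And>g. g \<in> carrier SL \<Longrightarrow> b ** g = g ** b" using that unfolding group_center_def SL_simps by blast+
   have "a ** b ** g = g ** (a ** b)" if g: "g \<in> carrier SL" for g
   proof -
    have "a ** b ** g = a ** (g ** b)" by (simp only: ab(4)[OF g] matrix_mul_assoc[symmetric])
    also have "\<dots> = g ** (a ** b)" by (simp only: ab(3)[OF g] matrix_mul_assoc)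
    finally show ?thesis .
   qed
   then show ?thesis using ab(1,2) by (simp add: group_center_def det_mul)
  qed
 qed (auto simp: group_center_def)
qed

lemma normal_center_SL: "group_center SL \<lhd> (SL :: 'n::finite cmat monoid)"
proof -
 interpret group "SL :: 'n cmat monoid" by (rule group_SL)
 show ?thesis by (rule normalI[OF subgroup_center_SL])
   (auto simp: r_coset_def l_coset_def group_center_def)
qed

lemma group_PSL: "group (PSL :: 'n::finite cmat set monoid)"
 unfolding PSL_def by (rule normal.factorgroup_is_group[OF normal_center_SL])

lemma PSL_simps: "carrier PSL = rcosets\<^bsub>SL\<^esub> (group_center SL)" "mult PSL = set_mult SL"
 "one PSL = group_center SL" by (simp_all add: PSL_def FactGroup_def)

lemma PSL_coset:
 assumes "C \<in> carrier PSL" "N \<in> C"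
 shows "C = group_center SL #>\<^bsub>SL\<^esub> N"
proof -
 obtain x where "x \<in> carrier SL" "C = group_center SL #>\<^bsub>SL\<^esub> x"
  using assms(1) unfolding PSL_simps RCOSETS_def by blast
 then show ?thesis using group.repr_independence[OF group_SL _ _ subgroup_center_SL] assms(2) by blast
qed

lemma PSL_subset_carrier: "C \<in> carrier PSL \<Longrightarrow> C \<subseteq> {M. det M = 1}"
 using subgroup.rcosets_carrier[OF subgroup_center_SL group_SL] by (simp add: PSL_simps)

lemma PSL_nonempty: "C \<in> carrier PSL \<Longrightarrow> C \<noteq> {}"
 unfolding PSL_simps RCOSETS_def using group.rcos_self[OF group_SL _ subgroup_center_SL] by blast

section \<open>The representation near the identity\<close>

lemma mult_inverse_unique:
 fixes a b c :: "'a::monoid_mult"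
 assumes "b * a = 1" "a * c = 1"
 shows "b = c"
proof -
 have "b = b * (a * c)" by (simp add: assms(2))
 also have "\<dots> = c" by (simp add: assms(1) flip: mult.assoc)
 finally show ?thesis .
qed

locale satake_data =
 fixes G :: "('g, 'e::euclidean_space) lie_struct" (structure)
  and K :: "'g set" and \<theta> :: "'g \<Rightarrow> 'g" and \<aa> :: "'e set"
  and \<tau> :: "'g \<Rightarrow> 'n::finite cmat set"
 assumes nss: "noncompact_symmetric_space G K \<theta> \<aa>"
  and frep: "faithful_projective_rep G \<tau>"
  and cc: "cartan_compatible G \<theta> \<tau>"
begin

abbreviation fc :: "'e \<Rightarrow> 'g" where "fc \<equiv> from_coord G"

abbreviation GT :: "'g topology" where "GT \<equiv> lie_top G"

lemma lie_group_G: "lie_group G" using nss by (simp add: noncompact_symmetric_space_def)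

lemma group_G: "group G" using lie_group_G by (simp add: lie_group_def)

sublocale group G by (rule group_G)

lemma top_G [simp]: "topspace GT = carrier G" using lie_group_G by (simp add: lie_group_def)

lemma openin_G_subset: "openin GT U \<Longrightarrow> U \<subseteq> carrier G" using openin_subset[of "GT" U] by simp

text \<open>All lifts of \<open>\<tau> g\<close> as operators: a multivalued homomorphism whose
  values, for \<open>g\<close> in the group, are cosets of \<open>cen\<close>.\<close>

definition H :: "'g \<Rightarrow> (complex^'n) endo set" where
 "H g = of_matrix ` \<tau> g"

lemma tau_hom: "\<tau> \<in> hom G PSL" using frep by (simp add: faithful_projective_rep_def)

lemma tau_carrier: "g \<in> carrier G \<Longrightarrow> \<tau> g \<in> carrier PSL" using tau_hom by (rule hom_in_carrier)

lemma tau_mult: "g \<in> carrier G \<Longrightarrow> h \<in> carrier G \<Longrightarrow> \<tau> (g \<otimes> h) = \<tau> g <#>\<^bsub>SL\<^esub> \<tau> h"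
 using hom_mult[OF tau_hom] by (simp add: PSL_simps)

lemma tau_one: "\<tau> \<one> = group_center SL" using hom_one[OF tau_hom group_G group_PSL] by (simp add: PSL_simps)

lemma H_nonempty: "g \<in> carrier G \<Longrightarrow> H g \<noteq> {}" using tau_carrier PSL_nonempty by (auto simp: H_def)

lemma H_det: "g \<in> carrier G \<Longrightarrow> N \<in> H g \<Longrightarrow> \<exists>M. N = of_matrix M \<and> det M = 1"
 using PSL_subset_carrier[OF tau_carrier] by (auto simp: H_def)

lemma H_mult:
 assumes "g \<in> carrier G" "h \<in> carrier G" "N \<in> H g" "N' \<in> H h"
 shows "N * N' \<in> H (g \<otimes> h)" using assms(3,4) unfolding H_def tau_mult[OF assms(1,2)]
 by (force simp: set_mult_def of_matrix_mult[symmetric])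

lemma H_one: "1 \<in> H \<one>" unfolding H_def tau_one
 using subgroup.one_closed[OF subgroup_center_SL] by (force simp flip: of_matrix_one)

lemma tau_coset: "g \<in> carrier G \<Longrightarrow> M \<in> \<tau> g \<Longrightarrow> \<tau> g = (\<lambda>z. z ** M) ` group_center SL"
 using PSL_coset[OF tau_carrier] by (force simp: r_coset_def)

lemma H_coset: "g \<in> carrier G \<Longrightarrow> N \<in> H g \<Longrightarrow> H g = (\<lambda>z. z * N) ` cen"
proof -
 assume g: "g \<in> carrier G" and "N \<in> H g"
 then obtain M where M: "M \<in> \<tau> g" "N = of_matrix M" by (auto simp: H_def)
 show ?thesis unfolding H_def tau_coset[OF g M(1)] M(2) cen_def by (simp add: image_image of_matrix_mult)
qed

lemma H_inj: "g \<in> carrier G \<Longrightarrow> h \<in> carrier G \<Longrightarrow> N \<in> H g \<Longrightarrow> N \<in> H h \<Longrightarrow> g = h"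
proof -
 assume g: "g \<in> carrier G" "h \<in> carrier G" and "N \<in> H g" "N \<in> H h"
 then obtain M where "M \<in> \<tau> g" "M \<in> \<tau> h" by (auto simp: H_def)
 then have "\<tau> g = \<tau> h" using tau_coset g by blast
 then show "g = h" using frep g by (auto simp: faithful_projective_rep_def inj_on_def)
qed

lemma H_commute_cen: "z \<in> cen \<Longrightarrow> N \<in> H g \<Longrightarrow> z * N = N * z" using cen_commute by (auto simp: H_def)

lemma cen_mult_H: "g \<in> carrier G \<Longrightarrow> z \<in> cen \<Longrightarrow> N \<in> H g \<Longrightarrow> z * N \<in> H g" using H_coset by blast

lemma H_inverse:
 assumes g: "g \<in> carrier G" and N: "N \<in> H g"
 obtains N' where "N' \<in> H (inv g)" "N' * N = 1" "N * N' = 1"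
proof -
 obtain N1 where N1: "N1 \<in> H (inv g)" using H_nonempty[of "inv g"] g by auto
 have "N1 * N \<in> H \<one>" using H_mult[OF _ _ N1 N] g by simp
 then obtain z where z: "z \<in> cen" "1 = z * (N1 * N)" using H_coset[OF one_closed, of "N1 * N"] H_one by blast
 have N': "z * N1 \<in> H (inv g)" by (rule cen_mult_H[OF _ z(1) N1]) (simp add: g)
 have l: "(z * N1) * N = 1" using z by (simp add: mult.assoc)
 have "N * (z * N1) \<in> H \<one>" using H_mult[OF _ _ N N'] g by simp
 then obtain w where w: "w \<in> cen" "1 = w * (N * (z * N1))"
  using H_coset[OF one_closed, of "N * (z * N1)"] H_one by blast
 \<comment> \<open>The product \<open>e = N * (z * N1)\<close> is idempotent and
   \<open>w * e = 1\<close>, so \<open>e = w * e * e = w * e = 1\<close>.\<close>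
 have "N * (z * N1) = w * (N * (z * N1)) * (N * (z * N1))" by (simp flip: w(2))
 also have "\<dots> = w * (N * ((z * N1) * N) * (z * N1))" by (simp only: mult.assoc)
 also have "\<dots> = 1" using l w(2) by simp
 finally show ?thesis using that N' l by blast
qed

lemma cart: "cartan_involution G K \<theta>" "maximal_abelian_in G (cartan_p G \<theta>) \<aa>"
  "maximal_compact_subgroup G K" "connected_space (sym_top G K)"
 using nss by (simp_all add: noncompact_symmetric_space_def)

lemma theta_hom: "\<theta> \<in> hom G G" using cart(1) by (simp add: cartan_involution_def)

lemma theta_closed: "g \<in> carrier G \<Longrightarrow> \<theta> g \<in> carrier G" using theta_hom by (rule hom_in_carrier)

lemma K_eq: "K = {g \<in> carrier G. \<theta> g = g}" using cart(1) by (simp add: cartan_involution_def)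

lemma K_subset: "k \<in> K \<Longrightarrow> k \<in> carrier G" by (simp add: K_eq)

lemma subgroup_K: "subgroup K G" and compact_K: "compactin GT K"
 using cart(3) by (simp_all add: maximal_compact_subgroup_def)

lemma cen_adj: "z \<in> cen \<Longrightarrow> adj z \<in> (cen :: (complex^'n) endo set)"
proof -
 assume z: "z \<in> cen"
 interpret SL: group "SL :: 'n cmat monoid" by (rule group_SL)
 from z obtain M where M: "M \<in> group_center SL" "z = of_matrix M" by (auto simp: cen_def)
 have inv: "inv\<^bsub>SL\<^esub> M \<in> group_center SL" by (rule subgroup.m_inv_closed[OF subgroup_center_SL M(1)])
 have "M \<in> carrier SL" using M(1) by (auto simp: group_center_def)
 from SL.r_inv[OF this] have "of_matrix (M ** inv\<^bsub>SL\<^esub> M) = 1" by simp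
 then have "z * of_matrix (inv\<^bsub>SL\<^esub> M) = 1" by (simp add: of_matrix_mult M(2))
 then have "adj z * z * of_matrix (inv\<^bsub>SL\<^esub> M) = adj z" by (simp add: mult.assoc)
 then have "of_matrix (inv\<^bsub>SL\<^esub> M) = adj z" using cen_unitary(1)[OF z] by simp
 then show ?thesis using inv by (metis cen_def imageI)
qed

text \<open>Compatibility with the involution makes a lift of \<open>\<theta> g\<close> times
  \<open>adj N\<close> central; multiplying by the adjoint of this central element, which is its
  inverse, gives an exact inverse.\<close>

lemma H_theta:
 assumes g: "g \<in> carrier G" and N: "N \<in> H g"
 obtains N' where "N' \<in> H (\<theta> g)" "N' * adj N = 1" "adj N * N' = 1"
proof -
 obtain M where M: "M \<in> \<tau> g" "N = of_matrix M" using N by (auto simp: H_def)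
 interpret SL: group "SL :: 'n cmat monoid" by (rule group_SL)
 interpret PSL: group "PSL :: 'n cmat set monoid" by (rule group_PSL)
 have det_ct: "det (ctransp M) = 1"
 proof -
  have "det (ctransp M) = cnj (det M)" unfolding ctransp_def det_transpose[of M, symmetric]
   by (simp add: det_def transpose_def)
  then show ?thesis using PSL_subset_carrier[OF tau_carrier[OF g]] M(1) by auto
 qed
 have ct: "ctransp ` \<tau> g = group_center SL #>\<^bsub>SL\<^esub> ctransp M"
 proof -
  have "of_matrix ` ctransp ` \<tau> g = (\<lambda>z. adj (z * N)) ` cen"
  proof -
   have "of_matrix ` ctransp ` \<tau> g = adj ` H g" by (simp add: H_def image_image of_matrix_ctransp)
   then show ?thesis by (simp only: H_coset[OF g N] image_image)
  qed
  also have "\<dots> = (\<lambda>z. z * adj N) ` cen"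
  proof -
   have "adj (z * N) = adj z * adj N" if "z \<in> cen" for z using H_commute_cen[OF that N] by simp
   then show ?thesis using cen_adj by (force simp: image_iff intro: bexI[of _ "adj z" for z])
  qed
  also have "\<dots> = of_matrix ` (group_center SL #>\<^bsub>SL\<^esub> ctransp M)"
   by (simp add: cen_def r_coset_def M(2) of_matrix_ctransp[symmetric] of_matrix_mult[symmetric]
     image_image UNION_singleton_eq_range)
  finally show ?thesis by (simp add: inj_image_eq_iff inj_def)
 qed
 have ctc: "ctransp ` \<tau> g \<in> carrier PSL"
  unfolding ct PSL_simps by (rule SL.rcosetsI) (use det_ct subgroup.subset[OF subgroup_center_SL] in auto)
 have th: "\<tau> (\<theta> g) = inv\<^bsub>PSL\<^esub> (ctransp ` \<tau> g)" using cc g by (simp add: cartan_compatible_def)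
 have "\<tau> (\<theta> g) <#>\<^bsub>SL\<^esub> (ctransp ` \<tau> g) = group_center SL" using PSL.l_inv[OF ctc] by (simp add: th PSL_simps)
 moreover obtain N1 where N1: "N1 \<in> \<tau> (\<theta> g)" using PSL_nonempty[OF tau_carrier[OF theta_closed[OF g]]] by blast
 ultimately have "N1 ** ctransp M \<in> group_center SL" using M(1) by (force simp: set_mult_def)
 then have "of_matrix (N1 ** ctransp M) \<in> cen" by (simp add: cen_def)
 then have c: "of_matrix N1 * adj N \<in> cen" by (simp add: of_matrix_mult of_matrix_ctransp M(2))
 let ?z = "adj (of_matrix N1 * adj N)"
 let ?N = "?z * of_matrix N1"
 have 1: "?N * adj N = 1" using cen_unitary(1)[OF c] by (simp add: mult.assoc)
 have N': "?N \<in> H (\<theta> g)" using cen_mult_H[OF theta_closed[OF g] cen_adj[OF c]] N1 by (simp add: H_def)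
 obtain Ni where Ni: "Ni * N = 1" "N * Ni = 1" by (rule H_inverse[OF g N])
 have "adj N * adj Ni = 1" "adj Ni * adj N = 1" using Ni by (metis adj_simps(4,5))+
 then have "adj N * ?N = 1" using mult_inverse_unique[OF 1, of "adj Ni"] by simp
 then show ?thesis using that N' 1 by blast
qed

text \<open>If \<open>\<theta> g = g\<close>, a lift inverse to \<open>adj N\<close> is
  \<open>z * N\<close> with \<open>z\<close> central, so \<open>adj N * N\<close> is inverse to
  \<open>z\<close>. Then \<open>z\<close> is symmetric and unitary, hence a scalar 1 or -1, and
  positivity of \<open>adj N * N\<close> excludes -1.\<close>

lemma K_iff: "g \<in> carrier G \<Longrightarrow> N \<in> H g \<Longrightarrow> g \<in> K \<longleftrightarrow> adj N * N = 1"
proof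
 assume g: "g \<in> carrier G" and N: "N \<in> H g"
 obtain N' where N': "N' \<in> H (\<theta> g)" "N' * adj N = 1" "adj N * N' = 1" by (rule H_theta[OF g N])
 {
  assume "g \<in> K"
  then have "N' \<in> H g" using N' by (simp add: K_eq)
  then obtain z where z: "z \<in> cen" "N' = z * N" using H_coset[OF g N] by blast
  have "N * adj N = adj z" using N'(2) z
   by (intro mult_inverse_unique[OF cen_unitary(1)[OF z(1)], symmetric]) (simp add: mult.assoc)
  then have "adj z = z" by (metis adj_simps(4,8))
  have "adj N * (z * N) = 1" using N' z by simp
  then have az: "adj N * N * z = 1" using H_commute_cen[OF z(1) N] by (simp add: mult.assoc)
  obtain c where c: "\<And>v. app z v = c *s v" "cmod c = 1" by (rule cenE[OF z(1)]) blast
  have pos: "app N v \<bullet> app N (app z v) = v \<bullet> v" for v using arg_cong[OF az, of "\<lambda>A. app A v"] by (simp add: inner_app)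
  define v where "v = (axis undefined 1 :: complex^'n)"
  have zz: "z * z = 1" using cen_unitary(1)[OF z(1)] \<open>adj z = z\<close> by simp
  then have "c *s (c *s v) = v" using c(1) by (metis app_simps(4,5))
  then have "(c *s (c *s v)) $ undefined = v $ undefined" by simp
  then have "c * c = 1" by (simp add: v_def axis_def)
  then have "c = 1 \<or> c = -1" by (metis power2_eq_1_iff power2_eq_square)
  moreover have False if "c = -1"
  proof -
   have "app z v = - v" using c(1)[of v] that by (simp add: vec_eq_iff)
   then have "- (app N v \<bullet> app N v) = v \<bullet> v" using pos[of v] by simp
   moreover have "v \<bullet> v = 1" by (simp add: v_def inner_axis)
   ultimately show False using inner_ge_zero[of "app N v"] by linarith
  qed
  ultimately have "z = 1" using c(1) by (intro endo_eqI) auto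
  then show "adj N * N = 1" using az by simp
 next
  assume "adj N * N = 1"
  then have "N' = N" by (rule mult_inverse_unique[OF N'(2)])
  then show "g \<in> K" using H_inj[OF theta_closed[OF g] g] N'(1) N g by (simp add: K_eq)
 }
qed

lemma K_unitary: "k \<in> K \<Longrightarrow> N \<in> H k \<Longrightarrow> adj N * N = 1 \<and> N * adj N = 1"
proof -
 assume k: "k \<in> K" and N: "N \<in> H k"
 have 1: "adj N * N = 1" using K_iff[OF K_subset[OF k] N] k by simp
 obtain N' where "N' * N = 1" "N * N' = 1" by (rule H_inverse[OF K_subset[OF k] N])
 then have "N * adj N = 1" using mult_inverse_unique[OF 1] by simp
 then show ?thesis using 1 by simp
qed

text \<open>The preimage in SL of the image of a ball is the union of its translates by the center,
  each of them open. This is the form in which continuity of \<open>\<tau>\<close> enters.\<close>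

lemma H_open: "openin GT {g \<in> carrier G. \<exists>N\<in>H g. norm (N - A) < \<epsilon>}"
proof -
 let ?q = "\<lambda>M :: 'n cmat. group_center SL #>\<^bsub>SL\<^esub> M" and ?S = "top_of_set (carrier SL :: 'n cmat set)"
 define U where "U = {M \<in> carrier SL. norm (of_matrix M - A) < \<epsilon>}"
 have U: "openin ?S {M \<in> carrier SL. norm (of_matrix (z ** M) - A) < \<epsilon>}" for z
 proof -
  have "continuous_on UNIV (\<lambda>M. norm (of_matrix z * of_matrix M - A))"
   using bounded_linear.continuous_on[OF bounded_linear_of_matrix continuous_on_id] by (intro continuous_intros)
  then have "open {M. norm (of_matrix z * of_matrix M - A) < \<epsilon>}" by (rule open_Collect_less) (intro continuous_intros)
  then have "openin ?S (carrier SL \<inter> {M. norm (of_matrix z * of_matrix M - A) < \<epsilon>})" by (rule openin_open_Int)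
  then show ?thesis by (simp add: of_matrix_mult Int_def)
 qed
 have sub: "z \<in> group_center SL \<Longrightarrow> z \<in> carrier SL" for z by (auto simp: group_center_def)
 have self: "M \<in> ?q M" if "M \<in> carrier SL" for M by (rule group.rcos_self[OF group_SL that subgroup_center_SL])
 have "openin PSL_top (?q ` U)" unfolding PSL_top_def openin_quotient_topology
 proof
  show "?q ` U \<subseteq> ?q ` topspace ?S" by (auto simp: U_def)
  have "{M \<in> topspace ?S. ?q M \<in> ?q ` U} =
    (\<Union>z\<in>group_center SL. {M \<in> carrier SL. norm (of_matrix (z ** M) - A) < \<epsilon>})"
  proof (intro equalityI subsetI)
   fix M assume "M \<in> {M \<in> topspace ?S. ?q M \<in> ?q ` U}"
   then obtain M' where M: "M \<in> carrier SL" "M' \<in> U" "?q M = ?q M'" by auto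
   then have "M' \<in> ?q M" using self by (auto simp: U_def)
   then obtain z where "z \<in> group_center SL" "M' = z ** M" by (auto simp: r_coset_def)
   then show "M \<in> (\<Union>z\<in>group_center SL. {M \<in> carrier SL. norm (of_matrix (z ** M) - A) < \<epsilon>})"
    using M by (auto simp: U_def)
  next
   fix M assume "M \<in> (\<Union>z\<in>group_center SL. {M \<in> carrier SL. norm (of_matrix (z ** M) - A) < \<epsilon>})"
   then obtain z where z: "z \<in> group_center SL" "M \<in> carrier SL" "norm (of_matrix (z ** M) - A) < \<epsilon>" by blast
   have zM: "z ** M \<in> carrier SL" using sub[OF z(1)] z(2) by (simp add: det_mul)
   then have "z ** M \<in> U" using z by (simp add: U_def)
   moreover have "?q M = ?q (z ** M)" by (rule group.repr_independence[OF group_SL _ z(2) subgroup_center_SL])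
     (use z(1) in \<open>auto simp: r_coset_def\<close>)
   ultimately show "M \<in> {M \<in> topspace ?S. ?q M \<in> ?q ` U}" using z(2) by auto
  qed
  then show "openin ?S {M \<in> topspace ?S. ?q M \<in> ?q ` U}" using U by auto
 qed
 moreover have "continuous_map GT PSL_top \<tau>" using frep by (simp add: faithful_projective_rep_def)
 ultimately have "openin GT {g \<in> topspace GT. \<tau> g \<in> ?q ` U}" by (rule openin_continuous_map_preimage[rotated])
 moreover have "\<tau> g \<in> ?q ` U \<longleftrightarrow> (\<exists>N\<in>H g. norm (N - A) < \<epsilon>)" if g: "g \<in> carrier G" for g
 proof
  assume "\<tau> g \<in> ?q ` U"
  then obtain M where "M \<in> U" "\<tau> g = ?q M" by blast
  then show "\<exists>N\<in>H g. norm (N - A) < \<epsilon>" using self[of M] by (auto simp: U_def H_def)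
 next
  assume "\<exists>N\<in>H g. norm (N - A) < \<epsilon>"
  then obtain M where "M \<in> \<tau> g" "norm (of_matrix M - A) < \<epsilon>" by (auto simp: H_def)
  then show "\<tau> g \<in> ?q ` U" using PSL_coset[OF tau_carrier[OF g]] PSL_subset_carrier[OF tau_carrier[OF g]]
   by (auto simp: U_def)
 qed
 ultimately show ?thesis by (simp add: conj_commute cong: conj_cong)
qed

end

section \<open>Charts and coordinates at the identity\<close>

context satake_data
begin

lemma continuous_map_mult_G:
 assumes "continuous_map X GT f" "continuous_map X GT h"
 shows "continuous_map X GT (\<lambda>x. f x \<otimes> h x)"
proof -
 have "continuous_map (prod_topology GT GT) GT (\<lambda>(g, h). g \<otimes> h)" using lie_group_G by (simp add: lie_group_def)
 from continuous_map_compose[OF continuous_map_pairedI[OF assms] this] show ?thesis by (simp add: comp_def)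
qed

lemma continuous_map_inv_G:
 assumes "continuous_map X GT f"
 shows "continuous_map X GT (\<lambda>x. inv (f x))"
proof -
 have "continuous_map GT GT (\<lambda>g. inv g)" using lie_group_G by (simp add: lie_group_def)
 from continuous_map_compose[OF assms this] show ?thesis by (simp add: comp_def)
qed

lemma continuous_map_const_G: "g \<in> carrier G \<Longrightarrow> continuous_map X GT (\<lambda>x. g)" by simp

lemma chart:
 assumes "(U, \<phi>) \<in> lie_atlas G"
 shows chart_open: "openin GT U" and chart_image_open: "open (\<phi> ` U)"
  and chart_inj: "inj_on \<phi> U" and chart_subset: "U \<subseteq> carrier G"
  and chart_inv_in: "\<And>x. x \<in> \<phi> ` U \<Longrightarrow> inv_into U \<phi> x \<in> U \<and> \<phi> (inv_into U \<phi> x) = x"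
  and chart_inv: "\<And>g. g \<in> U \<Longrightarrow> inv_into U \<phi> (\<phi> g) = g"
  and chart_continuous_inv: "continuous_map (top_of_set (\<phi> ` U)) GT (inv_into U \<phi>)"
  and chart_preimage: "\<And>V. open V \<Longrightarrow> openin GT {g \<in> U. \<phi> g \<in> V}"
proof -
 have c: "openin GT U" "open (\<phi> ` U)"
  "homeomorphic_map (subtopology GT U) (top_of_set (\<phi> ` U)) \<phi>"
  using lie_group_G assms by (auto simp: lie_group_def smooth_manifold_def)
 have UG: "U \<subseteq> carrier G" using openin_G_subset c(1) .
 have ts: "topspace (subtopology GT U) = U" using UG by auto
 show "openin GT U" "open (\<phi> ` U)" "U \<subseteq> carrier G" by fact+
 show inj: "inj_on \<phi> U" using homeomorphic_imp_injective_map[OF c(3)] ts by simp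
 show "\<And>x. x \<in> \<phi> ` U \<Longrightarrow> inv_into U \<phi> x \<in> U \<and> \<phi> (inv_into U \<phi> x) = x" by (simp add: inv_into_into f_inv_into_f)
 show inv: "\<And>g. g \<in> U \<Longrightarrow> inv_into U \<phi> (\<phi> g) = g" using inj by simp
 show "continuous_map (top_of_set (\<phi> ` U)) GT (inv_into U \<phi>)" unfolding continuous_map_def
 proof (intro conjI allI impI)
  show "inv_into U \<phi> \<in> topspace (top_of_set (\<phi> ` U)) \<rightarrow> topspace GT" using UG by (auto simp: inv_into_into subset_iff)
  fix V assume V: "openin GT V"
  have "openin (subtopology GT U) (U \<inter> V)" using V by (metis inf_commute openin_subtopology)
  then have "openin (top_of_set (\<phi> ` U)) (\<phi> ` (U \<inter> V))"
   using homeomorphic_imp_open_map[OF c(3)] by (simp add: open_map_def)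
  moreover have "\<phi> ` (U \<inter> V) = {x \<in> topspace (top_of_set (\<phi> ` U)). inv_into U \<phi> x \<in> V}" using inv by auto
  ultimately show "openin (top_of_set (\<phi> ` U)) {x \<in> topspace (top_of_set (\<phi> ` U)). inv_into U \<phi> x \<in> V}" by simp
 qed
 fix V :: "'e set" assume "open V"
 then have "openin (top_of_set (\<phi> ` U)) (\<phi> ` U \<inter> V)" by (rule openin_open_Int)
 from openin_continuous_map_preimage[OF homeomorphic_imp_continuous_map[OF c(3)] this]
 moreover have "{g \<in> topspace (subtopology GT U). \<phi> g \<in> \<phi> ` U \<inter> V} = {g \<in> U. \<phi> g \<in> V}" using ts by auto
 ultimately have "openin (subtopology GT U) {g \<in> U. \<phi> g \<in> V}" by simp
 then show "openin GT {g \<in> U. \<phi> g \<in> V}" using c(1) openin_trans_full by blast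
qed

lemma open_preimage_G:
 assumes "continuous_map (top_of_set S) GT f" "open S" "openin GT V"
 shows "open {x \<in> S. f x \<in> V}"
 using openin_continuous_map_preimage[OF assms(1,3)] assms(2) openin_open_eq by fastforce

lemma continuous_map_top_of_set_fst:
 "continuous_map (top_of_set A) X f \<Longrightarrow> continuous_map (top_of_set (A \<times> B)) X (\<lambda>p. f (fst p))"
 "continuous_map (top_of_set B) X f' \<Longrightarrow> continuous_map (top_of_set (A \<times> B)) X (\<lambda>p. f' (snd p))"
proof -
 have "continuous_map (top_of_set (A \<times> B)) (top_of_set A) fst"
  "continuous_map (top_of_set (A \<times> B)) (top_of_set B) snd" by (auto intro!: continuous_intros)
 then show "continuous_map (top_of_set A) X f \<Longrightarrow> continuous_map (top_of_set (A \<times> B)) X (\<lambda>p. f (fst p))"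
  "continuous_map (top_of_set B) X f' \<Longrightarrow> continuous_map (top_of_set (A \<times> B)) X (\<lambda>p. f' (snd p))"
  using continuous_map_compose unfolding comp_def by blast+
qed

abbreviation "W0 \<equiv> fst (id_chart G)"
abbreviation "\<phi>0 \<equiv> snd (id_chart G)"
text \<open>The domain on which \<open>from_coord\<close> inverts the shifted chart; elsewhere its
  values carry no information.\<close>

definition "Wc = {x. \<phi>0 \<one> + x \<in> \<phi>0 ` W0}"

lemma carrier_atlas: "g \<in> carrier G \<Longrightarrow> \<exists>U \<phi>. (U, \<phi>) \<in> lie_atlas G \<and> g \<in> U"
proof -
 assume "g \<in> carrier G"
 moreover have "\<Union> (fst ` lie_atlas G) = carrier G" using lie_group_G by (simp add: lie_group_def smooth_manifold_def)
 ultimately obtain c where "c \<in> lie_atlas G" "g \<in> fst c" by blast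
 then show ?thesis by (metis prod.collapse)
qed

lemma id_chart: "(W0, \<phi>0) \<in> lie_atlas G" "\<one> \<in> W0"
proof -
 have "\<exists>c. c \<in> lie_atlas G \<and> \<one> \<in> fst c" using carrier_atlas[OF one_closed] by force
 from someI_ex[OF this] show "(W0, \<phi>0) \<in> lie_atlas G" "\<one> \<in> W0" by (simp_all add: id_chart_def)
qed

lemma open_Wc: "open Wc" and zero_Wc: "0 \<in> Wc"
proof -
 have "Wc = (\<lambda>x. \<phi>0 \<one> + x) -` (\<phi>0 ` W0)" by (auto simp: Wc_def)
 moreover have "open ((\<lambda>x. \<phi>0 \<one> + x) -` (\<phi>0 ` W0))"
  by (intro open_vimage chart_image_open[OF id_chart(1)] continuous_intros)
 ultimately show "open Wc" by simp
 show "0 \<in> Wc" using id_chart(2) by (simp add: Wc_def)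
qed

lemma from_coord: "x \<in> Wc \<Longrightarrow> fc x \<in> W0 \<and> coord G (fc x) = x"
 using chart_inv_in[OF id_chart(1)] by (simp add: Wc_def from_coord_def coord_def)

lemma from_coord_carrier: "x \<in> Wc \<Longrightarrow> fc x \<in> carrier G" using from_coord chart_subset[OF id_chart(1)] by blast

lemma coord: "g \<in> W0 \<Longrightarrow> coord G g \<in> Wc \<and> fc (coord G g) = g"
 using chart_inv[OF id_chart(1)] by (simp add: Wc_def from_coord_def coord_def)

lemma from_coord_zero [simp]: "fc 0 = \<one>" using chart_inv[OF id_chart(1) id_chart(2)] by (simp add: from_coord_def)

lemma coord_one [simp]: "coord G \<one> = 0" by (simp add: coord_def)

lemma continuous_from_coord: "continuous_map (top_of_set Wc) GT (fc)"
proof -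
 have "continuous_map (top_of_set Wc) (top_of_set (\<phi>0 ` W0)) (\<lambda>x. \<phi>0 \<one> + x)"
  by (auto simp: Wc_def intro!: continuous_intros)
 from continuous_map_compose[OF this chart_continuous_inv[OF id_chart(1)]] show ?thesis
  by (simp add: comp_def from_coord_def[abs_def])
qed

lemma coord_preimage_open: "open V \<Longrightarrow> openin GT {g \<in> W0. coord G g \<in> V}"
proof -
 assume "open V"
 then have "open ((\<lambda>x. x - \<phi>0 \<one>) -` V)" by (intro open_vimage continuous_intros)
 from chart_preimage[OF id_chart(1) this] show ?thesis by (simp add: coord_def)
qed

lemma nbhd_from_coord:
 assumes "openin GT U" "\<one> \<in> U"
 obtains r where "r > 0" "\<And>x. norm x \<le> r \<Longrightarrow> x \<in> Wc \<and> fc x \<in> U"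
proof -
 have "open {x \<in> Wc. fc x \<in> U}" by (rule open_preimage_G[OF continuous_from_coord open_Wc assms(1)])
 moreover have "0 \<in> {x \<in> Wc. fc x \<in> U}" using assms(2) zero_Wc by simp
 ultimately obtain r where "r > 0" "cball 0 r \<subseteq> {x \<in> Wc. fc x \<in> U}" using open_contains_cball by metis
 then show ?thesis using that[of r] by (auto simp: subset_iff)
qed

lemma nbhd_pair:
 assumes f: "continuous_map (top_of_set (Wc \<times> Wc)) GT (\<lambda>p. f (fst p) (snd p))" and "f 0 0 = \<one>"
  and "openin GT U" "\<one> \<in> U"
 obtains r where "r > 0" "\<And>x y. norm x \<le> r \<Longrightarrow> norm y \<le> r \<Longrightarrow> x \<in> Wc \<and> y \<in> Wc \<and> f x y \<in> U"
proof -
 have "open {p \<in> Wc \<times> Wc. f (fst p) (snd p) \<in> U}" by (rule open_preimage_G[OF f open_Times[OF open_Wc open_Wc] assms(3)])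
 moreover have "(0, 0) \<in> {p \<in> Wc \<times> Wc. f (fst p) (snd p) \<in> U}" using assms(2,4) zero_Wc by simp
 ultimately obtain A B where AB: "open A" "open B" "(0, 0) \<in> A \<times> B" "A \<times> B \<subseteq> {p \<in> Wc \<times> Wc. f (fst p) (snd p) \<in> U}"
  by (rule open_prod_elim)
 then have z: "0 \<in> A" "0 \<in> B" by auto
 obtain r1 where r1: "r1 > 0" "cball 0 r1 \<subseteq> A" using AB(1) z(1) open_contains_cball by blast
 obtain r2 where r2: "r2 > 0" "cball 0 r2 \<subseteq> B" using AB(2) z(2) open_contains_cball by blast
 show ?thesis
 proof (rule that[of "min r1 r2"])
  show "x \<in> Wc \<and> y \<in> Wc \<and> f x y \<in> U" if "norm x \<le> min r1 r2" "norm y \<le> min r1 r2" for x y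
  proof -
   have "x \<in> A" "y \<in> B" using that r1(2) r2(2) by auto
   then have "(x, y) \<in> A \<times> B" by simp
   then show ?thesis using AB(4) by fastforce
  qed
 qed (use r1(1) r2(1) in simp)
qed

definition gm :: "'e \<Rightarrow> 'e \<Rightarrow> 'e" where
 "gm x y = coord G (fc x \<otimes> fc y)"

lemma continuous_gm_pair: "continuous_map (top_of_set (Wc \<times> Wc)) GT
  (\<lambda>p. fc (fst p) \<otimes> fc (snd p))"
 by (intro continuous_map_mult_G continuous_map_top_of_set_fst continuous_from_coord)

lemma smooth_chart_mult:
 assumes "(U, \<phi>) \<in> lie_atlas G" "(V, \<psi>) \<in> lie_atlas G" "(W, \<eta>) \<in> lie_atlas G"
 shows "open {p \<in> \<phi> ` U \<times> \<psi> ` V. inv_into U \<phi> (fst p) \<otimes> inv_into V \<psi> (snd p) \<in> W}"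
  and "smooth_on {p \<in> \<phi> ` U \<times> \<psi> ` V. inv_into U \<phi> (fst p) \<otimes> inv_into V \<psi> (snd p) \<in> W}
   (\<lambda>p. \<eta> (inv_into U \<phi> (fst p) \<otimes> inv_into V \<psi> (snd p)))"
proof -
 show "open {p \<in> \<phi> ` U \<times> \<psi> ` V. inv_into U \<phi> (fst p) \<otimes> inv_into V \<psi> (snd p) \<in> W}"
  by (rule open_preimage_G[OF _ open_Times[OF chart_image_open[OF assms(1)] chart_image_open[OF assms(2)]]
     chart_open[OF assms(3)]])
   (intro continuous_map_mult_G continuous_map_top_of_set_fst chart_continuous_inv[OF assms(1)]
    chart_continuous_inv[OF assms(2)])
 have "smooth_on {(x, y). x \<in> \<phi> ` U \<and> y \<in> \<psi> ` V \<and> inv_into U \<phi> x \<otimes> inv_into V \<psi> y \<in> W}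
     (\<lambda>(x, y). \<eta> (inv_into U \<phi> x \<otimes> inv_into V \<psi> y))"
  using lie_group_G assms unfolding lie_group_def by fast
 moreover have "{(x, y). x \<in> \<phi> ` U \<and> y \<in> \<psi> ` V \<and> inv_into U \<phi> x \<otimes> inv_into V \<psi> y \<in> W} =
   {p \<in> \<phi> ` U \<times> \<psi> ` V. inv_into U \<phi> (fst p) \<otimes> inv_into V \<psi> (snd p) \<in> W}" by auto
 ultimately show "smooth_on {p \<in> \<phi> ` U \<times> \<psi> ` V. inv_into U \<phi> (fst p) \<otimes> inv_into V \<psi> (snd p) \<in> W}
   (\<lambda>p. \<eta> (inv_into U \<phi> (fst p) \<otimes> inv_into V \<psi> (snd p)))"
  by (simp add: case_prod_unfold)
qed

lemma bounded_linear_shift_smooth: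
 "open S \<Longrightarrow> bounded_linear L \<Longrightarrow> smooth_on S (\<lambda>p. c + L p)"
 by (intro smooth_on_add smooth_on_const smooth_on_bounded_linear)

lemma gm_smooth:
 defines "D \<equiv> {p \<in> Wc \<times> Wc. fc (fst p) \<otimes> fc (snd p) \<in> W0}"
 shows "open D" "smooth_on D (\<lambda>p. gm (fst p) (snd p))"
proof -
 let ?c = "\<phi>0 \<one>"
 let ?s = "\<lambda>p :: 'e \<times> 'e. (?c + fst p, ?c + snd p)"
 let ?D = "{p \<in> \<phi>0 ` W0 \<times> \<phi>0 ` W0. inv_into W0 \<phi>0 (fst p) \<otimes> inv_into W0 \<phi>0 (snd p) \<in> W0}"
 note sm = smooth_chart_mult[OF id_chart(1) id_chart(1) id_chart(1)]
 show D: "open D" unfolding D_def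
  by (rule open_preimage_G[OF continuous_gm_pair open_Times[OF open_Wc open_Wc] chart_open[OF id_chart(1)]])
 have "smooth_on D ?s"
  by (intro smooth_on_Pair[OF D] bounded_linear_shift_smooth D bounded_linear_fst bounded_linear_snd)
 then have "smooth_on D (\<lambda>p. \<phi>0 (inv_into W0 \<phi>0 (fst (?s p)) \<otimes> inv_into W0 \<phi>0 (snd (?s p))))"
  by (intro smooth_on_compose[OF D sm(1) _ sm(2)]) (auto simp: D_def Wc_def from_coord_def)
 from smooth_on_add[OF D this smooth_on_const[of _ "- ?c"]]
 show "smooth_on D (\<lambda>p. gm (fst p) (snd p))" by (simp add: gm_def coord_def from_coord_def)
qed

lemma H_near_one_unique:
 assumes \<eta>: "\<eta> \<le> 1 / 2" "\<And>z. z \<in> (cen :: (complex^'n) endo set) \<Longrightarrow> norm (z - 1) < 4 * \<eta> \<Longrightarrow> z = 1"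
  and g: "g \<in> carrier G" "N \<in> H g" "N' \<in> H g" "norm (N - 1) < \<eta>" "norm (N' - 1) < \<eta>"
 shows "N = N'"
proof -
 obtain z where z: "z \<in> cen" "N' = z * N" using H_coset[OF g(1,2)] g(3) by blast
 have "z - 1 = (N' - 1) - (N - 1) - (z - 1) * (N - 1)" using z(2) by (simp add: algebra_simps)
 from arg_cong[OF this, of norm]
 have "norm (z - 1) \<le> norm ((N' - 1) - (N - 1)) + norm ((z - 1) * (N - 1))"
  by (rule ord_eq_le_trans[OF _ norm_triangle_ineq4])
 also have "\<dots> \<le> (norm (N' - 1) + norm (N - 1)) + norm (z - 1) * norm (N - 1)"
  by (intro add_mono norm_triangle_ineq4 norm_mult_ineq)
 finally have *: "norm (z - 1) \<le> norm (N' - 1) + norm (N - 1) + norm (z - 1) * norm (N - 1)" .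
 have "norm (z - 1) * norm (N - 1) \<le> norm (z - 1) * (1 / 2)" using g(4) \<eta>(1) by (intro mult_left_mono) auto
 then have "norm (z - 1) < 4 * \<eta>" using * g(4,5) by simp
 then show ?thesis using \<eta>(2)[OF z(1)] z(2) by simp
qed

text \<open>Close to 1 there is exactly one lift, and choosing it yields a representation
  \<open>\<rho>\<close> of the local group in coordinates, to which
  \<open>local_hom.exponential\<close> applies. \<open>\<alpha> Y\<close> is the coordinate of the
  group exponential of \<open>Y\<close>.\<close>

lemma exp_map: obtains T r C0 \<alpha> where "bounded_linear T" "inj T" "r > 0" "C0 \<ge> 0"
 "\<And>x. norm x \<le> r \<Longrightarrow> x \<in> Wc \<and> (\<exists>N\<in>H (fc x). norm (N - 1 - T x) \<le> C0 * (norm x)\<^sup>2)"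
 "\<And>Y. norm Y \<le> r \<Longrightarrow> \<alpha> Y \<in> Wc \<and> norm (\<alpha> Y - Y) \<le> C0 * (norm Y)\<^sup>2 \<and> exp (T Y) \<in> H (fc (\<alpha> Y))"
 "continuous_on (cball 0 r) \<alpha>"
proof -
 obtain \<eta> where \<eta>: "\<eta> > 0" "\<eta> \<le> 1 / 2"
  "\<And>z. z \<in> (cen :: (complex^'n) endo set) \<Longrightarrow> norm (z - 1) < 4 * \<eta> \<Longrightarrow> z = 1" by (rule cen_separated) blast
 define near where "near \<epsilon> = {g \<in> carrier G. \<exists>N\<in>H g. norm (N - 1) < \<epsilon>}" for \<epsilon>
 have near: "openin GT (near \<epsilon>)" "\<epsilon> > 0 \<Longrightarrow> \<one> \<in> near \<epsilon>" for \<epsilon>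
  unfolding near_def using H_open[of 1 \<epsilon>] H_one by (auto intro!: bexI[of _ 1])
 define \<rho> where "\<rho> x = (SOME N. N \<in> H (fc x) \<and> norm (N - 1) < \<eta>)" for x
 have \<rho>: "\<rho> x \<in> H (fc x) \<and> norm (\<rho> x - 1) < \<eta>"
  if "\<exists>N\<in>H (fc x). norm (N - 1) < \<eta>" for x unfolding \<rho>_def by (rule someI_ex) (use that in blast)
 have \<rho>_eq: "\<rho> x = N" if "fc x \<in> carrier G" "N \<in> H (fc x)" "norm (N - 1) < \<eta>" for x N
  using H_near_one_unique[OF \<eta>(2,3) that(1) _ that(2) _ that(3)] \<rho>[of x] that by blast
 \<comment> \<open>The radius \<open>\<eta> / 3\<close> ensures that the product of two chosen lifts
   is within \<open>\<eta>\<close> of 1 and is therefore the chosen lift of the product.\<close>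
 obtain r1 where r1: "r1 > 0" "\<And>x. norm x \<le> r1 \<Longrightarrow> x \<in> Wc \<and> fc x \<in> near (\<eta> / 3)"
  by (rule nbhd_from_coord[OF near(1) near(2), of "\<eta> / 3"]) (use \<eta> in auto)
 obtain r2 where r2: "r2 > 0" "\<And>x y. norm x \<le> r2 \<Longrightarrow> norm y \<le> r2 \<Longrightarrow>
   x \<in> Wc \<and> y \<in> Wc \<and> fc x \<otimes> fc y \<in> W0"
  by (rule nbhd_pair[where f = "\<lambda>x y. fc x \<otimes> fc y", OF continuous_gm_pair _
     chart_open[OF id_chart(1)] id_chart(2)]) (simp, blast)
 have z: "(0, 0) \<in> {p \<in> Wc \<times> Wc. fc (fst p) \<otimes> fc (snd p) \<in> W0}" using zero_Wc id_chart(2) by simp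
 have "\<exists>r>0. \<exists>C\<ge>0. \<forall>x y. norm x \<le> r \<longrightarrow> norm y \<le> r \<longrightarrow>
    norm (gm x y - gm x 0 - gm 0 y + gm 0 0) \<le> C * norm x * norm y"
 proof (rule smooth_on_mixed_difference[OF gm_smooth(2) gm_smooth(1) z])
  fix r C :: real assume "r > 0" "C \<ge> 0" and "\<And>x y. norm x \<le> r \<Longrightarrow> norm y \<le> r \<Longrightarrow>
    norm (gm (fst (x, y)) (snd (x, y)) - gm (fst (x, 0)) (snd (x, 0)) - gm (fst (0, y)) (snd (0, y))
     + gm (fst (0, 0)) (snd (0, 0))) \<le> C * norm x * norm y"
  then show ?thesis unfolding fst_conv snd_conv by blast
 qed
 then obtain r3 C where r3: "r3 > 0" "C \<ge> 0" "\<And>x y. norm x \<le> r3 \<Longrightarrow> norm y \<le> r3 \<Longrightarrow>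
    norm (gm x y - gm x 0 - gm 0 y + gm 0 0) \<le> C * norm x * norm y" by blast
 define R where "R = Min {r1, r2, r3}"
 have R: "R > 0" "R \<le> r1" "R \<le> r2" "R \<le> r3" using r1(1) r2(1) r3(1) by (auto simp: R_def)
 have inW: "x \<in> Wc" "fc x \<in> carrier G" if "norm x \<le> R" for x using r1(2)[of x] that R from_coord_carrier by auto
 have third: "\<rho> x \<in> H (fc x) \<and> norm (\<rho> x - 1) < \<eta> / 3" if x: "norm x \<le> R" for x
 proof -
  obtain N where N: "N \<in> H (fc x)" "norm (N - 1) < \<eta> / 3" using r1(2)[of x] x R by (auto simp: near_def)
  then have "\<rho> x = N" using inW[OF x] \<eta>(1) by (intro \<rho>_eq) auto
  then show ?thesis using N by simp
 qed
 have prod: "fc (gm x y) = fc x \<otimes> fc y"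
  if "norm x \<le> R" "norm y \<le> R" for x y using coord r2(2)[of x y] that R by (simp add: gm_def)
 have "local_hom gm \<rho> R C"
 proof
  show "R > 0" "C \<ge> 0" by fact+
  fix x y :: 'e assume xy: "norm x \<le> R" "norm y \<le> R"
  have "gm x 0 = x" "gm 0 y = y" "gm 0 0 = 0" using inW[OF xy(1)] inW[OF xy(2)] from_coord by (simp_all add: gm_def)
  then show "norm (gm x y - x - y) \<le> C * norm x * norm y" using r3(3)[of x y] xy R by simp
  note x = third[OF xy(1)] and y = third[OF xy(2)]
  have "\<rho> x * \<rho> y - 1 = (\<rho> x - 1) * (\<rho> y - 1) + (\<rho> x - 1) + (\<rho> y - 1)" by (simp add: algebra_simps)
  then have "norm (\<rho> x * \<rho> y - 1) \<le> norm (\<rho> x - 1) * norm (\<rho> y - 1) + norm (\<rho> x - 1) + norm (\<rho> y - 1)"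
   by (simp only:) (intro norm_triangle_mono norm_mult_ineq order_refl)
  moreover have "norm (\<rho> x - 1) * norm (\<rho> y - 1) \<le> 1 * norm (\<rho> y - 1)" using x \<eta> by (intro mult_right_mono) auto
  ultimately have "norm (\<rho> x * \<rho> y - 1) < \<eta>" using x y by simp
  then show "\<rho> (gm x y) = \<rho> x * \<rho> y" using H_mult[OF inW(2)[OF xy(1)] inW(2)[OF xy(2)]] x y inW(2) xy prod[OF xy]
   by (intro \<rho>_eq) auto
 next
  show "continuous_on (cball 0 R) \<rho>" unfolding continuous_on_iff
  proof (intro ballI allI impI)
   fix x e assume x: "x \<in> cball (0::'e) R" and "(0::real) < e"
   define e' where "e' = min e (\<eta> / 2)"
   have e': "e' > 0" "e' \<le> e" "e' \<le> \<eta> / 2" using \<open>0 < e\<close> \<eta> by (auto simp: e'_def)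
   have xR: "norm x \<le> R" using x by simp
   have "open {y \<in> Wc. fc y \<in> {g \<in> carrier G. \<exists>N\<in>H g. norm (N - \<rho> x) < e'}}"
    by (rule open_preimage_G[OF continuous_from_coord open_Wc H_open])
   moreover have "x \<in> {y \<in> Wc. fc y \<in> {g \<in> carrier G. \<exists>N\<in>H g. norm (N - \<rho> x) < e'}}"
    using inW[OF xR] third[OF xR] e' by (auto intro: bexI[of _ "\<rho> x"])
   ultimately obtain d where d: "d > 0" "ball x d \<subseteq> {y \<in> Wc. fc y \<in> {g \<in> carrier G. \<exists>N\<in>H g. norm (N - \<rho> x) < e'}}"
    using open_contains_ball by blast
   show "\<exists>d>0. \<forall>y\<in>cball 0 R. dist y x < d \<longrightarrow> dist (\<rho> y) (\<rho> x) < e"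
   proof (intro exI[of _ d] conjI ballI impI d(1))
    fix y assume y: "y \<in> cball (0::'e) R" "dist y x < d"
    then obtain N where N: "N \<in> H (fc y)" "norm (N - \<rho> x) < e'" using d(2) by (auto simp: dist_commute)
    have "norm (N - 1) \<le> norm (N - \<rho> x) + norm (\<rho> x - 1)" using norm_triangle_ineq[of "N - \<rho> x" "\<rho> x - 1"] by simp
    then have "norm (N - 1) < \<eta>" using N(2) e' third[OF xR] \<eta>(1) by linarith
    then have "\<rho> y = N" using \<rho>_eq N(1) inW(2)[of y] y(1) by simp
    then show "dist (\<rho> y) (\<rho> x) < e" using N(2) e' by (simp add: dist_norm)
   qed
  qed
  show "inj_on \<rho> (cball 0 R)"
  proof (rule inj_onI)
   fix x y assume "x \<in> cball (0::'e) R" "y \<in> cball (0::'e) R" and eq: "\<rho> x = \<rho> y"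
   then have xy: "norm x \<le> R" "norm y \<le> R" by auto
   have "fc x = fc y" using H_inj[OF inW(2)[OF xy(1)] inW(2)[OF xy(2)]] third[OF xy(1)] third[OF xy(2)] eq by metis
   then show "x = y" using from_coord[OF inW(1)[OF xy(1)]] from_coord[OF inW(1)[OF xy(2)]] by metis
  qed
  show "\<rho> 0 = 1" using H_one \<eta>(1) by (intro \<rho>_eq) auto
  let ?V = "{g \<in> W0. coord G g \<in> ball 0 R}"
  have c: "continuous_map (top_of_set (Wc \<times> Wc)) GT
    (\<lambda>p. inv (fc (fst p)) \<otimes> fc (snd p))"
   by (intro continuous_map_mult_G continuous_map_inv_G continuous_map_top_of_set_fst continuous_from_coord)
  have V: "\<one> \<in> ?V" using id_chart(2) R(1) by simp
  obtain R1 where R1: "R1 > 0" "\<And>x y. norm x \<le> R1 \<Longrightarrow> norm y \<le> R1 \<Longrightarrow>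
    x \<in> Wc \<and> y \<in> Wc \<and> inv (fc x) \<otimes> fc y \<in> ?V"
   by (rule nbhd_pair[where f = "\<lambda>x y. inv (fc x) \<otimes> fc y", OF c _
      coord_preimage_open[OF open_ball] V]) (simp, blast)
  show "\<exists>R1>0. \<forall>a b. norm a \<le> R1 \<longrightarrow> norm b \<le> R1 \<longrightarrow> (\<exists>e. norm e \<le> R \<and> gm a e = b)"
  proof (intro exI[of _ R1] conjI allI impI R1(1))
   fix a b :: 'e assume ab: "norm a \<le> R1" "norm b \<le> R1"
   let ?h = "inv (fc a) \<otimes> fc b"
   have h: "a \<in> Wc" "b \<in> Wc" "?h \<in> W0" "norm (coord G ?h) < R" using R1(2)[OF ab] by auto
   then have "gm a (coord G ?h) = coord G (fc a \<otimes> ?h)" using coord by (simp add: gm_def)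
   also have "fc a \<otimes> ?h = fc b" using from_coord_carrier h(1,2) by (simp add: m_assoc[symmetric])
   finally show "\<exists>e. norm e \<le> R \<and> gm a e = b" using h from_coord by (intro exI[of _ "coord G ?h"]) auto
  qed
 qed
 then interpret lh: local_hom gm \<rho> R C .
 obtain T r C0 where T: "bounded_linear T" "inj T" "r > 0" "C0 \<ge> 0"
  and d: "\<And>x. norm x \<le> r \<Longrightarrow> norm (\<rho> x - 1 - T x) \<le> C0 * (norm x)\<^sup>2"
  and e: "\<And>Y. norm Y \<le> r \<Longrightarrow> \<exists>a. norm a \<le> R \<and> norm (a - Y) \<le> C0 * (norm Y)\<^sup>2 \<and> \<rho> a = exp (T Y)"
  by (rule lh.exponential) blast
 define r' where "r' = min r R"
 obtain \<alpha> where \<alpha>: "\<And>Y. norm Y \<le> r \<Longrightarrow> norm (\<alpha> Y) \<le> R \<and> norm (\<alpha> Y - Y) \<le> C0 * (norm Y)\<^sup>2 \<and> \<rho> (\<alpha> Y) = exp (T Y)"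
  using e by metis
 \<comment> \<open>\<open>\<alpha>\<close> is the inverse of \<open>\<rho>\<close>, a continuous
   injection of a compact ball, applied to \<open>exp (T Y)\<close>.\<close>
 have "continuous_on (cball 0 r') \<alpha>"
 proof -
  have "continuous_on (\<rho> ` cball 0 R) (the_inv_into (cball 0 R) \<rho>)"
   by (rule continuous_on_inv_into[OF lh.cont compact_cball lh.inj])
  moreover have "continuous_on (cball 0 r') (\<lambda>Y. exp (T Y))" by (intro continuous_intros linear_continuous_on T)
  ultimately have "continuous_on (cball 0 r') (\<lambda>Y. the_inv_into (cball 0 R) \<rho> (exp (T Y)))"
   by (rule continuous_on_compose2) (use \<alpha> in \<open>force simp: r'_def\<close>)
  moreover have "the_inv_into (cball 0 R) \<rho> (exp (T Y)) = \<alpha> Y" if "Y \<in> cball 0 r'" for Y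
  proof -
   have "norm (\<alpha> Y) \<le> R" "\<rho> (\<alpha> Y) = exp (T Y)" using \<alpha>[of Y] that by (auto simp: r'_def)
   then show ?thesis using the_inv_into_f_f[OF lh.inj, of "\<alpha> Y"] by simp
  qed
  ultimately show ?thesis by (rule continuous_on_eq)
 qed
 moreover have "x \<in> Wc \<and> (\<exists>N\<in>H (fc x). norm (N - 1 - T x) \<le> C0 * (norm x)\<^sup>2)" if "norm x \<le> r'" for x
  using that d[of x] third[of x] inW[of x] by (auto simp: r'_def)
 moreover have "\<alpha> Y \<in> Wc \<and> norm (\<alpha> Y - Y) \<le> C0 * (norm Y)\<^sup>2 \<and> exp (T Y) \<in> H (fc (\<alpha> Y))"
  if "norm Y \<le> r'" for Y using \<alpha>[of Y] that third[of "\<alpha> Y"] inW[of "\<alpha> Y"] by (auto simp: r'_def)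
 moreover have "r' > 0" using T R by (simp add: r'_def)
 ultimately show ?thesis using that[of T r' C0 \<alpha>] T by blast
qed

end

section \<open>Derivatives seen through injective linear maps\<close>

lemma injective_linear_bounded_below:
 fixes T :: "'a::euclidean_space \<Rightarrow> 'b::real_normed_vector"
 assumes T: "bounded_linear T" and inj: "inj T"
 obtains c where "c > 0" "\<And>x. norm x \<le> c * norm (T x)"
proof -
 have ne: "sphere (0::'a) 1 \<noteq> {}" by (rule unit_sphere_nonempty)
 have "continuous_on (sphere 0 1) (\<lambda>x. norm (T x))" by (intro continuous_intros linear_continuous_on T)
 then obtain u where u: "norm u = 1" "\<And>x. norm x = 1 \<Longrightarrow> norm (T u) \<le> norm (T x)"
  using continuous_attains_inf[OF compact_sphere ne, of "\<lambda>x. norm (T x)"] by auto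
 have "T u \<noteq> 0"
 proof
  assume "T u = 0"
  then have "T u = T 0" by (simp add: linear_simps[OF T])
  then have "u = 0" using inj by (rule injD[rotated])
  then show False using u(1) by simp
 qed
 then have pos: "norm (T u) > 0" by simp
 have "norm x \<le> (1 / norm (T u)) * norm (T x)" for x
 proof (cases "x = 0")
  case False
  have "norm (T u) \<le> norm (T (x /\<^sub>R norm x))" using False by (intro u(2)) simp
  also have "\<dots> = norm (T x) / norm x" by (simp add: linear_simps[OF T] divide_inverse mult.commute)
  finally show ?thesis using pos False by (simp add: field_simps)
 qed simp
 then show ?thesis using that[of "1 / norm (T u)"] pos by simp
qed

lemma closed_range_injective_linear:
 fixes T :: "'a::euclidean_space \<Rightarrow> 'b::real_normed_vector"
 assumes T: "bounded_linear T" and inj: "inj T"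
 shows "closed (range T)" unfolding closed_sequential_limits
proof (intro allI impI, elim conjE)
 fix s l assume s: "\<forall>n. s n \<in> range T" and l: "s \<longlonglongrightarrow> l"
 obtain c where c: "c > 0" "\<And>x. norm x \<le> c * norm (T x)" by (rule injective_linear_bounded_below[OF T inj]) blast
 have "\<forall>n. \<exists>x. s n = T x" using s by blast
 then obtain x where x: "\<And>n. s n = T (x n)" by (elim choice[THEN exE]) blast
 have "Cauchy x"
 proof (rule metric_CauchyI)
  fix e :: real assume "e > 0"
  then have "e / c > 0" using c by simp
  then obtain M where M: "\<And>m n. m \<ge> M \<Longrightarrow> n \<ge> M \<Longrightarrow> dist (s m) (s n) < e / c"
   using LIMSEQ_imp_Cauchy[OF l] metric_CauchyD by blast
  have "dist (x m) (x n) < e" if "m \<ge> M" "n \<ge> M" for m n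
  proof -
   have "dist (x m) (x n) \<le> c * dist (s m) (s n)"
    using c(2)[of "x m - x n"] by (simp add: dist_norm x linear_simps[OF T])
   also have "\<dots> < e" using M[OF that] c(1) by (simp add: field_simps)
   finally show ?thesis .
  qed
  then show "\<exists>M. \<forall>m\<ge>M. \<forall>n\<ge>M. dist (x m) (x n) < e" by blast
 qed
 then obtain a where "x \<longlonglongrightarrow> a" using Cauchy_convergent_iff convergent_def by blast
 then have "s \<longlonglongrightarrow> T a" unfolding x[abs_def] using bounded_linear.tendsto[OF T] by blast
 then show "l \<in> range T" using l LIMSEQ_unique by blast
qed

text \<open>Difference quotients of \<open>T (h x)\<close> lie in the range of \<open>T\<close>,
  which is closed, so the derivative \<open>D\<close> takes values there and can be pulled back by a
  linear left inverse; the lower bound on \<open>T\<close> transfers the remainder estimate.\<close>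

lemma has_derivative_through_injection:
 fixes T :: "'e::euclidean_space \<Rightarrow> 'b::real_normed_vector" and h :: "'a::euclidean_space \<Rightarrow> 'e"
 assumes T: "bounded_linear T" and inj: "inj T"
  and D: "((\<lambda>x. T (h x)) has_derivative D) (at a)"
 obtains h' where "(h has_derivative h') (at a)" "\<And>v. T (h' v) = D v"
proof -
 obtain c where c: "c > 0" "\<And>x. norm x \<le> c * norm (T x)" by (rule injective_linear_bounded_below[OF T inj]) blast
 obtain P where P: "linear P" "P \<circ> T = id"
  using linear_injective_left_inverse[OF bounded_linear.linear[OF T] inj] by blast
 have linD: "linear D" using D by (rule has_derivative_linear)
 have range: "D v \<in> range T" for v
 proof -
  have 0: "((\<lambda>t. a + t *\<^sub>R v) has_derivative (\<lambda>t. t *\<^sub>R v)) (at (0::real))" by (auto intro!: derivative_eq_intros)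
  define F where "F t = T (h (a + t *\<^sub>R v))" for t
  have "(F has_derivative (\<lambda>t. t *\<^sub>R D v)) (at 0)" using has_derivative_compose[OF 0, of "\<lambda>x. T (h x)" D] D
   by (simp add: linear_cmul[OF linD] F_def[abs_def])
  then have "((\<lambda>t. norm (F t - F 0 - t *\<^sub>R D v) / \<bar>t\<bar>) \<longlongrightarrow> 0) (at 0)" by (simp add: has_derivative_iff_norm)
  moreover have "\<forall>\<^sub>F t in at (0::real). norm (F t - F 0 - t *\<^sub>R D v) / \<bar>t\<bar> = norm ((F t - F 0) /\<^sub>R t - D v)"
   unfolding eventually_at_filter
  proof (intro always_eventually allI impI)
   fix t :: real assume "t \<noteq> 0"
   then have "(F t - F 0) /\<^sub>R t - D v = (F t - F 0 - t *\<^sub>R D v) /\<^sub>R t" by (simp add: scaleR_right_diff_distrib)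
   then show "norm (F t - F 0 - t *\<^sub>R D v) / \<bar>t\<bar> = norm ((F t - F 0) /\<^sub>R t - D v)"
    by (simp only: norm_scaleR abs_inverse) (simp add: divide_inverse)
  qed
  ultimately have "((\<lambda>t. norm ((F t - F 0) /\<^sub>R t - D v)) \<longlongrightarrow> 0) (at 0)" by (rule Lim_transform_eventually)
  then have "((\<lambda>t. (F t - F 0) /\<^sub>R t - D v) \<longlongrightarrow> 0) (at 0)" by (simp only: tendsto_norm_zero_iff)
  then have lim: "((\<lambda>t. (F t - F 0) /\<^sub>R t) \<longlongrightarrow> D v) (at 0)" by (rule LIM_zero_cancel)
  have "(F t - F 0) /\<^sub>R t = T ((h (a + t *\<^sub>R v) - h a) /\<^sub>R t)" for t by (simp add: F_def linear_simps[OF T])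
  then have "\<forall>\<^sub>F t in at 0. (F t - F 0) /\<^sub>R t \<in> range T" by simp
  from Lim_in_closed_set[OF closed_range_injective_linear[OF T inj] this _ lim]
  show ?thesis by simp
 qed
 let ?h' = "\<lambda>v. P (D v)"
 have TP: "T (?h' v) = D v" for v
 proof -
  obtain x where "D v = T x" using range by blast
  then show ?thesis using P(2) by (metis comp_apply id_apply)
 qed
 have "(h has_derivative ?h') (at a)" unfolding has_derivative_iff_norm
 proof
  show "bounded_linear ?h'" using linear_compose[OF linD P(1)] by (simp add: linear_conv_bounded_linear comp_def)
  have lim: "((\<lambda>x. c * (norm (T (h x) - T (h a) - D (x - a)) / norm (x - a))) \<longlongrightarrow> c * 0) (at a)"
   using D unfolding has_derivative_iff_norm by (intro tendsto_intros) simp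
  show "((\<lambda>x. norm (h x - h a - ?h' (x - a)) / norm (x - a)) \<longlongrightarrow> 0) (at a)"
  proof (rule Lim_null_comparison)
   show "((\<lambda>x. c * (norm (T (h x) - T (h a) - D (x - a)) / norm (x - a))) \<longlongrightarrow> 0) (at a)" using lim by simp
   have "norm (h x - h a - ?h' (x - a)) \<le> c * norm (T (h x) - T (h a) - D (x - a))" for x
    using c(2)[of "h x - h a - ?h' (x - a)"] by (simp add: linear_simps[OF T] TP)
   then show "\<forall>\<^sub>F x in at a. norm (norm (h x - h a - ?h' (x - a)) / norm (x - a))
     \<le> c * (norm (T (h x) - T (h a) - D (x - a)) / norm (x - a))"
    by (intro always_eventually allI) (simp add: divide_right_mono)
  qed
 qed
 then show ?thesis using that TP by blast
qed

text \<open>From \<open>M' = M - M' ((N' - N) M)\<close> the last term is absorbed into half of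
  \<open>norm M'\<close>.\<close>

lemma norm_inverse_perturbed_le:
 fixes M :: "'a::real_normed_algebra_1"
 assumes "M' * N' = 1" "N * M = 1" and le: "norm (N' - N) * norm M \<le> 1 / 2"
 shows "norm M' \<le> 2 * norm M"
proof -
 have "M' * ((N' - N) * M) = (M' * N') * M - M' * (N * M)" by (simp add: algebra_simps)
 then have "M' * ((N' - N) * M) = M - M'" unfolding assms(1,2) by simp
 then have "norm M' = norm (M - M' * ((N' - N) * M))" by simp
 also have "\<dots> \<le> norm M + norm (M' * ((N' - N) * M))" by (rule norm_triangle_ineq4)
 finally have "norm M' \<le> norm M + norm (M' * ((N' - N) * M))" .
 moreover have "norm (M' * ((N' - N) * M)) \<le> norm M' * norm ((N' - N) * M)" by (rule norm_mult_ineq)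
 moreover have "norm M' * norm ((N' - N) * M) \<le> norm M' * (norm (N' - N) * norm M)"
  by (rule mult_left_mono[OF norm_mult_ineq norm_ge_zero])
 moreover have "norm M' * (norm (N' - N) * norm M) \<le> norm M' * (1 / 2)" by (rule mult_left_mono[OF le norm_ge_zero])
 ultimately show ?thesis by linarith
qed

text \<open>The error is measured by the increment of another differentiable map \<open>w\<close>,
  not by \<open>x - a\<close>. This suits logarithms and inverses, whose remainders are naturally
  quadratic in the operator rather than in the parameter.\<close>

lemma has_derivative_quadratic_error:
 fixes w :: "'a::real_normed_vector \<Rightarrow> 'b::real_normed_vector" and f :: "'a \<Rightarrow> 'c::real_normed_vector"
 assumes u: "(u has_derivative D) (at a)" and w: "(w has_derivative D') (at a)"
  and R: "\<forall>\<^sub>F x in nhds a. norm (f x - u x) \<le> C * (norm (w x - w a))\<^sup>2"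
 shows "(f has_derivative D) (at a)"
proof -
 obtain B where B: "\<And>v. norm (D' v) \<le> norm v * B"
  using bounded_linear.bounded[OF has_derivative_bounded_linear[OF w]] by blast
 let ?e = "\<lambda>x. norm (w x - w a - D' (x - a)) / norm (x - a)" and ?n = "\<lambda>x. norm (w x - w a)"
 have e: "(?e \<longlongrightarrow> 0) (at a)" using w by (simp add: has_derivative_iff_norm)
 have "(w \<longlongrightarrow> w a) (at a)" using has_derivative_continuous[OF w] by (simp add: continuous_at)
 then have "((\<lambda>x. \<bar>C\<bar> * ((?e x + B) * ?n x)) \<longlongrightarrow> \<bar>C\<bar> * ((0 + B) * norm (w a - w a))) (at a)" by (intro tendsto_intros e)
 then have L: "((\<lambda>x. \<bar>C\<bar> * ((?e x + B) * ?n x)) \<longlongrightarrow> 0) (at a)" by simp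
 have "((\<lambda>x. norm (f x - u x) / norm (x - a)) \<longlongrightarrow> 0) (at a)"
 proof (rule Lim_null_comparison[OF _ L])
  have "\<forall>\<^sub>F x in at a. norm (f x - u x) \<le> C * (?n x)\<^sup>2 \<and> x \<noteq> a"
   using R unfolding eventually_at_filter by (rule eventually_mono) simp
  then show "\<forall>\<^sub>F x in at a. norm (norm (f x - u x) / norm (x - a)) \<le> \<bar>C\<bar> * ((?e x + B) * ?n x)"
  proof eventually_elim
   case (elim x)
   then have x: "norm (x - a) > 0" by simp
   have "?n x \<le> norm (w x - w a - D' (x - a)) + norm (x - a) * B"
    using norm_triangle_ineq[of "w x - w a - D' (x - a)" "D' (x - a)"] B[of "x - a"] by simp
   from divide_right_mono[OF this, of "norm (x - a)"] have q: "?n x / norm (x - a) \<le> ?e x + B"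
    using x by (simp add: add_divide_distrib)
   have "C * (?n x)\<^sup>2 \<le> \<bar>C\<bar> * (?n x)\<^sup>2" by (rule mult_right_mono) auto
   then have "norm (f x - u x) \<le> \<bar>C\<bar> * (?n x)\<^sup>2" using elim by linarith
   from divide_right_mono[OF this, of "norm (x - a)"]
   have "norm (f x - u x) / norm (x - a) \<le> \<bar>C\<bar> * (?n x / norm (x - a) * ?n x)" by (simp add: power2_eq_square)
   also have "\<dots> \<le> \<bar>C\<bar> * ((?e x + B) * ?n x)" by (intro mult_left_mono mult_right_mono q) auto
   finally show ?case by simp
  qed
 qed
 moreover have "f a = u a" using eventually_nhds_x_imp_x[OF R] by simp
 ultimately have "((\<lambda>x. f x - u x) has_derivative (\<lambda>_. 0)) (at a)" by (simp add: has_derivative_iff_norm)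
 from has_derivative_add[OF u this] show ?thesis by simp
qed

lemma has_derivative_at_zero_quadratic:
 fixes f :: "'a::real_normed_vector \<Rightarrow> 'b::real_normed_vector"
 assumes "bounded_linear D" "r > 0" "\<And>x. norm x \<le> r \<Longrightarrow> norm (f x - f 0 - D x) \<le> C * (norm x)\<^sup>2"
 shows "(f has_derivative D) (at 0)"
proof (rule has_derivative_quadratic_error[where C = C, OF _ has_derivative_ident])
 show "((\<lambda>x. f 0 + D x) has_derivative D) (at 0)"
  using has_derivative_add[OF has_derivative_const bounded_linear_imp_has_derivative[OF assms(1)]] by simp
 show "\<forall>\<^sub>F x in nhds 0. norm (f x - (f 0 + D x)) \<le> C * (norm (x - 0))\<^sup>2"
  unfolding eventually_nhds_metric using assms(2,3) by (intro exI[of _ r]) (simp add: algebra_simps)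
qed

text \<open>A permutation other than the identity moves at least two points, so one of them survives
  the removal of \<open>i\<close>.\<close>

lemma prod_delta_permutation:
 fixes p :: "'n::finite \<Rightarrow> 'n"
 assumes "p permutes UNIV" "p \<noteq> id"
 shows "(\<Prod>j\<in>UNIV - {i}. if j = p j then 1 else (0::complex)) = 0"
proof -
 obtain j where j: "p j \<noteq> j" using assms(2) by (metis eq_id_iff)
 have "\<exists>k. k \<noteq> i \<and> p k \<noteq> k"
 proof (cases "j = i")
  case True
  have "p (p j) \<noteq> p j" using j permutes_inj[OF assms(1)] by (auto dest: injD)
  then show ?thesis using j True by metis
 qed (use j in blast)
 then show ?thesis by (force intro: prod_zero)
qed

text \<open>In the derivative of the Leibniz expansion at the identity matrix only the identity
  permutation contributes, and it contributes the trace.\<close>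

lemma trace_zero_of_det_one:
 fixes \<gamma> :: "real \<Rightarrow> 'n::finite cmat"
 assumes \<gamma>: "(\<gamma> has_vector_derivative M) (at 0)" "\<gamma> 0 = mat 1" and det: "\<forall>\<^sub>F t in nhds 0. det (\<gamma> t) = 1"
 shows "trace M = 0"
proof -
 have ent: "((\<lambda>t. \<gamma> t $ i $ j) has_derivative (\<lambda>t. t *\<^sub>R M $ i $ j)) (at 0)" for i j
 proof -
  have bl: "bounded_linear (\<lambda>A :: 'n cmat. A $ i $ j)"
   using bounded_linear_compose[OF bounded_linear_vec_nth bounded_linear_vec_nth] .
  show ?thesis using bounded_linear.has_derivative[OF bl \<gamma>(1)[unfolded has_vector_derivative_def]] by simp
 qed
 have g0: "\<gamma> 0 $ i $ j = (if i = j then 1 else 0)" for i j by (simp add: \<gamma>(2) mat_def)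
 have "((\<lambda>t. det (\<gamma> t)) has_derivative (\<lambda>t. \<Sum>p | p permutes UNIV. of_int (sign p) *
   (\<Sum>i\<in>UNIV. t *\<^sub>R M $ i $ p i * (\<Prod>j\<in>UNIV - {i}. \<gamma> 0 $ j $ p j)))) (at 0)"
  unfolding det_def by (intro has_derivative_sum has_derivative_mult_right has_derivative_prod ent)
 moreover have "((\<lambda>t. det (\<gamma> t)) has_derivative (\<lambda>t. 0)) (at 0)"
 proof (rule has_derivative_transform_eventually)
  show "((\<lambda>t. 1) has_derivative (\<lambda>t. 0)) (at (0::real) within UNIV)" by simp
  show "\<forall>\<^sub>F t in at 0. 1 = det (\<gamma> t)" using det by (auto simp: eventually_at_filter elim: eventually_mono)
 qed (simp_all add: \<gamma>(2))
 ultimately have "(\<lambda>t. \<Sum>p | p permutes UNIV. of_int (sign p) *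
   (\<Sum>i\<in>UNIV. t *\<^sub>R M $ i $ p i * (\<Prod>j\<in>UNIV - {i}. \<gamma> 0 $ j $ p j))) = (\<lambda>t. 0)"
  by (rule has_derivative_unique)
 from fun_cong[OF this, of 1]
 have "(\<Sum>p | p permutes UNIV. of_int (sign p) *
   (\<Sum>i\<in>UNIV. M $ i $ p i * (\<Prod>j\<in>UNIV - {i}. if j = p j then 1 else 0))) = 0"
  by (simp add: g0)
 moreover have "(\<Sum>p | p permutes UNIV. of_int (sign p) *
   (\<Sum>i\<in>UNIV. M $ i $ p i * (\<Prod>j\<in>UNIV - {i}. if j = p j then 1 else 0))) =
  (\<Sum>p | p permutes (UNIV :: 'n set). if p = id then trace M else 0)"
 proof (rule sum.cong[OF refl])
  fix p :: "'n \<Rightarrow> 'n" assume "p \<in> {p. p permutes UNIV}"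
  then show "of_int (sign p) * (\<Sum>i\<in>UNIV. M $ i $ p i * (\<Prod>j\<in>UNIV - {i}. if j = p j then 1 else 0)) =
    (if p = id then trace M else 0)"
   by (cases "p = id") (simp_all add: prod_delta_permutation trace_def sign_id)
 qed
 moreover have "finite {p. p permutes (UNIV :: 'n set)}" by (rule finite_permutations) simp
  then have "(\<Sum>p | p permutes (UNIV :: 'n set). if p = id then trace M else 0) = trace M"
  by (subst sum.delta) (simp_all add: permutes_id)
 ultimately show ?thesis by simp
qed

section \<open>The exponential map of the group\<close>

locale satake_exp = satake_data G K \<theta> \<aa> \<tau>
 for G :: "('g, 'e::euclidean_space) lie_struct" (structure) and K :: "'g set" and \<theta> :: "'g \<Rightarrow> 'g"
  and \<aa> :: "'e set" and \<tau> :: "'g \<Rightarrow> 'n::finite cmat set" +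
 fixes T :: "'e \<Rightarrow> (complex^'n) endo" and r0 C0 :: real and \<alpha> :: "'e \<Rightarrow> 'e"
 assumes T_bl: "bounded_linear T" and T_inj: "inj T" and r0: "r0 > 0" and C0: "C0 \<ge> 0"
  and local: "\<And>x. norm x \<le> r0 \<Longrightarrow>
   x \<in> Wc \<and> (\<exists>N\<in>H (fc x). norm (N - 1 - T x) \<le> C0 * (norm x)\<^sup>2)"
  and local_exp: "\<And>Y. norm Y \<le> r0 \<Longrightarrow>
   \<alpha> Y \<in> Wc \<and> norm (\<alpha> Y - Y) \<le> C0 * (norm Y)\<^sup>2 \<and> exp (T Y) \<in> H (fc (\<alpha> Y))"
  and \<alpha>_cont: "continuous_on (cball 0 r0) \<alpha>"
begin

lemmas T_simps = linear_simps[OF T_bl]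

lemma T_eq_iff: "T X = T Y \<longleftrightarrow> X = Y" using T_inj by (auto dest: injD)

lemma T_lower: obtains c where "c > 0" "\<And>x. norm x \<le> c * norm (T x)"
 using injective_linear_bounded_below[OF T_bl T_inj] by blast

lemma H_power: "g \<in> carrier G \<Longrightarrow> N \<in> H g \<Longrightarrow> N ^ n \<in> H (g [^] n)"
proof (induction n)
 case (Suc n)
 then show ?case using H_mult[of "g [^] n" g "N ^ n" N] by (simp add: power_commutes)
qed (simp add: H_one)

lemma exp_T_scaled: "n > 0 \<Longrightarrow> exp (T (Y /\<^sub>R real n)) ^ n = exp (T Y)"
proof -
 assume n: "n > 0"
 have "real n *\<^sub>R T (Y /\<^sub>R real n) = T Y" using n by (simp add: T_simps)
 moreover have "of_nat n * T (Y /\<^sub>R real n) = real n *\<^sub>R T (Y /\<^sub>R real n)"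
  by (metis of_real_of_nat_eq scaleR_conv_of_real)
 ultimately show ?thesis by (metis exp_of_nat_mult_algebra)
qed

text \<open>For large \<open>n\<close> the vector \<open>Y / n\<close> is in the ball of the local
  statement, and the \<open>n\<close>-th power of its exponential is that of \<open>Y\<close>. The
  same device makes \<open>expG\<close> continuous everywhere.\<close>

lemma exp_in_H: "\<exists>g\<in>carrier G. exp (T Y) \<in> H g"
proof -
 obtain n where n: "n > 0" "norm Y < real n * r0"
  using ex_less_of_nat_mult[OF r0] by (metis gr0I mult_zero_left norm_not_less_zero of_nat_0)
 then have "norm (Y /\<^sub>R real n) \<le> r0" by (simp add: field_simps)
 from local_exp[OF this] from_coord_carrier H_power exp_T_scaled[OF n(1), of Y]
 show ?thesis by (metis nat_pow_closed)
qed

text \<open>The group exponential, selected by its image under \<open>\<tau>\<close>; faithfulness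
  makes the choice unique.\<close>

definition expG :: "'e \<Rightarrow> 'g" where
 "expG Y = (SOME g. g \<in> carrier G \<and> exp (T Y) \<in> H g)"

lemma expG_carrier [simp]: "expG Y \<in> carrier G" and exp_H_expG: "exp (T Y) \<in> H (expG Y)"
proof -
 have "\<exists>g. g \<in> carrier G \<and> exp (T Y) \<in> H g" using exp_in_H by blast
 from someI_ex[OF this] show "expG Y \<in> carrier G" "exp (T Y) \<in> H (expG Y)" by (simp_all add: expG_def)
qed

lemma expG_eqI: "g \<in> carrier G \<Longrightarrow> exp (T Y) \<in> H g \<Longrightarrow> expG Y = g" using H_inj[OF expG_carrier _ exp_H_expG] by blast

lemma expG_zero [simp]: "expG 0 = \<one>" by (rule expG_eqI) (simp_all add: T_simps H_one)

lemma expG_local: "norm Y \<le> r0 \<Longrightarrow> expG Y = fc (\<alpha> Y)" using local_exp from_coord_carrier by (intro expG_eqI) auto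

lemma expG_add: "expG ((s + t) *\<^sub>R Y) = expG (s *\<^sub>R Y) \<otimes> expG (t *\<^sub>R Y)"
proof (rule expG_eqI)
 have "exp (T ((s + t) *\<^sub>R Y)) = exp (T (s *\<^sub>R Y)) * exp (T (t *\<^sub>R Y))"
  unfolding scaleR_left_distrib T_simps by (rule exp_add_commuting) simp
 then show "exp (T ((s + t) *\<^sub>R Y)) \<in> H (expG (s *\<^sub>R Y) \<otimes> expG (t *\<^sub>R Y))"
  using H_mult[OF _ _ exp_H_expG exp_H_expG] by simp
qed simp

lemma continuous_expG_ball: "continuous_map (top_of_set (cball 0 r0)) GT expG"
proof -
 have "continuous_map (top_of_set (cball 0 r0)) (top_of_set Wc) \<alpha>"
  using \<alpha>_cont local_exp by (auto simp: continuous_map_in_subtopology)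
 from continuous_map_compose[OF this continuous_from_coord]
 show ?thesis by (rule continuous_map_eq) (simp add: expG_local)
qed

lemma continuous_expG: "continuous_map euclidean GT expG" unfolding continuous_map_def
proof (intro conjI allI impI)
 fix V assume V: "openin GT V"
 have pow: "continuous_map X GT f \<Longrightarrow> continuous_map X GT (\<lambda>x. f x [^] n)"
  for X :: "'e topology" and f and n :: nat by (induction n) (auto intro: continuous_map_mult_G simp: nat_pow_def)
 have "open {Y \<in> ball 0 (real n * r0). expG Y \<in> V}" if n: "n > 0" for n
 proof -
  have "continuous_map (top_of_set (ball 0 (real n * r0))) (top_of_set (cball 0 r0)) (\<lambda>Y :: 'e. Y /\<^sub>R real n)"
   unfolding continuous_map_in_subtopology continuous_map_iff_continuous
  proof
   show "continuous_on (ball 0 (real n * r0)) (\<lambda>Y :: 'e. Y /\<^sub>R real n)" by (intro continuous_intros)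
   have "norm (Y /\<^sub>R real n) \<le> r0" if "norm Y < real n * r0" for Y :: 'e using that n by (simp add: field_simps)
   then show "(\<lambda>Y :: 'e. Y /\<^sub>R real n) \<in> topspace (top_of_set (ball 0 (real n * r0))) \<rightarrow> cball 0 r0" by simp
  qed
  from pow[OF continuous_map_compose[OF this continuous_expG_ball], of n]
  have "continuous_map (top_of_set (ball 0 (real n * r0))) GT (\<lambda>Y. expG (Y /\<^sub>R real n) [^] n)" by (simp add: comp_def)
  moreover have "expG (Y /\<^sub>R real n) [^] n = expG Y" for Y
   using H_power[OF expG_carrier exp_H_expG, of "Y /\<^sub>R real n" n] exp_T_scaled[OF n]
   by (intro expG_eqI[symmetric]) simp_all
  ultimately have "continuous_map (top_of_set (ball 0 (real n * r0))) GT expG" by simp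
  then show ?thesis by (rule open_preimage_G[OF _ open_ball V])
 qed
 then have "open (\<Union>n\<in>{0<..}. {Y \<in> ball 0 (real n * r0). expG Y \<in> V})" by auto
 moreover have "(\<Union>n\<in>{0<..}. {Y \<in> ball 0 (real n * r0). expG Y \<in> V}) = {Y. expG Y \<in> V}"
 proof (intro equalityI subsetI)
  fix Y assume "Y \<in> {Y. expG Y \<in> V}"
  moreover obtain n where "n > 0" "norm Y < real n * r0"
   using ex_less_of_nat_mult[OF r0] by (metis gr0I mult_zero_left norm_not_less_zero of_nat_0)
  ultimately show "Y \<in> (\<Union>n\<in>{0<..}. {Y \<in> ball 0 (real n * r0). expG Y \<in> V})" by auto
 qed auto
 ultimately show "openin euclidean {x \<in> topspace euclidean. expG x \<in> V}" by simp
qed simp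

text \<open>A lift of \<open>from_coord\<close>, chosen pointwise. Its choice near 0 fixes the value
  and the derivative at 0.\<close>

definition \<nu> :: "'e \<Rightarrow> (complex^'n) endo" where
 "\<nu> x = (SOME N. N \<in> H (fc x) \<and> norm (N - 1 - T x) \<le> C0 * (norm x)\<^sup>2)"

lemma \<nu>: "norm x \<le> r0 \<Longrightarrow> \<nu> x \<in> H (fc x) \<and> norm (\<nu> x - 1 - T x) \<le> C0 * (norm x)\<^sup>2"
 unfolding \<nu>_def by (rule someI_ex) (use local in blast)

lemma \<nu>_zero [simp]: "\<nu> 0 = 1" using \<nu>[of 0] r0 by (simp add: T_simps)

lemma \<nu>_derivative: "(\<nu> has_derivative T) (at 0)"
 by (rule has_derivative_at_zero_quadratic[OF T_bl r0]) (use \<nu> in auto)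

text \<open>If \<open>z\<close> is the coordinate of \<open>f x\<close>, then \<open>N x - 1\<close>
  equals \<open>T z\<close> up to a quadratic error in \<open>z\<close>, and the lower bound on
  \<open>T\<close> turns this into an error quadratic in \<open>N x - 1\<close>. So
  differentiability of a lift passes to the curve in \<open>G\<close>, and \<open>T\<close>
  intertwines the derivatives.\<close>

lemma coord_has_derivative:
 fixes f :: "'a::euclidean_space \<Rightarrow> 'g" and N :: "'a \<Rightarrow> (complex^'n) endo"
 assumes f: "\<And>V. openin GT V \<Longrightarrow> \<one> \<in> V \<Longrightarrow> \<forall>\<^sub>F x in nhds 0. f x \<in> V" and f0: "f 0 = \<one>"
  and N: "\<forall>\<^sub>F x in nhds 0. N x \<in> H (f x)" and N0: "N 0 = 1" and D: "(N has_derivative D) (at 0)"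
 obtains h where "((\<lambda>x. coord G (f x)) has_derivative h) (at 0)" "\<And>v. T (h v) = D v"
proof -
 obtain \<eta> where \<eta>: "\<eta> > 0" "\<eta> \<le> 1 / 2"
  "\<And>z. z \<in> (cen :: (complex^'n) endo set) \<Longrightarrow> norm (z - 1) < 4 * \<eta> \<Longrightarrow> z = 1" by (rule cen_separated) blast
 obtain c where c: "c > 0" "\<And>x. norm x \<le> c * norm (T x)" by (rule T_lower) blast
 obtain B where B: "B > 0" "\<And>x. norm (T x) \<le> norm x * B" using bounded_linear.pos_bounded[OF T_bl] by blast
 \<comment> \<open>The third bound keeps \<open>\<nu> z\<close> within \<open>\<eta>\<close> of 1,
   so that it is the same lift as \<open>N x\<close>; the fourth makes
   \<open>c C0 d \<le> 1/2\<close>, which absorbs the quadratic term in the estimate of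
   \<open>norm z\<close>.\<close>
 define d where "d = Min {r0, 1, \<eta> / (2 * (B + C0)), 1 / (2 * c * (C0 + 1))}"
 have d0: "d > 0" unfolding d_def by (subst Min_gr_iff) (use r0 \<eta> B C0 c in auto)
 have dle: "d \<le> v" if "v \<in> {r0, 1, \<eta> / (2 * (B + C0)), 1 / (2 * c * (C0 + 1))}" for v
  unfolding d_def by (rule Min_le) (use that in auto)
 have d: "d \<le> r0" "d \<le> 1" "(B + C0) * d \<le> \<eta> / 2" "c * C0 * d \<le> 1 / 2"
 proof -
  show "d \<le> r0" "d \<le> 1" using dle by auto
  have "d \<le> \<eta> / (2 * (B + C0))" by (rule dle) simp
  then show "(B + C0) * d \<le> \<eta> / 2" using B(1) C0 by (simp add: field_simps)
  have "d \<le> 1 / (2 * c * (C0 + 1))" by (rule dle) simp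
  then have "d * (2 * c * (C0 + 1)) \<le> 1" using c(1) C0 by (simp add: pos_le_divide_eq)
  moreover have "c * d \<ge> 0" using c(1) d0 by simp
  ultimately show "c * C0 * d \<le> 1 / 2" by (simp add: algebra_simps)
 qed
 let ?z = "\<lambda>x. coord G (f x)"
 have "(N \<longlongrightarrow> N 0) (nhds 0)" using has_derivative_continuous[OF D] unfolding continuous_at tendsto_at_iff_tendsto_nhds .
 from tendstoD[OF this \<eta>(1)] have Nn: "\<forall>\<^sub>F x in nhds 0. norm (N x - 1) < \<eta>" by (simp add: dist_norm N0)
 have "\<forall>\<^sub>F x in nhds 0. f x \<in> {g \<in> W0. coord G g \<in> ball 0 d}"
  by (rule f[OF coord_preimage_open[OF open_ball]]) (use id_chart d0 in auto)
 then have fV: "\<forall>\<^sub>F x in nhds 0. f x \<in> W0 \<and> norm (?z x) < d" by (rule eventually_mono) simp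
 have main: "\<forall>\<^sub>F x in nhds 0. norm (T (?z x) - (N x - 1)) \<le> 4 * c\<^sup>2 * C0 * (norm (N x - N 0))\<^sup>2"
  unfolding N0 using Nn fV N
 proof eventually_elim
  case (elim x)
  let ?zx = "?z x"
  have zr: "norm ?zx \<le> r0" and fz: "fc ?zx = f x" using elim d coord by auto
  note nu = \<nu>[OF zr, unfolded fz]
  have "norm (\<nu> ?zx - 1) \<le> norm (T ?zx) + C0 * (norm ?zx)\<^sup>2"
   using norm_triangle_ineq[of "\<nu> ?zx - 1 - T ?zx" "T ?zx"] nu by simp
  also have "\<dots> \<le> norm ?zx * B + C0 * (norm ?zx * 1)"
   unfolding power2_eq_square using elim d B(2)[of ?zx] C0 by (intro add_mono mult_left_mono) auto
  also have "\<dots> = (B + C0) * norm ?zx" by (simp add: algebra_simps)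
  also have "\<dots> \<le> (B + C0) * d" using elim B(1) C0 by (intro mult_left_mono) auto
  finally have "norm (\<nu> ?zx - 1) < \<eta>" using d \<eta>(1) by simp
  moreover have "f x \<in> carrier G" using elim chart_subset[OF id_chart(1)] by blast
  ultimately have eq: "\<nu> ?zx = N x" using H_near_one_unique[OF \<eta>(2,3)] nu elim by blast
  have q: "norm (N x - 1 - T ?zx) \<le> C0 * (norm ?zx)\<^sup>2" using nu eq by simp
  have "norm (T ?zx) \<le> norm (N x - 1) + C0 * (norm ?zx)\<^sup>2"
   using norm_triangle_ineq4[of "N x - 1" "N x - 1 - T ?zx"] q by simp
  then have "norm ?zx \<le> c * norm (N x - 1) + c * (C0 * (norm ?zx)\<^sup>2)"
   using c(2)[of ?zx] mult_left_mono[of "norm (T ?zx)" "norm (N x - 1) + C0 * (norm ?zx)\<^sup>2" c] c(1)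
   by (simp add: algebra_simps)
  moreover have "c * (C0 * (norm ?zx)\<^sup>2) \<le> (1 / 2) * norm ?zx"
  proof -
   have "c * C0 * norm ?zx \<le> c * C0 * d" using elim c(1) C0 by (intro mult_left_mono) auto
   then have "c * C0 * norm ?zx \<le> 1 / 2" using d by simp
   from mult_right_mono[OF this, of "norm ?zx"] show ?thesis by (simp add: power2_eq_square mult.assoc)
  qed
  ultimately have "norm ?zx \<le> 2 * c * norm (N x - 1)" by simp
  then have "(norm ?zx)\<^sup>2 \<le> (2 * c * norm (N x - 1))\<^sup>2" by (rule power_mono) simp
  then have "C0 * (norm ?zx)\<^sup>2 \<le> C0 * (2 * c * norm (N x - 1))\<^sup>2" using C0 by (rule mult_left_mono)
  then show ?case using q by (simp add: power_mult_distrib norm_minus_commute mult_ac)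
 qed
 have "((\<lambda>x. N x - 1) has_derivative D) (at 0)" using has_derivative_diff[OF D has_derivative_const] by simp
 from has_derivative_quadratic_error[OF this D main] have "((\<lambda>x. T (?z x)) has_derivative D) (at 0)" .
 then show ?thesis using that by (rule has_derivative_through_injection[OF T_bl T_inj]) blast
qed

end

section \<open>Differentials of conjugation and of the Cartan involution\<close>

context satake_exp
begin

lemma eventually_from_coord:
 assumes "openin GT V" "\<one> \<in> V"
 shows "\<forall>\<^sub>F x in nhds 0. fc x \<in> V"
proof -
 obtain r where "r > 0" "\<And>x. norm x \<le> r \<Longrightarrow> x \<in> Wc \<and> fc x \<in> V" by (rule nbhd_from_coord[OF assms]) blast
 then show ?thesis unfolding eventually_nhds_metric by (intro exI[of _ r]) (auto simp: dist_norm)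
qed

lemma eventually_image_from_coord:
 assumes \<Psi>: "continuous_map GT GT \<Psi>" "\<Psi> \<one> = \<one>"
  and "openin GT V" "\<one> \<in> V"
 shows "\<forall>\<^sub>F x in nhds 0. \<Psi> (fc x) \<in> V"
proof -
 have "openin GT {g \<in> carrier G. \<Psi> g \<in> V}" using openin_continuous_map_preimage[OF \<Psi>(1) assms(3)] by simp
 from eventually_from_coord[OF this] assms(2,4) show ?thesis by (auto elim: eventually_mono)
qed

lemma eventually_small: "\<forall>\<^sub>F x in nhds (0::'e). norm x \<le> r0 \<and> fc x \<in> carrier G"
 unfolding eventually_nhds_metric using r0 local from_coord_carrier by (intro exI[of _ r0]) (auto simp: dist_norm)

definition \<mu> :: "'e \<Rightarrow> (complex^'n) endo" where
 "\<mu> x = (SOME M. M \<in> H (inv (fc x)) \<and> M * \<nu> x = 1 \<and> \<nu> x * M = 1)"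

lemma \<mu>: "norm x \<le> r0 \<Longrightarrow> \<mu> x \<in> H (inv (fc x)) \<and> \<mu> x * \<nu> x = 1 \<and> \<nu> x * \<mu> x = 1"
proof -
 assume x: "norm x \<le> r0"
 show ?thesis unfolding \<mu>_def by (rule someI_ex, rule H_inverse[of "fc x" "\<nu> x"])
   (use x \<nu> local from_coord_carrier in auto)
qed

lemma \<mu>_zero [simp]: "\<mu> 0 = 1" using \<mu>[of 0] r0 by simp

text \<open>\<open>2 - \<nu> x\<close> is the first-order Neumann approximation of the inverse of
  \<open>\<nu> x\<close>; the difference is \<open>\<mu> x * (\<nu> x - 1)^2\<close>.\<close>

lemma \<mu>_derivative: "(\<mu> has_derivative (\<lambda>x. - T x)) (at 0)"
proof (rule has_derivative_quadratic_error[OF _ \<nu>_derivative])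
 show "((\<lambda>x. 2 - \<nu> x) has_derivative (\<lambda>x. - T x)) (at 0)"
  using has_derivative_diff[OF has_derivative_const \<nu>_derivative, of 2] by simp
 have "(\<nu> \<longlongrightarrow> 1) (nhds 0)"
  using has_derivative_continuous[OF \<nu>_derivative] unfolding continuous_at tendsto_at_iff_tendsto_nhds by simp
 then have "\<forall>\<^sub>F x in nhds 0. norm (\<nu> x - 1) < 1 / 2" using tendstoD[of \<nu> 1 "nhds 0" "1 / 2"] by (simp add: dist_norm)
 then show "\<forall>\<^sub>F x in nhds 0. norm (\<mu> x - (2 - \<nu> x)) \<le> 2 * (norm (\<nu> x - \<nu> 0))\<^sup>2" using eventually_small
 proof eventually_elim
  case (elim x)
  then have inv: "\<mu> x * \<nu> x = 1" using \<mu> by blast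
  have \<mu>2: "norm (\<mu> x) \<le> 2" using norm_inverse_perturbed_le[OF inv, of 1 1] elim by simp
  have "\<mu> x - (2 - \<nu> x) = \<mu> x - 2 * (\<mu> x * \<nu> x) + (\<mu> x * \<nu> x) * \<nu> x" unfolding inv by simp
  also have "\<dots> = \<mu> x * ((\<nu> x - 1) * (\<nu> x - 1))" by (simp add: algebra_simps mult_2 mult_2_right)
  finally have "norm (\<mu> x - (2 - \<nu> x)) \<le> norm (\<mu> x) * norm ((\<nu> x - 1) * (\<nu> x - 1))" by (simp add: norm_mult_ineq)
  also have "\<dots> \<le> 2 * (norm (\<nu> x - 1) * norm (\<nu> x - 1))" by (intro mult_mono \<mu>2 norm_mult_ineq) auto
  finally show ?case by (simp add: power2_eq_square)
 qed
qed

lemma diff_at_one: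
 assumes "((\<lambda>x. coord G (f (fc x))) has_derivative h) (at 0)"
 shows "diff_at_one G f = h" unfolding diff_at_one_def using frechet_derivative_at[OF assms] by simp

lemma Ad:
 assumes g: "g \<in> carrier G" and N: "N \<in> H g" "N' \<in> H (inv g)" "N' * N = 1"
 shows "((\<lambda>x. coord G (g \<otimes> fc x \<otimes> inv g)) has_derivative Ad G g) (at 0)"
  and "T (Ad G g Y) = N * T Y * N'"
proof -
 let ?\<Psi> = "\<lambda>h. g \<otimes> h \<otimes> inv g"
 have "N * N' \<in> H \<one>" using H_mult[OF g _ N(1,2)] g by simp
 then obtain M where M: "M * (N * N') = 1" using H_inverse[OF one_closed] by metis
 have "M * (N * N') * N = M * N" using N(3) by (simp add: mult.assoc)
 then have "M * N = N" using M by simp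
 then have "M * (N * N') = N * N'" by (simp flip: mult.assoc)
 then have NN: "N * N' = 1" using M by simp
 have ct: "continuous_map GT GT ?\<Psi>" using g by (intro continuous_map_mult_G) auto
 have NH: "\<forall>\<^sub>F x in nhds 0. N * \<nu> x * N' \<in> H (?\<Psi> (fc x))" using eventually_small
 proof eventually_elim
  case (elim x)
  then show ?case using H_mult[OF _ _ H_mult[OF g _ N(1)] N(2)] \<nu>[of x] g by simp
 qed
 have der: "((\<lambda>x. N * \<nu> x * N') has_derivative (\<lambda>x. N * T x * N')) (at 0)"
  by (rule bounded_linear.has_derivative[OF bounded_linear_mult_left
     bounded_linear.has_derivative[OF bounded_linear_mult_right \<nu>_derivative]])
 obtain h where h: "((\<lambda>x. coord G (?\<Psi> (fc x))) has_derivative h) (at 0)" "\<And>v. T (h v) = N * T v * N'"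
  by (rule coord_has_derivative[OF eventually_image_from_coord[OF ct] _ NH _ der]) (use g NN in auto)
 have "Ad G g = h" unfolding Ad_def by (rule diff_at_one[OF h(1)])
 then show "((\<lambda>x. coord G (g \<otimes> fc x \<otimes> inv g)) has_derivative Ad G g) (at 0)"
  and "T (Ad G g Y) = N * T Y * N'" using h by auto
qed

lemma adj_\<mu>_in_H: "norm x \<le> r0 \<Longrightarrow> adj (\<mu> x) \<in> H (\<theta> (fc x))"
proof -
 assume x: "norm x \<le> r0"
 have c: "fc x \<in> carrier G" "\<nu> x \<in> H (fc x)" using x local from_coord_carrier \<nu> by auto
 obtain N' where N': "N' \<in> H (\<theta> (fc x))" "N' * adj (\<nu> x) = 1" by (rule H_theta[OF c])
 have "adj (\<nu> x) * adj (\<mu> x) = 1" using \<mu>[OF x] by (metis adj_simps(4,5))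
 then show ?thesis using mult_inverse_unique[OF N'(2)] N'(1) by metis
qed

text \<open>On lifts the involution is the inverse of the adjoint, whose derivative at 1 is minus
  the adjoint. Hence the -1 eigenspace of the involution consists of the \<open>Y\<close> with
  \<open>T Y\<close> symmetric.\<close>

lemma T_diff_theta: "T (diff_at_one G \<theta> Y) = - adj (T Y)"
proof -
 have ct: "continuous_map GT GT \<theta>" using cart(1) by (simp add: cartan_involution_def)
 have one: "\<theta> \<one> = \<one>" by (rule hom_one[OF theta_hom group_G group_G])
 have NH: "\<forall>\<^sub>F x in nhds 0. adj (\<mu> x) \<in> H (\<theta> (fc x))" using eventually_small by eventually_elim (simp add: adj_\<mu>_in_H)
 have der: "((\<lambda>x. adj (\<mu> x)) has_derivative (\<lambda>x. - adj (T x))) (at 0)"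
  using bounded_linear.has_derivative[OF bounded_linear_adj \<mu>_derivative] by simp
 obtain h where h: "((\<lambda>x. coord G (\<theta> (fc x))) has_derivative h) (at 0)" "\<And>v. T (h v) = - adj (T v)"
  by (rule coord_has_derivative[OF eventually_image_from_coord[OF ct one] _ NH _ der]) (use one in auto)
 then show ?thesis using diff_at_one[OF h(1)] by simp
qed

lemma T_Ad_from_coord: "norm Z \<le> r0 \<Longrightarrow> T (Ad G (fc Z) Y) = \<nu> Z * T Y * \<mu> Z"
 using Ad(2)[of "fc Z" "\<nu> Z" "\<mu> Z"] \<nu> \<mu> local from_coord_carrier by blast

lemma T_bracket: "T (lie_bracket G X Y) = T X * T Y - T Y * T X"
proof -
 have "((\<lambda>Z. \<nu> Z * T Y * \<mu> Z) has_derivative (\<lambda>v. \<nu> 0 * T Y * (- T v) + T v * T Y * \<mu> 0)) (at 0)"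
  by (rule has_derivative_mult[OF bounded_linear.has_derivative[OF bounded_linear_mult_left \<nu>_derivative] \<mu>_derivative])
 then have "((\<lambda>Z. T (Ad G (fc Z) Y)) has_derivative (\<lambda>v. \<nu> 0 * T Y * (- T v) + T v * T Y * \<mu> 0)) (at 0)"
  by (rule has_derivative_transform_within_open[where s = "ball 0 r0"]) (use r0 T_Ad_from_coord in auto)
 then obtain h where h: "((\<lambda>Z. Ad G (fc Z) Y) has_derivative h) (at 0)"
   "\<And>v. T (h v) = \<nu> 0 * T Y * (- T v) + T v * T Y * \<mu> 0"
  by (rule has_derivative_through_injection[OF T_bl T_inj]) blast
 have "lie_bracket G X Y = h X" unfolding lie_bracket_def using frechet_derivative_at[OF h(1)] by simp
 then show ?thesis using h(2) by simp
qed

lemma cartan_p_iff: "Y \<in> cartan_p G \<theta> \<longleftrightarrow> adj (T Y) = T Y"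
proof -
 have "Y \<in> cartan_p G \<theta> \<longleftrightarrow> T (diff_at_one G \<theta> Y) = T (- Y)" by (simp add: cartan_p_def T_eq_iff)
 then show ?thesis by (simp add: T_diff_theta T_simps)
qed

lemma eventually_expG: "openin GT V \<Longrightarrow> \<one> \<in> V \<Longrightarrow> \<forall>\<^sub>F x in nhds 0. expG x \<in> V"
proof -
 assume V: "openin GT V" "\<one> \<in> V"
 have "open {x. expG x \<in> V}" using openin_continuous_map_preimage[OF continuous_expG V(1)] by simp
 then have "\<forall>\<^sub>F x in nhds 0. x \<in> {x. expG x \<in> V}" by (rule eventually_nhds_in_open) (use V in simp)
 then show ?thesis by simp
qed

lemma expG_coord_derivative: "((\<lambda>x. coord G (expG x)) has_derivative (\<lambda>x. x)) (at 0)"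
proof -
 obtain B where B: "B > 0" "\<And>x. norm (T x) \<le> norm x * B" using bounded_linear.pos_bounded[OF T_bl] by blast
 have der: "((\<lambda>x. exp (T x)) has_derivative T) (at 0)"
 proof (rule has_derivative_at_zero_quadratic[OF T_bl, of "1 / B" _ "B\<^sup>2"])
  fix x :: 'e assume "norm x \<le> 1 / B"
  then have "norm x * B \<le> 1" using B(1) by (simp add: field_simps)
  then have "norm (T x) \<le> 1" using B(2)[of x] by simp
  from exp_second_order[OF this] have "norm (exp (T x) - 1 - T x) \<le> (norm (T x))\<^sup>2" .
  also have "\<dots> \<le> (norm x * B)\<^sup>2" by (intro power_mono B) simp
  finally show "norm (exp (T x) - exp (T 0) - T x) \<le> B\<^sup>2 * (norm x)\<^sup>2"
   by (simp add: T_simps power_mult_distrib mult.commute)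
 qed (use B in simp)
 obtain h where h: "((\<lambda>x. coord G (expG x)) has_derivative h) (at 0)" "\<And>v. T (h v) = T v"
  by (rule coord_has_derivative[OF eventually_expG _ _ _ der]) (auto simp: exp_H_expG T_simps)
 then have "h = (\<lambda>x. x)" by (auto simp: T_eq_iff)
 then show ?thesis using h(1) by simp
qed

text \<open>Any differentiable lift of the curve with velocity \<open>Y\<close> must have derivative
  \<open>T Y\<close> by \<open>coord_has_derivative\<close>; conversely \<open>\<nu> (t Y)\<close>
  is such a lift and consists of matrices.\<close>

lemma has_differential_iff: "has_differential G \<tau> Y M \<longleftrightarrow> of_matrix M = T Y"
proof
 assume "has_differential G \<tau> Y M"
 then obtain \<gamma> where \<gamma>: "\<gamma> 0 = mat 1" "\<forall>\<^sub>F t in nhds 0. \<gamma> t \<in> \<tau> (fc (t *\<^sub>R Y))"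
  "(\<gamma> has_vector_derivative M) (at 0)" unfolding has_differential_def by blast
 have ev: "\<forall>\<^sub>F t in nhds 0. fc (t *\<^sub>R Y) \<in> V" if "openin GT V" "\<one> \<in> V" for V
 proof -
  have "filterlim (\<lambda>t. t *\<^sub>R Y) (nhds 0) (nhds (0::real))"
  proof -
   have "((\<lambda>t. t *\<^sub>R Y) \<longlongrightarrow> 0 *\<^sub>R Y) (nhds (0::real))" by (intro tendsto_scaleR filterlim_ident tendsto_const)
   then show ?thesis by simp
  qed
  then show ?thesis using eventually_from_coord[OF that] by (rule eventually_compose_filterlim[rotated])
 qed
 have NH: "\<forall>\<^sub>F t in nhds 0. of_matrix (\<gamma> t) \<in> H (fc (t *\<^sub>R Y))" using \<gamma>(2) by eventually_elim (simp add: H_def)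
 have der: "((\<lambda>t. of_matrix (\<gamma> t)) has_derivative (\<lambda>t. t *\<^sub>R of_matrix M)) (at 0)"
  using bounded_linear.has_derivative[OF bounded_linear_of_matrix \<gamma>(3)[unfolded has_vector_derivative_def]]
  by (simp add: of_matrix_simps)
 obtain h where h: "((\<lambda>t. coord G (fc (t *\<^sub>R Y))) has_derivative h) (at 0)"
  "\<And>v. T (h v) = v *\<^sub>R of_matrix M" by (rule coord_has_derivative[OF ev _ NH _ der]) (simp_all add: \<gamma>(1))
 have "((\<lambda>t. coord G (fc (t *\<^sub>R Y))) has_derivative (\<lambda>t. t *\<^sub>R Y)) (at 0)"
 proof -
  have "((\<lambda>t. t *\<^sub>R Y) has_derivative (\<lambda>t. t *\<^sub>R Y)) (at (0::real))" by (auto intro!: derivative_eq_intros)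
  then show ?thesis
  proof (rule has_derivative_transform_within_open)
   show "open ((\<lambda>t. t *\<^sub>R Y) -` Wc)" by (intro open_vimage open_Wc continuous_intros)
  qed (use zero_Wc from_coord in auto)
 qed
 from has_derivative_unique[OF h(1) this] have "h = (\<lambda>t. t *\<^sub>R Y)" .
 then show "of_matrix M = T Y" using h(2)[of 1] by simp
next
 assume M: "of_matrix M = T Y"
 let ?\<gamma> = "\<lambda>t. to_matrix (\<nu> (t *\<^sub>R Y))"
 have "((\<lambda>t. \<nu> (t *\<^sub>R Y)) has_derivative (\<lambda>t. T (t *\<^sub>R Y))) (at (0::real))"
 proof -
  have "((\<lambda>t. t *\<^sub>R Y) has_derivative (\<lambda>t. t *\<^sub>R Y)) (at (0::real))" by (auto intro!: derivative_eq_intros)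
  from has_derivative_compose[OF this, of \<nu> T] \<nu>_derivative show ?thesis by simp
 qed
 note der = bounded_linear.has_derivative[OF bounded_linear_to_matrix this]
 have tm: "to_matrix (T Y) = M" by (metis M to_matrix_of_matrix)
 from der have "(?\<gamma> has_vector_derivative M) (at 0)"
  by (simp add: has_vector_derivative_def T_simps linear_simps[OF bounded_linear_to_matrix] tm)
 moreover have "?\<gamma> 0 = mat 1" by (simp flip: of_matrix_one)
 moreover have "\<forall>\<^sub>F t in nhds (0::real). ?\<gamma> t \<in> \<tau> (fc (t *\<^sub>R Y))"
 proof -
  have "open ((\<lambda>t. norm (t *\<^sub>R Y)) -` {..<r0})" by (intro open_vimage continuous_intros open_lessThan)
  then have "\<forall>\<^sub>F t in nhds (0::real). t \<in> (\<lambda>t. norm (t *\<^sub>R Y)) -` {..<r0}"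
   by (rule eventually_nhds_in_open) (use r0 in simp)
  then show ?thesis
  proof eventually_elim
   case (elim t)
   then have "\<nu> (t *\<^sub>R Y) \<in> H (fc (t *\<^sub>R Y))" using \<nu>[of "t *\<^sub>R Y"] by simp
   then show ?case by (auto simp: H_def)
  qed
 qed
 ultimately show "has_differential G \<tau> Y M" unfolding has_differential_def by (intro exI[of _ ?\<gamma>] conjI)
qed

text \<open>For small \<open>t\<close> the operators \<open>\<nu> (t Y)\<close> are matrices of
  determinant 1. The injection \<open>of_matrix\<close> can be removed before differentiating, and
  the constant determinant gives trace zero.\<close>

lemma T_matrix: obtains M where "T Y = of_matrix M" "trace M = 0"
proof -
 have cl: "closed (range (of_matrix :: 'n cmat \<Rightarrow> _))"
  by (rule closed_range_injective_linear[OF bounded_linear_of_matrix]) (simp add: inj_def)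
 have "((\<lambda>t. \<nu> (t *\<^sub>R Y)) has_derivative (\<lambda>t. T (t *\<^sub>R Y))) (at (0::real))"
 proof -
  have "((\<lambda>t. t *\<^sub>R Y) has_derivative (\<lambda>t. t *\<^sub>R Y)) (at (0::real))" by (auto intro!: derivative_eq_intros)
  from has_derivative_compose[OF this, of \<nu> T] \<nu>_derivative show ?thesis by simp
 qed
 then have d: "((\<lambda>t. \<nu> (t *\<^sub>R Y)) has_derivative (\<lambda>t. t *\<^sub>R T Y)) (at (0::real))" by (simp add: T_simps)
 have ev: "\<forall>\<^sub>F t in nhds (0::real). norm (t *\<^sub>R Y) < r0"
 proof -
  have "open ((\<lambda>t. norm (t *\<^sub>R Y)) -` {..<r0})" by (intro open_vimage continuous_intros open_lessThan)
  then have "\<forall>\<^sub>F t in nhds (0::real). t \<in> (\<lambda>t. norm (t *\<^sub>R Y)) -` {..<r0}"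
   by (rule eventually_nhds_in_open) (use r0 in simp)
  then show ?thesis by simp
 qed
 have mat: "\<exists>M. \<nu> (t *\<^sub>R Y) = of_matrix M \<and> det M = 1" if "norm (t *\<^sub>R Y) < r0" for t
  using that \<nu>[of "t *\<^sub>R Y"] H_det local[of "t *\<^sub>R Y"] from_coord_carrier by (meson less_imp_le)
 have mat2: "\<nu> (t *\<^sub>R Y) = of_matrix (to_matrix (\<nu> (t *\<^sub>R Y)))" if "\<bar>t\<bar> * norm Y < r0" for t
  using mat[of t] that by auto
 let ?\<gamma> = "\<lambda>t. to_matrix (\<nu> (t *\<^sub>R Y))"
 have g: "((\<lambda>t. of_matrix (?\<gamma> t)) has_derivative (\<lambda>t. t *\<^sub>R T Y)) (at (0::real))"
  by (rule has_derivative_transform_within_open[OF d, where s = "(\<lambda>t. norm (t *\<^sub>R Y)) -` {..<r0}"])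
   (use r0 mat2 in \<open>auto intro!: open_vimage continuous_intros\<close>)
 then obtain h where h: "(?\<gamma> has_derivative h) (at 0)" "\<And>v. of_matrix (h v) = v *\<^sub>R T Y"
  by (rule has_derivative_through_injection[OF bounded_linear_of_matrix, rotated]) (auto simp: inj_def)
 have lin: "h v = v *\<^sub>R h 1" for v using linear_cmul[OF has_derivative_linear[OF h(1)], of v 1] by simp
 have "(?\<gamma> has_vector_derivative h 1) (at 0)"
  unfolding has_vector_derivative_def by (rule has_derivative_eq_rhs[OF h(1)]) (rule ext, rule lin)
 moreover have "?\<gamma> 0 = mat 1" by (simp flip: of_matrix_one)
 moreover have "\<forall>\<^sub>F t in nhds 0. det (?\<gamma> t) = 1" using ev by eventually_elim (use mat in force)
 ultimately have "trace (h 1) = 0" by (rule trace_zero_of_det_one)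
 then show ?thesis using that[of "h 1"] h(2)[of 1] by simp
qed

text \<open>Otherwise \<open>- T Y\<close> is positive semidefinite with trace zero, so each
  coordinate vector is a null vector of the form and lies in the kernel. This makes the Finsler norm
  definite and the dual ball bounded, although only the largest eigenvalue is seen.\<close>

lemma rmax_T_pos:
 assumes Y: "adj (T Y) = T Y" "Y \<noteq> 0"
 shows "rmax (T Y) > 0"
proof (rule ccontr)
 assume "\<not> rmax (T Y) > 0"
 then have neg: "w \<bullet> app (T Y) w \<le> 0" for w
  using rayleigh_le[of w "T Y"] mult_nonpos_nonneg[of "rmax (T Y)" "w \<bullet> w"] by simp
 obtain M where M: "T Y = of_matrix M" "trace M = 0" by (rule T_matrix)
 have ax: "axis i 1 \<bullet> app (T Y) (axis i 1) = Re (M $ i $ i)" for i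
 proof -
  have "app (T Y) (axis i 1) $ i = M $ i $ i"
   by (simp add: M app_of_matrix matrix_vector_mult_def axis_def if_distrib cong: if_cong)
  then show ?thesis by (simp add: inner_axis' inner_complex_def)
 qed
 have "(\<Sum>i\<in>UNIV. - Re (M $ i $ i)) = - Re (trace M)" by (simp add: trace_def sum_negf)
 then have s0: "(\<Sum>i\<in>UNIV. - Re (M $ i $ i)) = 0" using M by simp
 have "- Re (M $ i $ i) = 0" for i by (rule sum_nonneg_0[OF _ _ s0]) (use neg[of "axis _ 1"] ax in auto)
 then have z: "axis i 1 \<bullet> app (- T Y) (axis i 1) = 0" for i using ax[of i] by simp
 have "app (- T Y) (axis i 1) \<bullet> w = 0" for i w by (rule psd_null_vector[where W = UNIV]) (use Y neg z in auto)
 then have col: "app (T Y) (axis i 1) = 0" for i by (metis app_simps(3) inner_eq_zero_iff neg_equal_0_iff_equal)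
 have "M = 0" unfolding vec_eq_iff
 proof (intro allI)
  fix i j
  have "(M *v axis j 1) $ i = M $ i $ j" by (simp add: matrix_vector_mult_def axis_def if_distrib cong: if_cong)
  then show "M $ i $ j = 0 $ i $ j" using col[of j] by (simp add: M app_of_matrix)
 qed
 then have "T Y = T 0" by (simp add: M T_simps of_matrix_simps)
 then show False using Y(2) by (simp add: T_eq_iff)
qed

text \<open>Multiplication by a central element is an isometry, so closeness of one pair of lifts
  transfers to any prescribed lift of \<open>h\<close>.\<close>

lemma unitary_H_diff:
 assumes "g \<in> carrier G" "h \<in> carrier G" "N \<in> H g" "N' \<in> H h" "P \<in> H h"
 obtains P' where "P' \<in> H g" "norm (P' - P) = norm (N - N')"
proof -
 obtain z where z: "z \<in> cen" "P = z * N'" using H_coset[OF assms(2,4)] assms(5) by blast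
 have "z * N - P = z * (N - N')" using z by (simp add: algebra_simps)
 then have "norm (z * N - P) = norm (N - N')" using norm_mult_isometry_left[OF cen_unitary(1)[OF z(1)]] by simp
 then show ?thesis using that cen_mult_H[OF assms(1) z(1) assms(3)] by blast
qed

text \<open>The lifts of \<open>K\<close> are unitary, hence bounded. For closedness, a point
  \<open>N\<close> outside has distance at least \<open>2 \<delta> k\<close> from the finite set
  \<open>H k\<close>; the neighbourhoods of \<open>k\<close> on which lifts move by less than
  \<open>\<delta> k\<close> cover \<open>K\<close>, and a finite subcover gives a uniform distance.
  The factor 2 pays for the triangle inequality.\<close>

lemma compact_UK: "compact (\<Union>k\<in>K. H k)"
proof -
 let ?U = "\<Union>k\<in>K. H k"
 have "norm N \<le> 1" if "N \<in> ?U" for N using that K_unitary norm_adj_mult[of N] by (auto simp: power2_eq_1_iff)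
 then have "bounded ?U" unfolding bounded_iff by blast
 moreover have "closed ?U" unfolding closed_def open_contains_ball
 proof
  fix N assume N: "N \<in> - ?U"
  have "\<exists>\<delta>>0. \<exists>P\<in>H k. \<forall>N'\<in>H k. norm (N' - N) \<ge> 2 * \<delta>" if k: "k \<in> K" for k
  proof -
   obtain P where P: "P \<in> H k" using H_nonempty[OF K_subset[OF k]] by blast
   have fin: "finite (H k)" using H_coset[OF K_subset[OF k] P] finite_imageI[OF finite_cen] by simp
   let ?D = "(\<lambda>N'. norm (N' - N)) ` H k"
   have "Min ?D > 0" using fin P N k by (subst Min_gr_iff) auto
   moreover have "norm (N' - N) \<ge> Min ?D" if "N' \<in> H k" for N' using fin that by (intro Min_le) auto
   ultimately show ?thesis using P by (intro exI[of _ "Min ?D / 2"]) auto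
  qed
  then obtain \<delta> P where \<delta>: "\<And>k. k \<in> K \<Longrightarrow> \<delta> k > 0" and P: "\<And>k. k \<in> K \<Longrightarrow> P k \<in> H k"
   and far: "\<And>k N'. k \<in> K \<Longrightarrow> N' \<in> H k \<Longrightarrow> norm (N' - N) \<ge> 2 * \<delta> k" by metis
  define O' where "O' k = {g \<in> carrier G. \<exists>N'\<in>H g. norm (N' - P k) < \<delta> k}" for k
  have op: "openin GT (O' k)" for k unfolding O'_def by (rule H_open)
  have "K \<subseteq> \<Union> (O' ` K)"
  proof
   fix k assume k: "k \<in> K"
   then have "k \<in> O' k" using K_subset[OF k] P[OF k] \<delta>[OF k] by (auto simp: O'_def intro!: bexI[of _ "P k"])
   then show "k \<in> \<Union> (O' ` K)" using k by blast
  qed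
  then obtain F where F: "finite F" "F \<subseteq> O' ` K" "K \<subseteq> \<Union> F"
   using compact_K op unfolding compactin_def by (metis (mono_tags, lifting) imageE)
  then obtain I where I: "finite I" "I \<subseteq> K" "F = O' ` I" by (metis finite_subset_image)
  have ne: "I \<noteq> {}" using F(3) I subgroup.one_closed[OF subgroup_K] by auto
  define e where "e = Min (\<delta> ` I)"
  have e: "e > 0" "\<And>k. k \<in> I \<Longrightarrow> e \<le> \<delta> k" using I \<delta> ne by (auto simp: e_def)
  have "ball N e \<subseteq> - ?U"
  proof (rule subsetI, rule ccontr)
   fix Q assume Q: "Q \<in> ball N e" "Q \<notin> - ?U"
   then obtain g where g: "g \<in> K" "Q \<in> H g" by blast
   then obtain k where k: "k \<in> I" "g \<in> O' k" using F(3) I by blast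
   then obtain N' where N': "N' \<in> H g" "norm (N' - P k) < \<delta> k" by (auto simp: O'_def)
   have kK: "k \<in> K" using k I by blast
   obtain Q' where Q': "Q' \<in> H k" "norm (Q' - Q) = norm (P k - N')"
    by (rule unitary_H_diff[OF K_subset[OF kK] K_subset[OF g(1)] P[OF kK] N'(1) g(2)])
   have "norm (Q' - N) \<le> norm (Q' - Q) + norm (Q - N)" using norm_triangle_ineq[of "Q' - Q" "Q - N"] by simp
   also have "\<dots> < \<delta> k + \<delta> k" using Q'(2) N'(2) Q(1) e(2)[OF k(1)] by (simp add: norm_minus_commute dist_norm)
   finally show False using far[OF kK Q'(1)] by simp
  qed
  then show "\<exists>e>0. ball N e \<subseteq> - ?U" using e(1) by blast
 qed
 ultimately show ?thesis by (simp add: compact_eq_bounded_closed)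
qed

end

section \<open>Cartan decompositions\<close>

text \<open>A finite union of proper subspaces does not exhaust a real vector space: adding a
  multiple \<open>e\<close> of a vector outside the new kernel spoils the earlier conditions for
  finitely many \<open>e\<close> only.\<close>

lemma avoid_kernels:
 fixes \<aa> :: "'e::real_vector set" and \<F> :: "('e \<Rightarrow> real) set"
 assumes "finite \<F>" "subspace \<aa>" "\<And>f. f \<in> \<F> \<Longrightarrow> linear f" "\<And>f. f \<in> \<F> \<Longrightarrow> \<exists>Y\<in>\<aa>. f Y \<noteq> 0"
 shows "\<exists>H\<in>\<aa>. \<forall>f\<in>\<F>. f H \<noteq> 0" using assms(1,3,4)
proof (induction \<F> rule: finite_induct)
 case empty
 then show ?case using subspace_0[OF assms(2)] by blast
next
 case (insert f \<F>)
 obtain H where H: "H \<in> \<aa>" "\<forall>g\<in>\<F>. g H \<noteq> 0" using insert by auto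
 obtain Y where Y: "Y \<in> \<aa>" "f Y \<noteq> 0" using insert.prems(2) by blast
 have "finite (insert 0 ((\<lambda>g. - g H / g Y) ` insert f \<F>))" using insert.hyps by simp
 then obtain e :: real where e: "e \<notin> insert 0 ((\<lambda>g. - g H / g Y) ` insert f \<F>)"
  using ex_new_if_finite[OF infinite_UNIV_char_0] by blast
 have "g (H + e *\<^sub>R Y) \<noteq> 0" if g: "g \<in> insert f \<F>" for g
 proof
  assume "g (H + e *\<^sub>R Y) = 0"
  then have eq: "g H + e * g Y = 0" using insert.prems(1)[OF g] by (simp add: linear_add linear_cmul)
  show False
  proof (cases "g Y = 0")
   case True
   then show ?thesis using eq g H Y by auto
  next
   case False
   then have "e = - g H / g Y" using eq by (simp add: field_simps)
   then show ?thesis using e g by blast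
  qed
 qed
 moreover have "H + e *\<^sub>R Y \<in> \<aa>" using H Y assms(2) by (simp add: subspace_add subspace_scale)
 ultimately show ?case by blast
qed

text \<open>Dropping the terms of order 0 and 1 from the series and from its majorant leaves the
  factor \<open>exp r - 1\<close>. It is below 1 for \<open>r = 1/2\<close>, so \<open>exp\<close>
  is injective on that ball.\<close>

lemma exp_diff_second_order:
 fixes x y :: "'a::{real_normed_algebra_1,banach}"
 assumes "norm x \<le> r" "norm y \<le> r"
 shows "norm (exp x - exp y - (x - y)) \<le> (exp r - 1) * norm (x - y)"
proof -
 let ?g = "\<lambda>n. (real n * r ^ (n - 1) / fact n) * norm (x - y)"
 let ?f = "\<lambda>n. x ^ n /\<^sub>R fact n - y ^ n /\<^sub>R fact n"
 have g: "(\<lambda>n. ?g (n + 2)) sums (exp r * norm (x - y) - (\<Sum>i<2. ?g i))"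
  by (rule sums_split_initial_segment[OF sums_mult2[OF sums_exp_derivative]])
 have f: "(\<lambda>n. ?f (n + 2)) sums (exp x - exp y - (\<Sum>i<2. ?f i))"
  by (rule sums_split_initial_segment[OF sums_diff[OF exp_converges exp_converges]])
 have "norm (exp x - exp y - (\<Sum>i<2. ?f i)) \<le> exp r * norm (x - y) - (\<Sum>i<2. ?g i)"
  unfolding sums_unique[OF f] sums_unique[OF g]
  by (rule norm_suminf_le[OF norm_exp_term_diff_le[OF assms] sums_summable[OF g]])
 moreover have "(\<Sum>i<2. ?f i) = x - y" "(\<Sum>i<2. ?g i) = norm (x - y)" by (simp_all add: numeral_2_eq_2)
 ultimately show ?thesis by (simp add: left_diff_distrib)
qed

lemma exp_small_injective:
 fixes x y :: "'a::{real_normed_algebra_1,banach}"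
 assumes "norm x \<le> 1 / 2" "norm y \<le> 1 / 2" "exp x = exp y"
 shows "x = y"
proof (rule ccontr)
 assume "x \<noteq> y"
 then have pos: "norm (x - y) > 0" by simp
 have e: "exp (1 / 2) - 1 < (1 :: real)" using exp_bound[of "1 / 2 :: real"] by (simp add: power2_eq_square)
 have "norm (x - y) = norm (exp x - exp y - (x - y))" unfolding assms(3) by (simp add: norm_minus_commute)
 also have "\<dots> \<le> (exp (1 / 2) - 1) * norm (x - y)" by (rule exp_diff_second_order[OF assms(1,2)])
 also have "\<dots> < 1 * norm (x - y)" by (rule mult_strict_right_mono[OF e pos])
 finally show False by simp
qed

section \<open>Cosets of \<open>K\<close> and the maximal abelian subspace\<close>

context satake_exp
begin

lemma lcoset_iff: "x \<in> g <# K \<longleftrightarrow> (\<exists>k\<in>K. x = g \<otimes> k)" by (auto simp: l_coset_def)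

lemma K_one: "\<one> \<in> K" and K_mult: "k \<in> K \<Longrightarrow> k' \<in> K \<Longrightarrow> k \<otimes> k' \<in> K"
 and K_inv: "k \<in> K \<Longrightarrow> inv k \<in> K"
 using subgroup_K by (auto simp: subgroup.one_closed subgroup.m_closed subgroup.m_inv_closed)

lemma coset_eq_iff:
 assumes "g \<in> carrier G" "h \<in> carrier G"
 shows "g <# K = h <# K \<longleftrightarrow> (\<exists>k\<in>K. h = g \<otimes> k)"
proof
 assume eq: "g <# K = h <# K"
 have "h \<in> h <# K" using K_one assms by (force simp: lcoset_iff)
 then have "h \<in> g <# K" by (simp only: eq)
 then show "\<exists>k\<in>K. h = g \<otimes> k" by (simp only: lcoset_iff)
next
 assume "\<exists>k\<in>K. h = g \<otimes> k"
 then obtain k where k: "k \<in> K" "h = g \<otimes> k" by blast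
 have "g \<otimes> k' = h \<otimes> (inv k \<otimes> k')" if "k' \<in> K" for k'
 proof -
  have "g \<otimes> k \<otimes> (inv k \<otimes> k') = g \<otimes> (k \<otimes> inv k \<otimes> k')"
   using assms K_subset[OF k(1)] K_subset[OF that] by (simp only: m_assoc m_closed inv_closed)
  then show ?thesis using assms K_subset[OF k(1)] K_subset[OF that] by (simp add: k(2))
 qed
 moreover have "h \<otimes> k' = g \<otimes> (k \<otimes> k')" if "k' \<in> K" for k'
  using assms K_subset[OF k(1)] K_subset[OF that] by (simp add: k(2) m_assoc)
 ultimately show "g <# K = h <# K"
  using K_mult[OF k(1)] K_mult[OF K_inv[OF k(1)]] unfolding set_eq_iff lcoset_iff by metis
qed

lemma lcosets_iff: "x \<in> lcosets K \<longleftrightarrow> (\<exists>g\<in>carrier G. x = g <# K)" by (auto simp: LCOSETS_def)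

lemma lcosets_in: "g \<in> carrier G \<Longrightarrow> g <# K \<in> lcosets K" by (auto simp: lcosets_iff)

lemma one_coset: "\<one> <# K = K" using K_subset by (force simp: l_coset_def)

lemma coset_translate: "g \<in> carrier G \<Longrightarrow> h \<in> carrier G \<Longrightarrow> g <# (h <# K) = (g \<otimes> h) <# K"
 using lcos_m_assoc[of K g h] K_subset by blast

lemma topspace_sym_top: "topspace (sym_top G K) = lcosets K"
proof (rule subset_antisym)
 show "topspace (sym_top G K) \<subseteq> lcosets K"
 proof
  fix x assume "x \<in> topspace (sym_top G K)"
  then obtain U where "openin (sym_top G K) U" "x \<in> U" unfolding topspace_def by blast
  then show "x \<in> lcosets K" by (auto simp: sym_top_def openin_quotient_topology lcosets_iff)
 qed
 have eq: "{g \<in> topspace GT. g <# K \<in> lcosets K} = topspace GT" using lcosets_in by auto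
 have "openin (sym_top G K) (lcosets K)" unfolding sym_top_def openin_quotient_topology eq
  using openin_topspace[of "GT"] by (auto simp: lcosets_iff)
 then show "lcosets K \<subseteq> topspace (sym_top G K)" by (rule openin_subset)
qed

lemma openin_sym_top:
 "openin (sym_top G K) U \<longleftrightarrow> U \<subseteq> lcosets K \<and> openin GT {g \<in> carrier G. g <# K \<in> U}"
proof -
 have "(\<lambda>g. g <# K) ` topspace GT = lcosets K" by (auto simp: lcosets_iff)
 then show ?thesis unfolding sym_top_def openin_quotient_topology by simp
qed

lemma H_K_adj: "k \<in> K \<Longrightarrow> U \<in> H k \<Longrightarrow> adj U \<in> H (inv k)"
proof -
 assume k: "k \<in> K" and U: "U \<in> H k"
 obtain N' where "N' \<in> H (inv k)" "N' * U = 1" by (rule H_inverse[OF K_subset[OF k] U])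
 then show ?thesis using mult_inverse_unique[of N' U "adj U"] K_unitary[OF k U] by simp
qed

text \<open>Lifts of elements of \<open>K\<close> and central factors are both unitary, and both
  cancel in \<open>N' * adj N'\<close>. Thus this operator is attached to a point of
  \<open>X\<close>.\<close>

lemma symm_invariant_K:
 assumes g: "g \<in> carrier G" "N \<in> H g" and k: "k \<in> K" and N': "N' \<in> H (g \<otimes> k)"
 shows "N' * adj N' = N * adj N"
proof -
 obtain U where U: "U \<in> H k" using H_nonempty[OF K_subset[OF k]] by blast
 have "N * U \<in> H (g \<otimes> k)" using H_mult[OF g(1) K_subset[OF k] g(2) U] .
 then obtain z where z: "z \<in> cen" "N' = z * (N * U)" using H_coset[of "g \<otimes> k"] N' g K_subset[OF k] by auto
 have c1: "z * N = N * z" by (rule H_commute_cen[OF z(1) g(2)])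
 have c2: "adj N * adj z = adj z * adj N" using arg_cong[OF c1, of adj] by simp
 have "N' * adj N' = z * (N * (U * adj U) * adj N) * adj z" unfolding z(2) by (simp add: mult.assoc)
 also have "\<dots> = (z * N) * (adj N * adj z)" using K_unitary[OF k U] by (simp add: mult.assoc)
 also have "\<dots> = N * (z * adj z) * adj N" unfolding c1 c2 by (simp add: mult.assoc)
 also have "\<dots> = N * adj N" by (simp add: cen_unitary[OF z(1)])
 finally show ?thesis .
qed

lemma a_subspace: "subspace \<aa>" and a_symmetric: "Y \<in> \<aa> \<Longrightarrow> adj (T Y) = T Y"
 and a_commute: "X \<in> \<aa> \<Longrightarrow> Y \<in> \<aa> \<Longrightarrow> T X * T Y = T Y * T X"
proof -
 have a: "abelian_subspace_in G (cartan_p G \<theta>) \<aa>" using cart(2) by (simp add: maximal_abelian_in_def)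
 show "subspace \<aa>" using a by (simp add: abelian_subspace_in_def)
 show "adj (T Y) = T Y" if "Y \<in> \<aa>" using a that cartan_p_iff by (auto simp: abelian_subspace_in_def)
 show "T X * T Y = T Y * T X" if "X \<in> \<aa>" "Y \<in> \<aa>"
 proof -
  have "lie_bracket G X Y = 0" using a that by (simp add: abelian_subspace_in_def)
  then show ?thesis using T_bracket[of X Y] by (simp add: T_simps)
 qed
qed

lemma a_maximal:
 assumes Z: "adj (T Z) = T Z" and comm: "\<And>Y. Y \<in> \<aa> \<Longrightarrow> T Z * T Y = T Y * T Z"
 shows "Z \<in> \<aa>"
proof -
 let ?b = "span (insert Z \<aa>)"
 have dec: "\<exists>c Y. Y \<in> \<aa> \<and> X = c *\<^sub>R Z + Y" if X: "X \<in> ?b" for X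
 proof -
  obtain c where "X - c *\<^sub>R Z \<in> span \<aa>" using X span_breakdown_eq[of X Z \<aa>] by blast
  then have "X - c *\<^sub>R Z \<in> \<aa>" using span_eq_iff[THEN iffD2, OF a_subspace] by simp
  then show ?thesis by (intro exI[of _ c] exI[of _ "X - c *\<^sub>R Z"]) simp
 qed
 have "abelian_subspace_in G (cartan_p G \<theta>) ?b" unfolding abelian_subspace_in_def
 proof (intro conjI ballI subsetI)
  show "subspace ?b" by simp
  show "X \<in> cartan_p G \<theta>" if X: "X \<in> ?b" for X
  proof -
   obtain c Y where "Y \<in> \<aa>" "X = c *\<^sub>R Z + Y" using dec[OF X] by blast
   then show ?thesis using a_symmetric[of Y] Z by (simp add: cartan_p_iff T_simps)
  qed
  fix X X' assume X: "X \<in> ?b" and X': "X' \<in> ?b"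
  obtain c Y where Y: "Y \<in> \<aa>" "X = c *\<^sub>R Z + Y" using dec[OF X] by blast
  obtain c' Y' where Y': "Y' \<in> \<aa>" "X' = c' *\<^sub>R Z + Y'" using dec[OF X'] by blast
  have "T X * T X' = (c * c') *\<^sub>R (T Z * T Z) + c *\<^sub>R (T Z * T Y') + c' *\<^sub>R (T Y * T Z) + T Y * T Y'"
   unfolding Y(2) Y'(2) T_simps by (simp add: distrib_left distrib_right scaleR_right_distrib mult.commute)
  moreover have "T X' * T X = (c * c') *\<^sub>R (T Z * T Z) + c *\<^sub>R (T Y' * T Z) + c' *\<^sub>R (T Z * T Y) + T Y' * T Y"
   unfolding Y(2) Y'(2) T_simps by (simp add: distrib_left distrib_right scaleR_right_distrib mult.commute)
  ultimately have "T X * T X' - T X' * T X = 0"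
   unfolding comm[OF Y(1)] comm[OF Y'(1)] a_commute[OF Y(1) Y'(1)] by (metis diff_self)
  then have "T (lie_bracket G X X') = T 0" unfolding T_bracket T_simps .
  then show "lie_bracket G X X' = 0" by (simp add: T_eq_iff)
 qed
 moreover have "\<aa> \<subseteq> ?b" by (rule order_trans[OF subset_insertI span_superset])
 ultimately have "?b = \<aa>" using cart(2) by (simp add: maximal_abelian_in_def)
 moreover have "Z \<in> ?b" by (rule span_base) simp
 ultimately show ?thesis by simp
qed

lemma skew_expG_K: "adj (T X) = - T X \<Longrightarrow> expG X \<in> K"
proof -
 assume X: "adj (T X) = - T X"
 have "adj (exp (T X)) * exp (T X) = exp (- T X) * exp (- (- T X))" by (simp add: adj_exp X)
 also have "\<dots> = 1" by (rule exp_minus_inverse)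
 finally show ?thesis using K_iff[OF expG_carrier exp_H_expG] by simp
qed

end

section \<open>Weights in a joint eigenbasis and conjugation into \<open>\<aa>\<close>\<close>

locale satake_basis = satake_exp G K \<theta> \<aa> \<tau> T r0 C0 \<alpha>
 for G :: "('g, 'e::euclidean_space) lie_struct" (structure) and K :: "'g set" and \<theta> :: "'g \<Rightarrow> 'g"
  and \<aa> :: "'e set" and \<tau> :: "'g \<Rightarrow> 'n::finite cmat set"
  and T :: "'e \<Rightarrow> (complex^'n) endo" and r0 C0 :: real and \<alpha> :: "'e \<Rightarrow> 'e" +
 fixes S :: "(complex^'n) set"
 assumes S: "onb S" and joint: "\<And>Y b. Y \<in> \<aa> \<Longrightarrow> b \<in> S \<Longrightarrow> \<exists>r. app (T Y) b = r *\<^sub>R b"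
begin

text \<open>On \<open>\<aa>\<close> this is the weight with weight vector \<open>b\<close>; the
  formula extends it linearly to the whole Lie algebra, which keeps the linear algebra free of
  domain conditions.\<close>

definition wt :: "complex^'n \<Rightarrow> 'e \<Rightarrow> real" where
 "wt b Y = b \<bullet> app (T Y) b"

lemma app_T_basis: "Y \<in> \<aa> \<Longrightarrow> b \<in> S \<Longrightarrow> app (T Y) b = wt b Y *\<^sub>R b"
 using joint[of Y b] onb_inner[OF S, of b b] by (auto simp: wt_def)

lemma T_diag: "Y \<in> \<aa> \<Longrightarrow> T Y = diag S (\<lambda>b. wt b Y)" by (rule diag_eq[OF S app_T_basis])

lemma linear_wt: "linear (wt b)" by (rule linearI) (simp_all add: wt_def T_simps inner_simps)

text \<open>\<open>H0\<close> is chosen off the kernels of all nonzero differences of weights, so it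
  separates the joint eigenspaces. An operator commuting with \<open>T H0\<close> preserves these
  eigenspaces and thus commutes with all of \<open>T Y\<close>.\<close>

lemma regular_element: obtains H0 where "H0 \<in> \<aa>"
 "\<And>Z Y. Z * T H0 = T H0 * Z \<Longrightarrow> Y \<in> \<aa> \<Longrightarrow> Z * T Y = T Y * Z"
proof -
 let ?F = "(\<lambda>(b, c). \<lambda>Y. wt b Y - wt c Y) ` {(b, c) \<in> S \<times> S. \<exists>Y\<in>\<aa>. wt b Y \<noteq> wt c Y}"
 have "finite {(b, c) \<in> S \<times> S. \<exists>Y\<in>\<aa>. wt b Y \<noteq> wt c Y}"
  by (rule finite_subset[of _ "S \<times> S"]) (use onb_finite[OF S] in auto)
 then have fin: "finite ?F" by (rule finite_imageI)
 have "\<exists>H\<in>\<aa>. \<forall>f\<in>?F. f H \<noteq> 0"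
 proof (rule avoid_kernels[OF fin a_subspace])
  fix f assume "f \<in> ?F"
  then obtain b c where f: "f = (\<lambda>Y. wt b Y - wt c Y)" "\<exists>Y\<in>\<aa>. wt b Y \<noteq> wt c Y" by auto
  show "linear f" unfolding f(1) by (rule linear_compose_sub[OF linear_wt linear_wt])
  show "\<exists>Y\<in>\<aa>. f Y \<noteq> 0" using f by auto
 qed
 then obtain H0 where H0: "H0 \<in> \<aa>" "\<And>f. f \<in> ?F \<Longrightarrow> f H0 \<noteq> 0" by (elim bexE) blast
 have sep: "wt b Y = wt c Y" if "b \<in> S" "c \<in> S" "wt b H0 = wt c H0" "Y \<in> \<aa>" for b c Y
 proof (rule ccontr)
  assume "wt b Y \<noteq> wt c Y"
  then have "(\<lambda>Y. wt b Y - wt c Y) \<in> ?F" using that by force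
  from H0(2)[OF this] show False using that by simp
 qed
 have "Z * T Y = T Y * Z" if Z: "Z * T H0 = T H0 * Z" and Y: "Y \<in> \<aa>" for Z Y
 proof (rule endo_eq_onb[OF S])
  fix b assume b: "b \<in> S"
  show "app (Z * T Y) b = app (T Y * Z) b"
  proof (rule onb_eqI[OF S])
   fix c assume c: "c \<in> S"
   have sym: "app (T Q) v \<bullet> c = wt c Q * (v \<bullet> c)" if "Q \<in> \<aa>" for Q v
    using a_symmetric[OF that] app_T_basis[OF that c] by (simp add: inner_app)
   have "app (Z * T H0) b \<bullet> c = app (T H0 * Z) b \<bullet> c" using Z by simp
   then have "wt b H0 * (app Z b \<bullet> c) = wt c H0 * (app Z b \<bullet> c)" using app_T_basis[OF H0(1) b] sym[OF H0(1)] by simp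
   then have "app Z b \<bullet> c = 0 \<or> wt b Y = wt c Y" using sep[OF b c _ Y] by auto
   then show "app (Z * T Y) b \<bullet> c = app (T Y * Z) b \<bullet> c" using app_T_basis[OF Y b] sym[OF Y] by auto
  qed
 qed
 then show ?thesis using that[OF H0(1)] by blast
qed

text \<open>The trace pairing of \<open>Ad(k) P\<close> with a regular \<open>H0\<close> is
  maximised over the compact set of lifts of \<open>K\<close>. At a maximum the bracket of the
  conjugate \<open>P'\<close> with \<open>H0\<close> is orthogonal to all skew directions; being
  skew itself it vanishes, and regularity with maximality puts \<open>P'\<close> into
  \<open>\<aa>\<close>.\<close>

lemma conjugate_into_a:
 assumes P: "adj (T P) = T P"
 obtains k U Q where "k \<in> K" "U \<in> H k" "Q \<in> \<aa>" "T P = U * T Q * adj U"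
proof -
 obtain H0 where H0: "H0 \<in> \<aa>" "\<And>Z Y. Z * T H0 = T H0 * Z \<Longrightarrow> Y \<in> \<aa> \<Longrightarrow> Z * T Y = T Y * Z" by (rule regular_element) blast
 let ?f = "\<lambda>N. trc (N * T P * adj N * T H0)"
 have cf: "continuous_on (\<Union>k\<in>K. H k) ?f"
  by (intro bounded_linear.continuous_on[OF bounded_linear_trc] continuous_intros)
 have ne: "(\<Union>k\<in>K. H k) \<noteq> {}" using K_one H_one by blast
 from continuous_attains_sup[OF compact_UK ne cf]
 obtain N0 where N0: "N0 \<in> (\<Union>k\<in>K. H k)" and mx': "\<forall>N\<in>(\<Union>k\<in>K. H k). ?f N \<le> ?f N0" by (elim bexE)
 note mx = bspec[OF mx']
 from N0 obtain k0 where k0: "k0 \<in> K" "N0 \<in> H k0" by blast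
 note un = K_unitary[OF k0]
 define P' where "P' = Ad G k0 P"
 have TP': "T P' = N0 * T P * adj N0" unfolding P'_def
  using Ad(2)[OF K_subset[OF k0(1)] k0(2) H_K_adj[OF k0]] un by simp
 have P's: "adj (T P') = T P'" by (simp add: TP' P mult.assoc)
 define C where "C = T P' * T H0 - T H0 * T P'"
 \<comment> \<open>First variation along \<open>expG (t X) k0\<close>; skewness of
   \<open>T X\<close> keeps this curve in \<open>K\<close>.\<close>
 have crit: "trc (T X * C) = 0" if X: "adj (T X) = - T X" for X
 proof -
  let ?g = "\<lambda>t. trc (exp (t *\<^sub>R T X) * T P' * exp (t *\<^sub>R (- T X)) * T H0)"
  have eq: "?f (exp (t *\<^sub>R T X) * N0) = ?g t" for t
  proof -
   have "adj (exp (t *\<^sub>R T X)) = exp (t *\<^sub>R (- T X))" by (simp add: adj_exp X)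
   then show ?thesis by (simp only: TP' adj_simps(4) mult.assoc)
  qed
  have le: "?g t \<le> ?g 0" for t
  proof -
   have "adj (T (t *\<^sub>R X)) = - T (t *\<^sub>R X)" by (simp add: T_simps X)
   then have "expG (t *\<^sub>R X) \<otimes> k0 \<in> K" using K_mult[OF skew_expG_K k0(1)] by blast
   moreover have "exp (t *\<^sub>R T X) * N0 \<in> H (expG (t *\<^sub>R X) \<otimes> k0)"
    using H_mult[OF expG_carrier K_subset[OF k0(1)] exp_H_expG k0(2), of "t *\<^sub>R X"] by (simp add: T_simps)
   ultimately have "?f (exp (t *\<^sub>R T X) * N0) \<le> ?f N0" by (intro mx) blast
   then show ?thesis unfolding eq by (simp add: TP')
  qed
  have dE: "((\<lambda>t. exp (t *\<^sub>R A)) has_derivative (\<lambda>t. t *\<^sub>R A)) (at 0)" for A :: "(complex^'n) endo"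
   using exp_scaleR_has_vector_derivative_left[of A 0] by (simp add: has_vector_derivative_def)
  have "(?g has_derivative (\<lambda>t. trc ((exp (0 *\<^sub>R T X) * T P' * (t *\<^sub>R (- T X)) + t *\<^sub>R T X * T P' * exp (0 *\<^sub>R (- T X))) * T H0))) (at 0)"
   by (rule bounded_linear.has_derivative[OF bounded_linear_trc bounded_linear.has_derivative[OF bounded_linear_mult_left
      has_derivative_mult[OF bounded_linear.has_derivative[OF bounded_linear_mult_left dE] dE]]])
  moreover have "trc ((exp (0 *\<^sub>R T X) * T P' * (t *\<^sub>R (- T X)) + t *\<^sub>R T X * T P' * exp (0 *\<^sub>R (- T X))) * T H0)
    = t * trc (T X * C)" for t
  proof -
   have "trc ((exp (0 *\<^sub>R T X) * T P' * (t *\<^sub>R (- T X)) + t *\<^sub>R T X * T P' * exp (0 *\<^sub>R (- T X))) * T H0)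
    = t * (trc (T X * (T P' * T H0)) - trc (T P' * (T X * T H0)))"
    by (simp add: algebra_simps linear_simps[OF bounded_linear_trc])
   also have "trc (T P' * (T X * T H0)) = trc (T X * (T H0 * T P'))" by (subst trc_commute) (simp add: mult.assoc)
   finally show ?thesis by (simp add: C_def algebra_simps linear_simps[OF bounded_linear_trc])
  qed
  ultimately have "(?g has_derivative (\<lambda>t. t * trc (T X * C))) (at 0)" by simp
  then have "(?g has_real_derivative trc (T X * C)) (at 0)" unfolding has_field_derivative_def
   by (rule has_derivative_eq_rhs) (simp add: fun_eq_iff mult.commute)
  from DERIV_local_max[OF this zero_less_one] le show ?thesis by blast
 qed
 have adjC: "adj C = - C" using P's a_symmetric[OF H0(1)] by (simp add: C_def)
 have TC: "T (lie_bracket G P' H0) = C" by (simp add: T_bracket C_def)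
 \<comment> \<open>\<open>C\<close> is skew and is the image of a bracket under \<open>T\<close>, so
   it may serve as the test direction.\<close>
 have "trc (C * C) = 0" using crit[of "lie_bracket G P' H0"] adjC TC by simp
 then have "trc (adj C * C) = 0" by (simp add: adjC linear_simps[OF bounded_linear_trc])
 then have "C = 0" by (rule trc_adj_mult_self)
 then have "T P' * T H0 = T H0 * T P'" by (simp add: C_def)
 then have "P' \<in> \<aa>" using H0(2) by (intro a_maximal[OF P's]) blast
 moreover have "T P = adj N0 * T P' * adj (adj N0)"
 proof -
  have "adj N0 * T P' * N0 = (adj N0 * N0) * T P * (adj N0 * N0)" by (simp add: TP' mult.assoc)
  then show ?thesis using un by simp
 qed
 ultimately show ?thesis using that[OF K_inv[OF k0(1)] H_K_adj[OF k0]] by blast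
qed

end

section \<open>The Cartan decomposition by connectedness\<close>

context satake_exp
begin

definition pp :: "'e \<Rightarrow> 'e" where "pp Y = (1 / 2) *\<^sub>R (Y - diff_at_one G \<theta> Y)"
definition kp :: "'e \<Rightarrow> 'e" where "kp Y = (1 / 2) *\<^sub>R (Y + diff_at_one G \<theta> Y)"

lemma T_pp: "T (pp Y) = (1 / 2) *\<^sub>R (T Y + adj (T Y))" by (simp add: pp_def T_simps T_diff_theta)

lemma T_kp: "T (kp Y) = (1 / 2) *\<^sub>R (T Y - adj (T Y))" by (simp add: kp_def T_simps T_diff_theta)

lemma pp_kp: "pp Y + kp Y = Y" by (simp add: pp_def kp_def flip: scaleR_right_distrib)

lemma pp_symmetric: "adj (T (pp Y)) = T (pp Y)" and kp_skew: "adj (T (kp Y)) = - T (kp Y)"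
 by (simp_all add: T_pp T_kp add.commute flip: scaleR_minus_right)

lemma linear_pp: "linear pp" and linear_kp: "linear kp"
proof -
 have "T (pp (X + Y)) = T (pp X + pp Y)" "T (pp (r *\<^sub>R X)) = T (r *\<^sub>R pp X)"
  "T (kp (X + Y)) = T (kp X + kp Y)" "T (kp (r *\<^sub>R X)) = T (r *\<^sub>R kp X)" for X Y r
  by (simp_all add: T_pp T_kp T_simps algebra_simps)
 then show "linear pp" "linear kp" by (auto intro!: linearI simp: T_eq_iff)
qed

lemma pp_of_symmetric: "adj (T Y) = T Y \<Longrightarrow> pp Y = Y \<and> kp Y = 0" using T_eq_iff[of "pp Y" Y] T_eq_iff[of "kp Y" 0]
 by (simp add: T_pp T_kp T_simps flip: scaleR_2)

text \<open>The candidate \<open>exp(p) K\<close> for the whole group. It is shown to be open,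
  closed and a union of cosets of \<open>K\<close>, and connectedness of \<open>X\<close> does the
  rest.\<close>

definition expK :: "'g set" where
 "expK = {g \<in> carrier G. \<exists>P. adj (T P) = T P \<and> (\<exists>k\<in>K. g = expG P \<otimes> k)}"

lemma expK_symm: "adj (T P) = T P \<Longrightarrow> k \<in> K \<Longrightarrow> N \<in> H (expG P \<otimes> k) \<Longrightarrow> N * adj N = exp (T (2 *\<^sub>R P))"
proof -
 assume P: "adj (T P) = T P" and k: "k \<in> K" and N: "N \<in> H (expG P \<otimes> k)"
 have "exp (T P) * exp (T P) = exp (T (2 *\<^sub>R P))" by (simp add: T_simps scaleR_2 exp_add_commuting)
 then show ?thesis using symm_invariant_K[OF expG_carrier exp_H_expG k N] by (simp add: adj_exp P)
qed

text \<open>The lift \<open>exp (- T P) * N\<close> of \<open>expG (- P) \<otimes> g\<close> is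
  unitary, and elements with a unitary lift belong to \<open>K\<close>. So membership in
  \<open>expK\<close> can be tested on \<open>N * adj N\<close>, which is what passes to
  limits.\<close>

lemma expK_of_symm:
 assumes g: "g \<in> carrier G" "N \<in> H g" and P: "adj (T P) = T P" "N * adj N = exp (T (2 *\<^sub>R P))"
 shows "\<exists>k\<in>K. g = expG P \<otimes> k"
proof -
 let ?k = "expG (- P) \<otimes> g"
 let ?U = "exp (- T P) * N"
 have kc: "?k \<in> carrier G" using g by simp
 have U: "?U \<in> H ?k" using H_mult[OF expG_carrier g(1) exp_H_expG[of "- P"] g(2)] by (simp add: T_simps)
 have e: "exp (T P) * exp (- T P) = 1" "exp (- T P) * exp (T P) = 1"
  using exp_minus_inverse[of "T P"] exp_minus_inverse[of "- T P"] by simp_all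
 have "exp (T (2 *\<^sub>R P)) = exp (T P) * exp (T P)" by (simp add: T_simps scaleR_2 exp_add_commuting)
 then have "?U * adj ?U = (exp (- T P) * exp (T P)) * (exp (T P) * exp (- T P))"
  using P by (simp add: adj_exp mult.assoc) (simp flip: mult.assoc)
 then have U1: "?U * adj ?U = 1" using e by simp
 obtain V where "V * ?U = 1" by (rule H_inverse[OF kc U])
 then have "V = adj ?U" using U1 by (rule mult_inverse_unique)
 then have "adj ?U * ?U = 1" using \<open>V * ?U = 1\<close> by simp
 then have "?k \<in> K" using K_iff[OF kc U] by simp
 moreover have "g = expG P \<otimes> ?k"
 proof -
  have "expG P \<otimes> expG (- P) = \<one>" using expG_add[of 1 "- 1" P] by simp
  then show ?thesis using g(1) by (simp flip: m_assoc)
 qed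
 ultimately show ?thesis by blast
qed

text \<open>If \<open>g\<close> were approached from \<open>expK\<close>, lifts \<open>N'\<close>
  would converge to \<open>N\<close> with \<open>N' * adj N' = exp (2 T P)\<close>. Both
  \<open>N'\<close> and its inverse stay bounded, hence so do the \<open>P\<close>; a limit point
  \<open>Q\<close> of the \<open>P\<close> gives the same identity for \<open>N\<close> and puts
  \<open>g\<close> into \<open>expK\<close>.\<close>

lemma expK_complement_open: "openin GT (carrier G - expK)"
proof (subst openin_subopen, intro ballI)
 fix g assume g: "g \<in> carrier G - expK"
 then have gc: "g \<in> carrier G" by blast
 obtain N where N: "N \<in> H g" using H_nonempty[OF gc] by blast
 obtain M where M: "M * N = 1" "N * M = 1" by (rule H_inverse[OF gc N])
 define V where "V n = {h \<in> carrier G. \<exists>N'\<in>H h. norm (N' - N) < 1 / real (Suc n)}" for n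
 have V: "openin GT (V n)" "g \<in> V n" for n unfolding V_def using H_open gc N by (auto intro!: bexI[of _ N])
 have "\<exists>n. V n \<inter> expK = {}"
 proof (rule ccontr)
  assume "\<nexists>n. V n \<inter> expK = {}"
  then have "\<forall>n. \<exists>N' P. adj (T P) = T P \<and> norm (N' - N) < 1 / real (Suc n) \<and> N' * adj N' = exp (T (2 *\<^sub>R P))
    \<and> (\<exists>M'. M' * N' = 1 \<and> N' * M' = 1)"
  proof (intro allI)
   fix n
   assume "\<nexists>n. V n \<inter> expK = {}"
   then obtain h where h: "h \<in> V n" "h \<in> expK" by blast
   then obtain N' where N': "N' \<in> H h" "norm (N' - N) < 1 / real (Suc n)" by (auto simp: V_def)
   obtain P k where P: "adj (T P) = T P" "k \<in> K" "h = expG P \<otimes> k" using h by (auto simp: expK_def)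
   have "h \<in> carrier G" using h by (simp add: V_def)
   then obtain M' where "M' * N' = 1" "N' * M' = 1" by (rule H_inverse[OF _ N'(1)])
   then show "\<exists>N' P. adj (T P) = T P \<and> norm (N' - N) < 1 / real (Suc n) \<and> N' * adj N' = exp (T (2 *\<^sub>R P))
    \<and> (\<exists>M'. M' * N' = 1 \<and> N' * M' = 1)" using N' P expK_symm[OF P(1,2)] by blast
  qed
  then obtain N' P M' where P: "\<And>n. adj (T (P n)) = T (P n)" and N': "\<And>n. norm (N' n - N) < 1 / real (Suc n)"
   and e: "\<And>n. N' n * adj (N' n) = exp (T (2 *\<^sub>R P n))" and M': "\<And>n. M' n * N' n = 1" "\<And>n. N' n * M' n = 1" by metis
  have lim: "N' \<longlonglongrightarrow> N"
  proof (rule LIM_zero_cancel, rule Lim_null_comparison)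
   show "\<forall>\<^sub>F n in sequentially. norm (N' n - N) \<le> 1 / real (Suc n)" by (intro always_eventually allI less_imp_le N')
   show "(\<lambda>n. 1 / real (Suc n)) \<longlonglongrightarrow> 0" using LIMSEQ_inverse_real_of_nat by (simp add: inverse_eq_divide)
  qed
  have ev: "\<forall>\<^sub>F n in sequentially. norm (N' n - N) < 1 / (2 * (norm M + 1))"
   using tendstoD[OF lim, of "1 / (2 * (norm M + 1))"] by (simp add: dist_norm add_nonneg_pos)
  \<comment> \<open>The first entry bounds \<open>N' * adj N'\<close>, the second its inverse,
    because the inverse of \<open>N'\<close> eventually has norm at most
    \<open>2 * norm M\<close>.\<close>
  define c where "c = max ((norm N + 1)\<^sup>2) ((2 * norm M)\<^sup>2)"
  have "\<forall>\<^sub>F n in sequentially. norm (T (P n)) \<le> c" using ev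
  proof eventually_elim
   case (elim n)
   have m: "norm M + 1 > 0" by (rule add_nonneg_pos[OF norm_ge_zero zero_less_one])
   have h: "1 / (2 * x) * x = 1 / 2" if "x > 0" for x :: real using that by simp
   have "norm (N' n - N) * norm M \<le> 1 / (2 * (norm M + 1)) * (norm M + 1)"
    by (rule mult_mono[OF less_imp_le[OF elim]]) (use m in simp_all)
   also have "\<dots> = 1 / 2" by (rule h[OF m])
   finally have "norm (M' n) \<le> 2 * norm M" by (rule norm_inverse_perturbed_le[OF M'(1) M(2)])
   moreover have ex: "exp (- T (2 *\<^sub>R P n)) = adj (M' n) * M' n"
   proof -
    have "exp (- T (2 *\<^sub>R P n)) * exp (T (2 *\<^sub>R P n)) = 1" using exp_minus_inverse[of "- T (2 *\<^sub>R P n)"] by simp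
    moreover have "exp (T (2 *\<^sub>R P n)) * (adj (M' n) * M' n) = 1"
    proof -
     have "adj (N' n) * adj (M' n) = 1" using M'(1)[of n] by (metis adj_simps(4,5))
     then have "N' n * adj (N' n) * (adj (M' n) * M' n) = 1"
      using M'(2)[of n] by (simp add: mult.assoc) (simp flip: mult.assoc)
     then show ?thesis by (simp add: e)
    qed
    ultimately show ?thesis by (rule mult_inverse_unique)
   qed
   ultimately have 1: "norm (exp (- T (2 *\<^sub>R P n))) \<le> c"
    unfolding ex norm_adj_mult c_def by (intro max.coboundedI2 power_mono) auto
   have "norm (N' n) \<le> norm N + 1"
   proof -
    have "1 / real (Suc n) \<le> 1" by simp
    then show ?thesis using N'[of n] norm_triangle_ineq2[of "N' n" N] by linarith
   qed
   then have 2: "norm (exp (T (2 *\<^sub>R P n))) \<le> c"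
    unfolding e[symmetric] norm_mult_adj c_def by (intro max.coboundedI1 power_mono) auto
   have "adj (T (2 *\<^sub>R P n)) = T (2 *\<^sub>R P n)" by (simp add: T_simps P)
   from symmetric_norm_le_of_exp[OF this 2 1] have "exp (norm (T (2 *\<^sub>R P n))) \<le> c" .
   then have "norm (T (2 *\<^sub>R P n)) \<le> c" using exp_ge_add_one_self[of "norm (T (2 *\<^sub>R P n))"] by linarith
   moreover have "norm (T (2 *\<^sub>R P n)) = 2 * norm (T (P n))" by (simp add: T_simps)
   ultimately show ?case using norm_ge_zero[of "T (P n)"] by linarith
  qed
  then obtain m where m: "\<And>n. n \<ge> m \<Longrightarrow> norm (T (P n)) \<le> c" unfolding eventually_sequentially by blast
  obtain c' where c': "c' > 0" "\<And>x. norm x \<le> c' * norm (T x)" by (rule T_lower) blast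
  have "norm (P (n + m)) \<le> c' * c" for n using order_trans[OF c'(2) mult_left_mono[OF m[of "n + m"]]] c'(1) by simp
  then have "bounded (range (\<lambda>n. P (n + m)))" unfolding bounded_iff by blast
  from bounded_imp_convergent_subsequence[OF this] obtain Q s where Q: "strict_mono s" "((\<lambda>n. P (n + m)) \<circ> s) \<longlonglongrightarrow> Q" by blast
  have TQ: "(\<lambda>n. T (P (s n + m))) \<longlonglongrightarrow> T Q" using bounded_linear.tendsto[OF T_bl Q(2)] by (simp add: comp_def)
  have "adj (T Q) = T Q" using LIMSEQ_unique[OF tendsto_adj[OF TQ]] TQ by (simp add: P)
  moreover have "N * adj N = exp (T (2 *\<^sub>R Q))"
  proof (rule LIMSEQ_unique)
   have "(\<lambda>n. N' (s n + m)) \<longlonglongrightarrow> N"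
    using LIMSEQ_subseq_LIMSEQ[OF LIMSEQ_ignore_initial_segment[OF lim, of m] Q(1)] by (simp add: comp_def)
   then show "(\<lambda>n. N' (s n + m) * adj (N' (s n + m))) \<longlonglongrightarrow> N * adj N" by (intro tendsto_intros)
   have "continuous_on UNIV (\<lambda>A :: (complex^'n) endo. exp (2 *\<^sub>R A))" by (intro continuous_intros)
   from continuous_on_tendsto_compose[OF this TQ]
   show "(\<lambda>n. N' (s n + m) * adj (N' (s n + m))) \<longlonglongrightarrow> exp (T (2 *\<^sub>R Q))" by (simp add: e T_simps)
  qed
  ultimately have "g \<in> expK" using expK_of_symm[OF gc N] gc by (auto simp: expK_def)
  then show False using g by blast
 qed
 then obtain n where "V n \<inter> expK = {}" by blast
 then show "\<exists>U. openin GT U \<and> g \<in> U \<and> U \<subseteq> carrier G - expK" using V openin_G_subset by (intro exI[of _ "V n"]) blast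
qed

text \<open>The map \<open>f Y = expG (pp Y) \<otimes> expG (kp Y)\<close> is continuous and
  injective near the symmetric \<open>P\<close>, between spaces of equal dimension, so invariance of
  domain makes its image a neighbourhood of \<open>expG P\<close>. Right translation by
  \<open>k\<close> moves this to \<open>g\<close>.\<close>

lemma expK_open: "openin GT expK"
proof (subst openin_subopen, intro ballI)
 fix g assume "g \<in> expK"
 then obtain P k where g: "g \<in> carrier G" and P: "adj (T P) = T P" and k: "k \<in> K" "g = expG P \<otimes> k"
  by (auto simp: expK_def)
 obtain \<eta> where \<eta>: "\<eta> > 0" "\<eta> \<le> 1 / 2"
  "\<And>z. z \<in> (cen :: (complex^'n) endo set) \<Longrightarrow> norm (z - 1) < 4 * \<eta> \<Longrightarrow> z = 1" by (rule cen_separated) blast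
 define s where "s = \<eta> / 2"
 have s: "s > 0" "s \<le> 1 / 2" "2 * s \<le> \<eta>" using \<eta> by (auto simp: s_def)
 \<comment> \<open>Only the skew part is restricted: on symmetric operators \<open>exp\<close> is
   injective globally, whereas on skew ones injectivity is available only near 0.\<close>
 define \<Omega> where "\<Omega> = {Y. norm (T (kp Y)) < s}"
 define f where "f Y = expG (pp Y) \<otimes> expG (kp Y)" for Y
 have cl: "continuous_on UNIV pp" "continuous_on UNIV kp"
  by (simp_all add: linear_continuous_on linear_conv_bounded_linear[THEN iffD1] linear_pp linear_kp)
 have open\<Omega>: "open \<Omega>"
 proof -
  have "continuous_on UNIV (\<lambda>Y. norm (T (kp Y)))"
   by (intro continuous_on_norm bounded_linear.continuous_on[OF T_bl] cl)
  then show ?thesis unfolding \<Omega>_def by (rule open_Collect_less) (intro continuous_intros)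
 qed
 have cf: "continuous_map (top_of_set A) GT f" for A
 proof -
  have "continuous_map euclidean GT (\<lambda>Y. expG (pp Y))" "continuous_map euclidean GT (\<lambda>Y. expG (kp Y))"
   using continuous_map_compose[of euclidean euclidean pp, OF _ continuous_expG]
    continuous_map_compose[of euclidean euclidean kp, OF _ continuous_expG] cl by (simp_all add: comp_def)
  then have "continuous_map euclidean GT f" unfolding f_def by (rule continuous_map_mult_G)
  then show ?thesis by (rule continuous_map_from_subtopology)
 qed
 have near: "norm (exp (T (kp Y)) - 1) < \<eta>" if "Y \<in> \<Omega>" for Y
 proof -
  let ?A = "T (kp Y)"
  have A: "norm ?A < s" using that by (simp add: \<Omega>_def)
  have "norm (exp ?A - 1) \<le> norm (exp ?A - 1 - ?A) + norm ?A"
   using norm_triangle_ineq[of "exp ?A - 1 - ?A" ?A] by simp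
  also have "\<dots> \<le> (norm ?A)\<^sup>2 + norm ?A" using exp_second_order[of ?A] A s by simp
  also have "\<dots> \<le> 1 * norm ?A + norm ?A" unfolding power2_eq_square using A s by (intro add_mono mult_right_mono) auto
  finally show ?thesis using A s by simp
 qed
 have inj: "inj_on f \<Omega>"
 proof (rule inj_onI)
  fix Y Y' assume Y: "Y \<in> \<Omega>" "Y' \<in> \<Omega>" and eq: "f Y = f Y'"
  have fc: "f Y \<in> carrier G" by (simp add: f_def)
  obtain N where N: "N \<in> H (f Y)" using H_nonempty[OF fc] by blast
  have "N * adj N = exp (T (2 *\<^sub>R pp Y))"
   by (rule expK_symm[OF pp_symmetric skew_expG_K[OF kp_skew]]) (use N in \<open>simp add: f_def\<close>)
  moreover have "N * adj N = exp (T (2 *\<^sub>R pp Y'))"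
   by (rule expK_symm[OF pp_symmetric skew_expG_K[OF kp_skew]]) (use N eq in \<open>simp add: f_def\<close>)
  ultimately have "exp (T (2 *\<^sub>R pp Y)) = exp (T (2 *\<^sub>R pp Y'))" by simp
  then have "T (2 *\<^sub>R pp Y) = T (2 *\<^sub>R pp Y')"
   by (rule symmetric_exp_inj[rotated 2]) (simp_all add: T_simps pp_symmetric)
  then have p: "pp Y = pp Y'" by (simp add: T_eq_iff)
  then have "expG (kp Y) = expG (kp Y')" using eq by (simp add: f_def)
  then have "exp (T (kp Y')) \<in> H (expG (kp Y))" using exp_H_expG[of "kp Y'"] by simp
  from H_near_one_unique[OF \<eta>(2,3) expG_carrier exp_H_expG this near[OF Y(1)] near[OF Y(2)]]
  have "exp (T (kp Y)) = exp (T (kp Y'))" by simp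
  then have "T (kp Y) = T (kp Y')" by (rule exp_small_injective[rotated 2]) (use Y s in \<open>auto simp: \<Omega>_def\<close>)
  then have "kp Y = kp Y'" by (simp add: T_eq_iff)
  then show "Y = Y'" using p pp_kp by metis
 qed
 obtain U \<phi> where U: "(U, \<phi>) \<in> lie_atlas G" "expG P \<in> U" using carrier_atlas[OF expG_carrier] by blast
 define \<Omega>' where "\<Omega>' = {Y \<in> \<Omega>. f Y \<in> U}"
 have open\<Omega>': "open \<Omega>'" unfolding \<Omega>'_def by (rule open_preimage_G[OF cf open\<Omega> chart_open[OF U(1)]])
 have "continuous_on \<Omega>' (\<phi> \<circ> f)" unfolding continuous_on_open_vimage[OF open\<Omega>']
 proof (intro allI impI)
  fix B :: "'e set" assume "open B"
  have "open {Y \<in> \<Omega>'. f Y \<in> {g \<in> U. \<phi> g \<in> B}}"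
   by (rule open_preimage_G[OF cf open\<Omega>' chart_preimage[OF U(1) \<open>open B\<close>]])
  moreover have "{Y \<in> \<Omega>'. f Y \<in> {g \<in> U. \<phi> g \<in> B}} = (\<phi> \<circ> f) -` B \<inter> \<Omega>'" by (auto simp: \<Omega>'_def)
  ultimately show "open ((\<phi> \<circ> f) -` B \<inter> \<Omega>')" by simp
 qed
 moreover have "inj_on (\<phi> \<circ> f) \<Omega>'"
  by (rule comp_inj_on[OF inj_on_subset[OF inj] inj_on_subset[OF chart_inj[OF U(1)]]]) (auto simp: \<Omega>'_def)
 ultimately have "open ((\<phi> \<circ> f) ` \<Omega>')" by (intro invariance_of_domain open\<Omega>')
 from chart_preimage[OF U(1) this] have "openin GT {g \<in> U. \<phi> g \<in> (\<phi> \<circ> f) ` \<Omega>'}" .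
 moreover have "{g \<in> U. \<phi> g \<in> (\<phi> \<circ> f) ` \<Omega>'} = f ` \<Omega>'" using inj_onD[OF chart_inj[OF U(1)]] by (force simp: \<Omega>'_def)
 ultimately have of: "openin GT (f ` \<Omega>')" by simp
 let ?V = "{h \<in> carrier G. h \<otimes> inv k \<in> f ` \<Omega>'}"
 have kc: "k \<in> carrier G" by (rule K_subset[OF k(1)])
 have "continuous_map GT GT (\<lambda>h. h \<otimes> inv k)" using kc by (intro continuous_map_mult_G) auto
 from openin_continuous_map_preimage[OF this of] have oV: "openin GT ?V" by simp
 have "P \<in> \<Omega>'" "f P = expG P" using pp_of_symmetric[OF P] U(2) s by (auto simp: \<Omega>'_def \<Omega>_def f_def T_simps)
 moreover have "g \<otimes> inv k = expG P" using kc by (simp add: k(2) m_assoc)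
 ultimately have gV: "g \<in> ?V" using g by force
 have "?V \<subseteq> expK"
 proof
  fix h assume "h \<in> ?V"
  then obtain Y where h: "h \<in> carrier G" "h \<otimes> inv k = expG (pp Y) \<otimes> expG (kp Y)" by (auto simp: f_def)
  have "h = (h \<otimes> inv k) \<otimes> k" using h(1) kc by (simp add: m_assoc)
  also have "\<dots> = expG (pp Y) \<otimes> (expG (kp Y) \<otimes> k)" unfolding h(2) using kc by (simp add: m_assoc)
  finally show "h \<in> expK" using h(1) K_mult[OF skew_expG_K[OF kp_skew] k(1)] pp_symmetric by (auto simp: expK_def)
 qed
 then show "\<exists>V. openin GT V \<and> g \<in> V \<and> V \<subseteq> expK" using oV gV by blast
qed

lemma expK_coset: "g \<in> carrier G \<Longrightarrow> h \<in> expK \<Longrightarrow> g <# K = h <# K \<Longrightarrow> g \<in> expK"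
proof -
 assume g: "g \<in> carrier G" and h: "h \<in> expK" and eq: "g <# K = h <# K"
 obtain P k where P: "adj (T P) = T P" "k \<in> K" "h = expG P \<otimes> k" and hc: "h \<in> carrier G"
  using h by (auto simp: expK_def)
 obtain k' where k': "k' \<in> K" "g = h \<otimes> k'" using coset_eq_iff[OF hc g] eq by auto
 have "g = expG P \<otimes> (k \<otimes> k')" using k'(2) P(3) K_subset[OF P(2)] K_subset[OF k'(1)] by (simp add: m_assoc)
 then show "g \<in> expK" using g P K_mult[OF P(2) k'(1)] by (auto simp: expK_def)
qed

text \<open>As \<open>expK\<close> is a union of cosets, its image and the image of its complement
  are disjoint open sets covering the connected space \<open>X\<close>, and the first is
  nonempty.\<close>

theorem cartan_decomposition:
 assumes g: "g \<in> carrier G"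
 obtains P k where "adj (T P) = T P" "k \<in> K" "g = expG P \<otimes> k"
proof -
 have "g \<in> expK"
 proof (rule ccontr)
  assume ng: "g \<notin> expK"
  let ?q = "\<lambda>g. g <# K"
  have sub: "expK \<subseteq> carrier G" by (auto simp: expK_def)
  have dis: False if "a \<in> expK" "b \<in> carrier G - expK" "?q a = ?q b" for a b using expK_coset[of b a] that by simp
  have p1: "{h \<in> carrier G. ?q h \<in> ?q ` expK} = expK"
  proof (intro equalityI subsetI)
   fix x assume "x \<in> {h \<in> carrier G. ?q h \<in> ?q ` expK}"
   then obtain h where "x \<in> carrier G" "h \<in> expK" "?q x = ?q h" by blast
   then show "x \<in> expK" by (rule expK_coset)
  qed (use sub in blast)
  have p2: "{h \<in> carrier G. ?q h \<in> ?q ` (carrier G - expK)} = carrier G - expK"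
  proof (intro equalityI subsetI)
   fix x assume "x \<in> {h \<in> carrier G. ?q h \<in> ?q ` (carrier G - expK)}"
   then obtain h where "x \<in> carrier G" "h \<in> carrier G - expK" "?q x = ?q h" by blast
   then show "x \<in> carrier G - expK" using dis by blast
  qed blast
  have im: "?q ` A \<subseteq> lcosets K" if "A \<subseteq> carrier G" for A using that lcosets_in by blast
  have "openin (sym_top G K) (?q ` expK)" "openin (sym_top G K) (?q ` (carrier G - expK))"
   unfolding openin_sym_top p1 p2 using expK_open expK_complement_open im[OF sub] im[OF Diff_subset] by simp_all
  moreover have "topspace (sym_top G K) \<subseteq> ?q ` expK \<union> ?q ` (carrier G - expK)"
  proof
   fix x assume "x \<in> topspace (sym_top G K)"
   then obtain h where "h \<in> carrier G" "x = ?q h" unfolding topspace_sym_top lcosets_iff by blast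
   then show "x \<in> ?q ` expK \<union> ?q ` (carrier G - expK)" by blast
  qed
  moreover have "?q ` expK \<inter> ?q ` (carrier G - expK) = {}"
  proof (rule ccontr)
   assume "?q ` expK \<inter> ?q ` (carrier G - expK) \<noteq> {}"
   then obtain a b where "a \<in> expK" "b \<in> carrier G - expK" "?q a = ?q b" by blast
   then show False by (rule dis)
  qed
  moreover have "?q ` (carrier G - expK) \<noteq> {}" using g ng by blast
  moreover have "\<one> \<in> expK" using K_one by (auto simp: expK_def T_simps intro!: exI[of _ 0] bexI[of _ "\<one>"])
  then have "?q ` expK \<noteq> {}" by blast
  ultimately have "\<not> connected_space (sym_top G K)" unfolding connected_space_def not_not
   by (intro exI[of _ "?q ` expK"] exI[of _ "?q ` (carrier G - expK)"] conjI)
  then show False using cart(4) by contradiction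
 qed
 then show ?thesis using that by (auto simp: expK_def)
qed

end

context satake_basis
begin

text \<open>The right factor in \<open>K\<close> disappears from \<open>N * adj N\<close>; what
  remains is the exponential of a symmetric operator, which is conjugated into
  \<open>\<aa>\<close>.\<close>

lemma KAK:
 assumes g: "g \<in> carrier G" "N \<in> H g"
 obtains k U Q where "k \<in> K" "U \<in> H k" "Q \<in> \<aa>" "N * adj N = U * exp (2 *\<^sub>R T Q) * adj U"
proof -
 obtain P k where P: "adj (T P) = T P" "k \<in> K" "g = expG P \<otimes> k" by (rule cartan_decomposition[OF g(1)])
 have e: "N * adj N = exp (T (2 *\<^sub>R P))" by (rule expK_symm[OF P(1,2)]) (use g P in simp)
 obtain k' U Q where Q: "k' \<in> K" "U \<in> H k'" "Q \<in> \<aa>" "T P = U * T Q * adj U" by (rule conjugate_into_a[OF P(1)])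
 have "T (2 *\<^sub>R P) = U * (2 *\<^sub>R T Q) * adj U" by (simp add: T_simps Q(4))
 then have "N * adj N = U * exp (2 *\<^sub>R T Q) * adj U"
  using e exp_conj[of "adj U" U "2 *\<^sub>R T Q"] K_unitary[OF Q(1,2)] by simp
 then show ?thesis using that Q by blast
qed

end

section \<open>Smooth functions and tangent vectors on the symmetric space\<close>

context satake_exp
begin

definition smoothG :: "('g \<Rightarrow> 'b::real_normed_vector) \<Rightarrow> bool" where
 "smoothG F \<longleftrightarrow> (\<forall>(U, \<phi>)\<in>lie_atlas G. smooth_on (\<phi> ` U) (\<lambda>x. F (inv_into U \<phi> x)))"

lemma smoothG_chart: "smoothG F \<Longrightarrow> (U, \<phi>) \<in> lie_atlas G \<Longrightarrow> smooth_on (\<phi> ` U) (\<lambda>x. F (inv_into U \<phi> x))"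
 by (auto simp: smoothG_def)

lemma smooth_fun_iff: "smooth_fun G K f \<longleftrightarrow> smoothG (\<lambda>g. f (g <# K))" by (simp add: smooth_fun_def smoothG_def)

lemma smoothG_cong:
 assumes eq: "\<And>g. g \<in> carrier G \<Longrightarrow> F g = F' g" and F: "smoothG F"
 shows "smoothG F'" unfolding smoothG_def
proof clarify
 fix U \<phi> assume c: "(U, \<phi>) \<in> lie_atlas G"
 show "smooth_on (\<phi> ` U) (\<lambda>x. F' (inv_into U \<phi> x))"
 proof (rule smooth_on_cong[OF chart_image_open[OF c] _ smoothG_chart[OF F c]])
  fix x assume "x \<in> \<phi> ` U"
  then show "F (inv_into U \<phi> x) = F' (inv_into U \<phi> x)" using chart_inv_in[OF c] chart_subset[OF c] by (intro eq) blast
 qed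
qed

lemma smooth_mult:
 assumes F: "smoothG F" and U: "(U, \<phi>) \<in> lie_atlas G" and V: "(V, \<psi>) \<in> lie_atlas G"
 shows "smooth_on (\<phi> ` U \<times> \<psi> ` V) (\<lambda>p. F (inv_into U \<phi> (fst p) \<otimes> inv_into V \<psi> (snd p)))"
proof (rule smooth_on_local)
 fix p assume p: "p \<in> \<phi> ` U \<times> \<psi> ` V"
 let ?m = "\<lambda>p. inv_into U \<phi> (fst p) \<otimes> inv_into V \<psi> (snd p)"
 have "?m p \<in> carrier G" using p chart_inv_in[OF U] chart_inv_in[OF V] chart_subset[OF U] chart_subset[OF V]
  by (intro m_closed) (auto simp: subset_iff)
 then obtain W \<eta> where W: "(W, \<eta>) \<in> lie_atlas G" "?m p \<in> W" using carrier_atlas by blast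
 let ?D = "{p \<in> \<phi> ` U \<times> \<psi> ` V. ?m p \<in> W}"
 note sm = smooth_chart_mult[OF U V W(1)]
 have "smooth_on ?D (\<lambda>p. F (inv_into W \<eta> (\<eta> (?m p))))"
  by (rule smooth_on_compose[OF sm(1) chart_image_open[OF W(1)] _ smoothG_chart[OF F W(1)] sm(2)]) auto
 then have "smooth_on ?D (\<lambda>p. F (?m p))" by (rule smooth_on_cong[OF sm(1), rotated]) (simp add: chart_inv[OF W(1)])
 then show "\<exists>D. open D \<and> p \<in> D \<and> smooth_on D (\<lambda>p. F (?m p))" using sm(1) p W(2) by blast
qed

lemma smooth_mult_from_coord:
 assumes F: "smoothG F" and U: "(U, \<phi>) \<in> lie_atlas G"
 shows "open (\<phi> ` U \<times> Wc)" "smooth_on (\<phi> ` U \<times> Wc) (\<lambda>p. F (inv_into U \<phi> (fst p) \<otimes> fc (snd p)))"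
proof -
 let ?c = "\<phi>0 \<one>"
 show o: "open (\<phi> ` U \<times> Wc)" by (rule open_Times[OF chart_image_open[OF U] open_Wc])
 have "smooth_on (\<phi> ` U \<times> Wc) (\<lambda>p. (0 + fst p, ?c + snd p))"
  by (intro smooth_on_Pair[OF o] bounded_linear_shift_smooth[OF o] bounded_linear_fst bounded_linear_snd)
 then have "smooth_on (\<phi> ` U \<times> Wc) (\<lambda>p. F (inv_into U \<phi> (fst (0 + fst p, ?c + snd p)) \<otimes>
   inv_into W0 \<phi>0 (snd (0 + fst p, ?c + snd p))))"
  by (intro smooth_on_compose[OF o open_Times[OF chart_image_open[OF U] chart_image_open[OF id_chart(1)]] _
     smooth_mult[OF F U id_chart(1)]]) (auto simp: Wc_def)
 then show "smooth_on (\<phi> ` U \<times> Wc) (\<lambda>p. F (inv_into U \<phi> (fst p) \<otimes> fc (snd p)))" by (simp add: from_coord_def)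
qed

lemma smoothG_translate:
 assumes g: "g \<in> carrier G" and F: "smoothG F"
 shows "smoothG (\<lambda>h. F (g \<otimes> h))" unfolding smoothG_def
proof clarify
 fix V \<psi> assume V: "(V, \<psi>) \<in> lie_atlas G"
 obtain U \<phi> where U: "(U, \<phi>) \<in> lie_atlas G" "g \<in> U" using carrier_atlas[OF g] by blast
 have o: "open (\<psi> ` V)" by (rule chart_image_open[OF V])
 have "smooth_on (\<psi> ` V) (\<lambda>z. (\<phi> g, 0 + z))"
  by (intro smooth_on_Pair[OF o] smooth_on_const bounded_linear_shift_smooth[OF o] bounded_linear_ident)
 then have "smooth_on (\<psi> ` V) (\<lambda>z. F (inv_into U \<phi> (fst (\<phi> g, 0 + z)) \<otimes> inv_into V \<psi> (snd (\<phi> g, 0 + z))))"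
  by (intro smooth_on_compose[OF o open_Times[OF chart_image_open[OF U(1)] o] _ smooth_mult[OF F U(1) V]])
   (use U in auto)
 then show "smooth_on (\<psi> ` V) (\<lambda>x. F (g \<otimes> inv_into V \<psi> x))" by (simp add: chart_inv[OF U(1) U(2)])
qed

text \<open>The derivative of \<open>F\<close> at \<open>g\<close> along left-invariant vector
  fields.\<close>

definition dF :: "('g \<Rightarrow> 'b::real_normed_vector) \<Rightarrow> 'g \<Rightarrow> 'e \<Rightarrow> 'b" where
 "dF F g = frechet_derivative (\<lambda>z. F (g \<otimes> fc z)) (at 0)"

lemma dF_partial:
 assumes F: "smoothG F" and U: "(U, \<phi>) \<in> lie_atlas G" and x: "x \<in> \<phi> ` U"
 defines "m \<equiv> \<lambda>p. F (inv_into U \<phi> (fst p) \<otimes> fc (snd p))"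
 shows "((\<lambda>z. F (inv_into U \<phi> x \<otimes> fc z)) has_derivative
  (\<lambda>v. frechet_derivative m (at (x, 0)) (0, v))) (at 0)"
proof -
 have "(m has_derivative frechet_derivative m (at (x, 0))) (at (x, 0))"
  unfolding m_def by (rule smooth_on_differentiable[OF smooth_mult_from_coord(2,1)[OF F U]]) (use x zero_Wc in auto)
 moreover have "((\<lambda>z. (x, z)) has_derivative (\<lambda>v. (0, v))) (at 0)" by (auto intro!: derivative_eq_intros)
 ultimately show ?thesis using has_derivative_compose[of "\<lambda>z. (x, z)" "\<lambda>v. (0, v)" 0 UNIV m] by (simp add: m_def)
qed

lemma dF: "smoothG F \<Longrightarrow> g \<in> carrier G \<Longrightarrow> ((\<lambda>z. F (g \<otimes> fc z)) has_derivative dF F g) (at 0)"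
proof -
 assume F: "smoothG F" and g: "g \<in> carrier G"
 obtain U \<phi> where U: "(U, \<phi>) \<in> lie_atlas G" "g \<in> U" using carrier_atlas[OF g] by blast
 have "(\<lambda>z. F (g \<otimes> fc z)) differentiable (at 0)"
  using dF_partial[OF F U(1) imageI[OF U(2)]] chart_inv[OF U] by (auto simp: differentiable_def)
 then show ?thesis unfolding dF_def by (simp add: frechet_derivative_works)
qed

lemma dF_eqI:
 "((\<lambda>z. F (g \<otimes> fc z)) has_derivative D) (at 0) \<Longrightarrow> dF F g = D"
 unfolding dF_def by (simp add: frechet_derivative_at[symmetric])

lemma linear_dF: "smoothG F \<Longrightarrow> g \<in> carrier G \<Longrightarrow> linear (dF F g)" by (rule has_derivative_linear[OF dF])

text \<open>In a chart this is a partial derivative, at second argument 0, of a function smooth in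
  both arguments. It provides the continuous derivative that makes geodesics
  \<open>C^1\<close>.\<close>

lemma continuous_dF:
 fixes F :: "'g \<Rightarrow> real"
 assumes F: "smoothG F"
 shows "continuous_map GT euclideanreal (\<lambda>g. dF F g Y)" unfolding continuous_map_def
proof (intro conjI allI impI)
 fix B :: "real set" assume "openin euclideanreal B"
 then have B: "open B" by simp
 show "openin GT {g \<in> topspace GT. dF F g Y \<in> B}"
 proof (subst openin_subopen, intro ballI)
  fix g assume g: "g \<in> {g \<in> topspace GT. dF F g Y \<in> B}"
  then have gc: "g \<in> carrier G" by simp
  obtain U \<phi> where U: "(U, \<phi>) \<in> lie_atlas G" "g \<in> U" using carrier_atlas[OF gc] by blast
  let ?m = "\<lambda>p. F (inv_into U \<phi> (fst p) \<otimes> fc (snd p))"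
  let ?h = "\<lambda>x. frechet_derivative ?m (at (x, 0)) (0, Y)"
  have eq: "dF F (inv_into U \<phi> x) Y = ?h x" if "x \<in> \<phi> ` U" for x using dF_eqI[OF dF_partial[OF F U(1) that]] by simp
  have "continuous_on (\<phi> ` U \<times> Wc) (\<lambda>p. frechet_derivative ?m (at p) (0, Y))"
   by (rule smooth_on_continuous[OF smooth_on_derivative[OF smooth_mult_from_coord(2)[OF F U(1)]]])
  then have "continuous_on (\<phi> ` U) ?h"
   by (rule continuous_on_compose2[of _ _ _ "\<lambda>x. (x, 0)"]) (use zero_Wc in \<open>auto intro!: continuous_intros\<close>)
  then have "open (?h -` B \<inter> \<phi> ` U)" using B chart_image_open[OF U(1)] continuous_on_open_vimage by blast
  from chart_preimage[OF U(1) this] have "openin GT {g \<in> U. \<phi> g \<in> ?h -` B \<inter> \<phi> ` U}" .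
  moreover have "{g \<in> U. \<phi> g \<in> ?h -` B \<inter> \<phi> ` U} = {g \<in> U. dF F g Y \<in> B}"
   using eq[OF imageI] chart_inv[OF U(1)] by auto
  ultimately show "\<exists>T. openin GT T \<and> g \<in> T \<and> T \<subseteq> {g \<in> topspace GT. dF F g Y \<in> B}"
   using g U(2) chart_subset[OF U(1)] by (intro exI[of _ "{g \<in> U. dF F g Y \<in> B}"]) auto
 qed
qed simp

lemma dF_chain:
 fixes c :: "'a::euclidean_space \<Rightarrow> 'g"
 assumes F: "smoothG F" and g: "g \<in> carrier G" and c0: "c 0 = \<one>"
  and c: "\<forall>\<^sub>F x in nhds 0. c x \<in> W0" and h: "((\<lambda>x. coord G (c x)) has_derivative h) (at 0)"
 shows "((\<lambda>x. F (g \<otimes> c x)) has_derivative (\<lambda>v. dF F g (h v))) (at 0)"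
proof -
 obtain S where S: "open S" "0 \<in> S" "\<And>x. x \<in> S \<Longrightarrow> c x \<in> W0" using c unfolding eventually_nhds by blast
 have "((\<lambda>x. F (g \<otimes> fc (coord G (c x)))) has_derivative (\<lambda>v. dF F g (h v))) (at 0)"
  using has_derivative_compose[OF h, of "\<lambda>z. F (g \<otimes> fc z)" "dF F g"] dF[OF F g] c0 by simp
 then show ?thesis by (rule has_derivative_transform_within_open[OF _ S(1,2)]) (use S(3) coord in simp)
qed

lemma dF_expG:
 assumes F: "smoothG F" and g: "g \<in> carrier G"
 shows "((\<lambda>x. F (g \<otimes> expG x)) has_derivative dF F g) (at 0)"
 using dF_chain[OF F g expG_zero eventually_expG[OF chart_open[OF id_chart(1)] id_chart(2)] expG_coord_derivative]
 by simp

lemma dF_curve: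
 assumes F: "smoothG F" and g: "g \<in> carrier G"
 shows "((\<lambda>s. F (g \<otimes> expG (s *\<^sub>R Y))) has_vector_derivative dF F (g \<otimes> expG (t *\<^sub>R Y)) Y) (at t)"
proof -
 let ?g = "g \<otimes> expG (t *\<^sub>R Y)"
 have gc: "?g \<in> carrier G" using g by simp
 have "((\<lambda>s. (s - t) *\<^sub>R Y) has_derivative (\<lambda>s. s *\<^sub>R Y)) (at t)" by (auto intro!: derivative_eq_intros)
 from has_derivative_compose[OF this, of "\<lambda>x. F (?g \<otimes> expG x)" "dF F ?g"] dF_expG[OF F gc]
 have "((\<lambda>s. F (?g \<otimes> expG ((s - t) *\<^sub>R Y))) has_derivative (\<lambda>s. dF F ?g (s *\<^sub>R Y))) (at t)" by simp
 moreover have "?g \<otimes> expG ((s - t) *\<^sub>R Y) = g \<otimes> expG (s *\<^sub>R Y)" for s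
  using expG_add[of t "s - t" Y] g by (simp add: m_assoc)
 ultimately show ?thesis using linear_cmul[OF linear_dF[OF F gc]] by (simp add: has_vector_derivative_def)
qed

lemma tvec_def': "tvec G K g Y f = (if smooth_fun G K f then dF (\<lambda>g. f (g <# K)) g Y else 0)"
 by (simp add: tvec_def dF_def)

lemma tvec_add: "g \<in> carrier G \<Longrightarrow> tvec G K g (Y + Z) = (\<lambda>f. tvec G K g Y f + tvec G K g Z f)"
 by (rule ext) (simp add: tvec_def' smooth_fun_iff linear_add[OF linear_dF])

lemma tvec_scale: "g \<in> carrier G \<Longrightarrow> tvec G K g (r *\<^sub>R Y) = (\<lambda>f. r * tvec G K g Y f)"
 by (rule ext) (simp add: tvec_def' smooth_fun_iff linear_cmul[OF linear_dF])

text \<open>The curve \<open>g expG(s Y)\<close> stays inside one coset of \<open>K\<close>, so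
  every smooth function on \<open>X\<close> is constant along it.\<close>

lemma tvec_skew:
 assumes g: "g \<in> carrier G" and Y: "adj (T Y) = - T Y"
 shows "tvec G K g Y = (\<lambda>f. 0)"
proof (rule ext)
 fix f
 show "tvec G K g Y f = 0"
 proof (cases "smooth_fun G K f")
  case True
  let ?F = "\<lambda>g. f (g <# K)"
  have "?F (g \<otimes> expG (s *\<^sub>R Y)) = ?F g" for s
  proof -
   have "adj (T (s *\<^sub>R Y)) = - T (s *\<^sub>R Y)" by (simp add: T_simps Y)
   then have "expG (s *\<^sub>R Y) \<in> K" by (rule skew_expG_K)
   then have "g <# K = (g \<otimes> expG (s *\<^sub>R Y)) <# K" 
    by (intro coset_eq_iff[THEN iffD2] bexI[of _ "expG (s *\<^sub>R Y)"] g m_closed expG_carrier refl)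
   then show ?thesis by simp
  qed
  then have "((\<lambda>s. ?F g) has_vector_derivative dF ?F g Y) (at 0)"
   using dF_curve[OF True[unfolded smooth_fun_iff] g, of Y 0] g by simp
  then have "dF ?F g Y = 0" using vector_derivative_unique_at has_vector_derivative_const by blast
  then show ?thesis by (simp add: tvec_def')
 qed (simp add: tvec_def')
qed

lemma tvec_pp: "g \<in> carrier G \<Longrightarrow> tvec G K g Y = tvec G K g (pp Y)"
 using tvec_add[of g "pp Y" "kp Y"] tvec_skew[OF _ kp_skew] by (simp add: pp_kp)

text \<open>\<open>g k z = (g (k z inv k)) k\<close>, and the last factor is swallowed by the coset.
  This is how the choice of a representative of a point acts on tangent vectors.\<close>

lemma tvec_K:
 assumes g: "g \<in> carrier G" and k: "k \<in> K"
 shows "tvec G K (g \<otimes> k) Y = tvec G K g (Ad G k Y)"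
proof (rule ext)
 fix f
 show "tvec G K (g \<otimes> k) Y f = tvec G K g (Ad G k Y) f"
 proof (cases "smooth_fun G K f")
  case True
  have kc: "k \<in> carrier G" by (rule K_subset[OF k])
  let ?F = "\<lambda>g. f (g <# K)"
  let ?c = "\<lambda>z. k \<otimes> fc z \<otimes> inv k"
  obtain U where U: "U \<in> H k" using H_nonempty[OF kc] by blast
  have ct: "continuous_map GT GT (\<lambda>h. k \<otimes> h \<otimes> inv k)" using kc by (intro continuous_map_mult_G) auto
  have ev: "\<forall>\<^sub>F z in nhds 0. ?c z \<in> W0"
   by (rule eventually_image_from_coord[OF ct _ chart_open[OF id_chart(1)] id_chart(2)]) (use kc in simp)
  have der: "((\<lambda>z. coord G (?c z)) has_derivative Ad G k) (at 0)"
   by (rule Ad(1)[OF kc U H_K_adj[OF k U]]) (use K_unitary[OF k U] in simp)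
  have d: "((\<lambda>z. ?F (g \<otimes> ?c z)) has_derivative (\<lambda>v. dF ?F g (Ad G k v))) (at 0)"
   by (rule dF_chain[OF True[unfolded smooth_fun_iff] g _ ev der]) (use kc in simp)
  have eq: "?F (g \<otimes> ?c z) = ?F (g \<otimes> k \<otimes> fc z)" if z: "z \<in> Wc" for z
  proof -
   have fc: "fc z \<in> carrier G" by (rule from_coord_carrier[OF z])
   have "g \<otimes> k \<otimes> fc z = g \<otimes> ?c z \<otimes> k" using g kc fc by (simp add: m_assoc)
   then have "(g \<otimes> ?c z) <# K = (g \<otimes> k \<otimes> fc z) <# K"
    using coset_eq_iff[of "g \<otimes> ?c z" "g \<otimes> k \<otimes> fc z"] g kc fc k by auto
   then show ?thesis by simp
  qed
  have "((\<lambda>z. ?F (g \<otimes> k \<otimes> fc z)) has_derivative (\<lambda>v. dF ?F g (Ad G k v))) (at 0)"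
   by (rule has_derivative_transform_within_open[OF d open_Wc zero_Wc eq])
  from dF_eqI[OF this] show ?thesis using True by (simp add: tvec_def')
 qed (simp add: tvec_def')
qed

lemma tvec_translate:
 assumes h: "h \<in> carrier G" and g: "g \<in> carrier G"
 shows "(\<lambda>f. tvec G K g Y (\<lambda>x. f (h <# x))) = tvec G K (h \<otimes> g) Y"
proof (rule ext)
 fix f
 have sm: "smooth_fun G K (\<lambda>x. f (a <# x))" if "smooth_fun G K f" "a \<in> carrier G" for f a unfolding smooth_fun_iff
  by (rule smoothG_cong[OF _ smoothG_translate[OF that(2) that(1)[unfolded smooth_fun_iff]]])
   (simp add: coset_translate that)
 \<comment> \<open>Tangent vectors are extended by 0 to functions that are not smooth, so the
   equality needs smoothness to be preserved in both directions.\<close>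
 have iff: "smooth_fun G K (\<lambda>x. f (h <# x)) \<longleftrightarrow> smooth_fun G K f"
 proof
  assume a: "smooth_fun G K (\<lambda>x. f (h <# x))"
  from sm[OF this, of "inv h"] h have "smooth_fun G K (\<lambda>x. f (h <# (inv h <# x)))" by simp
  then show "smooth_fun G K f" unfolding smooth_fun_iff
   by (rule smoothG_cong[rotated]) (simp add: coset_translate h m_assoc[symmetric])
 qed (rule sm[OF _ h])
 have "dF (\<lambda>g. f (h <# (g <# K))) g Y = dF (\<lambda>g. f (g <# K)) (h \<otimes> g) Y" if s: "smooth_fun G K f"
 proof -
  have hg: "h \<otimes> g \<in> carrier G" using h g by simp
  have "((\<lambda>z. f (h <# ((g \<otimes> fc z) <# K))) has_derivative dF (\<lambda>g. f (g <# K)) (h \<otimes> g)) (at 0)"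
   by (rule has_derivative_transform_within_open[OF dF[OF s[unfolded smooth_fun_iff] hg] open_Wc zero_Wc])
    (use from_coord_carrier h g in \<open>simp add: coset_translate m_assoc\<close>)
  from dF_eqI[OF this] show ?thesis by simp
 qed
 then show "tvec G K g Y (\<lambda>x. f (h <# x)) = tvec G K (h \<otimes> g) Y f" by (simp add: tvec_def' iff)
qed

text \<open>The action \<open>A \<mapsto> N * A * adj N\<close>, independent of the lift for
  \<open>A\<close> in \<open>Comm\<close>. At \<open>A = 1\<close> it is the point of
  \<open>X\<close> as a positive operator; other \<open>A\<close> are needed because differentiation
  at 1 produces them.\<close>

definition Rg :: "'g \<Rightarrow> (complex^'n) endo \<Rightarrow> (complex^'n) endo" where
 "Rg g A = (SOME N. N \<in> H g) * A * adj (SOME N. N \<in> H g)"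

definition Comm :: "(complex^'n) endo set" where
 "Comm = {A. \<forall>z\<in>cen. z * A = A * z}"

lemma Comm_H: "N \<in> H g \<Longrightarrow> N \<in> Comm \<and> adj N \<in> Comm"
proof -
 assume "N \<in> H g"
 then obtain M where "N = of_matrix M" by (auto simp: H_def)
 then show ?thesis by (simp add: Comm_def cen_commute of_matrix_ctransp[symmetric])
qed

lemma Comm_T: "T Y \<in> Comm" "adj (T Y) \<in> Comm"
proof -
 obtain M where "T Y = of_matrix M" by (rule T_matrix)
 then show "T Y \<in> Comm" "adj (T Y) \<in> Comm" by (simp_all add: Comm_def cen_commute of_matrix_ctransp[symmetric])
qed

lemma Comm_closed: "1 \<in> Comm" "A \<in> Comm \<Longrightarrow> B \<in> Comm \<Longrightarrow> A + B \<in> Comm" "A \<in> Comm \<Longrightarrow> B \<in> Comm \<Longrightarrow> A * B \<in> Comm"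
proof -
 show "1 \<in> Comm" by (simp add: Comm_def)
 show "A \<in> Comm \<Longrightarrow> B \<in> Comm \<Longrightarrow> A + B \<in> Comm" by (simp add: Comm_def distrib_left distrib_right)
 show "A * B \<in> Comm" if A: "A \<in> Comm" and B: "B \<in> Comm" unfolding Comm_def
 proof (intro CollectI ballI)
  fix z :: "(complex^'n) endo" assume z: "z \<in> cen"
  have "z * (A * B) = A * (z * B)" using A z by (simp add: Comm_def flip: mult.assoc)
  then show "z * (A * B) = A * B * z" using B z by (simp add: Comm_def mult.assoc)
 qed
qed

lemma Rg_eq:
 assumes g: "g \<in> carrier G" and N: "N \<in> H g" and A: "A \<in> Comm"
 shows "Rg g A = N * A * adj N"
proof -
 define N' where "N' = (SOME N. N \<in> H g)"
 have N': "N' \<in> H g" unfolding N'_def using N by (rule someI)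
 then obtain z where z: "z \<in> cen" "N' = z * N" using H_coset[OF g N] by blast
 have "N * A * adj N \<in> Comm" 
  by (rule Comm_closed(3)[OF Comm_closed(3)[OF conjunct1[OF Comm_H[OF N]] A] conjunct2[OF Comm_H[OF N]]])
 then have "z * (N * A * adj N) = N * A * adj N * z" using z(1) by (simp add: Comm_def)
 moreover have "N' * A * adj N' = z * (N * A * adj N) * adj z" by (simp add: z(2) mult.assoc)
 ultimately have "N' * A * adj N' = N * A * adj N * (z * adj z)" by (simp add: mult.assoc)
 then show ?thesis using cen_unitary(2)[OF z(1)] by (simp add: Rg_def N'_def)
qed

lemma Rg_mult:
 assumes "g \<in> carrier G" "h \<in> carrier G" "N \<in> H g" "A \<in> Comm"
 shows "Rg (g \<otimes> h) A = N * Rg h A * adj N"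
proof -
 obtain N' where N': "N' \<in> H h" using H_nonempty[OF assms(2)] by blast
 show ?thesis using Rg_eq[OF _ H_mult[OF assms(1,2,3) N'] assms(4)] Rg_eq[OF assms(2) N' assms(4)] assms
  by (simp add: mult.assoc)
qed

lemma Rg_from_coord_derivative:
 assumes A: "A \<in> Comm"
 shows "((\<lambda>z. Rg (fc z) A) has_derivative (\<lambda>v. T v * A + A * adj (T v))) (at 0)"
proof -
 have adjd: "((\<lambda>x. adj (\<nu> x)) has_derivative (\<lambda>v. adj (T v))) (at 0)"
  by (rule bounded_linear.has_derivative[OF bounded_linear_adj \<nu>_derivative])
 have "((\<lambda>z. \<nu> z * A * adj (\<nu> z)) has_derivative (\<lambda>v. \<nu> 0 * A * adj (T v) + T v * A * adj (\<nu> 0))) (at 0)"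
  by (rule has_derivative_mult[OF bounded_linear.has_derivative[OF bounded_linear_mult_left \<nu>_derivative] adjd])
 then have "((\<lambda>z. \<nu> z * A * adj (\<nu> z)) has_derivative (\<lambda>v. T v * A + A * adj (T v))) (at 0)"
  by (simp add: add.commute)
 then show ?thesis
 proof (rule has_derivative_transform_within_open[OF _ open_ball])
  show "0 \<in> ball 0 r0" using r0 by simp
  fix z :: 'e assume "z \<in> ball 0 r0"
  then have "z \<in> Wc" "\<nu> z \<in> H (fc z)" using \<nu>[of z] local[of z] by simp_all
  then show "\<nu> z * A * adj (\<nu> z) = Rg (fc z) A" by (simp only: Rg_eq[OF from_coord_carrier _ A])
 qed
qed

text \<open>Near the diagonal the coordinate of the quotient of two group elements is smooth. Its
  derivative in the second argument on the diagonal is the Maurer-Cartan form in the chart.\<close>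

lemma quotient_coord_smooth:
 assumes U: "(U, \<phi>) \<in> lie_atlas G"
 defines "D \<equiv> {p \<in> \<phi> ` U \<times> \<phi> ` U. inv (inv_into U \<phi> (fst p)) \<otimes> inv_into U \<phi> (snd p) \<in> W0}"
 shows "open D" "smooth_on D (\<lambda>p. coord G (inv (inv_into U \<phi> (fst p)) \<otimes> inv_into U \<phi> (snd p)))"
proof -
 note oU = chart_image_open[OF U]
 show oD: "open D" unfolding D_def by (rule open_preimage_G[OF _ open_Times[OF oU oU] chart_open[OF id_chart(1)]])
   (intro continuous_map_mult_G continuous_map_inv_G continuous_map_top_of_set_fst chart_continuous_inv[OF U])
 show "smooth_on D (\<lambda>p. coord G (inv (inv_into U \<phi> (fst p)) \<otimes> inv_into U \<phi> (snd p)))"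
 proof (rule smooth_on_local)
  fix p assume p: "p \<in> D"
  have "inv (inv_into U \<phi> (fst p)) \<in> carrier G"
   using p chart_inv_in[OF U] chart_subset[OF U] by (intro inv_closed) (auto simp: D_def)
  then obtain V \<psi> where V: "(V, \<psi>) \<in> lie_atlas G" "inv (inv_into U \<phi> (fst p)) \<in> V" using carrier_atlas by blast
  let ?O = "{x \<in> \<phi> ` U. inv (inv_into U \<phi> x) \<in> V}"
  let ?\<iota> = "\<lambda>x. \<psi> (inv (inv_into U \<phi> x))"
  have oO: "open ?O"
   by (rule open_preimage_G[OF continuous_map_inv_G[OF chart_continuous_inv[OF U]] oU chart_open[OF V(1)]])
  have s\<iota>: "smooth_on ?O ?\<iota>" using lie_group_G U V(1) unfolding lie_group_def by fast
  let ?D = "D \<inter> (?O \<times> UNIV)"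
  have oD': "open ?D" by (intro open_Int oD open_Times oO open_UNIV)
  note sm = smooth_chart_mult[OF V(1) U id_chart(1)]
  have "smooth_on ?D (\<lambda>p. ?\<iota> (fst p))"
   by (rule smooth_on_compose[OF oD' oO _ s\<iota> smooth_on_bounded_linear[OF bounded_linear_fst oD']]) auto
  then have pr: "smooth_on ?D (\<lambda>p. (?\<iota> (fst p), snd p))"
   by (rule smooth_on_Pair[OF oD' _ smooth_on_bounded_linear[OF bounded_linear_snd oD']])
  have "smooth_on ?D (\<lambda>p. \<phi>0 (inv_into V \<psi> (fst (?\<iota> (fst p), snd p)) \<otimes> inv_into U \<phi> (snd (?\<iota> (fst p), snd p))))"
   by (rule smooth_on_compose[OF oD' sm(1) _ sm(2) pr])
    (auto simp: D_def chart_inv[OF V(1)])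
  from smooth_on_add[OF oD' this smooth_on_const[of _ "- \<phi>0 \<one>"]]
  have "smooth_on ?D (\<lambda>p. \<phi>0 (inv_into V \<psi> (?\<iota> (fst p)) \<otimes> inv_into U \<phi> (snd p)) + - \<phi>0 \<one>)" by simp
  then have "smooth_on ?D (\<lambda>p. coord G (inv (inv_into U \<phi> (fst p)) \<otimes> inv_into U \<phi> (snd p)))"
   by (rule smooth_on_cong[OF oD', rotated]) (auto simp: coord_def chart_inv[OF V(1)])
  moreover have "p \<in> ?D" using p V(2) by (auto simp: D_def)
  ultimately show "\<exists>D'. open D' \<and> p \<in> D' \<and>
    smooth_on D' (\<lambda>p. coord G (inv (inv_into U \<phi> (fst p)) \<otimes> inv_into U \<phi> (snd p)))"
   using oD' by blast
 qed
qed

text \<open>\<open>Rg\<close> solves a linear differential equation with smooth coefficients, so it gains one derivative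
 at each step.\<close>

lemma Rg_smooth: "A \<in> Comm \<Longrightarrow> smoothG (\<lambda>g. Rg g A)" unfolding smoothG_def
proof clarify
 fix U \<phi> assume U: "(U, \<phi>) \<in> lie_atlas G" and "A \<in> Comm"
 let ?p = "inv_into U \<phi>"
 let ?q = "\<lambda>p. coord G (inv (?p (fst p)) \<otimes> ?p (snd p))"
 let ?D = "{p \<in> \<phi> ` U \<times> \<phi> ` U. inv (?p (fst p)) \<otimes> ?p (snd p) \<in> W0}"
 note oU = chart_image_open[OF U] and q = quotient_coord_smooth[OF U]
 have pc: "?p x \<in> carrier G" if "x \<in> \<phi> ` U" for x using that chart_inv_in[OF U] chart_subset[OF U] by blast
 \<comment> \<open>The left-invariant Maurer-Cartan form in the chart; it supplies the smooth
   coefficients of the differential equation.\<close>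
 define \<omega> where "\<omega> x v = frechet_derivative ?q (at (x, x)) (0, v)" for x v
 have dg: "(x, x) \<in> ?D" if "x \<in> \<phi> ` U" for x using that pc[OF that] id_chart(2) by simp
 have smooth_\<omega>: "smooth_on (\<phi> ` U) (\<lambda>x. \<omega> x v)" for v
 proof -
  have di: "smooth_on (\<phi> ` U) (\<lambda>x. (x, x))"
   by (intro smooth_on_Pair[OF oU] smooth_on_bounded_linear[OF bounded_linear_ident oU])
  show ?thesis unfolding \<omega>_def by (rule smooth_on_compose[OF oU q(1) dg smooth_on_derivative[OF q(2)] di])
 qed
 \<comment> \<open>The derivative is again a combination of functions of the form \<open>Rg\<close>,
   at other elements of \<open>Comm\<close>; therefore the induction below runs over all
   \<open>A\<close> simultaneously.\<close>
 have der: "((\<lambda>x. Rg (?p x) A) has_derivative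
   (\<lambda>v. \<Sum>b\<in>Basis. (\<omega> x v \<bullet> b) *\<^sub>R Rg (?p x) (T b * A + A * adj (T b)))) (at x)"
  if A: "A \<in> Comm" and x: "x \<in> \<phi> ` U" for A x
 proof -
  let ?g = "?p x"
  obtain N where N: "N \<in> H ?g" using H_nonempty[OF pc[OF x]] by blast
  have "(?q has_derivative frechet_derivative ?q (at (x, x))) (at (x, x))"
   by (rule smooth_on_differentiable[OF q(2,1) dg[OF x]])
  moreover have "((\<lambda>y. (x, y)) has_derivative (\<lambda>v. (0, v))) (at x)" by (auto intro!: derivative_eq_intros)
  ultimately have dq: "((\<lambda>y. ?q (x, y)) has_derivative \<omega> x) (at x)"
   using has_derivative_compose[of "\<lambda>y. (x, y)" "\<lambda>v. (0, v)" x UNIV ?q] by (simp add: \<omega>_def[abs_def])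
  have "?q (x, x) = 0" using pc[OF x] by simp
  then have "((\<lambda>y. Rg (fc (?q (x, y))) A) has_derivative (\<lambda>v. T (\<omega> x v) * A + A * adj (T (\<omega> x v)))) (at x)"
   using has_derivative_compose[OF dq, of "\<lambda>z. Rg (fc z) A"] Rg_from_coord_derivative[OF A] by simp
  then have "((\<lambda>y. N * Rg (fc (?q (x, y))) A * adj N) has_derivative
    (\<lambda>v. N * (T (\<omega> x v) * A + A * adj (T (\<omega> x v))) * adj N)) (at x)"
   by (intro bounded_linear.has_derivative[OF bounded_linear_mult_left] bounded_linear.has_derivative[OF bounded_linear_mult_right])
  then have "((\<lambda>y. Rg (?p y) A) has_derivative (\<lambda>v. N * (T (\<omega> x v) * A + A * adj (T (\<omega> x v))) * adj N)) (at x)"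
  proof (rule has_derivative_transform_within_open)
   have "continuous_map (top_of_set (\<phi> ` U)) GT (\<lambda>y. inv ?g \<otimes> ?p y)"
    using pc[OF x] by (intro continuous_map_mult_G chart_continuous_inv[OF U]) auto
   then show "open {y \<in> \<phi> ` U. inv ?g \<otimes> ?p y \<in> W0}" by (rule open_preimage_G[OF _ oU chart_open[OF id_chart(1)]])
   show "x \<in> {y \<in> \<phi> ` U. inv ?g \<otimes> ?p y \<in> W0}" using x pc[OF x] id_chart(2) by simp
   fix y assume y: "y \<in> {y \<in> \<phi> ` U. inv ?g \<otimes> ?p y \<in> W0}"
   then have "fc (?q (x, y)) = inv ?g \<otimes> ?p y" using coord by simp
   then show "N * Rg (fc (?q (x, y))) A * adj N = Rg (?p y) A"
    using Rg_mult[OF pc[OF x] _ N A, of "inv ?g \<otimes> ?p y"] pc[OF x] pc[of y] y by (simp add: m_assoc[symmetric])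
  qed
  then show ?thesis
  proof (rule has_derivative_eq_rhs, intro ext)
   fix v
   have lin: "linear (\<lambda>Y. N * (T Y * A + A * adj (T Y)) * adj N)"
    by (rule linearI) (simp_all add: T_simps algebra_simps)
   have "Rg ?g (T b * A + A * adj (T b)) = N * (T b * A + A * adj (T b)) * adj N" for b
    by (rule Rg_eq[OF pc[OF x] N]) (intro Comm_closed Comm_T A)
   then show "N * (T (\<omega> x v) * A + A * adj (T (\<omega> x v))) * adj N =
     (\<Sum>b\<in>Basis. (\<omega> x v \<bullet> b) *\<^sub>R Rg ?g (T b * A + A * adj (T b)))"
    using linear_basis_sum[OF lin, of "\<omega> x v"] by simp
  qed
 qed
 have "Ck_on k (\<phi> ` U) (\<lambda>x. Rg (?p x) A)" if "A \<in> Comm" for k A using that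
 proof (induction k arbitrary: A)
  case 0
  have "(\<lambda>x. Rg (?p x) A) differentiable_on \<phi> ` U"
   using der[OF 0] by (meson differentiableI differentiable_at_withinI differentiable_on_def)
  then show ?case by (simp add: differentiable_imp_continuous_on)
 next
  case (Suc k)
  show ?case
  proof (rule Ck_on_SucI[OF oU der[OF Suc.prems]])
   fix v
   have "Ck_on k (\<phi> ` U) (\<lambda>x. \<omega> x v \<bullet> b)" for b
    using smooth_\<omega>[of v] Ck_on_bounded_linear_compose[OF bounded_linear_inner_left oU] unfolding smooth_on_def by blast
   then show "Ck_on k (\<phi> ` U) (\<lambda>x. \<Sum>b\<in>Basis. (\<omega> x v \<bullet> b) *\<^sub>R Rg (?p x) (T b * A + A * adj (T b)))"
    by (intro Ck_on_sum[OF oU] Ck_on_bounded_bilinear[OF bounded_bilinear_scaleR oU] Suc.IH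
      Comm_closed Comm_T Suc.prems)
  qed
 qed
 then show "smooth_on (\<phi> ` U) (\<lambda>x. Rg (?p x) A)" unfolding smooth_on_def using \<open>A \<in> Comm\<close> by blast
qed

definition Mx :: "'g set \<Rightarrow> (complex^'n) endo" where
 "Mx x = Rg (SOME g. g \<in> carrier G \<and> x = g <# K) 1"

lemma Mx: "g \<in> carrier G \<Longrightarrow> N \<in> H g \<Longrightarrow> Mx (g <# K) = N * adj N"
proof -
 assume g: "g \<in> carrier G" and N: "N \<in> H g"
 define h where "h = (SOME h. h \<in> carrier G \<and> g <# K = h <# K)"
 have h: "h \<in> carrier G \<and> g <# K = h <# K" unfolding h_def by (rule someI[of _ g]) (use g in simp)
 then obtain k where k: "k \<in> K" "h = g \<otimes> k" using coset_eq_iff[OF g] by blast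
 obtain N' where N': "N' \<in> H h" using H_nonempty h by blast
 have "Mx (g <# K) = N' * adj N'" unfolding Mx_def h_def[symmetric] using Rg_eq[OF _ N' Comm_closed(1)] h by simp
 then show ?thesis using symm_invariant_K[OF g N k(1)] N' k(2) by simp
qed

lemma Mx_Rg: "g \<in> carrier G \<Longrightarrow> Mx (g <# K) = Rg g 1"
 using Mx[of g] Rg_eq[of g _ 1] H_nonempty[of g] Comm_closed(1) by fastforce

text \<open>This supplies the test functions on \<open>X\<close> through which tangent vectors are
  distinguished and curves are differentiated.\<close>

lemma Mx_smooth: "bounded_linear l \<Longrightarrow> smooth_fun G K (\<lambda>x. l (Mx x))"
proof -
 assume l: "bounded_linear l"
 have "smoothG (\<lambda>g. l (Rg g 1))"
  using Rg_smooth[OF Comm_closed(1)] smooth_on_bounded_linear_compose[OF l chart_image_open]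
  unfolding smoothG_def by blast
 then show ?thesis unfolding smooth_fun_iff by (rule smoothG_cong[rotated]) (simp add: Mx_Rg)
qed

lemma tvec_Mx:
 assumes l: "bounded_linear l" and g: "g \<in> carrier G" and N: "N \<in> H g"
 shows "tvec G K g Y (\<lambda>x. l (Mx x)) = l (N * (T Y + adj (T Y)) * adj N)"
proof -
 have "((\<lambda>z. l (N * Rg (fc z) 1 * adj N)) has_derivative (\<lambda>v. l (N * (T v * 1 + 1 * adj (T v)) * adj N))) (at 0)"
  by (intro bounded_linear.has_derivative[OF l] bounded_linear.has_derivative[OF bounded_linear_mult_left]
    bounded_linear.has_derivative[OF bounded_linear_mult_right] Rg_from_coord_derivative Comm_closed)
 then have "((\<lambda>z. l (Mx ((g \<otimes> fc z) <# K))) has_derivative (\<lambda>v. l (N * (T v * 1 + 1 * adj (T v)) * adj N))) (at 0)"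
  by (rule has_derivative_transform_within_open[OF _ open_Wc zero_Wc])
   (use g from_coord_carrier Rg_mult[OF g _ N Comm_closed(1)] in \<open>simp add: Mx_Rg\<close>)
 from dF_eqI[OF this] show ?thesis using Mx_smooth[OF l] by (simp add: tvec_def')
qed

end

section \<open>The invariant Finsler metric\<close>

lemma rmax_symmetrized: "rmax ((1 / 2) *\<^sub>R (A + adj A)) = rmax A"
proof -
 have "v \<bullet> app ((1 / 2) *\<^sub>R (A + adj A)) v = v \<bullet> app A v" for v
  using inner_app[of A v v] by (simp add: inner_add_right inner_commute)
 then show ?thesis by (simp add: rmax_def)
qed

lemma eq_of_same_upper_bounds:
 fixes a b :: real
 assumes nn: "0 \<le> a" "0 \<le> b" and iff: "\<And>c. c > 0 \<Longrightarrow> a \<le> c \<longleftrightarrow> b \<le> c"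
 shows "a = b"
proof (rule ccontr)
 assume "a \<noteq> b"
 then have "(a + b) / 2 > 0" using nn by (cases "a = 0") auto
 from iff[OF this] \<open>a \<noteq> b\<close> show False by (auto simp: field_simps)
qed

lemma scaleR_complex_vec: "r *\<^sub>R v = complex_of_real r *s (v :: complex^'n)"
 by (simp add: vec_eq_iff scaleR_conv_of_real[where 'a = complex])

context satake_basis
begin

lemma rmax_T_leI: "Y \<in> \<aa> \<Longrightarrow> (\<And>b. b \<in> S \<Longrightarrow> wt b Y \<le> c) \<Longrightarrow> rmax (T Y) \<le> c"
proof -
 assume Y: "Y \<in> \<aa>" and le: "\<And>b. b \<in> S \<Longrightarrow> wt b Y \<le> c"
 have "finite ((\<lambda>b. wt b Y) ` S)" "(\<lambda>b. wt b Y) ` S \<noteq> {}" using onb_finite[OF S] onb_nonempty[OF S] by auto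
 from Max_in[OF this] obtain b where b: "b \<in> S" "wt b Y = Max ((\<lambda>b. wt b Y) ` S)" by auto
 have "rmax (diag S (\<lambda>b. wt b Y)) = wt b Y" by (rule symmetric_rmax_diag[OF S b(1)]) (simp add: b(2) onb_finite[OF S])
 then show ?thesis using T_diag[OF Y] le[OF b(1)] by simp
qed

lemma wt_le_rmax: "b \<in> S \<Longrightarrow> wt b Y \<le> rmax (T Y)" using S by (simp add: wt_def rayleigh_le_unit onb_def)

lemma weight_in_weights: "b \<in> S \<Longrightarrow> restrict (wt b) \<aa> \<in> weights G \<aa> \<tau>"
proof -
 assume b: "b \<in> S"
 have "restrict (wt b) \<aa> \<in> dual_space \<aa>" using a_subspace linear_wt[of b]
  by (auto simp: dual_space_def subspace_add subspace_scale linear_add linear_cmul)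
 moreover have "b \<noteq> 0" using S b by (auto simp: onb_def)
 moreover have "\<exists>M. has_differential G \<tau> Y M \<and> M *v b = complex_of_real (restrict (wt b) \<aa> Y) *s b" if Y: "Y \<in> \<aa>" for Y
 proof -
  obtain M where M: "T Y = of_matrix M" by (rule T_matrix)
  have "M *v b = wt b Y *\<^sub>R b" using app_T_basis[OF Y b] by (simp add: M app_of_matrix)
  also have "\<dots> = complex_of_real (restrict (wt b) \<aa> Y) *s b" using Y by (simp add: scaleR_complex_vec)
  finally show ?thesis using M by (intro exI[of _ M]) (simp add: has_differential_iff)
 qed
 ultimately show ?thesis unfolding weights_def by blast
qed

lemma weight_ge_neg_rmax:
 assumes \<omega>: "\<omega> \<in> weights G \<aa> \<tau>" and Y: "Y \<in> \<aa>"
 shows "- rmax (T (- Y)) \<le> \<omega> Y"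
proof -
 obtain v M where v: "v \<noteq> 0" and M: "has_differential G \<tau> Y M" "M *v v = complex_of_real (\<omega> Y) *s v"
  using \<omega> Y unfolding weights_def by blast
 have "app (T Y) v = complex_of_real (\<omega> Y) *s v" using M by (simp add: has_differential_iff flip: app_of_matrix)
 also have "\<dots> = \<omega> Y *\<^sub>R v" by (rule scaleR_complex_vec[symmetric])
 finally have "- \<omega> Y * (v \<bullet> v) \<le> rmax (T (- Y)) * (v \<bullet> v)" using rayleigh_le[of v "T (- Y)"] by (simp add: T_simps)
 then have "- \<omega> Y \<le> rmax (T (- Y))" by (rule mult_right_le_imp_le) (use v in simp)
 then show ?thesis by simp
qed

text \<open>The polar condition says that every weight is at least -1 at \<open>Y\<close>, that is,
  all eigenvalues of \<open>T (- Y)\<close> are at most 1; the reflection then gives the stated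
  ball. Convex combinations inherit the bound, and conversely the weights of the basis vectors
  suffice to determine \<open>rmax\<close>.\<close>

lemma dual_ball_eq:
 "uminus ` polar \<aa> (dual_convex_hull \<aa> (weights G \<aa> \<tau>)) = {Y \<in> \<aa>. rmax (T Y) \<le> 1}"
proof -
 have "Y \<in> polar \<aa> (dual_convex_hull \<aa> (weights G \<aa> \<tau>)) \<longleftrightarrow> rmax (T (- Y)) \<le> 1" if Y: "Y \<in> \<aa>" for Y
 proof
  assume p: "Y \<in> polar \<aa> (dual_convex_hull \<aa> (weights G \<aa> \<tau>))"
  show "rmax (T (- Y)) \<le> 1"
  proof (rule rmax_T_leI)
   show "- Y \<in> \<aa>" by (rule subspace_neg[OF a_subspace Y])
   fix b assume b: "b \<in> S"
   have "restrict (wt b) \<aa> \<in> dual_convex_hull \<aa> (weights G \<aa> \<tau>)"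
    unfolding dual_convex_hull_def using weight_in_weights[OF b]
    by (intro CollectI exI[of _ "{restrict (wt b) \<aa>}"] exI[of _ "\<lambda>_. 1"]) (auto simp: restrict_def)
   then have "restrict (wt b) \<aa> Y \<ge> - 1" using p by (auto simp: polar_def)
   then show "wt b (- Y) \<le> 1" using Y linear_neg[OF linear_wt] by simp
  qed
 next
  assume r: "rmax (T (- Y)) \<le> 1"
  have "\<omega> Y \<ge> - 1" if \<omega>: "\<omega> \<in> dual_convex_hull \<aa> (weights G \<aa> \<tau>)" for \<omega>
  proof -
   obtain W u where W: "\<omega> = (\<lambda>Y\<in>\<aa>. \<Sum>\<omega>\<in>W. u \<omega> * \<omega> Y)" "W \<subseteq> weights G \<aa> \<tau>" "\<forall>\<omega>\<in>W. 0 \<le> u \<omega>" "(\<Sum>\<omega>\<in>W. u \<omega>) = 1"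
    using \<omega> unfolding dual_convex_hull_def by blast
   have "(\<Sum>\<omega>\<in>W. u \<omega> * (- 1)) \<le> (\<Sum>\<omega>\<in>W. u \<omega> * \<omega> Y)"
   proof (rule sum_mono)
    fix \<nu> assume \<nu>: "\<nu> \<in> W"
    then have "- 1 \<le> \<nu> Y" using weight_ge_neg_rmax[of \<nu> Y] W(2) r Y by force
    then show "u \<nu> * (- 1) \<le> u \<nu> * \<nu> Y" using W(3) \<nu> by (intro mult_left_mono) auto
   qed
   then show ?thesis using W(4) Y by (simp add: W(1) sum_negf)
  qed
  then show "Y \<in> polar \<aa> (dual_convex_hull \<aa> (weights G \<aa> \<tau>))" using Y by (simp add: polar_def)
 qed
 moreover have "polar \<aa> (dual_convex_hull \<aa> (weights G \<aa> \<tau>)) \<subseteq> \<aa>" by (auto simp: polar_def)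
 ultimately show ?thesis using subspace_neg[OF a_subspace] by (auto simp: image_iff intro!: bexI[of _ "- Y" for Y])
qed

text \<open>One half-space for each basis vector cuts the set out of \<open>\<aa>\<close>. It is
  bounded because \<open>rmax (T Y)\<close> is positive for nonzero \<open>Y\<close>, hence bounded
  below by a positive constant on the unit sphere of \<open>\<aa>\<close>.\<close>

lemma polytope_dual_ball: "polytope {Y \<in> \<aa>. rmax (T Y) \<le> 1}" unfolding polytope_eq_bounded_polyhedron
proof
 have eq: "{Y \<in> \<aa>. rmax (T Y) \<le> 1} = \<aa> \<inter> \<Inter>((\<lambda>b. {Y. (\<Sum>i\<in>Basis. wt b i *\<^sub>R i) \<bullet> Y \<le> 1}) ` S)"
 proof -
  have "(\<Sum>i\<in>Basis. wt b i *\<^sub>R i) \<bullet> Y = wt b Y" for b Y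
   using linear_basis_sum[OF linear_wt, of b Y] by (simp add: inner_sum_left inner_commute[of Y] mult.commute)
  then show ?thesis using rmax_T_leI by (auto intro: order_trans[OF wt_le_rmax])
 qed
 show "polyhedron {Y \<in> \<aa>. rmax (T Y) \<le> 1}" unfolding eq using onb_finite[OF S]
  by (intro polyhedron_Int[OF affine_imp_polyhedron[OF subspace_imp_affine[OF a_subspace]]] polyhedron_Inter)
   (auto intro: polyhedron_halfspace_le)
 show "bounded {Y \<in> \<aa>. rmax (T Y) \<le> 1}"
 \<comment> \<open>If \<open>\<aa>\<close> is trivial its unit sphere is empty and there is no
   minimum to take.\<close>
 proof (cases "\<aa> \<inter> sphere 0 1 = {}")
  case True
  have "Y = 0" if Y: "Y \<in> \<aa>" for Y
  proof (rule ccontr)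
   assume "Y \<noteq> 0"
   then have "inverse (norm Y) *\<^sub>R Y \<in> \<aa> \<inter> sphere 0 1" using subspace_scale[OF a_subspace Y] by simp
   then show False using True by simp
  qed
  then have "{Y \<in> \<aa>. rmax (T Y) \<le> 1} \<subseteq> {0}" by blast
  then show ?thesis by (rule bounded_subset[rotated]) simp
 next
  case False
  have c: "compact (\<aa> \<inter> sphere 0 1)" by (intro closed_Int_compact closed_subspace a_subspace compact_sphere)
  have "continuous_on (\<aa> \<inter> sphere 0 1) (\<lambda>Y. rmax (T Y))"
   by (intro continuous_on_rmax bounded_linear.continuous_on[OF T_bl] continuous_on_id)
  from continuous_attains_inf[OF c False this] obtain X where X: "X \<in> \<aa>" "norm X = 1"
   and mn: "\<And>Y. Y \<in> \<aa> \<inter> sphere 0 1 \<Longrightarrow> rmax (T X) \<le> rmax (T Y)" by auto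
  have pos: "rmax (T X) > 0" by (rule rmax_T_pos[OF a_symmetric[OF X(1)]]) (use X in auto)
  have "norm Y \<le> 1 / rmax (T X)" if Y: "Y \<in> \<aa>" "rmax (T Y) \<le> 1" for Y
  proof (cases "Y = 0")
   case False
   then have "inverse (norm Y) *\<^sub>R Y \<in> \<aa> \<inter> sphere 0 1" using subspace_scale[OF a_subspace Y(1)] by simp
   from mn[OF this] have "rmax (T X) \<le> inverse (norm Y) * rmax (T Y)" by (simp add: T_simps rmax_scaleR)
   then have "rmax (T X) * norm Y \<le> rmax (T Y)" using False by (simp add: field_simps)
   then show ?thesis using Y(2) pos by (simp add: field_simps)
  qed (use pos in simp)
  then show ?thesis unfolding bounded_iff by blast
 qed
qed

lemma pp_zero: "pp 0 = 0" using linear_0[OF linear_pp] .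

lemma rmax_zero: "rmax (0 :: (complex^'n) endo) = 0" using rmax_scaleR[of 0 "0 :: (complex^'n) endo"] by simp

lemma rmax_pp_nonneg: "rmax (T (pp Y)) \<ge> 0" and rmax_pp_zero_iff: "rmax (T (pp Y)) = 0 \<longleftrightarrow> pp Y = 0"
 using rmax_T_pos[OF pp_symmetric, of Y] rmax_zero by (cases "pp Y = 0"; force simp: T_simps)+

lemma H_conj_inverse:
 assumes "N' * N = 1"
 shows "N' * (N * A * adj N) * adj N' = (A :: (complex^'n) endo)"
proof -
 have "N' * (N * A * adj N) * adj N' = (N' * N) * A * adj (N' * N)" by (simp only: adj_simps mult.assoc)
 then show ?thesis by (simp only: assms adj_simps mult_1_left mult_1_right)
qed

text \<open>Evaluating on the matrix coefficients of \<open>Mx\<close> recovers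
  \<open>N * (T Y + adj (T Y)) * adj N\<close>, from which the invertible \<open>N\<close> is
  removed. So a tangent vector determines the symmetric part of its representative.\<close>

lemma tvec_inj:
 assumes g: "g \<in> carrier G" and eq: "tvec G K g Y = tvec G K g Z"
 shows "pp Y = pp Z"
proof -
 obtain N where N: "N \<in> H g" using H_nonempty[OF g] by blast
 obtain N' where N': "N' * N = 1" "N * N' = 1" by (rule H_inverse[OF g N])
 have "N * (T Y + adj (T Y)) * adj N = N * (T Z + adj (T Z)) * adj N"
 proof (rule endo_eqI, rule vector_eq_ldot[THEN iffD1], rule allI)
  fix v w :: "complex^'n"
  have "bounded_linear (\<lambda>A. app A v)" by (rule bounded_bilinear.bounded_linear_left[OF bounded_bilinear_app])
  then have "bounded_linear (\<lambda>A. w \<bullet> app A v)" by (rule bounded_linear_compose[OF bounded_linear_inner_right])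
  from tvec_Mx[OF this g N] show "w \<bullet> app (N * (T Y + adj (T Y)) * adj N) v = w \<bullet> app (N * (T Z + adj (T Z)) * adj N) v"
   using eq by metis
 qed
 then have "N' * (N * (T Y + adj (T Y)) * adj N) * adj N' = N' * (N * (T Z + adj (T Z)) * adj N) * adj N'" by simp
 then have "T Y + adj (T Y) = T Z + adj (T Z)" by (simp only: H_conj_inverse[OF N'(1)])
 then have "T (pp Y) = T (pp Z)" by (simp only: T_pp)
 then show ?thesis by (simp only: T_eq_iff)
qed

lemma T_Ad_K: "k \<in> K \<Longrightarrow> U \<in> H k \<Longrightarrow> T (Ad G k Y) = U * T Y * adj U" using Ad(2)[OF K_subset _ H_K_adj] K_unitary by blast

lemma rmax_pp_Ad: "k \<in> K \<Longrightarrow> rmax (T (pp (Ad G k Y))) = rmax (T (pp Y))"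
proof -
 assume k: "k \<in> K"
 obtain U where U: "U \<in> H k" using H_nonempty[OF K_subset[OF k]] by blast
 have "T (pp (Ad G k Y)) = U * T (pp Y) * adj U"
  by (simp add: T_pp T_Ad_K[OF k U] distrib_left distrib_right mult.assoc)
 then show ?thesis using rmax_conj[of U] K_unitary[OF k U] by simp
qed

lemma tangent_space_eq: "g \<in> carrier G \<Longrightarrow> tangent_space G K (g <# K) = range (tvec G K g)"
proof (rule subset_antisym)
 assume g: "g \<in> carrier G"
 show "range (tvec G K g) \<subseteq> tangent_space G K (g <# K)" using g by (auto simp: tangent_space_def)
 show "tangent_space G K (g <# K) \<subseteq> range (tvec G K g)"
 proof
  fix v assume "v \<in> tangent_space G K (g <# K)"
  then obtain h Y where h: "h \<in> carrier G" "g <# K = h <# K" "v = tvec G K h Y" by (auto simp: tangent_space_def)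
  then obtain k where k: "k \<in> K" "h = g \<otimes> k" using coset_eq_iff[OF g h(1)] by blast
  show "v \<in> range (tvec G K g)" using tvec_K[OF g k(1), of Y] h(3) k(2) by blast
 qed
qed

text \<open>The description is meaningful because \<open>tvec_inj\<close> fixes the symmetric part
  for a given \<open>g\<close> and \<open>rmax_pp_Ad\<close> removes the dependence on
  \<open>g\<close>. In terms of \<open>Mx\<close> it is half of the largest relative eigenvalue of
  its derivative.\<close>

definition rmax_metric :: "'g set \<Rightarrow> 'g set tangent \<Rightarrow> real" where
 "rmax_metric p v = (THE r. \<exists>g Y. g \<in> carrier G \<and> g <# K = p \<and> tvec G K g Y = v \<and> r = rmax (T (pp Y)))"

lemma rmax_metric: "g \<in> carrier G \<Longrightarrow> rmax_metric (g <# K) (tvec G K g Y) = rmax (T (pp Y))" unfolding rmax_metric_def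
proof (rule the_equality)
 assume g: "g \<in> carrier G"
 then show "\<exists>h Z. h \<in> carrier G \<and> h <# K = g <# K \<and> tvec G K h Z = tvec G K g Y \<and> rmax (T (pp Y)) = rmax (T (pp Z))"
  by blast
 fix r assume "\<exists>h Z. h \<in> carrier G \<and> h <# K = g <# K \<and> tvec G K h Z = tvec G K g Y \<and> r = rmax (T (pp Z))"
 then obtain h Z where h: "h \<in> carrier G" "h <# K = g <# K" "tvec G K h Z = tvec G K g Y" "r = rmax (T (pp Z))"
  by blast
 obtain k where k: "k \<in> K" "h = g \<otimes> k" using coset_eq_iff[OF g h(1)] h(2) by auto
 have "tvec G K g (Ad G k Z) = tvec G K g Y" using tvec_K[OF g k(1), of Z] h(3) k(2) by simp
 from tvec_inj[OF g this] show "r = rmax (T (pp Y))" using rmax_pp_Ad[OF k(1), of Z] h(4) by simp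
qed

lemma rmax_metric_invariant: "invariant_finsler_metric G K rmax_metric"
 unfolding invariant_finsler_metric_def finsler_metric_def
proof (intro conjI ballI)
 have "continuous_map (prod_topology GT euclidean) euclideanreal ((\<lambda>Y. rmax (T (pp Y))) \<circ> snd)"
 proof (rule continuous_map_compose[OF continuous_map_snd])
  have "continuous_on UNIV (\<lambda>Y. rmax (T (pp Y)))"
   by (intro continuous_on_rmax bounded_linear.continuous_on[OF T_bl] linear_continuous_on linear_conv_bounded_linear[THEN iffD1] linear_pp)
  then show "continuous_map euclidean euclideanreal (\<lambda>Y. rmax (T (pp Y)))" by simp
 qed
 then show "continuous_map (prod_topology GT euclidean) euclideanreal
   (\<lambda>(g, Y). rmax_metric (g <# K) (tvec G K g Y))"
  by (rule continuous_map_eq) (auto simp: rmax_metric)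
next
 fix p v assume "p \<in> lcosets K" and v: "v \<in> tangent_space G K p"
 then obtain g where g: "g \<in> carrier G" "p = g <# K" using lcosets_iff by blast
 obtain Y where Y: "v = tvec G K g Y" using v tangent_space_eq[OF g(1)] g(2) by auto
 have r: "rmax_metric p (tvec G K g Z) = rmax (T (pp Z))" for Z using rmax_metric[OF g(1)] g(2) by simp
 show "rmax_metric p v \<ge> 0" using r rmax_pp_nonneg by (simp add: Y)
 have t0: "tvec G K g 0 = (\<lambda>f. 0)" using tvec_scale[OF g(1), of 0 0] by simp
 show "rmax_metric p v = 0 \<longleftrightarrow> v = (\<lambda>f. 0)"
 proof
  assume "rmax_metric p v = 0"
  then have "pp Y = 0" using r rmax_pp_zero_iff by (simp add: Y)
  then show "v = (\<lambda>f. 0)" using tvec_pp[OF g(1), of Y] t0 Y by simp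
 next
  assume "v = (\<lambda>f. 0)"
  then have "tvec G K g Y = tvec G K g 0" using Y t0 by simp
  from tvec_inj[OF g(1) this] have "pp Y = 0" by (simp add: pp_zero)
  then show "rmax_metric p v = 0" using r rmax_pp_zero_iff[of Y] by (simp add: Y)
 qed
 show "\<forall>s\<ge>0. rmax_metric p (\<lambda>f. s * v f) = s * rmax_metric p v"
 proof (intro allI impI)
  fix s :: real assume "s \<ge> 0"
  then show "rmax_metric p (\<lambda>f. s * v f) = s * rmax_metric p v"
   unfolding Y tvec_scale[OF g(1), symmetric] r by (simp add: linear_cmul[OF linear_pp] T_simps rmax_scaleR)
 qed
 fix w assume "w \<in> tangent_space G K p"
 then obtain Z where Z: "w = tvec G K g Z" using tangent_space_eq[OF g(1)] g(2) by auto
 show "rmax_metric p (\<lambda>f. v f + w f) \<le> rmax_metric p v + rmax_metric p w"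
  unfolding Y Z tvec_add[OF g(1), symmetric] r by (simp add: linear_add[OF linear_pp] T_simps rmax_add)
next
 fix h p v assume h: "h \<in> carrier G" and "p \<in> lcosets K" and v: "v \<in> tangent_space G K p"
 then obtain g where g: "g \<in> carrier G" "p = g <# K" using lcosets_iff by blast
 obtain Y where Y: "v = tvec G K g Y" using v tangent_space_eq[OF g(1)] g(2) by auto
 show "rmax_metric (h <# p) (\<lambda>f. v (\<lambda>x. f (h <# x))) = rmax_metric p v"
  unfolding Y g(2) tvec_translate[OF h g(1)] coset_translate[OF h g(1)] using h g(1) by (simp add: rmax_metric)
qed

lemma rmax_metric_unit_ball: "finsler_unit_ball G K \<aa> rmax_metric = {Y \<in> \<aa>. rmax (T Y) \<le> 1}"
 using rmax_metric[OF one_closed] pp_of_symmetric[OF a_symmetric] by (auto simp: finsler_unit_ball_def one_coset)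

text \<open>An invariant metric is determined by its unit ball in \<open>\<aa>\<close>, since every symmetric element is
 conjugate under \<open>K\<close> to an element of \<open>\<aa>\<close>.\<close>

lemma invariant_metric_eq:
 assumes F: "invariant_finsler_metric G K F" "finsler_unit_ball G K \<aa> F = {Y \<in> \<aa>. rmax (T Y) \<le> 1}"
  and g: "g \<in> carrier G"
 shows "F (g <# K) (tvec G K g Y) = rmax (T (pp Y))"
proof -
 have Kl: "K \<in> lcosets K" using lcosets_in[OF one_closed] by (simp add: one_coset)
 have tK: "tvec G K \<one> Z \<in> tangent_space G K K" for Z using tangent_space_eq[OF one_closed] by (simp add: one_coset)
 have inv: "F (h <# K) (tvec G K h Z) = F K (tvec G K \<one> Z)" if h: "h \<in> carrier G" for h Z
 proof -
  have "F (h <# K) (\<lambda>f. tvec G K \<one> Z (\<lambda>x. f (h <# x))) = F K (tvec G K \<one> Z)"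
   using F(1) h Kl tK unfolding invariant_finsler_metric_def by blast
  then show ?thesis using tvec_translate[OF h one_closed] h by simp
 qed
 obtain k U Q where k: "k \<in> K" "U \<in> H k" and Q: "Q \<in> \<aa>" and eq: "T (pp Y) = U * T Q * adj U"
  by (rule conjugate_into_a[OF pp_symmetric])
 have kc: "k \<in> carrier G" by (rule K_subset[OF k(1)])
 have "T (pp Y) = T (Ad G k Q)" using eq T_Ad_K[OF k] by simp
 then have ppY: "pp Y = Ad G k Q" by (simp only: T_eq_iff)
 have kK: "k <# K = K"
 proof -
  have "\<one> <# K = k <# K" by (rule coset_eq_iff[THEN iffD2, OF one_closed kc]) (use k kc in \<open>auto intro!: bexI[of _ k]\<close>)
  then show ?thesis by (simp add: one_coset)
 qed
 have "tvec G K \<one> Y = tvec G K \<one> (Ad G k Q)" using tvec_pp[OF one_closed, of Y] ppY by simp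
 also have "\<dots> = tvec G K k Q" using tvec_K[OF one_closed k(1), of Q] kc by simp
 finally have "F (g <# K) (tvec G K g Y) = F K (tvec G K \<one> Q)"
  using inv[OF g, of Y] inv[OF kc, of Q] by (simp add: kK)
 \<comment> \<open>Both sides are nonnegative and positively homogeneous in \<open>Q\<close>, so
   comparing them with \<open>c > 0\<close> amounts to testing whether \<open>Q / c\<close> is in
   the common unit ball.\<close>
 moreover have "F K (tvec G K \<one> Q) = rmax (T Q)"
 proof (rule eq_of_same_upper_bounds)
  have fm: "F K v \<ge> 0 \<and> (\<forall>r\<ge>0. F K (\<lambda>f. r * v f) = r * F K v)" if "v \<in> tangent_space G K K" for v
   using F(1) Kl that unfolding invariant_finsler_metric_def finsler_metric_def by blast
  have ppQ: "pp Q = Q" using pp_of_symmetric[OF a_symmetric[OF Q]] by simp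
  show "0 \<le> F K (tvec G K \<one> Q)" using fm tK by blast
  show "0 \<le> rmax (T Q)" using rmax_pp_nonneg[of Q] ppQ by simp
  fix c :: real assume c: "c > 0"
  have sQ: "inverse c *\<^sub>R Q \<in> \<aa>" by (rule subspace_scale[OF a_subspace Q])
  have "F K (tvec G K \<one> (inverse c *\<^sub>R Q)) = inverse c * F K (tvec G K \<one> Q)"
   using fm[OF tK[of Q]] c by (simp add: tvec_scale[OF one_closed])
  moreover have "F K (tvec G K \<one> (inverse c *\<^sub>R Q)) \<le> 1 \<longleftrightarrow> rmax (T (inverse c *\<^sub>R Q)) \<le> 1"
   using F(2) sQ by (auto simp: finsler_unit_ball_def set_eq_iff)
  ultimately have "inverse c * F K (tvec G K \<one> Q) \<le> 1 \<longleftrightarrow> inverse c * rmax (T Q) \<le> 1"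
   using c by (simp add: T_simps rmax_scaleR)
  then show "F K (tvec G K \<one> Q) \<le> c \<longleftrightarrow> rmax (T Q) \<le> c" using c by (simp add: field_simps)
 qed
 moreover have "rmax (T (pp Y)) = rmax (T Q)" using rmax_conj[of U "T Q"] K_unitary[OF k] by (simp add: eq)
 ultimately show ?thesis by simp
qed

end

section \<open>The Finsler distance\<close>

lemma rmax_pos_iff: "rmax A > 0 \<longleftrightarrow> (\<exists>w. w \<bullet> app A w > 0)"
proof
 assume "rmax A > 0"
 moreover obtain v where "v \<bullet> app A v = rmax A" using rayleigh_attained[of A] by metis
 ultimately show "\<exists>w. w \<bullet> app A w > 0" by metis
next
 assume "\<exists>w. w \<bullet> app A w > 0"
 then obtain w where "w \<bullet> app A w > 0" by blast
 then have "rmax A * (w \<bullet> w) > 0" using rayleigh_le[of w A] by simp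
 then show "rmax A > 0" using mult_nonpos_nonneg[of "rmax A" "w \<bullet> w"] by force
qed

lemma rmax_neg_iff: "rmax A < 0 \<longleftrightarrow> (\<forall>w. w \<noteq> 0 \<longrightarrow> w \<bullet> app A w < 0)"
proof
 assume r: "rmax A < 0"
 show "\<forall>w. w \<noteq> 0 \<longrightarrow> w \<bullet> app A w < 0"
 proof (intro allI impI)
  fix w :: 'a assume "w \<noteq> 0"
  then have "rmax A * (w \<bullet> w) < 0" using r by (simp add: mult_neg_pos)
  then show "w \<bullet> app A w < 0" using rayleigh_le[of w A] by simp
 qed
next
 assume neg: "\<forall>w. w \<noteq> 0 \<longrightarrow> w \<bullet> app A w < 0"
 obtain v where v: "norm v = 1" "v \<bullet> app A v = rmax A" using rayleigh_attained[of A] by metis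
 then have "v \<noteq> 0" by auto
 then show "rmax A < 0" using neg v(2) by metis
qed

text \<open>Congruence by an invertible operator only reparametrises the vectors at which the
  quadratic form is evaluated, as in the law of inertia; the value of \<open>rmax\<close> changes
  but its sign does not.\<close>

lemma rmax_congruence:
 assumes N: "N' * N = 1" "N * N' = 1"
 shows "rmax (N * A * adj N) > 0 \<longleftrightarrow> rmax A > 0" "rmax (N * A * adj N) < 0 \<longleftrightarrow> rmax A < 0"
proof -
 have q: "w \<bullet> app (N * A * adj N) w = app (adj N) w \<bullet> app A (app (adj N) w)" for w by (simp add: inner_app)
 have i: "app (adj N) (app (adj N') w) = w" "app (adj N') (app (adj N) w) = w" for w
  using N by (metis adj_simps(4,5) app_simps(4,5))+
 have z: "app (adj N) w = 0 \<longleftrightarrow> w = 0" for w using i(2)[of w] by (metis app_right_simps(4))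
 show "rmax (N * A * adj N) > 0 \<longleftrightarrow> rmax A > 0" unfolding rmax_pos_iff q by (metis i(1))
 show "rmax (N * A * adj N) < 0 \<longleftrightarrow> rmax A < 0" unfolding rmax_neg_iff q using i(1) z by metis
qed

lemma rmax_minus_scalar: "rmax (A - c *\<^sub>R 1) = rmax A - c"
proof (rule antisym)
 show "rmax (A - c *\<^sub>R 1) \<le> rmax A - c"
  by (rule rmax_leI) (simp add: inner_diff_right dot_square_norm rayleigh_le_unit)
 have "rmax A \<le> rmax (A - c *\<^sub>R 1) + c"
 proof (rule rmax_leI)
  fix w :: 'a assume "norm w = 1"
  then show "w \<bullet> app A w \<le> rmax (A - c *\<^sub>R 1) + c"
   using rayleigh_le_unit[of w "A - c *\<^sub>R 1"] by (simp add: inner_diff_right dot_square_norm)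
 qed
 then show "rmax A - c \<le> rmax (A - c *\<^sub>R 1)" by simp
qed

definition unit_endo :: "'v::euclidean_space \<Rightarrow> 'v \<Rightarrow> 'v endo" where
 "unit_endo e b = endo_of (\<lambda>v. (b \<bullet> v) *\<^sub>R e)"

lemma app_unit_endo: "app (unit_endo e b) v = (b \<bullet> v) *\<^sub>R e"
 unfolding unit_endo_def by (rule app_endo_of, rule linearI) (simp_all add: inner_add_right scaleR_add_left)

text \<open>Expansion in matrix units, which reduces regularity of operator-valued curves to that of
  scalar coefficients.\<close>

lemma endo_expand: "A = (\<Sum>b\<in>Basis. \<Sum>e\<in>Basis. (e \<bullet> app A b) *\<^sub>R unit_endo e b)"
proof (rule endo_eqI)
 fix v
 have "(\<Sum>e\<in>Basis. (e \<bullet> app A b) *\<^sub>R (b \<bullet> v) *\<^sub>R e) = (b \<bullet> v) *\<^sub>R app A b" for b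
 proof -
  have "(\<Sum>e\<in>Basis. (e \<bullet> app A b) *\<^sub>R (b \<bullet> v) *\<^sub>R e) = (b \<bullet> v) *\<^sub>R (\<Sum>e\<in>Basis. (app A b \<bullet> e) *\<^sub>R e)"
   by (simp add: scaleR_sum_right inner_commute mult.commute)
  then show ?thesis by (simp add: euclidean_representation)
 qed
 then have "app (\<Sum>b\<in>Basis. \<Sum>e\<in>Basis. (e \<bullet> app A b) *\<^sub>R unit_endo e b) v = app A (\<Sum>b\<in>Basis. (b \<bullet> v) *\<^sub>R b)"
  by (simp add: app_sum_left app_unit_endo app_sum_right)
 then show "app A v = app (\<Sum>b\<in>Basis. \<Sum>e\<in>Basis. (e \<bullet> app A b) *\<^sub>R unit_endo e b) v"
  by (simp add: inner_commute[of _ v] euclidean_representation)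
qed

text \<open>The function \<open>ln m / 2\<close> has derivative \<open>m' / (2 m)\<close>, which is
  at most \<open>q\<close>. In the application \<open>m\<close> is a quadratic form along a curve
  and \<open>q\<close> the speed of the curve.\<close>

lemma ln_quotient_integral_bound:
 fixes m m' q :: "real \<Rightarrow> real"
 assumes ab: "a \<le> b" and m: "\<And>t. t \<in> {a..b} \<Longrightarrow> m t > 0"
  and d: "\<And>t. t \<in> {a..b} \<Longrightarrow> (m has_real_derivative m' t) (at t within {a..b})"
  and q: "q integrable_on {a..b}" and le: "\<And>t. t \<in> {a..b} \<Longrightarrow> m' t \<le> 2 * q t * m t"
 shows "(ln (m b) - ln (m a)) / 2 \<le> integral {a..b} q"
proof -
 have "((\<lambda>t. m' t / (2 * m t)) has_integral ln (m b) / 2 - ln (m a) / 2) {a..b}"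
 proof (rule fundamental_theorem_of_calculus[OF ab])
  fix t assume t: "t \<in> {a..b}"
  have "((\<lambda>t. ln (m t)) has_real_derivative 1 / m t * m' t) (at t within {a..b})"
   by (rule DERIV_chain2[OF DERIV_ln_divide[OF m[OF t]] d[OF t]])
  from DERIV_cdivide[OF this, of 2]
  have "((\<lambda>t. ln (m t) / 2) has_real_derivative m' t / (2 * m t)) (at t within {a..b})" by (simp add: mult.commute)
  then show "((\<lambda>t. ln (m t) / 2) has_vector_derivative m' t / (2 * m t)) (at t within {a..b})"
   by (simp add: has_real_derivative_iff_has_vector_derivative)
 qed
 from has_integral_le[OF this integrable_integral[OF q]]
 have "ln (m b) / 2 - ln (m a) / 2 \<le> integral {a..b} q" using le m by (simp add: divide_le_eq mult_ac)
 then show ?thesis by (simp add: diff_divide_distrib)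
qed

context satake_basis
begin

text \<open>For curves in \<open>X\<close>, being \<open>C^1\<close> is a condition on their
  composition with smooth functions; it is applied to all matrix coefficients of \<open>Mx\<close>
  and the results are assembled.\<close>

lemma Mx_C1:
 assumes c: "C1_curve_on G K a b c"
 obtains M' where "continuous_on {a..b} M'"
  "\<And>t. t \<in> {a..b} \<Longrightarrow> ((\<lambda>s. Mx (c s)) has_vector_derivative M' t) (at t within {a..b})"
proof -
 let ?P = "\<lambda>b' e f'. continuous_on {a..b} f' \<and>
   (\<forall>t\<in>{a..b}. ((\<lambda>s. e \<bullet> app (Mx (c s)) b') has_real_derivative f' t) (at t within {a..b}))"
 define d where "d b' e = (SOME f'. ?P b' e f')" for b' e :: "complex^'n"
 have d: "?P b' e (d b' e)" for b' e
 proof -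
  have "bounded_linear (\<lambda>A. app A b')" by (rule bounded_bilinear.bounded_linear_left[OF bounded_bilinear_app])
  then have "bounded_linear (\<lambda>A. e \<bullet> app A b')" by (rule bounded_linear_compose[OF bounded_linear_inner_right])
  from Mx_smooth[OF this] have "\<exists>f'. ?P b' e f'" using c unfolding C1_curve_on_def by fast
  then show ?thesis unfolding d_def by (rule someI_ex)
 qed
 let ?M' = "\<lambda>t. \<Sum>b'\<in>Basis. \<Sum>e\<in>Basis. d b' e t *\<^sub>R unit_endo e b'"
 show ?thesis
 proof
  show "continuous_on {a..b} ?M'" by (intro continuous_intros) (use d in blast)
  fix t assume t: "t \<in> {a..b}"
  have "((\<lambda>s. (e \<bullet> app (Mx (c s)) b') *\<^sub>R unit_endo e b') has_vector_derivative d b' e t *\<^sub>R unit_endo e b') (at t within {a..b})" for e b'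
   using has_vector_derivative_scaleR[of "\<lambda>s. e \<bullet> app (Mx (c s)) b'" "d b' e t" t "{a..b}" "\<lambda>s. unit_endo e b'" 0]
    d[of b' e] t by simp
  then have "((\<lambda>s. \<Sum>b'\<in>Basis. \<Sum>e\<in>Basis. (e \<bullet> app (Mx (c s)) b') *\<^sub>R unit_endo e b') has_vector_derivative ?M' t) (at t within {a..b})"
   by (intro has_vector_derivative_sum)
  then show "((\<lambda>s. Mx (c s)) has_vector_derivative ?M' t) (at t within {a..b})" by (simp only: endo_expand[symmetric])
 qed
qed

text \<open>Near \<open>t\<close> the curve is \<open>g expG(y s) K\<close> with \<open>y\<close> symmetric, and \<open>y\<close> is differentiable at \<open>t\<close>
 because \<open>exp (2 T y)\<close> is.\<close>

lemma curve_velocity: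
 assumes c: "\<And>s. s \<in> {a<..<b} \<Longrightarrow> c s \<in> lcosets K" and t: "t \<in> {a<..<b}"
  and M: "((\<lambda>s. Mx (c s)) has_vector_derivative M') (at t)"
  and g: "g \<in> carrier G" "c t = g <# K" and N: "N \<in> H g" "N' * N = 1" "N * N' = 1"
 obtains Y where "velocity G K c t = tvec G K g Y" "T Y = (1 / 2) *\<^sub>R (N' * M' * adj N')"
proof -
 have "\<exists>y. adj (T y) = T y \<and> c s = (g \<otimes> expG y) <# K" if s: "s \<in> {a<..<b}" for s
 proof -
  obtain h where h: "h \<in> carrier G" "c s = h <# K" using c[OF s] lcosets_iff by blast
  obtain P k where P: "adj (T P) = T P" "k \<in> K" "inv g \<otimes> h = expG P \<otimes> k"
   by (rule cartan_decomposition[of "inv g \<otimes> h"]) (use g h in simp)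
  have kc: "k \<in> carrier G" by (rule K_subset[OF P(2)])
  have "h = g \<otimes> (inv g \<otimes> h)" using g h by (simp add: m_assoc[symmetric])
  then have "h = g \<otimes> expG P \<otimes> k" using P(3) g kc by (simp add: m_assoc)
  then have "(g \<otimes> expG P) <# K = h <# K"
   by (intro coset_eq_iff[THEN iffD2] bexI[of _ k] P(2) m_closed g expG_carrier h)
  then show ?thesis using P(1) h(2) by auto
 qed
 then obtain y where y: "\<And>s. s \<in> {a<..<b} \<Longrightarrow> adj (T (y s)) = T (y s) \<and> c s = (g \<otimes> expG (y s)) <# K" by metis
 \<comment> \<open>\<open>Mx\<close> along the curve, seen in the frame \<open>N\<close> at time
   \<open>t\<close>: it is 1 there and \<open>exp (2 T y)\<close> nearby, so the derivative of
   \<open>T y\<close> is half of that of \<open>u\<close>.\<close>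
 define u where "u s = N' * Mx (c s) * adj N'" for s
 have u: "u s = exp (T (2 *\<^sub>R y s))" if s: "s \<in> {a<..<b}" for s
 proof -
  have "Mx (c s) = (N * exp (T (y s))) * adj (N * exp (T (y s)))"
   using y[OF s] Mx[OF m_closed[OF g(1) expG_carrier] H_mult[OF g(1) expG_carrier N(1) exp_H_expG]] by simp
  also have "\<dots> = N * (exp (T (y s)) * exp (T (y s))) * adj N" using y[OF s] by (simp add: adj_exp mult.assoc)
  also have "exp (T (y s)) * exp (T (y s)) = exp (T (2 *\<^sub>R y s))" by (simp add: T_simps scaleR_2 exp_add_commuting)
  finally show ?thesis unfolding u_def using H_conj_inverse[OF N(2)] by simp
 qed
 have ut: "u t = 1" using Mx[OF g(1) N(1)] H_conj_inverse[OF N(2), of 1] g(2) by (simp add: u_def)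
 have "exp (T (2 *\<^sub>R y t)) = exp (T 0)" using u[OF t] ut by (simp add: T_simps)
 then have "T (2 *\<^sub>R y t) = T 0" by (rule symmetric_exp_inj[rotated 2]) (use y[OF t] in \<open>simp_all add: T_simps\<close>)
 then have yt: "y t = 0" by (simp add: T_eq_iff)
 let ?U = "N' * M' * adj N'"
 have du: "(u has_vector_derivative ?U) (at t)" unfolding u_def
  by (rule bounded_linear.has_vector_derivative[OF bounded_linear_mult_left
     bounded_linear.has_vector_derivative[OF bounded_linear_mult_right M]])
 have "continuous (at t) u" by (rule has_vector_derivative_continuous[OF du])
 then have "(u \<longlongrightarrow> u t) (nhds t)" unfolding continuous_at tendsto_at_iff_tendsto_nhds .
 then have "((\<lambda>s. norm (u s - 1)) \<longlongrightarrow> norm (u t - 1)) (nhds t)" by (intro tendsto_intros)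
 then have "\<forall>\<^sub>F s in nhds t. norm (u s - 1) < 1 / 2" by (rule order_tendstoD) (simp add: ut)
 moreover have "\<forall>\<^sub>F s in nhds t. s \<in> {a<..<b}" using t by (intro eventually_nhds_in_open) auto
 ultimately have "\<forall>\<^sub>F s in nhds t. norm (T (y s) - (1 / 2) *\<^sub>R (u s - 1)) \<le> 2 * (norm (u s - u t))\<^sup>2"
 proof eventually_elim
  case (elim s)
  let ?A = "T (2 *\<^sub>R y s)"
  have A: "adj ?A = ?A" using y[OF elim(2)] by (simp add: T_simps)
  have n: "norm ?A \<le> 2 * norm (u s - 1)" using symmetric_norm_le_exp_minus_one[OF A] u[OF elim(2)] elim(1) by simp
  have "norm (exp ?A - 1 - ?A) \<le> (norm ?A)\<^sup>2" by (rule exp_second_order) (use n elim(1) in simp)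
  also have "\<dots> \<le> (2 * norm (u s - 1))\<^sup>2" by (rule power_mono[OF n]) simp
  finally have "norm (u s - 1 - ?A) \<le> 4 * (norm (u s - u t))\<^sup>2"
   using u[OF elim(2)] ut by (simp add: power_mult_distrib)
  moreover have "T (y s) - (1 / 2) *\<^sub>R (u s - 1) = - ((1 / 2) *\<^sub>R (u s - 1 - ?A))"
   by (simp add: T_simps scaleR_diff_right)
  ultimately show ?case by (simp only: norm_minus_cancel norm_scaleR)
 qed
 note q = this
 have d: "((\<lambda>s. (1 / 2) *\<^sub>R (u s - 1)) has_vector_derivative (1 / 2) *\<^sub>R (?U - 0)) (at t)"
  by (rule bounded_linear.has_vector_derivative[OF bounded_linear_scaleR_right
     has_vector_derivative_diff[OF du has_vector_derivative_const]])
 have "((\<lambda>s. T (y s)) has_derivative (\<lambda>r. r *\<^sub>R (1 / 2) *\<^sub>R ?U)) (at t)"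
  by (rule has_derivative_quadratic_error[OF d[unfolded has_vector_derivative_def diff_0_right]
     du[unfolded has_vector_derivative_def] q])
 then obtain y' where y': "(y has_derivative y') (at t)" "\<And>v. T (y' v) = v *\<^sub>R (1 / 2) *\<^sub>R ?U"
  by (rule has_derivative_through_injection[OF T_bl T_inj]) blast
 show ?thesis
 proof
  show "T (y' 1) = (1 / 2) *\<^sub>R ?U" by (simp add: y'(2))
  show "velocity G K c t = tvec G K g (y' 1)"
  proof (rule ext)
   fix f
   show "velocity G K c t f = tvec G K g (y' 1) f"
   proof (cases "smooth_fun G K f")
    case True
    let ?F = "\<lambda>g. f (g <# K)"
    note sF = True[unfolded smooth_fun_iff]
    have "((\<lambda>s. ?F (g \<otimes> expG (y s))) has_derivative (\<lambda>r. dF ?F g (y' r))) (at t)"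
     by (rule has_derivative_compose[OF y'(1)]) (simp add: yt dF_expG[OF sF g(1)])
    then have "((\<lambda>s. f (c s)) has_derivative (\<lambda>r. dF ?F g (y' r))) (at t)"
     by (rule has_derivative_transform_within_open[where s = "{a<..<b}"]) (use y t in auto)
    moreover have "(\<lambda>r. dF ?F g (y' r)) = (*) (dF ?F g (y' 1))"
    proof
     fix r
     show "dF ?F g (y' r) = dF ?F g (y' 1) * r"
      using linear_cmul[OF has_derivative_linear[OF y'(1)], of r 1] linear_cmul[OF linear_dF[OF sF g(1)], of r "y' 1"]
      by (simp add: mult.commute)
    qed
    ultimately have "((\<lambda>s. f (c s)) has_real_derivative dF ?F g (y' 1)) (at t)"
     by (simp add: has_field_derivative_def)
    then show ?thesis using True by (simp add: velocity_def tvec_def' DERIV_imp_deriv)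
   qed (simp add: velocity_def tvec_def')
  qed
 qed
qed

text \<open>An inverse of some lift of some representative of \<open>x\<close>, chosen without any
  continuity; what is formed with it has to be shown insensitive to the choice.\<close>

definition rep :: "'g set \<Rightarrow> (complex^'n) endo" where
 "rep x = (SOME N'. \<exists>g N. g \<in> carrier G \<and> x = g <# K \<and> N \<in> H g \<and> N' * N = 1 \<and> N * N' = 1)"

lemma rep:
 assumes "x \<in> lcosets K"
 obtains g N where "g \<in> carrier G" "x = g <# K" "N \<in> H g" "rep x * N = 1" "N * rep x = 1"
proof -
 obtain g where g: "g \<in> carrier G" "x = g <# K" using assms lcosets_iff by blast
 obtain N where N: "N \<in> H g" using H_nonempty[OF g(1)] by blast
 obtain N' where "N' * N = 1" "N * N' = 1" by (rule H_inverse[OF g(1) N])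
 then have "\<exists>N' g N. g \<in> carrier G \<and> x = g <# K \<and> N \<in> H g \<and> N' * N = 1 \<and> N * N' = 1" using g N by blast
 from someI_ex[OF this, folded rep_def] show ?thesis using that by blast
qed

text \<open>The invariant metric evaluated at the derivative \<open>A\<close> of \<open>Mx (c t)\<close> is half of the largest
 eigenvalue of \<open>A\<close> relative to \<open>Mx (c t)\<close>; the sign of its difference to \<open>r\<close> is that of
 \<open>rmax (A - r *\<^sub>R Mx (c t))\<close>.\<close>

lemma rep_rmax:
 assumes x: "x \<in> lcosets K"
 shows "r < rmax (rep x * A * adj (rep x)) \<longleftrightarrow> rmax (A - r *\<^sub>R Mx x) > 0"
  "rmax (rep x * A * adj (rep x)) < r \<longleftrightarrow> rmax (A - r *\<^sub>R Mx x) < 0"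
proof -
 obtain g N where g: "g \<in> carrier G" "x = g <# K" "N \<in> H g" "rep x * N = 1" "N * rep x = 1" by (rule rep[OF x])
 have "rep x * Mx x * adj (rep x) = 1" using H_conj_inverse[OF g(4), of 1] Mx[OF g(1,3)] g(2) by simp
 then have "rep x * (A - r *\<^sub>R Mx x) * adj (rep x) = rep x * A * adj (rep x) - r *\<^sub>R 1"
  by (simp add: left_diff_distrib right_diff_distrib)
 then have "rmax (rep x * (A - r *\<^sub>R Mx x) * adj (rep x)) = rmax (rep x * A * adj (rep x)) - r"
  by (simp add: rmax_minus_scalar)
 then show "r < rmax (rep x * A * adj (rep x)) \<longleftrightarrow> rmax (A - r *\<^sub>R Mx x) > 0"
  "rmax (rep x * A * adj (rep x)) < r \<longleftrightarrow> rmax (A - r *\<^sub>R Mx x) < 0"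
  using rmax_congruence[OF g(5,4), of "A - r *\<^sub>R Mx x"] by auto
qed

text \<open>By \<open>rep_rmax\<close> both strict comparisons with a number \<open>r\<close> are
  sign conditions on \<open>rmax (A t - r *\<^sub>R Mx (x t))\<close>, which is continuous in
  \<open>t\<close>, so the discontinuity of \<open>rep\<close> does no harm.\<close>

lemma continuous_rep_rmax:
 fixes x :: "real \<Rightarrow> 'g set"
 assumes x: "\<And>t. t \<in> I \<Longrightarrow> x t \<in> lcosets K" and M: "continuous_on I (\<lambda>t. Mx (x t))" and A: "continuous_on I A"
 shows "continuous_on I (\<lambda>t. rmax (rep (x t) * A t * adj (rep (x t))))" unfolding continuous_on_def
proof (intro ballI order_tendstoI)
 fix t r assume t: "t \<in> I"
 have "continuous_on I (\<lambda>t. rmax (A t - r *\<^sub>R Mx (x t)))" by (intro continuous_intros A M)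
 then have lim: "((\<lambda>t. rmax (A t - r *\<^sub>R Mx (x t))) \<longlongrightarrow> rmax (A t - r *\<^sub>R Mx (x t))) (at t within I)"
  using t by (simp add: continuous_on_def)
 have I: "\<forall>\<^sub>F s in at t within I. s \<in> I" by (simp add: eventually_at_filter)
 show "\<forall>\<^sub>F s in at t within I. r < rmax (rep (x s) * A s * adj (rep (x s)))"
  if "r < rmax (rep (x t) * A t * adj (rep (x t)))"
 proof -
  have "\<forall>\<^sub>F s in at t within I. 0 < rmax (A s - r *\<^sub>R Mx (x s))"
   by (rule order_tendstoD(1)[OF lim]) (use that rep_rmax(1)[OF x[OF t]] in blast)
  with I show ?thesis by eventually_elim (simp add: rep_rmax(1)[OF x])
 qed
 show "\<forall>\<^sub>F s in at t within I. rmax (rep (x s) * A s * adj (rep (x s))) < r"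
  if "rmax (rep (x t) * A t * adj (rep (x t))) < r"
 proof -
  have "\<forall>\<^sub>F s in at t within I. rmax (A s - r *\<^sub>R Mx (x s)) < 0"
   by (rule order_tendstoD(2)[OF lim]) (use that rep_rmax(2)[OF x[OF t]] in blast)
  with I show ?thesis by eventually_elim (simp add: rep_rmax(2)[OF x])
 qed
qed

lemma Mx_pos: "x \<in> lcosets K \<Longrightarrow> w \<noteq> 0 \<Longrightarrow> w \<bullet> app (Mx x) w > 0"
proof -
 assume x: "x \<in> lcosets K" and w: "w \<noteq> 0"
 obtain g N where g: "g \<in> carrier G" "x = g <# K" "N \<in> H g" "rep x * N = 1" "N * rep x = 1" by (rule rep[OF x])
 have "adj (rep x) * adj N = 1" using g(5) by (metis adj_simps(4,5))
 then have "app (adj (rep x)) (app (adj N) w) = w" by (metis app_simps(4,5))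
 then have "app (adj N) w \<noteq> 0" using w by (metis app_right_simps(4))
 moreover have "w \<bullet> app (Mx x) w = app (adj N) w \<bullet> app (adj N) w"
  using Mx[OF g(1,3)] g(2) app_adj[of N w "app (adj N) w"] by simp
 ultimately show ?thesis by simp
qed

lemma norm_H_coset:
 assumes g: "g \<in> carrier G" and k: "k \<in> K" and A: "A \<in> H g" and B: "B \<in> H (g \<otimes> k)"
 shows "norm B = norm A"
proof -
 have "(norm B)\<^sup>2 = (norm A)\<^sup>2" using symm_invariant_K[OF g A k B] by (simp flip: norm_mult_adj)
 then show ?thesis by simp
qed

context
 fixes F
 assumes F: "invariant_finsler_metric G K F" "finsler_unit_ball G K \<aa> F = {Y \<in> \<aa>. rmax (T Y) \<le> 1}"
begin

text \<open>For fixed \<open>w\<close> the number \<open>m = w \<bullet> app (Mx (c t)) w\<close>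
  satisfies \<open>m' \<le> 2 q m\<close>, because \<open>2 q\<close> is the largest eigenvalue of
  the derivative relative to \<open>Mx (c t)\<close>. Hence \<open>ln m / 2\<close> cannot grow
  faster than the length.\<close>

lemma piece_length:
 assumes ab: "a < b" and c1: "C1_curve_on G K a b c" and c: "\<And>s. s \<in> {a..b} \<Longrightarrow> c s \<in> lcosets K" and w: "w \<noteq> 0"
 shows "(\<lambda>t. F (c t) (velocity G K c t)) integrable_on {a..b}"
  "(ln (w \<bullet> app (Mx (c b)) w) - ln (w \<bullet> app (Mx (c a)) w)) / 2 \<le> integral {a..b} (\<lambda>t. F (c t) (velocity G K c t))"
proof -
 obtain M' where M': "continuous_on {a..b} M'"
  "\<And>t. t \<in> {a..b} \<Longrightarrow> ((\<lambda>s. Mx (c s)) has_vector_derivative M' t) (at t within {a..b})" by (rule Mx_C1[OF c1]) blast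
 let ?q = "\<lambda>t. rmax (rep (c t) * M' t * adj (rep (c t))) / 2"
 have cM: "continuous_on {a..b} (\<lambda>t. Mx (c t))"
  unfolding continuous_on_eq_continuous_within using M'(2) has_vector_derivative_continuous by blast
 have "continuous_on {a..b} (\<lambda>t. rmax (rep (c t) * M' t * adj (rep (c t))))"
  by (rule continuous_rep_rmax[OF c cM M'(1)])
 then have "continuous_on {a..b} ?q" by (rule continuous_on_divide[OF _ continuous_on_const]) simp
 then have iq: "?q integrable_on {a..b}" by (rule integrable_continuous_real)
 have eq: "F (c t) (velocity G K c t) = ?q t" if t: "t \<in> {a<..<b}" for t
 proof -
  have t': "t \<in> {a..b}" using t by simp
  obtain g N where g: "g \<in> carrier G" "c t = g <# K" "N \<in> H g" "rep (c t) * N = 1" "N * rep (c t) = 1"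
   by (rule rep[OF c[OF t']])
  have d: "((\<lambda>s. Mx (c s)) has_vector_derivative M' t) (at t)" using M'(2)[OF t'] t by (simp add: at_within_Icc_at)
  obtain Y where Y: "velocity G K c t = tvec G K g Y" "T Y = (1 / 2) *\<^sub>R (rep (c t) * M' t * adj (rep (c t)))"
   by (rule curve_velocity[OF _ t d g]) (use c in auto)
  have "F (c t) (velocity G K c t) = rmax (T (pp Y))" using invariant_metric_eq[OF F g(1)] Y(1) g(2) by simp
  also have "\<dots> = rmax (T Y)" unfolding T_pp by (rule rmax_symmetrized)
  finally show ?thesis unfolding Y(2) by (simp add: rmax_scaleR)
 qed
 \<comment> \<open>\<open>velocity\<close> uses the two-sided derivative, which is controlled only
   inside the piece; the two end points are discarded as a null set.\<close>
 have eq': "F (c t) (velocity G K c t) = ?q t" if "t \<in> {a..b} - {a, b}" for t by (rule eq) (use that in auto)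
 show "(\<lambda>t. F (c t) (velocity G K c t)) integrable_on {a..b}"
  by (rule integrable_spike_finite[where S = "{a, b}", OF _ eq' iq]) simp_all
 have "(ln (w \<bullet> app (Mx (c b)) w) - ln (w \<bullet> app (Mx (c a)) w)) / 2 \<le> integral {a..b} ?q"
 proof (rule ln_quotient_integral_bound[OF _ _ _ iq])
  show "a \<le> b" using ab by simp
  fix t assume t: "t \<in> {a..b}"
  show pos: "w \<bullet> app (Mx (c t)) w > 0" by (rule Mx_pos[OF c[OF t] w])
  have bl: "bounded_linear (\<lambda>A. w \<bullet> app A w)" by (rule bounded_linear_compose[OF bounded_linear_inner_right
      bounded_bilinear.bounded_linear_left[OF bounded_bilinear_app]])
  from bounded_linear.has_vector_derivative[OF bl M'(2)[OF t]]
  show "((\<lambda>t. w \<bullet> app (Mx (c t)) w) has_real_derivative w \<bullet> app (M' t) w) (at t within {a..b})"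
   by (simp add: has_real_derivative_iff_has_vector_derivative)
  have "\<not> rmax (M' t - (2 * ?q t) *\<^sub>R Mx (c t)) > 0" unfolding rep_rmax(1)[OF c[OF t], symmetric] by simp
  then have "\<not> w \<bullet> app (M' t - (2 * ?q t) *\<^sub>R Mx (c t)) w > 0" unfolding rmax_pos_iff by blast
  then show "w \<bullet> app (M' t) w \<le> 2 * ?q t * (w \<bullet> app (Mx (c t)) w)" by (simp add: inner_diff_right)
 qed
 also have "integral {a..b} ?q = integral {a..b} (\<lambda>t. F (c t) (velocity G K c t))"
  by (rule integral_spike[of "{a, b}", OF _ eq']) simp_all
 finally show "(ln (w \<bullet> app (Mx (c b)) w) - ln (w \<bullet> app (Mx (c a)) w)) / 2 \<le> integral {a..b} (\<lambda>t. F (c t) (velocity G K c t))" .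
qed

lemma curve_length_lower_bound:
 assumes c: "piecewise_C1_curve G K c" and w: "w \<noteq> 0"
 shows "(ln (w \<bullet> app (Mx (c 1)) w) - ln (w \<bullet> app (Mx (c 0)) w)) / 2 \<le> curve_length G K F c"
proof -
 let ?f = "\<lambda>t. F (c t) (velocity G K c t)" and ?h = "\<lambda>t. ln (w \<bullet> app (Mx (c t)) w) / 2"
 from c have "\<exists>P. finite P \<and> {0, 1} \<subseteq> P \<and> P \<subseteq> {0..1} \<and>
   (\<forall>a\<in>P. \<forall>b\<in>P. a < b \<and> {a<..<b} \<inter> P = {} \<longrightarrow> C1_curve_on G K a b c)"
  unfolding piecewise_C1_curve_def by (rule conjunct2)
 then obtain P where P: "finite P" "{0, 1} \<subseteq> P" "P \<subseteq> {0..1}"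
  and pc': "\<forall>a\<in>P. \<forall>b\<in>P. a < b \<and> {a<..<b} \<inter> P = {} \<longrightarrow> C1_curve_on G K a b c" by (elim exE conjE)
 have pc: "C1_curve_on G K a b c" if "a \<in> P" "b \<in> P" "a < b" "{a<..<b} \<inter> P = {}" for a b
  using pc'[rule_format, OF that(1,2)] that(3,4) by simp
 have cl: "c s \<in> lcosets K" if "s \<in> {0..1}" for s using c that unfolding piecewise_C1_curve_def by blast
 \<comment> \<open>Induction on the number of partition points below \<open>p\<close>: the last of
   them and \<open>p\<close> bound a single \<open>C^1\<close> piece.\<close>
 have "?f integrable_on {0..p} \<and> ?h p - ?h 0 \<le> integral {0..p} ?f" if "p \<in> P" for p using that
 proof (induction "card {x \<in> P. x < p}" arbitrary: p rule: less_induct)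
  case (less p)
  show ?case
  proof (cases "p = 0")
   case False
   then have p0: "0 < p" using less.prems P(3) by force
   let ?L = "{x \<in> P. x < p}"
   have L: "finite ?L" "?L \<noteq> {}" using P p0 by auto
   define a where "a = Max ?L"
   have a: "a \<in> P" "a < p" using Max_in[OF L] by (auto simp: a_def)
   have a0: "0 \<le> a" using a(1) P(3) by auto
   have gap: "{a<..<p} \<inter> P = {}" using Max_ge[OF L(1)] by (force simp: a_def[symmetric])
   have "{x \<in> P. x < a} \<subset> ?L" using a by auto
   then have "card {x \<in> P. x < a} < card ?L" by (rule psubset_card_mono[OF L(1)])
   from less.hyps[OF this a(1)] have IH: "?f integrable_on {0..a}" "?h a - ?h 0 \<le> integral {0..a} ?f" by blast+
   have "p \<le> 1" using less.prems P(3) by auto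
   then have cl': "c s \<in> lcosets K" if "s \<in> {a..p}" for s using that a0 by (intro cl) auto
   have pl: "?f integrable_on {a..p}" "?h p - ?h a \<le> integral {a..p} ?f"
    using piece_length[where c = c, OF a(2) pc[OF a(1) less.prems a(2) gap] _ w] cl' by (simp_all add: diff_divide_distrib)
   have "?f integrable_on {0..p}"
    by (rule Henstock_Kurzweil_Integration.integrable_combine[OF a0 _ IH(1) pl(1)]) (use a in simp)
   moreover from this have "integral {0..a} ?f + integral {a..p} ?f = integral {0..p} ?f"
    by (rule Henstock_Kurzweil_Integration.integral_combine[OF a0 less_imp_le[OF a(2)]])
   ultimately show ?thesis using IH(2) pl(2) by simp
  next
   case True
   show ?thesis unfolding True using has_integral_refl(2)[of ?f 0] by (simp add: has_integral_integrable_integral)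
  qed
 qed
 from this[of 1] P(2) show ?thesis by (simp add: curve_length_def diff_divide_distrib)
qed

lemma geodesic:
 assumes g: "g \<in> carrier G" and Y: "adj (T Y) = T Y"
 defines "c \<equiv> \<lambda>t. (g \<otimes> expG (t *\<^sub>R Y)) <# K"
 shows "piecewise_C1_curve G K c" "curve_length G K F c = rmax (T Y)"
proof -
 have gc: "g \<otimes> expG (t *\<^sub>R Y) \<in> carrier G" for t using g by simp
 have d: "((\<lambda>s. f (c s)) has_real_derivative dF (\<lambda>g. f (g <# K)) (g \<otimes> expG (t *\<^sub>R Y)) Y) (at t)"
  if "smooth_fun G K f" for f t using dF_curve[OF that[unfolded smooth_fun_iff] g, of Y t]
  by (simp add: c_def has_real_derivative_iff_has_vector_derivative)
 have "C1_curve_on G K 0 1 c" unfolding C1_curve_on_def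
 proof (intro allI impI)
  fix f assume f: "smooth_fun G K f"
  let ?f' = "\<lambda>t. dF (\<lambda>g. f (g <# K)) (g \<otimes> expG (t *\<^sub>R Y)) Y"
  have cs: "continuous_map euclideanreal euclidean (\<lambda>t. t *\<^sub>R Y)" by (simp add: continuous_intros)
  have ce: "continuous_map euclideanreal GT (\<lambda>t. expG (t *\<^sub>R Y))"
   using continuous_map_compose[OF cs continuous_expG] by (simp add: o_def)
  have "continuous_map euclideanreal GT (\<lambda>t. g \<otimes> expG (t *\<^sub>R Y))"
   by (rule continuous_map_mult_G[OF _ ce]) (simp add: g)
  from continuous_map_compose[OF this continuous_dF[OF f[unfolded smooth_fun_iff], of Y]]
  have "continuous_on UNIV ?f'" by (simp add: o_def)
  then have "continuous_on {0..1} ?f'" by (rule continuous_on_subset) simp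
  then show "\<exists>f'. continuous_on {0..1} f' \<and> (\<forall>t\<in>{0..1}. ((\<lambda>s. f (c s)) has_real_derivative f' t) (at t within {0..1}))"
   using has_field_derivative_at_within[OF d[OF f]] by blast
 qed
 then show "piecewise_C1_curve G K c"
  unfolding piecewise_C1_curve_def by (intro conjI exI[of _ "{0, 1}"]) (auto simp: c_def lcosets_in[OF gc])
 have "F (c t) (velocity G K c t) = rmax (T Y)" for t
 proof -
  have "velocity G K c t = tvec G K (g \<otimes> expG (t *\<^sub>R Y)) Y"
   by (rule ext) (simp add: velocity_def tvec_def' DERIV_imp_deriv[OF d])
  then show ?thesis using invariant_metric_eq[OF F gc, of t Y] pp_of_symmetric[OF Y] by (simp add: c_def)
 qed
 then show "curve_length G K F c = rmax (T Y)" by (simp add: curve_length_def)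
qed

text \<open>The geodesic given by the Cartan decomposition of \<open>inv g \<otimes> h\<close> has
  length \<open>rmax (T P) = ln (norm A)\<close>. No curve is shorter, since the test vector of the
  lower bound can be chosen where \<open>adj A\<close> attains its norm.\<close>

theorem finsler_dist_eq:
 assumes g: "g \<in> carrier G" and h: "h \<in> carrier G" and A: "A \<in> H (inv g \<otimes> h)"
 shows "finsler_dist G K F (g <# K) (h <# K) = ln (norm A)"
proof -
 let ?C = "{c. piecewise_C1_curve G K c \<and> c 0 = g <# K \<and> c 1 = h <# K}"
 obtain P k where P: "adj (T P) = T P" "k \<in> K" "inv g \<otimes> h = expG P \<otimes> k"
  by (rule cartan_decomposition[of "inv g \<otimes> h"]) (use g h in simp)
 have kc: "k \<in> carrier G" by (rule K_subset[OF P(2)])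
 have "norm A = norm (exp (T P))" by (rule norm_H_coset[OF expG_carrier P(2) exp_H_expG]) (use A P(3) in simp)
 then have lnA: "ln (norm A) = rmax (T P)" using norm_exp_symmetric[OF P(1)] by simp
 let ?c = "\<lambda>t. (g \<otimes> expG (t *\<^sub>R P)) <# K"
 have "h = g \<otimes> (inv g \<otimes> h)" using g h by (simp add: m_assoc[symmetric])
 then have "h = g \<otimes> expG P \<otimes> k" using P(3) g kc by (simp add: m_assoc)
 then have "(g \<otimes> expG P) <# K = h <# K"
  by (intro coset_eq_iff[THEN iffD2] bexI[of _ k] P(2) m_closed g expG_carrier h)
 then have cC: "?c \<in> ?C" using geodesic(1)[OF g P(1)] g by simp
 have lower: "ln (norm A) \<le> curve_length G K F c" if c: "c \<in> ?C" for c
 proof -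
  obtain N where N: "N \<in> H g" using H_nonempty[OF g] by blast
  obtain N' where N': "N' \<in> H (inv g)" "N' * N = 1" "N * N' = 1" by (rule H_inverse[OF g N])
  obtain L where L: "L \<in> H h" using H_nonempty[OF h] by blast
  have "norm (N' * L) = norm A"
   using norm_H_coset[OF _ K_one A, of "N' * L"] H_mult[OF inv_closed[OF g] h N'(1) L] g h by simp
  then have "norm (adj (N' * L)) = norm A" by (simp only: norm_adj)
  then obtain e where e: "norm e = 1" "norm (app (adj (N' * L)) e) = norm A" using norm_attained by metis
  \<comment> \<open>This makes the quadratic form equal to 1 at the start and to
    \<open>(norm A)^2\<close> at the end of the curve.\<close>
  let ?w = "app (adj N') e"
  have wN: "app (adj N) ?w = e" using N'(2) by (metis adj_simps(4,5) app_simps(4,5))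
  then have w: "?w \<noteq> 0" using e(1) by (metis app_right_simps(4) norm_zero zero_neq_one)
  have q: "v \<bullet> app (R * adj R) v = (norm (app (adj R) v))\<^sup>2" for R v
   using app_adj[of R v "app (adj R) v"] by (simp add: dot_square_norm)
  have "?w \<bullet> app (Mx (c 0)) ?w = 1" using c Mx[OF g N] q[of ?w N] wN e(1) by simp
  moreover have "?w \<bullet> app (Mx (c 1)) ?w = (norm A)\<^sup>2" using c Mx[OF h L] q[of ?w L] e(2) by simp
  moreover have "norm A > 0" using norm_exp_symmetric[OF P(1)] \<open>norm A = norm (exp (T P))\<close> by simp
  ultimately show ?thesis using curve_length_lower_bound[of c, OF _ w] c by (simp add: ln_realpow)
 qed
 have "Inf (curve_length G K F ` ?C) = rmax (T P)"
 proof (rule cInf_eq_minimum)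
  show "rmax (T P) \<in> curve_length G K F ` ?C" using geodesic(2)[OF g P(1)] cC by (intro image_eqI[of _ _ ?c]) auto
  show "rmax (T P) \<le> x" if "x \<in> curve_length G K F ` ?C" for x using that lower lnA by auto
 qed
 then show ?thesis by (simp add: finsler_dist_def lnA)
qed

end

end

section \<open>Limits of rescaled points\<close>

lemma inner_diag: "onb S \<Longrightarrow> b \<in> S \<Longrightarrow> b \<bullet> app (diag S f) v = f b * (b \<bullet> v)"
 using inner_app[of "diag S f" b v] by (simp add: app_diag_basis adj_diag)

lemma diag_cong: "(\<And>b. b \<in> S \<Longrightarrow> f b = g b) \<Longrightarrow> diag S f = diag S g" by (rule endo_eqI) (simp add: app_diag)

lemma diag_kernel_iff:
 assumes S: "onb S"
 shows "app (diag S f) v = 0 \<longleftrightarrow> (\<forall>b\<in>S. f b = 0 \<or> b \<bullet> v = 0)"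
proof
 assume "app (diag S f) v = 0"
 then show "\<forall>b\<in>S. f b = 0 \<or> b \<bullet> v = 0" using inner_diag[OF S, of _ f v] by auto
next
 assume "\<forall>b\<in>S. f b = 0 \<or> b \<bullet> v = 0"
 then show "app (diag S f) v = 0"
  by (intro onb_zero[OF S]) (simp add: inner_commute[of "app (diag S f) v"] inner_diag[OF S])
qed

lemma projection_eqI:
 fixes E E' :: "'v::euclidean_space endo"
 assumes E: "adj E = E" "E * E = E" and E': "adj E' = E'" "E' * E' = E'"
  and ker: "\<And>v. app E v = 0 \<longleftrightarrow> app E' v = 0"
 shows "E = E'"
proof -
 have "app E' (v - app E' v) = 0" "app E (v - app E v) = 0" for v
  using arg_cong[OF E(2), of "\<lambda>A. app A v"] arg_cong[OF E'(2), of "\<lambda>A. app A v"] by simp_all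
 then have "app E (v - app E' v) = 0" "app E' (v - app E v) = 0" for v using ker by blast+
 then have "E * (1 - E') = 0" "E' * (1 - E) = 0" by (auto intro!: endo_eqI)
 then have "E = E * E'" "E' = E' * E" by (simp_all add: right_diff_distrib)
 then show ?thesis by (metis E(1) E'(1) adj_simps(4))
qed

lemma nonpos_of_exp_bound:
 fixes x B h :: real
 assumes h: "h > 0" and le: "\<And>t. x * exp (2 * t * h) \<le> B"
 shows "x \<le> 0"
proof (rule ccontr)
 assume "\<not> x \<le> 0"
 then have x: "x > 0" by simp
 have "2 * (B / x / (2 * h)) * h = B / x" using h by simp
 then have "x * exp (B / x) \<le> B" using le[of "B / x / (2 * h)"] by simp
 then have "exp (B / x) \<le> B / x" using x by (simp add: le_divide_eq mult.commute)
 then show False using exp_ge_add_one_self[of "B / x"] by simp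
qed

context satake_basis
begin

text \<open>Representatives of the lines in the closure of the points of \<open>X\<close>.
  Positivity of the factors fixes the sign that a line leaves open.\<close>

definition CL :: "(complex^'n) endo \<Rightarrow> bool" where
 "CL M \<longleftrightarrow> M \<noteq> 0 \<and> (\<exists>x r. (\<forall>n::nat. x n \<in> lcosets K \<and> r n > (0::real)) \<and>
   (\<lambda>n. r n *\<^sub>R Mx (x n)) \<longlonglongrightarrow> M)"

text \<open>The projection onto the eigenvectors whose weight takes the value \<open>l\<close> at
  \<open>Z\<close>. If \<open>l\<close> is the largest such value, this is the top eigenspace of
  \<open>T Z\<close> for \<open>Z\<close> in \<open>\<aa>\<close>, the analogue of a face of the
  weight polytope.\<close>

definition face :: "'e \<Rightarrow> real \<Rightarrow> (complex^'n) endo" where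
 "face Z l = diag S (\<lambda>b. if wt b Z = l then 1 else 0)"

lemma exp_T_diag: "Y \<in> \<aa> \<Longrightarrow> exp (t *\<^sub>R T Y) = diag S (\<lambda>b. exp (t * wt b Y))"
 by (simp add: T_diag diag_scaleR exp_diag[OF S])

lemma face_facts:
 "adj (face Z l) = face Z l" "face Z l * face Z l = face Z l"
 "Y \<in> \<aa> \<Longrightarrow> face Z l * exp (t *\<^sub>R T Y) = exp (t *\<^sub>R T Y) * face Z l"
proof -
 show "adj (face Z l) = face Z l" by (simp add: face_def adj_diag)
 show "face Z l * face Z l = face Z l" unfolding face_def diag_mult[OF S] by (rule diag_cong) simp
 show "Y \<in> \<aa> \<Longrightarrow> face Z l * exp (t *\<^sub>R T Y) = exp (t *\<^sub>R T Y) * face Z l"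
  unfolding face_def exp_T_diag diag_mult[OF S] by (rule diag_cong) simp
qed

lemma Mx_translate: "g \<in> carrier G \<Longrightarrow> N \<in> H g \<Longrightarrow> x \<in> lcosets K \<Longrightarrow> Mx (g <# x) = N * Mx x * adj N"
proof -
 assume g: "g \<in> carrier G" and N: "N \<in> H g" and "x \<in> lcosets K"
 then obtain h where h: "h \<in> carrier G" "x = h <# K" using lcosets_iff by blast
 obtain L where L: "L \<in> H h" using H_nonempty[OF h(1)] by blast
 show ?thesis using Mx[OF m_closed[OF g h(1)] H_mult[OF g h(1) N L]] Mx[OF h(1) L]
  by (simp add: h(2) coset_translate[OF g h(1)] mult.assoc)
qed

lemma translate_lcosets: "g \<in> carrier G \<Longrightarrow> x \<in> lcosets K \<Longrightarrow> g <# x \<in> lcosets K"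
 using coset_translate m_closed unfolding lcosets_iff by blast

lemma CL_translate:
 assumes g: "g \<in> carrier G" and N: "N \<in> H g" and M: "CL M"
 shows "CL (N * M * adj N)"
proof -
 obtain x r where x: "M \<noteq> 0" "\<And>n. x n \<in> lcosets K \<and> r n > 0" "(\<lambda>n. r n *\<^sub>R Mx (x n)) \<longlonglongrightarrow> M"
  using M unfolding CL_def by blast
 have "(\<lambda>n. N * (r n *\<^sub>R Mx (x n)) * adj N) \<longlonglongrightarrow> N * M * adj N" by (intro tendsto_intros x)
 then have l: "(\<lambda>n. r n *\<^sub>R Mx (g <# x n)) \<longlonglongrightarrow> N * M * adj N" using Mx_translate[OF g N] x(2) by simp
 obtain N' where "N' * N = 1" by (rule H_inverse[OF g N])
 then have "N' * (N * M * adj N) * adj N' = M" by (rule H_conj_inverse)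
 then have "N * M * adj N \<noteq> 0" using x(1) by force
 moreover have "\<forall>n. g <# x n \<in> lcosets K \<and> r n > 0" using x(2) translate_lcosets[OF g] by blast
 ultimately show ?thesis unfolding CL_def using l by (intro conjI exI[of _ "\<lambda>n. g <# x n"] exI[of _ r])
qed

text \<open>The functions \<open>b \<mapsto> wt b Q + q\<close> on a set of weights form a closed space, with a continuous
 section to \<open>\<aa> \<times> \<real>\<close>. Subtracting the section from a divergent sequence makes the weights in the
 limiting face agree exactly.\<close>

lemma diagonal_limit:
 fixes Q :: "nat \<Rightarrow> 'e" and r :: "nat \<Rightarrow> real"
 assumes Q: "\<And>n. Q n \<in> \<aa>" and r: "\<And>n. r n > 0"
  and lim: "\<And>b. b \<in> S \<Longrightarrow> (\<lambda>n. r n * exp (2 * wt b (Q n))) \<longlonglongrightarrow> f b"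
 obtains Z Y l s where "Z \<in> \<aa>" "Y \<in> \<aa>" "s > 0" "\<And>b. b \<in> S \<Longrightarrow> wt b Z \<le> l"
  "\<And>b. b \<in> S \<Longrightarrow> f b = s * (if wt b Z = l then exp (2 * wt b Y) else 0)"
proof -
 \<comment> \<open>Then \<open>r n * exp (2 * wt b (Q n)) = exp (2 * (wt b (Q n) + q n))\<close>:
   the scalar becomes a common shift of all weights.\<close>
 define q where "q n = ln (r n) / 2" for n
 have re: "r n * exp (2 * wt b (Q n)) = exp (2 * (wt b (Q n) + q n))" for b n
  using r[of n] by (simp add: q_def exp_add distrib_left)
 have f0: "f b \<ge> 0" if "b \<in> S" for b
  by (rule LIMSEQ_le_const[OF lim[OF that]]) (use r in \<open>auto intro!: exI[of _ 0] less_imp_le\<close>)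
 define S0 where "S0 = {b \<in> S. f b > 0}"
 have fS: "finite S" by (rule onb_finite[OF S])
 define L where "L p = (\<Sum>b\<in>S0. (wt b (fst p) + snd p) *\<^sub>R b)" for p :: "'e \<times> real"
 have linL: "linear L" by (rule linearI)
   (simp_all add: L_def linear_add[OF linear_wt] linear_cmul[OF linear_wt] sum.distrib[symmetric] scaleR_sum_right algebra_simps)
 have Lb: "b \<bullet> L p = wt b (fst p) + snd p" if b: "b \<in> S0" for b p
 proof -
  have "b \<bullet> L p = (\<Sum>c\<in>S0. (wt c (fst p) + snd p) * (b \<bullet> c))" by (simp add: L_def inner_sum_right)
  also have "\<dots> = (\<Sum>c\<in>S0. if c = b then wt c (fst p) + snd p else 0)"
   using b by (intro sum.cong) (auto simp: S0_def onb_inner[OF S])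
  also have "\<dots> = wt b (fst p) + snd p" using b fS by (simp add: S0_def)
  finally show ?thesis .
 qed
 let ?V = "\<aa> \<times> (UNIV :: real set)"
 have V: "subspace ?V" by (intro subspace_Times a_subspace subspace_UNIV)
 \<comment> \<open>A linear, hence continuous, right inverse of \<open>L\<close> on the image of
   \<open>\<aa> \<times> \<real>\<close>. The surviving weights converge in this image, so
   \<open>J\<close> lifts them to a convergent sequence in
   \<open>\<aa> \<times> \<real>\<close>.\<close>
 obtain J where J: "range J \<subseteq> ?V" "linear J" "\<And>v. v \<in> L ` ?V \<Longrightarrow> L (J v) = v"
  using real_vector.linear_exists_right_inverse_on[OF linL V] by blast
 define v where "v n = L (Q n, q n)" for n
 define y where "y = (\<Sum>b\<in>S0. (ln (f b) / 2) *\<^sub>R b)"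
 have vV: "v n \<in> L ` ?V" for n unfolding v_def by (rule imageI) (simp add: Q)
 have vy: "v \<longlonglongrightarrow> y" unfolding v_def[abs_def] y_def L_def
 proof (intro tendsto_sum tendsto_scaleR tendsto_const)
  fix b assume b: "b \<in> S0"
  have "(\<lambda>n. ln (exp (2 * (wt b (Q n) + q n)))) \<longlonglongrightarrow> ln (f b)"
   using lim[of b] b unfolding re by (intro tendsto_ln) (auto simp: S0_def)
  then have "(\<lambda>n. ln (exp (2 * (wt b (Q n) + q n))) / 2) \<longlonglongrightarrow> ln (f b) / 2"
   by (rule tendsto_divide[OF _ tendsto_const]) simp
  moreover have "ln (exp (2 * (wt b (Q n) + q n))) / 2 = wt b (Q n) + q n" for n by simp
  ultimately have "(\<lambda>n. wt b (Q n) + q n) \<longlonglongrightarrow> ln (f b) / 2" by (simp only:)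
  then show "(\<lambda>n. wt b (fst (Q n, q n)) + snd (Q n, q n)) \<longlonglongrightarrow> ln (f b) / 2" by simp
 qed
 have "closed (L ` ?V)" by (intro closed_subspace linear_subspace_image linL V)
 then have yV: "y \<in> L ` ?V" by (rule closed_sequentially) (use vV vy in auto)
 have Jy: "(\<lambda>n. J (v n)) \<longlonglongrightarrow> J y"
  by (rule bounded_linear.tendsto[OF linear_conv_bounded_linear[THEN iffD1, OF J(2)] vy])
 define Zn where "Zn n = Q n - fst (J (v n))" for n
 define ln' where "ln' n = snd (J (v n)) - q n" for n
 have Ja: "fst (J u) \<in> \<aa>" for u
 proof -
  have "J u \<in> ?V" using J(1) by blast
  then show ?thesis by (simp add: mem_Times_iff)
 qed
 have Zna: "Zn n \<in> \<aa>" for n unfolding Zn_def by (rule subspace_diff[OF a_subspace Q Ja])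
 have wZ: "wt b (Zn n) = wt b (Q n) - wt b (fst (J (v n)))" for b n by (simp add: Zn_def linear_diff[OF linear_wt])
 have on: "wt b (Zn n) = ln' n" if b: "b \<in> S0" for b n
  using Lb[OF b, of "J (v n)"] Lb[OF b, of "(Q n, q n)"] J(3)[OF vV] by (simp add: wZ ln'_def v_def)
 have off: "\<forall>\<^sub>F n in sequentially. wt b (Zn n) < ln' n" if b: "b \<in> S - S0" for b
 proof -
  have fb: "f b = 0" using b f0[of b] by (auto simp: S0_def)
  have "continuous_on UNIV (wt b)" by (rule linear_continuous_on) (use linear_wt in \<open>simp add: linear_conv_bounded_linear\<close>)
  then have "(\<lambda>n. wt b (fst (J (v n)))) \<longlonglongrightarrow> wt b (fst (J y))"
   by (rule continuous_on_tendsto_compose) (use tendsto_fst[OF Jy] in auto)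
  then have "(\<lambda>n. exp (2 * (wt b (Q n) + q n)) * exp (- 2 * (wt b (fst (J (v n))) + snd (J (v n))))) \<longlonglongrightarrow>
    f b * exp (- 2 * (wt b (fst (J y)) + snd (J y)))"
   using lim[of b] b Jy unfolding re by (intro tendsto_intros) auto
  moreover have "exp (2 * (wt b (Q n) + q n)) * exp (- 2 * (wt b (fst (J (v n))) + snd (J (v n)))) = exp (2 * (wt b (Zn n) - ln' n))" for n
   by (simp add: wZ ln'_def algebra_simps flip: exp_add)
  ultimately have "(\<lambda>n. exp (2 * (wt b (Zn n) - ln' n))) \<longlonglongrightarrow> 0" by (simp add: fb)
  then have "\<forall>\<^sub>F n in sequentially. exp (2 * (wt b (Zn n) - ln' n)) < 1" by (rule order_tendstoD) simp
  then show ?thesis by eventually_elim simp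
 qed
 have "\<forall>\<^sub>F n in sequentially. \<forall>b\<in>S - S0. wt b (Zn n) < ln' n" using off fS by (intro eventually_ball_finite) auto
 \<comment> \<open>One index suffices: the equalities on \<open>S0\<close> hold for every
   \<open>n\<close>, the finitely many strict inequalities off \<open>S0\<close> hold
   eventually.\<close>
 then obtain n where n: "\<And>b. b \<in> S - S0 \<Longrightarrow> wt b (Zn n) < ln' n" using eventually_happens'[OF sequentially_bot] by blast
 show ?thesis
 proof
  show "Zn n \<in> \<aa>" by (rule Zna)
  show "fst (J y) \<in> \<aa>" by (rule Ja)
  show "exp (2 * snd (J y)) > 0" by simp
  fix b assume b: "b \<in> S"
  show "wt b (Zn n) \<le> ln' n" using on[of b n] n[of b] b by (cases "b \<in> S0") auto
  show "f b = exp (2 * snd (J y)) * (if wt b (Zn n) = ln' n then exp (2 * wt b (fst (J y))) else 0)"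
  proof (cases "b \<in> S0")
   case True
   have "b \<bullet> y = (\<Sum>c\<in>S0. (ln (f c) / 2) * (b \<bullet> c))" by (simp add: y_def inner_sum_right)
   also have "\<dots> = (\<Sum>c\<in>S0. if c = b then ln (f c) / 2 else 0)"
    using True by (intro sum.cong) (auto simp: S0_def onb_inner[OF S])
   also have "\<dots> = ln (f b) / 2" using True fS by (simp add: S0_def)
   finally have "ln (f b) = 2 * (wt b (fst (J y)) + snd (J y))" using Lb[OF True, of "J y"] J(3)[OF yV] by simp
   then have "f b = exp (2 * (wt b (fst (J y)) + snd (J y)))" using True exp_ln[of "f b"] by (simp add: S0_def)
   then show ?thesis using on[OF True] by (simp add: exp_add distrib_left mult.commute)
  next
   case False
   then show ?thesis using b f0[OF b] n[of b] by (auto simp: S0_def)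
  qed
 qed
qed

text \<open>Each point is written in KAK form; the unitary parts have a convergent subsequence by
  \<open>compact_UK\<close>. Undoing the limit unitary leaves diagonal operators, whose limit is
  described by \<open>diagonal_limit\<close>.\<close>

lemma CL_form:
 assumes "CL M"
 obtains k U Z Y s l where "k \<in> K" "U \<in> H k" "Z \<in> \<aa>" "Y \<in> \<aa>" "s > 0" "\<forall>b\<in>S. wt b Z \<le> l"
  "M = s *\<^sub>R (U * (face Z l * exp (2 *\<^sub>R T Y)) * adj U)"
proof -
 obtain x r where x: "M \<noteq> 0" "\<And>n. x n \<in> lcosets K \<and> r n > 0" "(\<lambda>n. r n *\<^sub>R Mx (x n)) \<longlonglongrightarrow> M"
  using assms unfolding CL_def by blast
 have "\<exists>U Q. U \<in> (\<Union>k\<in>K. H k) \<and> Q \<in> \<aa> \<and> Mx (x n) = U * exp (2 *\<^sub>R T Q) * adj U" for n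
 proof -
  obtain g where g: "g \<in> carrier G" "x n = g <# K" using x(2) lcosets_iff by blast
  obtain N where N: "N \<in> H g" using H_nonempty[OF g(1)] by blast
  obtain k U Q where "k \<in> K" "U \<in> H k" "Q \<in> \<aa>" "N * adj N = U * exp (2 *\<^sub>R T Q) * adj U" by (rule KAK[OF g(1) N])
  then show ?thesis using Mx[OF g(1) N] g(2) by auto
 qed
 then obtain U Q where UQ: "\<And>n. U n \<in> (\<Union>k\<in>K. H k)" "\<And>n. Q n \<in> \<aa>" "\<And>n. Mx (x n) = U n * exp (2 *\<^sub>R T (Q n)) * adj (U n)"
  by metis
 have "seq_compact (\<Union>k\<in>K. H k)" using compact_UK by (rule compact_imp_seq_compact)
 then obtain V \<phi> where V: "V \<in> (\<Union>k\<in>K. H k)" "strict_mono \<phi>" "(U \<circ> \<phi>) \<longlonglongrightarrow> V"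
  using UQ(1) unfolding seq_compact_def by blast
 then obtain k where k: "k \<in> K" "V \<in> H k" by blast
 have uni: "adj W * W = 1 \<and> W * adj W = 1" if "W \<in> (\<Union>k\<in>K. H k)" for W using that K_unitary by blast
 let ?D = "adj V * M * V"
 have "(\<lambda>n. adj (U (\<phi> n)) * (r (\<phi> n) *\<^sub>R Mx (x (\<phi> n))) * U (\<phi> n)) \<longlonglongrightarrow> ?D"
  using V(3) LIMSEQ_subseq_LIMSEQ[OF x(3) V(2)] by (intro tendsto_intros) (simp_all add: o_def)
 moreover have "adj (U (\<phi> n)) * (r (\<phi> n) *\<^sub>R Mx (x (\<phi> n))) * U (\<phi> n) = r (\<phi> n) *\<^sub>R exp (2 *\<^sub>R T (Q (\<phi> n)))" for n
 proof -
  have "adj (U (\<phi> n)) * Mx (x (\<phi> n)) * U (\<phi> n) = exp (2 *\<^sub>R T (Q (\<phi> n)))"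
   unfolding UQ(3) using H_conj_inverse[of "adj (U (\<phi> n))" "U (\<phi> n)"] uni[OF UQ(1)] by simp
  then show ?thesis by simp
 qed
 ultimately have D: "(\<lambda>n. r (\<phi> n) *\<^sub>R exp (2 *\<^sub>R T (Q (\<phi> n)))) \<longlonglongrightarrow> ?D" by (simp only:)
 have ev: "(\<lambda>n. (r (\<phi> n) * exp (2 * wt b (Q (\<phi> n)))) *\<^sub>R b) \<longlonglongrightarrow> app ?D b" if b: "b \<in> S" for b
  using tendsto_app[OF D tendsto_const, of b] by (simp add: exp_T_diag[OF UQ(2)] app_diag_basis[OF S b])
 define f where "f b = b \<bullet> app ?D b" for b
 have bb: "b \<bullet> b = 1" if "b \<in> S" for b using onb_inner[OF S that that] by simp
 have lim: "(\<lambda>n. r (\<phi> n) * exp (2 * wt b (Q (\<phi> n)))) \<longlonglongrightarrow> f b" if b: "b \<in> S" for b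
  using tendsto_inner[OF tendsto_const ev[OF b], of b] bb[OF b] by (simp add: f_def)
 have "?D = diag S f"
 proof (rule diag_eq[OF S])
  fix b assume b: "b \<in> S"
  show "app ?D b = f b *\<^sub>R b" by (rule LIMSEQ_unique[OF ev[OF b] tendsto_scaleR[OF lim[OF b] tendsto_const]])
 qed
 moreover obtain Z Y l s where Z: "Z \<in> \<aa>" "Y \<in> \<aa>" "s > 0" "\<And>b. b \<in> S \<Longrightarrow> wt b Z \<le> l"
  and f: "\<And>b. b \<in> S \<Longrightarrow> f b = s * (if wt b Z = l then exp (2 * wt b Y) else 0)"
  by (rule diagonal_limit[where Q = "\<lambda>n. Q (\<phi> n)" and r = "\<lambda>n. r (\<phi> n)" and f = f]) (use UQ(2) x(2) lim in auto)
 moreover have "diag S f = s *\<^sub>R (face Z l * exp (2 *\<^sub>R T Y))"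
  unfolding face_def exp_T_diag[OF Z(2)] diag_mult[OF S] diag_scaleR by (rule diag_cong) (simp add: f)
 ultimately have "?D = s *\<^sub>R (face Z l * exp (2 *\<^sub>R T Y))" by simp
 moreover have "M = V * ?D * adj V" using H_conj_inverse[of V "adj V" M] uni[OF V(1)] by simp
 ultimately have "M = s *\<^sub>R (V * (face Z l * exp (2 *\<^sub>R T Y)) * adj V)" by simp
 then show ?thesis using that[OF k Z(1,2,3) _] Z(4) by blast
qed

lemma CL_psd: "CL M \<Longrightarrow> adj M = M \<and> w \<bullet> app M w \<ge> 0"
proof -
 assume "CL M"
 then obtain x r where x: "\<And>n. x n \<in> lcosets K \<and> r n > 0" "(\<lambda>n. r n *\<^sub>R Mx (x n)) \<longlonglongrightarrow> M" unfolding CL_def by blast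
 have "adj (Mx (x n)) = Mx (x n) \<and> w \<bullet> app (Mx (x n)) w \<ge> 0" for n
 proof -
  obtain g where g: "g \<in> carrier G" "x n = g <# K" using x(1) lcosets_iff by blast
  obtain N where N: "N \<in> H g" using H_nonempty[OF g(1)] by blast
  have "w \<bullet> app (Mx (x n)) w = app (adj N) w \<bullet> app (adj N) w"
   using Mx[OF g(1) N] g(2) app_adj[of N w "app (adj N) w"] by simp
  then show ?thesis using Mx[OF g(1) N] g(2) by simp
 qed
 then have a: "adj (r n *\<^sub>R Mx (x n)) = r n *\<^sub>R Mx (x n)" and p: "w \<bullet> app (r n *\<^sub>R Mx (x n)) w \<ge> 0" for n
  using x(1) by (simp_all add: less_imp_le)
 have "(\<lambda>n. adj (r n *\<^sub>R Mx (x n))) \<longlonglongrightarrow> adj M" by (intro tendsto_intros x)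
 then have "adj M = M" unfolding a using x(2) LIMSEQ_unique by blast
 moreover have "(\<lambda>n. w \<bullet> app (r n *\<^sub>R Mx (x n)) w) \<longlonglongrightarrow> w \<bullet> app M w" by (intro tendsto_intros x)
 then have "w \<bullet> app M w \<ge> 0" by (rule LIMSEQ_le_const) (use p in blast)
 ultimately show ?thesis by blast
qed

text \<open>For operators of norm 1 this says exactly that they define the same function on
  \<open>X\<close>.\<close>

definition same_norms :: "(complex^'n) endo \<Rightarrow> (complex^'n) endo \<Rightarrow> bool" where
 "same_norms M1 M2 \<longleftrightarrow> (\<forall>g\<in>carrier G. \<forall>N\<in>H g. norm (N * M1 * adj N) = norm (N * M2 * adj N))"

lemma same_normsD: "same_norms M1 M2 \<Longrightarrow> g \<in> carrier G \<Longrightarrow> N \<in> H g \<Longrightarrow> norm (N * M1 * adj N) = norm (N * M2 * adj N)"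
 by (simp add: same_norms_def)

lemma same_norms_sym: "same_norms M1 M2 \<Longrightarrow> same_norms M2 M1" by (simp add: same_norms_def)

lemma same_norms_translate:
 assumes "same_norms M1 M2" "g \<in> carrier G" "N \<in> H g"
 shows "same_norms (N * M1 * adj N) (N * M2 * adj N)" unfolding same_norms_def
proof (intro ballI)
 fix h L assume h: "h \<in> carrier G" "L \<in> H h"
 from same_normsD[OF assms(1) m_closed[OF h(1) assms(2)] H_mult[OF h(1) assms(2) h(2) assms(3)]]
 show "norm (L * (N * M1 * adj N) * adj L) = norm (L * (N * M2 * adj N) * adj L)" by (simp add: mult.assoc)
qed

lemma conj_flow:
 assumes Y: "Y \<in> \<aa>" and k: "k \<in> K" "U \<in> H k"
 obtains g where "g \<in> carrier G" "exp (t *\<^sub>R T Y) * adj U \<in> H g"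
  "\<forall>A. (exp (t *\<^sub>R T Y) * adj U) * A * adj (exp (t *\<^sub>R T Y) * adj U) =
    exp (t *\<^sub>R T Y) * (adj U * A * U) * exp (t *\<^sub>R T Y)"
proof
 have kc: "k \<in> carrier G" by (rule K_subset[OF k(1)])
 have e: "exp (t *\<^sub>R T Y) \<in> H (expG (t *\<^sub>R Y))" using exp_H_expG[of "t *\<^sub>R Y"] by (simp add: T_simps)
 show "expG (t *\<^sub>R Y) \<otimes> inv k \<in> carrier G" using kc by simp
 show "exp (t *\<^sub>R T Y) * adj U \<in> H (expG (t *\<^sub>R Y) \<otimes> inv k)"
  by (rule H_mult[OF expG_carrier inv_closed[OF kc] e H_K_adj[OF k]])
 show "\<forall>A. (exp (t *\<^sub>R T Y) * adj U) * A * adj (exp (t *\<^sub>R T Y) * adj U) =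
    exp (t *\<^sub>R T Y) * (adj U * A * U) * exp (t *\<^sub>R T Y)"
  by (simp add: adj_exp a_symmetric[OF Y] mult.assoc)
qed

lemma conj_cancel: "k \<in> K \<Longrightarrow> U \<in> H k \<Longrightarrow> adj U * (U * A * adj U) * U = A"
 using H_conj_inverse[of "adj U" U A] K_unitary by simp

lemma norm_conj: "k \<in> K \<Longrightarrow> U \<in> H k \<Longrightarrow> norm (U * A * adj U) = norm A"
 using norm_mult_isometry_right[of "adj U" "U * A"] norm_mult_isometry_left[of U A] K_unitary by simp

text \<open>Moving in the direction \<open>-Z\<close> blows up everything outside the face of \<open>M1\<close>, so \<open>M2\<close> vanishes
 there.\<close>

lemma kernel_mono:
 assumes M: "CL M1" "CL M2" and sn: "same_norms M1 M2" and v: "app M1 v = 0"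
 shows "app M2 v = 0"
proof -
 obtain k U Z l Y s where k: "k \<in> K" "U \<in> H k" and Z: "Z \<in> \<aa>" "Y \<in> \<aa>" "s > 0" "\<forall>b\<in>S. wt b Z \<le> l"
  and M1: "M1 = s *\<^sub>R (U * (face Z l * exp (2 *\<^sub>R T Y)) * adj U)" by (rule CL_form[OF M(1)])
 have U: "adj U * U = 1" "U * adj U = 1" using K_unitary[OF k] by auto
 let ?D = "face Z l * exp (2 *\<^sub>R T Y)"
 have D: "?D = diag S (\<lambda>b. if wt b Z = l then exp (2 * wt b Y) else 0)"
  unfolding face_def exp_T_diag[OF Z(2)] diag_mult[OF S] by (rule diag_cong) simp
 have off: "app M2 (app U b) = 0" if b: "b \<in> S" "wt b Z \<noteq> l" for b
 proof -
  have bl: "wt b Z < l" using bspec[OF Z(4) b(1)] b(2) by simp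
  let ?w = "app U b"
  \<comment> \<open>In the frame \<open>U\<close>, conjugation by \<open>exp (- t Z)\<close>
    multiplies \<open>M1\<close> by exactly \<open>exp (- 2 t l)\<close>, whereas the coefficient of
    \<open>M2\<close> at \<open>b\<close> is multiplied by \<open>exp (- 2 t wt b Z)\<close>.
    Equality of the norms bounds the quotient for all \<open>t\<close>.\<close>
  have bound: "(?w \<bullet> app M2 ?w) * exp (2 * t * (l - wt b Z)) \<le> s * norm ?D" for t
  proof -
   let ?e = "exp ((- t) *\<^sub>R T Z)"
   obtain g where g: "g \<in> carrier G" "?e * adj U \<in> H g"
    "\<forall>A. (?e * adj U) * A * adj (?e * adj U) = ?e * (adj U * A * U) * ?e" by (rule conj_flow[OF Z(1) k])
   have ae: "adj ?e = ?e" by (simp add: adj_exp a_symmetric[OF Z(1)])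
   have "(?e * adj U) * M1 * adj (?e * adj U) = s *\<^sub>R (?e * ?D * ?e)"
    unfolding g(3)[rule_format] M1 mult_scaleR_left mult_scaleR_right conj_cancel[OF k] ..
   also have "?e * ?D * ?e = exp (- 2 * t * l) *\<^sub>R ?D" unfolding D exp_T_diag[OF Z(1)] diag_mult[OF S] diag_scaleR
    by (rule diag_cong) (simp flip: exp_add)
   finally have n1: "norm ((?e * adj U) * M1 * adj (?e * adj U)) = s * exp (- 2 * t * l) * norm ?D" using Z(3) by simp
   have nb: "norm b = 1" using S b by (simp add: onb_def)
   have eb: "app ?e b = exp (- t * wt b Z) *\<^sub>R b"  unfolding exp_T_diag[OF Z(1)] by (rule app_diag_basis[OF S b(1)])
   have "exp (- 2 * t * wt b Z) * (?w \<bullet> app M2 ?w) = b \<bullet> app ((?e * adj U) * M2 * adj (?e * adj U)) b"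
   proof -
    have "(?e * adj U) * M2 * adj (?e * adj U) = ?e * (adj U * M2 * U * ?e)" unfolding g(3)[rule_format] by (simp only: mult.assoc)
    then have "b \<bullet> app ((?e * adj U) * M2 * adj (?e * adj U)) b = app ?e b \<bullet> app (adj U * M2 * U) (app ?e b)"
     using inner_app[of ?e b "app (adj U * M2 * U) (app ?e b)"] unfolding ae by (simp only: app_simps(4))
    also have "\<dots> = exp (- t * wt b Z) * exp (- t * wt b Z) * (?w \<bullet> app M2 ?w)"
     unfolding eb by (simp add: inner_app[of U b])
    also have "exp (- t * wt b Z) * exp (- t * wt b Z) = exp (- 2 * t * wt b Z)" by (simp flip: exp_add)
    finally show ?thesis by simp
   qed
   also have "\<dots> \<le> rmax ((?e * adj U) * M2 * adj (?e * adj U))" by (rule rayleigh_le_unit[OF nb])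
   also have "\<dots> \<le> norm ((?e * adj U) * M2 * adj (?e * adj U))" by (rule rmax_le_norm)
   also have "\<dots> = s * exp (- 2 * t * l) * norm ?D" using same_normsD[OF sn g(1,2)] n1 by simp
   finally have "exp (2 * t * l) * (exp (- 2 * t * wt b Z) * (?w \<bullet> app M2 ?w)) \<le> exp (2 * t * l) * (s * exp (- 2 * t * l) * norm ?D)"
    by (rule mult_left_mono) simp
   moreover have "exp (2 * t * l) * exp (- 2 * t * wt b Z) = exp (2 * t * (l - wt b Z))" "exp (2 * t * l) * exp (- 2 * t * l) = 1"
    by (simp_all add: algebra_simps flip: exp_add)
   ultimately show ?thesis by (simp only: mult.assoc[symmetric] mult.commute[of s] mult.commute[of "?w \<bullet> app M2 ?w"] mult_1_left)
  qed
  have "?w \<bullet> app M2 ?w \<le> 0" by (rule nonpos_of_exp_bound[OF _ bound]) (use bl in simp)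
  then have z: "?w \<bullet> app M2 ?w = 0" using CL_psd[OF M(2), of ?w] by simp
  have "app M2 ?w \<bullet> app M2 ?w = 0"
   by (rule psd_null_vector[of M2 UNIV ?w "app M2 ?w"]) (use CL_psd[OF M(2)] z in auto)
  then show ?thesis by simp
 qed
 have "app ?D (app (adj U) v) = 0"
 proof -
  have "adj U * M1 = s *\<^sub>R ((adj U * U) * ?D * adj U)" unfolding M1 by (simp add: mult.assoc)
  then have "adj U * M1 = s *\<^sub>R (?D * adj U)" by (simp only: U mult_1_left)
  from arg_cong[OF this, of "\<lambda>A. app A v"]
  have "s *\<^sub>R app ?D (app (adj U) v) = app (adj U) (app M1 v)" by (simp only: app_simps)
  then show ?thesis using v Z(3) by simp
 qed
 then have on: "b \<bullet> app (adj U) v = 0" if "b \<in> S" "wt b Z = l" for b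
  using that unfolding D diag_kernel_iff[OF S] by auto
 have "v = app U (app (adj U) v)" using U(2) by (metis app_simps(4,5))
 also have "app (adj U) v = (\<Sum>b\<in>S. (b \<bullet> app (adj U) v) *\<^sub>R b)" by (rule onb_expand[OF S])
 finally have "app M2 v = app M2 (app U (\<Sum>b\<in>S. (b \<bullet> app (adj U) v) *\<^sub>R b))" by (rule arg_cong)
 also have "\<dots> = (\<Sum>b\<in>S. (b \<bullet> app (adj U) v) *\<^sub>R app M2 (app U b))" by (simp only: app_sum_right app_right_simps)
 also have "\<dots> = 0"
 proof (rule sum.neutral, rule ballI)
  fix b assume "b \<in> S"
  then show "(b \<bullet> app (adj U) v) *\<^sub>R app M2 (app U b) = 0" using on[of b] off[of b] by (cases "wt b Z = l") auto
 qed
 finally show ?thesis .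
qed

text \<open>The kernels agree, so the two projections behind \<open>M1\<close> and \<open>M2\<close>
  coincide and only the factors \<open>s * exp (2 * wt b Y)\<close> on the face remain to be
  compared with \<open>r\<close>. The norms at the identity bound them above; the norms after
  flowing by \<open>exp (- Y)\<close>, which flattens \<open>M2\<close>, bound them below.\<close>

lemma face_normal_form:
 assumes M: "CL M1" "CL M2" and sn: "same_norms M1 M2" and M1: "M1 = r *\<^sub>R face Z l" and r: "r > 0"
 shows "M1 = M2"
proof -
 obtain k U Z' l' Y s where k: "k \<in> K" "U \<in> H k" and Z': "Z' \<in> \<aa>" "Y \<in> \<aa>" "s > 0" "\<forall>b\<in>S. wt b Z' \<le> l'"
  and M2: "M2 = s *\<^sub>R (U * (face Z' l' * exp (2 *\<^sub>R T Y)) * adj U)" by (rule CL_form[OF M(2)])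
 let ?E = "face Z' l'" and ?P = "\<lambda>t. U * exp (t *\<^sub>R T Y) * adj U"
 have U: "adj U * U = 1" "U * adj U = 1" using K_unitary[OF k] by auto
 have cm: "(U * A * adj U) * (U * B * adj U) = U * (A * B) * adj U" for A B
 proof -
  have "(U * A * adj U) * (U * B * adj U) = U * A * (adj U * U) * B * adj U" by (simp only: mult.assoc)
  then show ?thesis by (simp only: U mult_1_right mult.assoc)
 qed
 have M2': "M2 = s *\<^sub>R (?P 2 * (U * ?E * adj U))" unfolding M2 cm face_facts(3)[OF Z'(2)] ..
 have "exp ((- 2) *\<^sub>R T Y) * exp (2 *\<^sub>R T Y) = 1" by (subst exp_add_commuting[symmetric]) simp_all
 then have inv: "?P (- 2) * ?P 2 = 1" unfolding cm using U by simp
 have "face Z l = U * ?E * adj U"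
 proof (rule projection_eqI[OF face_facts(1,2)])
  show "adj (U * ?E * adj U) = U * ?E * adj U" "(U * ?E * adj U) * (U * ?E * adj U) = U * ?E * adj U"
   unfolding cm by (simp_all add: face_facts mult.assoc)
  fix v
  have "app (face Z l) v = 0 \<longleftrightarrow> app M1 v = 0" using r by (simp add: M1)
  also have "\<dots> \<longleftrightarrow> app M2 v = 0" using kernel_mono[OF M sn] kernel_mono[OF M(2,1) same_norms_sym[OF sn]] by blast
  also have "\<dots> \<longleftrightarrow> app (U * ?E * adj U) v = 0"
  proof
   assume "app M2 v = 0"
   then have "app (?P 2) (app (U * ?E * adj U) v) = 0" using Z'(3) unfolding M2' by simp
   then have "app (?P (- 2) * ?P 2) (app (U * ?E * adj U) v) = 0" by (simp only: app_simps(4) app_right_simps(4))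
   then show "app (U * ?E * adj U) v = 0" unfolding inv by simp
  next
   assume "app (U * ?E * adj U) v = 0"
   then show "app M2 v = 0" unfolding M2' by (simp only: app_simps(4,7) app_right_simps(4) scaleR_zero_right)
  qed
  finally show "app (face Z l) v = 0 \<longleftrightarrow> app (U * ?E * adj U) v = 0" .
 qed
 then have M1': "M1 = r *\<^sub>R (U * ?E * adj U)" by (simp add: M1)
 have nE: "norm ?E \<le> 1" unfolding face_def by (rule norm_diag_le[OF S]) auto
 have dg: "\<bar>f b\<bar> \<le> norm (diag S f)" if "b \<in> S" for f b
  using eigenvalue_le_norm[OF app_diag_basis[OF S that]] S that by (simp add: onb_def)
 let ?e = "exp ((- 1) *\<^sub>R T Y)"
 have D: "?E * exp (2 *\<^sub>R T Y) = diag S (\<lambda>b. if wt b Z' = l' then exp (2 * wt b Y) else 0)"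
  and D': "?e * ?E * ?e = diag S (\<lambda>b. if wt b Z' = l' then exp (- 2 * wt b Y) else 0)"
  and D'': "?e * (?E * exp (2 *\<^sub>R T Y)) * ?e = ?E"
  unfolding face_def exp_T_diag[OF Z'(2)] diag_mult[OF S] by (rule diag_cong, simp flip: exp_add)+
 have eq: "s * exp (2 * wt b Y) = r" if b: "b \<in> S" "wt b Z' = l'" for b
 proof (rule antisym)
  have "s * exp (2 * wt b Y) \<le> s * norm (?E * exp (2 *\<^sub>R T Y))"
   using dg[OF b(1), of "\<lambda>b. if wt b Z' = l' then exp (2 * wt b Y) else 0"] b(2) Z'(3) by (simp add: D)
  also have "\<dots> = norm M2" using Z'(3) by (simp add: M2 norm_conj[OF k])
  also have "\<dots> = r * norm ?E" using same_normsD[OF sn one_closed H_one] r by (simp add: M1' norm_conj[OF k])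
  also have "\<dots> \<le> r" using nE r by simp
  finally show "s * exp (2 * wt b Y) \<le> r" .
  obtain g where g: "g \<in> carrier G" "?e * adj U \<in> H g"
   "\<forall>A. (?e * adj U) * A * adj (?e * adj U) = ?e * (adj U * A * U) * ?e" by (rule conj_flow[OF Z'(2) k])
  have "r * exp (- 2 * wt b Y) \<le> r * norm (?e * ?E * ?e)"
   unfolding D' using dg[OF b(1), of "\<lambda>b. if wt b Z' = l' then exp (- 2 * wt b Y) else 0"] b(2) r by simp
  also have "\<dots> = norm ((?e * adj U) * M1 * adj (?e * adj U))"
   unfolding g(3)[rule_format] M1' mult_scaleR_left mult_scaleR_right conj_cancel[OF k] using r by simp
  also have "\<dots> = norm ((?e * adj U) * M2 * adj (?e * adj U))" by (rule same_normsD[OF sn g(1,2)])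
  also have "\<dots> = s * norm ?E"
   unfolding g(3)[rule_format] M2 mult_scaleR_left mult_scaleR_right conj_cancel[OF k] D'' using Z'(3) by simp
  also have "\<dots> \<le> s" using nE Z'(3) by simp
  finally have "r * exp (- 2 * wt b Y) * exp (2 * wt b Y) \<le> s * exp (2 * wt b Y)" by (rule mult_right_mono) simp
  then show "r \<le> s * exp (2 * wt b Y)" by (simp add: mult.assoc flip: exp_add)
 qed
 have "s *\<^sub>R (?E * exp (2 *\<^sub>R T Y)) = diag S (\<lambda>b. s * (if wt b Z' = l' then exp (2 * wt b Y) else 0))"
  by (simp only: D diag_scaleR)
 also have "\<dots> = r *\<^sub>R ?E" unfolding face_def diag_scaleR by (rule diag_cong) (use eq in auto)
 finally have "s *\<^sub>R (?E * exp (2 *\<^sub>R T Y)) = r *\<^sub>R ?E" .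
 moreover have "M2 = U * (s *\<^sub>R (?E * exp (2 *\<^sub>R T Y))) * adj U" by (simp only: M2 mult_scaleR_left mult_scaleR_right)
 ultimately have "M2 = U * (r *\<^sub>R ?E) * adj U" by (simp only:)
 then show ?thesis by (simp only: M1' mult_scaleR_left mult_scaleR_right)
qed

text \<open>All hypotheses are invariant under translation by \<open>G\<close>, and flowing by
  \<open>exp (- Y)\<close> in the frame of \<open>M1\<close> brings \<open>M1\<close> to the normal
  form of \<open>face_normal_form\<close>.\<close>

theorem same_norms_eq:
 assumes M: "CL M1" "CL M2" and sn: "same_norms M1 M2"
 shows "M1 = M2"
proof -
 obtain k U Z l Y s where k: "k \<in> K" "U \<in> H k" and Z: "Z \<in> \<aa>" "Y \<in> \<aa>" "s > 0" "\<forall>b\<in>S. wt b Z \<le> l"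
  and M1: "M1 = s *\<^sub>R (U * (face Z l * exp (2 *\<^sub>R T Y)) * adj U)" by (rule CL_form[OF M(1)])
 let ?e = "exp ((- 1) *\<^sub>R T Y)" and ?N = "exp ((- 1) *\<^sub>R T Y) * adj U"
 obtain g where g: "g \<in> carrier G" "?N \<in> H g" "\<forall>A. ?N * A * adj ?N = ?e * (adj U * A * U) * ?e"
  by (rule conj_flow[OF Z(2) k])
 have "?N * M1 * adj ?N = s *\<^sub>R (?e * (face Z l * exp (2 *\<^sub>R T Y)) * ?e)"
  unfolding g(3)[rule_format] M1 mult_scaleR_left mult_scaleR_right conj_cancel[OF k] ..
 also have "?e * (face Z l * exp (2 *\<^sub>R T Y)) * ?e = face Z l"
  unfolding face_def exp_T_diag[OF Z(2)] diag_mult[OF S] by (rule diag_cong) (simp flip: exp_add)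
 finally have "?N * M1 * adj ?N = s *\<^sub>R face Z l" .
 from face_normal_form[OF CL_translate[OF g(1,2) M(1)] CL_translate[OF g(1,2) M(2)] same_norms_translate[OF sn g(1,2)] this Z(3)]
 have eq: "?N * M1 * adj ?N = ?N * M2 * adj ?N" .
 obtain N' where "N' * ?N = 1" by (rule H_inverse[OF g(1,2)])
 note inv = H_conj_inverse[OF this]
 have "M1 = N' * (?N * M1 * adj ?N) * adj N'" by (rule inv[symmetric])
 also have "\<dots> = M2" unfolding eq by (rule inv)
 finally show ?thesis .
qed

end

section \<open>Quotient topologies and bounded convergence\<close>

lemma topspace_quotient_topology: "topspace (quotient_topology T q) = q ` topspace T"
proof (rule subset_antisym)
 show "topspace (quotient_topology T q) \<subseteq> q ` topspace T"
  using openin_topspace[of "quotient_topology T q"] unfolding openin_quotient_topology by blast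
 have "{x \<in> topspace T. q x \<in> q ` topspace T} = topspace T" by blast
 then have "openin (quotient_topology T q) (q ` topspace T)" unfolding openin_quotient_topology by simp
 then show "q ` topspace T \<subseteq> topspace (quotient_topology T q)" by (rule openin_subset)
qed

lemma continuous_map_quotient_projection: "continuous_map T (quotient_topology T q) q"
 unfolding continuous_map_def topspace_quotient_topology openin_quotient_topology by auto

lemma continuous_map_from_quotient:
 assumes "continuous_map T Y (\<lambda>x. f (q x))"
 shows "continuous_map (quotient_topology T q) Y f" unfolding continuous_map_def
proof (intro conjI allI impI)
 show "f \<in> topspace (quotient_topology T q) \<rightarrow> topspace Y"
  using assms unfolding continuous_map_def topspace_quotient_topology by auto
 fix U assume "openin Y U"
 then have "openin T {x \<in> topspace T. f (q x) \<in> U}" using assms by (simp add: continuous_map_def)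
 moreover have "{x \<in> topspace T. q x \<in> {y \<in> q ` topspace T. f y \<in> U}} = {x \<in> topspace T. f (q x) \<in> U}" by auto
 ultimately show "openin (quotient_topology T q) {x \<in> topspace (quotient_topology T q). f x \<in> U}"
  unfolding topspace_quotient_topology openin_quotient_topology by auto
qed

lemma topspace_bounded_convergence: "topspace (bounded_convergence_topology T d p) = pointed_functions T p"
proof (rule subset_antisym)
 show "topspace (bounded_convergence_topology T d p) \<subseteq> pointed_functions T p"
  using openin_topspace[of "bounded_convergence_topology T d p"] unfolding openin_bounded_convergence_topology by blast
 have "openin (bounded_convergence_topology T d p) (pointed_functions T p)"
  unfolding openin_bounded_convergence_topology
  by (intro conjI ballI exI[of _ "{}"] exI[of _ 1]) (auto simp: sym_bounded_def)
 then show "pointed_functions T p \<subseteq> topspace (bounded_convergence_topology T d p)" by (rule openin_subset)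
qed

text \<open>Singletons are bounded, so this topology refines pointwise convergence;
  \<open>extensional\<close> makes functions that agree on the space equal.\<close>

lemma Hausdorff_bounded_convergence: "Hausdorff_space (bounded_convergence_topology T d p)"
 unfolding Hausdorff_space_def topspace_bounded_convergence
proof (intro allI impI)
 fix f g assume fg: "f \<in> pointed_functions T p \<and> g \<in> pointed_functions T p \<and> f \<noteq> g"
 obtain x where x: "x \<in> topspace T" "f x \<noteq> g x"
 proof (rule ccontr)
  assume "\<not> thesis"
  then have "\<And>x. x \<in> topspace T \<Longrightarrow> f x = g x" using that by blast
  then have "f = g" using fg by (intro extensionalityI[of f "topspace T" g]) (auto simp: pointed_functions_def)
  then show False using fg by blast
 qed
 define e where "e = \<bar>f x - g x\<bar> / 2"
 have e: "e > 0" using x by (simp add: e_def)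
 let ?U = "\<lambda>f. {h \<in> pointed_functions T p. \<bar>h x - f x\<bar> < e}"
 have op: "openin (bounded_convergence_topology T d p) (?U f)" for f unfolding openin_bounded_convergence_topology
 proof (intro conjI ballI)
  fix h assume h: "h \<in> ?U f"
  have "{k \<in> pointed_functions T p. \<forall>y\<in>{x}. \<bar>k y - h y\<bar> < e - \<bar>h x - f x\<bar>} \<subseteq> ?U f" by auto
  moreover have "sym_bounded d p {x}" by (auto simp: sym_bounded_def)
  ultimately show "\<exists>S \<epsilon>. S \<subseteq> topspace T \<and> sym_bounded d p S \<and> \<epsilon> > 0 \<and>
    {k \<in> pointed_functions T p. \<forall>y\<in>S. \<bar>k y - h y\<bar> < \<epsilon>} \<subseteq> ?U f"
   using h x(1) by (intro exI[of _ "{x}"] exI[of _ "e - \<bar>h x - f x\<bar>"]) simp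
 qed blast
 have "disjnt (?U f) (?U g)" unfolding disjnt_iff e_def by (auto simp: abs_if split: if_splits)
 then show "\<exists>U V. openin (bounded_convergence_topology T d p) U \<and> openin (bounded_convergence_topology T d p) V \<and>
   f \<in> U \<and> g \<in> V \<and> disjnt U V"
  using op fg e by (intro exI[of _ "?U f"] exI[of _ "?U g"]) simp
qed

text \<open>\<open>ln t \<le> t - 1\<close> is applied to both quotients; the factor 2 arises
  because \<open>a\<close> may be as small as \<open>b / 2\<close>.\<close>

lemma ln_diff_le:
 fixes a b \<eta> :: real
 assumes b: "b > 0" and le: "\<bar>a - b\<bar> \<le> \<eta> * b" and \<eta>: "\<eta> \<le> 1 / 2"
 shows "a > 0" "\<bar>ln a - ln b\<bar> \<le> 2 * \<eta>"
proof -
 have "\<eta> * b \<le> (1 / 2) * b" by (rule mult_right_mono[OF \<eta>]) (use b in simp)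
 then have a: "a \<ge> b / 2" using le by linarith
 then show a0: "a > 0" using b by linarith
 have "0 \<le> \<eta> * b" using le by linarith
 then have \<eta>0: "\<eta> \<ge> 0" using b by (simp add: zero_le_mult_iff)
 have "ln a - ln b = ln (a / b)" using a0 b by (simp add: ln_div)
 also have "\<dots> \<le> a / b - 1" by (rule ln_le_minus_one) (use a0 b in simp)
 also have "\<dots> = (a - b) / b" using b by (simp add: field_simps)
 also have "\<dots> \<le> \<eta>" using le b by (simp add: divide_le_eq)
 finally have 1: "ln a - ln b \<le> 2 * \<eta>" using \<eta>0 by linarith
 have "ln b - ln a = ln (b / a)" using a0 b by (simp add: ln_div)
 also have "\<dots> \<le> b / a - 1" by (rule ln_le_minus_one) (use a0 b in simp)
 also have "\<dots> = (b - a) / a" using a0 by (simp add: field_simps)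
 also have "\<dots> \<le> 2 * \<eta>"
 proof -
  have "b - a \<le> \<eta> * b" using le by linarith
  also have "\<dots> \<le> \<eta> * (2 * a)" using a \<eta>0 by (intro mult_left_mono) auto
  finally show ?thesis using a0 by (simp add: divide_le_eq)
 qed
 finally show "\<bar>ln a - ln b\<bar> \<le> 2 * \<eta>" using 1 by linarith
qed

lemma proj_class_range: "proj_class M = range (\<lambda>r. r *\<^sub>R M)" unfolding proj_class_def by (rule span_singleton)

lemma proj_class_eqD: "proj_class A = proj_class M \<Longrightarrow> M \<noteq> 0 \<Longrightarrow> \<exists>r. r \<noteq> 0 \<and> M = r *\<^sub>R A"
proof -
 assume eq: "proj_class A = proj_class M" and M: "M \<noteq> 0"
 have "M \<in> proj_class M" unfolding proj_class_def by (rule span_base) simp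
 then have "M \<in> proj_class A" by (simp only: eq)
 then obtain r where "M = r *\<^sub>R A" unfolding proj_class_range by blast
 then show ?thesis using M by auto
qed

lemma proj_class_scaleR: "r \<noteq> 0 \<Longrightarrow> proj_class (r *\<^sub>R M) = proj_class M"
proof -
 assume r: "r \<noteq> 0"
 have "\<exists>t. s *\<^sub>R M = t *\<^sub>R r *\<^sub>R M" for s using r by (intro exI[of _ "s / r"]) simp
 then show ?thesis unfolding proj_class_range by (auto simp: image_iff)
qed

definition herm :: "'n::finite cmat set" where
 "herm = {M. ctransp M = M} - {0}"

lemma herm_iff: "M \<in> herm \<longleftrightarrow> adj (of_matrix M) = of_matrix M \<and> M \<noteq> 0" by (auto simp: herm_def of_matrix_hermitian_iff)

lemma proj_top: "proj_hermitian_top = quotient_topology (top_of_set herm) proj_class"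
 by (simp add: proj_hermitian_top_def herm_def)

lemma topspace_proj: "topspace proj_hermitian_top = proj_class ` (herm :: 'n::finite cmat set)"
 by (simp add: proj_top topspace_quotient_topology)

lemma of_matrix_eq_0: "of_matrix M = 0 \<longleftrightarrow> M = 0" using of_matrix_inject[of M 0] by (simp only: of_matrix_simps)

lemma herm_scaleR: "M \<in> herm \<Longrightarrow> r \<noteq> 0 \<Longrightarrow> r *\<^sub>R M \<in> herm" by (simp add: herm_iff of_matrix_simps)

text \<open>Every line meets the compact unit sphere of the Hermitian matrices, so the space is a
  continuous image of it.\<close>

lemma compact_proj: "compact_space (proj_hermitian_top :: 'n::finite cmat set topology)"
proof -
 have c1: "continuous_on UNIV (\<lambda>M :: 'n cmat. of_matrix M)"
  by (rule bounded_linear.continuous_on[OF bounded_linear_of_matrix continuous_on_id])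
 have "closed {M :: 'n cmat. adj (of_matrix M) = of_matrix M}"
  by (rule closed_Collect_eq[OF continuous_on_adj[OF c1] c1])
 then have "compact ({M :: 'n cmat. adj (of_matrix M) = of_matrix M} \<inter> sphere 0 1)" by (rule closed_Int_compact) simp
 moreover have "{M :: 'n cmat. adj (of_matrix M) = of_matrix M} \<inter> sphere 0 1 = herm \<inter> sphere 0 1"
  by (auto simp: herm_iff)
 ultimately have "compactin (top_of_set herm) (herm \<inter> sphere 0 1 :: 'n cmat set)" by (simp add: compactin_subtopology)
 from image_compactin[OF this continuous_map_quotient_projection[of _ proj_class]]
 have "compactin proj_hermitian_top (proj_class ` (herm \<inter> sphere 0 1 :: 'n cmat set))" by (simp add: proj_top)
 moreover have "proj_class ` (herm \<inter> sphere 0 1) = proj_class ` (herm :: 'n cmat set)"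
 proof (rule subset_antisym; rule subsetI)
  fix p :: "'n cmat set" assume "p \<in> proj_class ` herm"
  then obtain M where M: "M \<in> herm" "p = proj_class M" by blast
  then have n: "norm M \<noteq> 0" by (simp add: herm_iff)
  have "inverse (norm M) *\<^sub>R M \<in> herm \<inter> sphere 0 1" using herm_scaleR[OF M(1), of "inverse (norm M)"] n by simp
  moreover have "p = proj_class (inverse (norm M) *\<^sub>R M)" using M(2) n by (simp add: proj_class_scaleR)
  ultimately show "p \<in> proj_class ` (herm \<inter> sphere 0 1)" by blast
 qed blast
 ultimately show ?thesis by (simp add: compact_space_def topspace_proj)
qed

section \<open>The isomorphism of compactifications\<close>

context satake_data
begin

text \<open>No continuous lift is needed: if \<open>h\<close> has the value \<open>f N\<close> at
  every lift \<open>N\<close>, then by \<open>H_open\<close> elements near \<open>g\<close> have a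
  lift near \<open>N\<close>, where \<open>f\<close> is close.\<close>

lemma continuous_map_of_H:
 fixes f :: "(complex^'n) endo \<Rightarrow> real"
 assumes f: "\<And>g N. g \<in> carrier G \<Longrightarrow> N \<in> H g \<Longrightarrow> isCont f N" and h: "\<And>g N. g \<in> carrier G \<Longrightarrow> N \<in> H g \<Longrightarrow> h g = f N"
 shows "continuous_map GT euclideanreal h" unfolding continuous_map_def
proof (intro conjI allI impI)
 fix B :: "real set" assume "openin euclideanreal B"
 then have B: "open B" by simp
 show "openin GT {g \<in> topspace GT. h g \<in> B}"
 proof (subst openin_subopen, intro ballI)
  fix g assume g: "g \<in> {g \<in> topspace GT. h g \<in> B}"
  then have gc: "g \<in> carrier G" by simp
  obtain N where N: "N \<in> H g" using H_nonempty[OF gc] by blast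
  have "f N \<in> B" using g h[OF gc N] by simp
  then have "\<forall>\<^sub>F N' in nhds N. f N' \<in> B"
   using f[OF gc N] B unfolding continuous_at tendsto_at_iff_tendsto_nhds by (rule topological_tendstoD[rotated 2])
  then obtain \<epsilon> where \<epsilon>: "\<epsilon> > 0" "\<And>N'. dist N' N < \<epsilon> \<Longrightarrow> f N' \<in> B" unfolding eventually_nhds_metric by blast
  let ?V = "{g \<in> carrier G. \<exists>N'\<in>H g. norm (N' - N) < \<epsilon>}"
  have "g \<in> ?V" using gc N \<epsilon>(1) by (intro CollectI conjI bexI[of _ N]) auto
  moreover have "?V \<subseteq> {g \<in> topspace GT. h g \<in> B}" using \<epsilon>(2) h by (fastforce simp: dist_norm)
  ultimately show "\<exists>T. openin GT T \<and> g \<in> T \<and> T \<subseteq> {g \<in> topspace GT. h g \<in> B}" using H_open[of N \<epsilon>] by blast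
 qed
qed simp

end

context satake_basis
begin

lemma rep_H:
 assumes x: "x \<in> lcosets K"
 obtains g N where "g \<in> carrier G" "x = g <# K" "N \<in> H g" "rep x * N = 1" "N * rep x = 1" "rep x \<in> H (inv g)"
proof -
 obtain g N where g: "g \<in> carrier G" "x = g <# K" "N \<in> H g" "rep x * N = 1" "N * rep x = 1" by (rule rep[OF x])
 obtain N' where N': "N' \<in> H (inv g)" "N' * N = 1" by (rule H_inverse[OF g(1,3)])
 have "N' = rep x" by (rule mult_inverse_unique[OF N'(2) g(5)])
 then show ?thesis using that g N'(1) by simp
qed

text \<open>Inverse lifts belonging to two representatives of the same coset differ by a unitary
  factor on the left, to which the norm is blind.\<close>

lemma norm_rep:
 assumes g: "g \<in> carrier G" and N: "N \<in> H (inv g)"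
 defines "x \<equiv> g <# K"
 shows "norm (rep x * A * adj (rep x)) = norm (N * A * adj N)"
proof -
 have x: "x \<in> lcosets K" unfolding x_def by (rule lcosets_in[OF g])
 obtain h L where h: "h \<in> carrier G" "x = h <# K" "rep x \<in> H (inv h)" by (rule rep_H[OF x])
 then obtain k where k: "k \<in> K" "g = h \<otimes> k" using coset_eq_iff[OF h(1) g] by (auto simp: x_def)
 have kc: "k \<in> carrier G" by (rule K_subset[OF k(1)])
 obtain U where U: "U \<in> H k" using H_nonempty[OF kc] by blast
 have ig: "inv g = inv k \<otimes> inv h" using k(2) h(1) kc by (simp add: inv_mult_group)
 have "adj U * rep x \<in> H (inv g)"
  unfolding ig by (rule H_mult[OF inv_closed[OF kc] inv_closed[OF h(1)] H_K_adj[OF k(1) U] h(3)])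
 from H_coset[OF inv_closed[OF g] this] N obtain z where z: "z \<in> cen" "N = z * (adj U * rep x)" by blast
 let ?V = "z * adj U"
 have V: "adj ?V * ?V = 1"
 proof -
  have "adj ?V * ?V = U * (adj z * z) * adj U" by (simp add: mult.assoc)
  then show ?thesis using cen_unitary(1)[OF z(1)] K_unitary[OF k(1) U] by simp
 qed
 have "N * A * adj N = ?V * (rep x * A * adj (rep x)) * adj ?V" by (simp add: z(2) mult.assoc)
 then have "norm (N * A * adj N) = norm (?V * (rep x * A * adj (rep x)))"
  using norm_mult_isometry_right[of "adj ?V"] V by simp
 then show ?thesis using norm_mult_isometry_left[OF V] by simp
qed

definition Psi :: "(complex^'n) endo \<Rightarrow> 'g set \<Rightarrow> real" where
 "Psi A x = (ln (norm (rep x * A * adj (rep x))) - ln (norm A)) / 2"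

lemma Psi_eq: "g \<in> carrier G \<Longrightarrow> N \<in> H (inv g) \<Longrightarrow> Psi A (g <# K) = (ln (norm (N * A * adj N)) - ln (norm A)) / 2"
 by (simp add: Psi_def norm_rep)

lemma H_conj_nonzero: "g \<in> carrier G \<Longrightarrow> N \<in> H g \<Longrightarrow> A \<noteq> 0 \<Longrightarrow> N * A * adj N \<noteq> 0"
proof
 assume g: "g \<in> carrier G" "N \<in> H g" and A: "A \<noteq> 0" and z: "N * A * adj N = 0"
 obtain N' where "N' * N = 1" by (rule H_inverse[OF g])
 from H_conj_inverse[OF this, of A] z A show False by simp
qed

lemma rep_nonzero: "x \<in> lcosets K \<Longrightarrow> A \<noteq> 0 \<Longrightarrow> norm (rep x * A * adj (rep x)) > 0"
proof -
 assume x: "x \<in> lcosets K" and A: "A \<noteq> 0"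
 obtain g N where "g \<in> carrier G" "rep x \<in> H (inv g)" by (rule rep_H[OF x])
 then show ?thesis using H_conj_nonzero[OF inv_closed _ A] by simp
qed

lemma Psi_scaleR:
 assumes x: "x \<in> lcosets K" and A: "A \<noteq> 0" and r: "r \<noteq> 0"
 shows "Psi (r *\<^sub>R A) x = Psi A x" using rep_nonzero[OF x A] A r by (simp add: Psi_def ln_mult)

lemma Psi_base: "Psi A K = 0" using Psi_eq[OF one_closed, of 1 A] H_one by (simp add: one_coset)

lemma Psi_continuous:
 assumes A: "A \<noteq> 0"
 shows "continuous_map (sym_top G K) euclideanreal (Psi A)" unfolding sym_top_def
proof (rule continuous_map_from_quotient)
 let ?f = "\<lambda>N. (ln (norm (N * A * adj N)) - ln (norm A)) / 2"
 have "continuous_map GT euclideanreal (\<lambda>g. Psi A (inv g <# K))"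
 proof (rule continuous_map_of_H[of ?f])
  fix g N assume g: "g \<in> carrier G" and N: "N \<in> H g"
  have nz: "norm (N * A * adj N) \<noteq> 0" using H_conj_nonzero[OF g N A] by simp
  show "isCont ?f N" unfolding isCont_def
   by (intro tendsto_divide tendsto_diff tendsto_ln tendsto_norm tendsto_mult tendsto_adj tendsto_const tendsto_ident_at nz) simp
  show "Psi A (inv g <# K) = ?f N" by (rule Psi_eq) (use g N in simp_all)
 qed
 from continuous_map_compose[OF continuous_map_inv_G[OF continuous_map_id] this, unfolded o_def id_def]
 show "continuous_map GT euclideanreal (\<lambda>g. Psi A (g <# K))" by (rule continuous_map_eq) simp
qed

text \<open>Translating the operator changes the normalising term \<open>ln (norm A)\<close>; this
  change is exactly the base-point correction in the action on horofunctions.\<close>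

lemma Psi_translate:
 assumes g: "g \<in> carrier G" and N: "N \<in> H g" and A: "A \<noteq> 0" and x: "x \<in> lcosets K"
 shows "Psi (N * A * adj N) x = Psi A (inv g <# x) - Psi A (inv g <# K)"
proof -
 obtain h L where h: "h \<in> carrier G" "x = h <# K" "rep x \<in> H (inv h)" by (rule rep_H[OF x])
 have i: "inv (inv g \<otimes> h) = inv h \<otimes> g" using g h(1) by (simp add: inv_mult_group)
 have "rep x * N \<in> H (inv (inv g \<otimes> h))" unfolding i by (rule H_mult[OF inv_closed[OF h(1)] g h(3) N])
 from Psi_eq[OF _ this, of A] g h(1,2)
 have "Psi A (inv g <# x) = (ln (norm (rep x * N * A * adj (rep x * N))) - ln (norm A)) / 2"
  by (simp add: coset_translate)
 moreover have "Psi A (inv g <# K) = (ln (norm (N * A * adj N)) - ln (norm A)) / 2"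
  by (rule Psi_eq) (use g N in simp_all)
 ultimately show ?thesis by (simp add: Psi_def mult.assoc diff_divide_distrib)
qed

text \<open>Any nonzero representative of the line gives the same function by
  \<open>Psi_scaleR\<close>.\<close>

definition Phi :: "'n cmat set \<Rightarrow> 'g set \<Rightarrow> real" where
 "Phi L = restrict (Psi (of_matrix (SOME M. M \<in> L \<and> M \<noteq> 0))) (lcosets K)"

lemma Phi_class: "M \<noteq> 0 \<Longrightarrow> Phi (proj_class M) = restrict (Psi (of_matrix M)) (lcosets K)"
proof -
 assume M: "M \<noteq> 0"
 define M' where "M' = (SOME M'. M' \<in> proj_class M \<and> M' \<noteq> 0)"
 have mem: "M \<in> proj_class M" unfolding proj_class_def by (rule span_base) simp
 have "M' \<in> proj_class M \<and> M' \<noteq> 0"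
  unfolding M'_def by (rule someI[of "\<lambda>M'. M' \<in> proj_class M \<and> M' \<noteq> 0", OF conjI[OF mem M]])
 then obtain r where r: "M' = r *\<^sub>R M" "r \<noteq> 0" unfolding proj_class_range by auto
 have "of_matrix M \<noteq> 0" using M by (simp add: of_matrix_eq_0)
 then show ?thesis
  unfolding Phi_def M'_def[symmetric] r(1) of_matrix_simps using Psi_scaleR r(2) by (intro restrict_ext) blast
qed

lemma Psi_pointed: "A \<noteq> 0 \<Longrightarrow> restrict (Psi A) (lcosets K) \<in> pointed_functions (sym_top G K) K"
proof -
 assume A: "A \<noteq> 0"
 have "continuous_map (sym_top G K) euclideanreal (restrict (Psi A) (lcosets K))"
  by (rule continuous_map_eq[OF Psi_continuous[OF A]]) (simp add: topspace_sym_top)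
 moreover have "restrict (Psi A) (lcosets K) K = 0"  using lcosets_in[OF one_closed] by (simp add: one_coset Psi_base)
 ultimately show ?thesis by (simp add: pointed_functions_def topspace_sym_top)
qed

lemma satake_embedding_eq:
 assumes x: "x \<in> lcosets K"
 obtains M where "M \<in> herm" "of_matrix M = Mx x" "satake_embedding \<tau> x = proj_class M"
proof -
 obtain g where g: "g \<in> carrier G" "x = g <# K" using x lcosets_iff by blast
 obtain N where "N \<in> H g" using H_nonempty[OF g(1)] by blast
 then obtain N0 where N0: "N0 \<in> \<tau> g" "N = of_matrix N0" "of_matrix N0 \<in> H g" by (auto simp: H_def)
 let ?M = "N0 ** ctransp N0"
 have M: "of_matrix ?M = Mx x" using Mx[OF g(1) N0(3)] g(2) by (simp add: of_matrix_mult of_matrix_ctransp)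
 have all: "N' ** ctransp N' = ?M" if h: "h \<in> x" and N': "N' \<in> \<tau> h" for h N'
 proof -
  obtain k where k: "k \<in> K" "h = g \<otimes> k" using h g(2) lcoset_iff by blast
  have "of_matrix N' \<in> H (g \<otimes> k)" using N' k(2) by (simp add: H_def)
  from symm_invariant_K[OF g(1) N0(3) k(1) this] have "of_matrix (N' ** ctransp N') = of_matrix ?M"
   by (simp add: of_matrix_mult of_matrix_ctransp)
  then show ?thesis by simp
 qed
 have gx: "g \<in> x" using g K_one by (auto simp: lcoset_iff intro!: bexI[of _ "\<one>"])
 have "(\<Union>g\<in>x. (\<lambda>N. proj_class (N ** ctransp N)) ` \<tau> g) = {proj_class ?M}"
 proof (rule subset_antisym; rule subsetI)
  fix p assume "p \<in> (\<Union>g\<in>x. (\<lambda>N. proj_class (N ** ctransp N)) ` \<tau> g)"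
  then obtain h N' where "h \<in> x" "N' \<in> \<tau> h" "p = proj_class (N' ** ctransp N')" by blast
  then show "p \<in> {proj_class ?M}" using all by simp
 next
  fix p assume "p \<in> {proj_class ?M}"
  then show "p \<in> (\<Union>g\<in>x. (\<lambda>N. proj_class (N ** ctransp N)) ` \<tau> g)" using gx N0(1) by blast
 qed
 then have "satake_embedding \<tau> x = proj_class ?M" by (simp add: satake_embedding_def)
 moreover have "?M \<in> herm"
 proof -
  have "N0 ** ctransp N0 \<noteq> 0"
  proof
   assume "?M = 0"
   then have "of_matrix N0 * 1 * adj (of_matrix N0) = 0" by (metis M Mx[OF g(1) N0(3)] g(2) mult_1_right of_matrix_eq_0)
   then show False using H_conj_nonzero[OF g(1) N0(3), of 1] by simp
  qed
  then show ?thesis by (simp add: herm_iff of_matrix_mult of_matrix_ctransp)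
 qed
 ultimately show ?thesis using that M by blast
qed

text \<open>Balls around a representative project to neighbourhoods of the line, which gives points
  \<open>Mx (x n)\<close> and real factors \<open>r n\<close> with products converging to
  \<open>M\<close>. The signs of the factors are then corrected and \<open>M\<close> is
  normalised.\<close>

lemma closure_CL:
 assumes p: "p \<in> proj_hermitian_top closure_of (satake_embedding \<tau> ` (lcosets K))"
 obtains M where "M \<in> herm" "p = proj_class M" "CL (of_matrix M)" "norm (of_matrix M) = 1"
proof -
 have "p \<in> proj_class ` herm"  using subsetD[OF closure_of_subset_topspace p] by (simp only: topspace_proj)
 then obtain M where M: "M \<in> herm" "p = proj_class M" by blast
 have "\<exists>x r. x \<in> lcosets K \<and> r \<noteq> 0 \<and> norm (r *\<^sub>R to_matrix (Mx x) - M) < 1 / real (Suc n)" for n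
 proof -
  let ?B = "herm \<inter> ball M (1 / real (Suc n))"
  let ?S = "\<lambda>r. {A \<in> herm. r *\<^sub>R A \<in> ball M (1 / real (Suc n))}"
  \<comment> \<open>Saturation of the ball: a line meets it if and only if some nonzero multiple of
    a given representative lies in it.\<close>
  have eq: "{A \<in> herm. proj_class A \<in> proj_class ` ?B} = (\<Union>r\<in>- {0}. ?S r)"
  proof (rule subset_antisym; rule subsetI)
   fix A assume "A \<in> {A \<in> herm. proj_class A \<in> proj_class ` ?B}"
   then obtain A' where A: "A \<in> herm" "A' \<in> ?B" "proj_class A = proj_class A'" by blast
   then have "A' \<noteq> 0" by (simp add: herm_iff)
   from proj_class_eqD[OF A(3) this] obtain r where "r \<noteq> 0" "A' = r *\<^sub>R A" by blast
   then show "A \<in> (\<Union>r\<in>- {0}. ?S r)" using A by auto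
  next
   fix A assume "A \<in> (\<Union>r\<in>- {0}. ?S r)"
   then obtain r where r: "r \<noteq> 0" "A \<in> herm" "r *\<^sub>R A \<in> ball M (1 / real (Suc n))" by blast
   then have "r *\<^sub>R A \<in> ?B" using herm_scaleR by blast
   moreover have "proj_class A = proj_class (r *\<^sub>R A)" by (rule proj_class_scaleR[OF r(1), symmetric])
   ultimately show "A \<in> {A \<in> herm. proj_class A \<in> proj_class ` ?B}" using r(2) by blast
  qed
  have "openin (top_of_set herm) (?S r)" for r
  proof -
   have "open ((\<lambda>A. r *\<^sub>R A) -` ball M (1 / real (Suc n)))"
    by (rule open_vimage[OF open_ball]) (intro continuous_intros)
   moreover have "?S r = herm \<inter> ((\<lambda>A. r *\<^sub>R A) -` ball M (1 / real (Suc n)))" by auto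
   ultimately show ?thesis by (simp only: openin_open_Int)
  qed
  then have "openin (top_of_set herm) (\<Union>r\<in>- {0}. ?S r)" by (intro openin_Union) blast
  then have op: "openin proj_hermitian_top (proj_class ` ?B)"
   unfolding proj_top openin_quotient_topology using eq by auto
  have mem: "p \<in> proj_class ` ?B" unfolding M(2) by (rule imageI) (simp add: M(1))
  from p[unfolded in_closure_of, THEN conjunct2, rule_format, OF conjI, OF mem op]
  obtain y where y: "y \<in> satake_embedding \<tau> ` (lcosets K)" "y \<in> proj_class ` ?B" by (elim exE conjE)
  obtain x where x1: "x \<in> lcosets K" "y = satake_embedding \<tau> x" using y(1) by (rule imageE)
  obtain A' where "y = proj_class A'" "A' \<in> ?B" using y(2) by (rule imageE)
  with x1 have x: "x \<in> lcosets K" "satake_embedding \<tau> x = proj_class A'" "A' \<in> ?B" by simp_all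
  obtain A where A: "of_matrix A = Mx x" "satake_embedding \<tau> x = proj_class A" by (rule satake_embedding_eq[OF x(1)])
  have "A' \<noteq> 0" using x(3) by (simp add: herm_iff)
  with x(2) A(2) proj_class_eqD[of A A'] obtain r where r: "r \<noteq> 0" "A' = r *\<^sub>R A" by auto
  have "to_matrix (Mx x) = A" unfolding A(1)[symmetric] by simp
  then show ?thesis using x(1,3) r by (intro exI[of _ x] exI[of _ r]) (simp add: dist_norm norm_minus_commute)
 qed
 then obtain x r where x: "\<And>n. x n \<in> lcosets K" "\<And>n. r n \<noteq> 0"
  and close: "\<And>n. norm (r n *\<^sub>R to_matrix (Mx (x n)) - M) < 1 / real (Suc n)" by metis
 have "(\<lambda>n. r n *\<^sub>R to_matrix (Mx (x n)) - M) \<longlonglongrightarrow> 0" by (rule Lim_null_comparison[OF _ LIMSEQ_inverse_real_of_nat])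
   (use close in \<open>auto intro!: always_eventually less_imp_le simp: inverse_eq_divide\<close>)
 then have "(\<lambda>n. r n *\<^sub>R to_matrix (Mx (x n))) \<longlonglongrightarrow> M" by (rule LIM_zero_cancel)
 from bounded_linear.tendsto[OF bounded_linear_of_matrix this]
 have "(\<lambda>n. r n *\<^sub>R of_matrix (to_matrix (Mx (x n)))) \<longlonglongrightarrow> of_matrix M" by (simp add: of_matrix_simps)
 moreover have "of_matrix (to_matrix (Mx (x n))) = Mx (x n)" for n
 proof -
  obtain A where "of_matrix A = Mx (x n)" by (rule satake_embedding_eq[OF x(1)])
  then show ?thesis by (metis to_matrix_of_matrix)
 qed
 ultimately have lim: "(\<lambda>n. r n *\<^sub>R Mx (x n)) \<longlonglongrightarrow> of_matrix M" by simp
 have M0: "of_matrix M \<noteq> 0" "adj (of_matrix M) = of_matrix M" using M(1) by (simp_all add: herm_iff of_matrix_eq_0)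
 \<comment> \<open>An eigenvector with nonzero eigenvalue detects the sign: \<open>Mx (x n)\<close>
   is positive definite, so \<open>r n\<close> eventually has the sign of \<open>c\<close>.\<close>
 from M0(2) obtain w c where w: "norm w = 1" "app (of_matrix M) w = c *\<^sub>R w" "\<bar>c\<bar> = norm (of_matrix M)"
  by (rule symmetric_norm_eigenvector)
 have c0: "c \<noteq> 0" using w(3) M0(1) by auto
 have "(\<lambda>n. w \<bullet> app (r n *\<^sub>R Mx (x n)) w) \<longlonglongrightarrow> w \<bullet> app (of_matrix M) w" by (intro tendsto_intros lim)
 moreover have "w \<bullet> app (of_matrix M) w = c" using w by (simp add: dot_square_norm)
 ultimately have "(\<lambda>n. sgn c * (w \<bullet> app (r n *\<^sub>R Mx (x n)) w)) \<longlonglongrightarrow> sgn c * c" by (intro tendsto_intros) simp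
 then have ev: "\<forall>\<^sub>F n in sequentially. sgn c * (w \<bullet> app (r n *\<^sub>R Mx (x n)) w) > 0"
  by (rule order_tendstoD) (use c0 in \<open>simp add: sgn_if\<close>)
 have "w \<noteq> 0" using w(1) by auto
 have evr: "\<forall>\<^sub>F n in sequentially. (sgn c / norm (of_matrix M)) *\<^sub>R r n *\<^sub>R Mx (x n) = (\<bar>r n\<bar> / norm (of_matrix M)) *\<^sub>R Mx (x n)"
  using ev
 proof eventually_elim
  case (elim n)
  have "w \<bullet> app (Mx (x n)) w > 0" by (rule Mx_pos[OF x(1) \<open>w \<noteq> 0\<close>])
  with elim have "sgn c * r n > 0" by (simp add: zero_less_mult_iff mult_less_0_iff)
  then have "sgn c * r n = \<bar>r n\<bar>" using c0 by (cases "c > 0") (auto simp: sgn_if)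
  then show ?case by simp
 qed
 let ?s = "sgn c / norm (of_matrix M)"
 have s0: "?s \<noteq> 0" using c0 M0(1) by (simp add: sgn_if)
 have "(\<lambda>n. ?s *\<^sub>R r n *\<^sub>R Mx (x n)) \<longlonglongrightarrow> ?s *\<^sub>R of_matrix M" by (intro tendsto_intros lim)
 then have "(\<lambda>n. (\<bar>r n\<bar> / norm (of_matrix M)) *\<^sub>R Mx (x n)) \<longlonglongrightarrow> of_matrix (?s *\<^sub>R M)"
  unfolding of_matrix_simps using tendsto_cong[OF evr] by blast
 then have "CL (of_matrix (?s *\<^sub>R M))" unfolding CL_def using x M0(1) s0
  by (intro conjI exI[of _ x] exI[of _ "\<lambda>n. \<bar>r n\<bar> / norm (of_matrix M)"]) (simp_all add: of_matrix_simps)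
 moreover have "norm (of_matrix (?s *\<^sub>R M)) = 1" using c0 M0(1) by (simp add: of_matrix_simps abs_sgn_eq)
 ultimately show ?thesis
  using that[of "?s *\<^sub>R M"] herm_scaleR[OF M(1) s0] M(2) proj_class_scaleR[OF s0, of M, symmetric] by simp
qed

text \<open>With representatives of norm 1 the normalising term vanishes, so equal functions have
  equal norms \<open>norm (N * A * adj N)\<close> for all lifts, and \<open>same_norms_eq\<close>
  applies.\<close>

lemma inj_Phi: "inj_on Phi (proj_hermitian_top closure_of (satake_embedding \<tau> ` (lcosets K)))"
proof (rule inj_onI)
 fix p q assume p: "p \<in> proj_hermitian_top closure_of (satake_embedding \<tau> ` (lcosets K))"
  and q: "q \<in> proj_hermitian_top closure_of (satake_embedding \<tau> ` (lcosets K))" and eq: "Phi p = Phi q"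
 obtain A where A: "A \<in> herm" "p = proj_class A" "CL (of_matrix A)" "norm (of_matrix A) = 1" by (rule closure_CL[OF p])
 obtain B where B: "B \<in> herm" "q = proj_class B" "CL (of_matrix B)" "norm (of_matrix B) = 1" by (rule closure_CL[OF q])
 have A0: "A \<noteq> 0" "of_matrix A \<noteq> 0" and B0: "B \<noteq> 0" "of_matrix B \<noteq> 0"
  using A(1) B(1) by (simp_all add: herm_iff of_matrix_eq_0)
 have "same_norms (of_matrix A) (of_matrix B)" unfolding same_norms_def
 proof (intro ballI)
  fix g N assume g: "g \<in> carrier G" and N: "N \<in> H g"
  have ig: "inv g \<in> carrier G" "N \<in> H (inv (inv g))" using g N by simp_all
  have "Psi (of_matrix A) (inv g <# K) = Psi (of_matrix B) (inv g <# K)"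
   using fun_cong[OF eq, of "inv g <# K"] lcosets_in[OF ig(1)]
   unfolding A(2) B(2) Phi_class[OF A0(1)] Phi_class[OF B0(1)] by simp
  then have "ln (norm (N * of_matrix A * adj N)) = ln (norm (N * of_matrix B * adj N))"
   unfolding Psi_eq[OF ig] by (simp add: A(4) B(4))
  then show "norm (N * of_matrix A * adj N) = norm (N * of_matrix B * adj N)"
   using H_conj_nonzero[OF g N A0(2)] H_conj_nonzero[OF g N B0(2)] by (simp add: ln_inj_iff)
 qed
 from same_norms_eq[OF A(3) B(3) this] show "p = q" by (simp add: A(2) B(2))
qed

lemma satake_action_class:
 assumes g: "g \<in> carrier G" and M: "M \<in> herm"
 obtains M' where "M' \<in> herm" "satake_action \<tau> g (proj_class M) = proj_class M'"
  "\<exists>N\<in>H g. of_matrix M' = N * of_matrix M * adj N"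
proof -
 obtain N where "N \<in> H g" using H_nonempty[OF g] by blast
 then obtain N0 where N0: "N0 \<in> \<tau> g" "of_matrix N0 \<in> H g" by (auto simp: H_def)
 let ?M' = "N0 ** M ** ctransp N0"
 have om: "of_matrix (N' ** A ** ctransp N') = of_matrix N' * of_matrix A * adj (of_matrix N')" for N' A :: "'n cmat"
  by (simp add: of_matrix_mult of_matrix_ctransp)
 have act: "N' ** (r *\<^sub>R M) ** ctransp N' = r *\<^sub>R ?M'" if N': "N' \<in> \<tau> g" for N' r
 proof -
  have "of_matrix N' \<in> H g" using N' by (simp add: H_def)
  then obtain z where z: "z \<in> cen" "of_matrix N' = z * of_matrix N0" using H_coset[OF g N0(2)] by blast
  have "of_matrix (N' ** (r *\<^sub>R M) ** ctransp N') = r *\<^sub>R (z * of_matrix ?M' * adj z)"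
   by (simp add: om z(2) of_matrix_simps mult.assoc)
  also have "z * of_matrix ?M' * adj z = of_matrix ?M' * (z * adj z)" by (simp only: cen_commute[OF z(1)] mult.assoc)
  finally have "of_matrix (N' ** (r *\<^sub>R M) ** ctransp N') = of_matrix (r *\<^sub>R ?M')"
   using cen_unitary(2)[OF z(1)] by (simp add: of_matrix_simps)
  then show ?thesis by simp
 qed
 have "satake_action \<tau> g (proj_class M) = proj_class ?M'" unfolding satake_action_def proj_class_range
 proof (rule subset_antisym; rule subsetI)
  fix A assume "A \<in> (\<Union>N\<in>\<tau> g. (\<lambda>M. N ** M ** ctransp N) ` range (\<lambda>r. r *\<^sub>R M))"
  then obtain N' r where "N' \<in> \<tau> g" "A = N' ** (r *\<^sub>R M) ** ctransp N'" by blast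
  then show "A \<in> range (\<lambda>r. r *\<^sub>R ?M')" by (intro image_eqI[of _ _ r]) (simp_all add: act)
 next
  fix A assume "A \<in> range (\<lambda>r. r *\<^sub>R ?M')"
  then obtain r where "A = r *\<^sub>R ?M'" by blast
  then have "A = N0 ** (r *\<^sub>R M) ** ctransp N0" using act[OF N0(1)] by simp
  then show "A \<in> (\<Union>N\<in>\<tau> g. (\<lambda>M. N ** M ** ctransp N) ` range (\<lambda>r. r *\<^sub>R M))" using N0(1) by blast
 qed
 moreover have "?M' \<in> herm"
 proof -
  have "of_matrix M \<noteq> 0" "adj (of_matrix M) = of_matrix M" using M by (simp_all add: herm_iff of_matrix_eq_0)
  then have "of_matrix ?M' \<noteq> 0" "adj (of_matrix ?M') = of_matrix ?M'"
   unfolding om using H_conj_nonzero[OF g N0(2)] by (auto simp: mult.assoc)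
  then show ?thesis by (simp add: herm_iff of_matrix_eq_0)
 qed
 ultimately show ?thesis using that N0(2) om by blast
qed

context
 fixes F
 assumes F: "invariant_finsler_metric G K F" "finsler_unit_ball G K \<aa> F = {Y \<in> \<aa>. rmax (T Y) \<le> 1}"
begin

lemma norm_H_pos: "g \<in> carrier G \<Longrightarrow> N \<in> H g \<Longrightarrow> norm N > 0" using H_conj_nonzero[of g N 1] by auto

lemma dist_base: "g \<in> carrier G \<Longrightarrow> N \<in> H g \<Longrightarrow> finsler_dist G K F K (g <# K) = ln (norm N)"
 using finsler_dist_eq[OF F one_closed, of g N] by (simp add: one_coset)

text \<open>For \<open>A = Mx z\<close> the conjugate of \<open>A\<close> by \<open>rep x\<close>
  has the form \<open>B * adj B\<close> with \<open>ln (norm B)\<close> the distance from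
  \<open>x\<close> to \<open>z\<close>; by the C*-identity the 1/2 in \<open>Psi\<close> undoes the
  square.\<close>

lemma Phi_embedding:
 assumes z: "z \<in> lcosets K"
 shows "Phi (satake_embedding \<tau> z) = horo_embedding G K (finsler_dist G K F) z"
proof -
 obtain M where M: "M \<in> herm" "of_matrix M = Mx z" "satake_embedding \<tau> z = proj_class M" by (rule satake_embedding_eq[OF z])
 obtain g where g: "g \<in> carrier G" "z = g <# K" using z lcosets_iff by blast
 obtain N where N: "N \<in> H g" using H_nonempty[OF g(1)] by blast
 have Mz: "Mx z = N * adj N" using Mx[OF g(1) N] g(2) by simp
 have "Psi (Mx z) x = finsler_dist G K F x z - finsler_dist G K F K z" if x: "x \<in> lcosets K" for x
 proof -
  obtain h L where h: "h \<in> carrier G" "x = h <# K" "rep x \<in> H (inv h)" by (rule rep_H[OF x])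
  have A: "rep x * N \<in> H (inv h \<otimes> g)" by (rule H_mult[OF inv_closed[OF h(1)] g(1) h(3) N])
  have "rep x * Mx z * adj (rep x) = (rep x * N) * adj (rep x * N)" by (simp add: Mz mult.assoc)
  then have "norm (rep x * Mx z * adj (rep x)) = (norm (rep x * N))\<^sup>2" by (simp only: norm_mult_adj)
  moreover have "norm (Mx z) = (norm N)\<^sup>2" by (simp add: Mz norm_mult_adj)
  moreover have "finsler_dist G K F x z = ln (norm (rep x * N))" using finsler_dist_eq[OF F h(1) g(1) A] h(2) g(2) by simp
  moreover have "finsler_dist G K F K z = ln (norm N)" using dist_base[OF g(1) N] g(2) by simp
  moreover have "norm N > 0" "norm (rep x * N) > 0" using norm_H_pos[OF g(1) N] norm_H_pos[OF _ A] h(1) g(1) by simp_all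
  ultimately show ?thesis by (simp add: Psi_def ln_realpow diff_divide_distrib)
 qed
 moreover have "M \<noteq> 0" using M(1) by (simp add: herm_iff)
 ultimately show ?thesis unfolding M(3) Phi_class[OF \<open>M \<noteq> 0\<close>] M(2) horo_embedding_def by (intro restrict_ext) blast
qed

text \<open>The two distances between \<open>x\<close> and the base point are the logarithms of the
  norms of a lift and of its inverse. Hence the condition number of the lift is at most
  \<open>exp r\<close>, and conjugation changes ratios of norms by at most its square.\<close>

lemma rep_distortion:
 assumes x: "x \<in> lcosets K" and r: "finsler_dist G K F K x + finsler_dist G K F x K \<le> r"
 shows "norm (rep x * A * adj (rep x)) * norm B \<le> exp (2 * r) * norm A * norm (rep x * B * adj (rep x))"
proof -
 obtain g N where g: "g \<in> carrier G" "x = g <# K" "N \<in> H g" "rep x * N = 1" "N * rep x = 1" "rep x \<in> H (inv g)"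
  by (rule rep_H[OF x])
 have "finsler_dist G K F x K = ln (norm (rep x))"
  using finsler_dist_eq[OF F g(1) one_closed, of "rep x"] g by (simp add: one_coset)
 then have "ln (norm N) + ln (norm (rep x)) \<le> r" using r dist_base[OF g(1,3)] g(2) by simp
 moreover have pos: "norm N > 0" "norm (rep x) > 0" using norm_H_pos[OF g(1,3)] norm_H_pos[OF _ g(6)] g(1) by simp_all
 ultimately have "ln (norm N * norm (rep x)) \<le> r" by (simp add: ln_mult)
 then have "exp (ln (norm N * norm (rep x))) \<le> exp r" by simp
 then have le: "norm N * norm (rep x) \<le> exp r" using mult_pos_pos[OF pos] by simp
 have sub: "norm (C * D * adj C) \<le> (norm C)\<^sup>2 * norm D" for C D :: "(complex^'n) endo"
 proof -
  have "norm (C * D * adj C) \<le> norm (C * D) * norm (adj C)" by (rule norm_mult_ineq)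
  also have "\<dots> \<le> (norm C * norm D) * norm C" by (simp add: mult_right_mono norm_mult_ineq)
  finally show ?thesis by (simp add: power2_eq_square mult_ac)
 qed
 let ?X = "\<lambda>A. rep x * A * adj (rep x)"
 have "N * ?X B * adj N = B" by (rule H_conj_inverse[OF g(5)])
 then have "norm B \<le> (norm N)\<^sup>2 * norm (?X B)" using sub[of N "?X B"] by simp
 then have "norm (?X A) * norm B \<le> ((norm (rep x))\<^sup>2 * norm A) * ((norm N)\<^sup>2 * norm (?X B))"
  by (intro mult_mono sub) auto
 also have "\<dots> = (norm N * norm (rep x))\<^sup>2 * norm A * norm (?X B)" by (simp add: power_mult_distrib mult_ac)
 also have "\<dots> \<le> (exp r)\<^sup>2 * norm A * norm (?X B)" by (intro mult_right_mono power_mono le) auto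
 also have "(exp r)\<^sup>2 = exp (2 * r)" by (simp add: exp_double)
 finally show ?thesis .
qed

text \<open>Both logarithms in \<open>Psi\<close> are estimated relatively: the summand 1 in the
  hypothesis serves \<open>norm A\<close>, and the summand \<open>exp (2 * r)\<close> serves the
  conjugated norm through \<open>rep_distortion\<close>. The bound depends on \<open>x\<close> only
  through \<open>r\<close>, which gives uniformity on bounded sets.\<close>

lemma Psi_close:
 assumes x: "x \<in> lcosets K" and r: "finsler_dist G K F K x + finsler_dist G K F x K \<le> r"
  and B: "B \<noteq> 0" and \<eta>: "\<eta> \<le> 1 / 2" and le: "(1 + exp (2 * r)) * norm (A - B) \<le> \<eta> * norm B"
 shows "\<bar>Psi A x - Psi B x\<bar> \<le> 2 * \<eta>"
proof -
 let ?X = "\<lambda>A. rep x * A * adj (rep x)"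
 have nB: "norm B > 0" using B by simp
 have e: "norm (A - B) \<le> \<eta> * norm B" "exp (2 * r) * norm (A - B) \<le> \<eta> * norm B"
 proof -
  have "0 \<le> exp (2 * r) * norm (A - B)" "0 \<le> norm (A - B)" by simp_all
  then show "norm (A - B) \<le> \<eta> * norm B" "exp (2 * r) * norm (A - B) \<le> \<eta> * norm B"
   using le by (simp_all only: distrib_right mult_1_left)
 qed
 have "\<bar>norm A - norm B\<bar> \<le> \<eta> * norm B" using norm_triangle_ineq3[of A B] e(1) by linarith
 from ln_diff_le(2)[OF nB this \<eta>] have 1: "\<bar>ln (norm A) - ln (norm B)\<bar> \<le> 2 * \<eta>" .
 have X: "?X A - ?X B = ?X (A - B)" by (simp add: left_diff_distrib right_diff_distrib)
 have "norm (?X (A - B)) * norm B \<le> (exp (2 * r) * norm (A - B)) * norm (?X B)" by (rule rep_distortion[OF x r])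
 also have "\<dots> \<le> (\<eta> * norm B) * norm (?X B)" by (rule mult_right_mono[OF e(2)]) simp
 finally have "norm (?X (A - B)) * norm B \<le> (\<eta> * norm (?X B)) * norm B" by (simp add: mult_ac)
 then have "norm (?X (A - B)) \<le> \<eta> * norm (?X B)" using nB by (rule mult_right_le_imp_le)
 then have "\<bar>norm (?X A) - norm (?X B)\<bar> \<le> \<eta> * norm (?X B)"
  using norm_triangle_ineq3[of "?X A" "?X B"] unfolding X by linarith
 from ln_diff_le(2)[OF rep_nonzero[OF x B] this \<eta>] have 2: "\<bar>ln (norm (?X A)) - ln (norm (?X B))\<bar> \<le> 2 * \<eta>" .
 have "\<bar>(c - a) / 2 - (d - b) / 2\<bar> \<le> 2 * \<eta>" if "\<bar>a - b\<bar> \<le> 2 * \<eta>" "\<bar>c - d\<bar> \<le> 2 * \<eta>" for a b c d :: real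
 proof -
  have "\<bar>(c - d) - (a - b)\<bar> \<le> \<bar>c - d\<bar> + \<bar>a - b\<bar>" by (rule abs_triangle_ineq4)
  then have "\<bar>((c - d) - (a - b)) / 2\<bar> \<le> 2 * \<eta>" using that by (simp only: abs_divide) simp
  then show ?thesis by (simp add: diff_divide_distrib)
 qed
 from this[OF 1 2] show ?thesis by (simp only: Psi_def)
qed

lemma Phi_continuous:
 "continuous_map proj_hermitian_top (bounded_convergence_topology (sym_top G K) (finsler_dist G K F) K) Phi"
 unfolding proj_top
proof (rule continuous_map_from_quotient)
 let ?T = "bounded_convergence_topology (sym_top G K) (finsler_dist G K F) K"
 have Ph: "Phi (proj_class M) = restrict (Psi (of_matrix M)) (lcosets K)" "of_matrix M \<noteq> 0" if "M \<in> herm" for M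
  using that Phi_class by (simp_all add: herm_iff of_matrix_eq_0)
 obtain b where b: "b > 0" "\<And>M :: 'n cmat. norm (of_matrix M) \<le> norm M * b"
  using bounded_linear.pos_bounded[OF bounded_linear_of_matrix] by blast
 show "continuous_map (top_of_set herm) ?T (\<lambda>M. Phi (proj_class M))"
  unfolding continuous_map_def topspace_bounded_convergence
 proof (intro conjI allI impI)
  show "(\<lambda>M. Phi (proj_class M)) \<in> topspace (top_of_set herm) \<rightarrow> pointed_functions (sym_top G K) K"
   using Ph Psi_pointed by auto
  fix U assume U: "openin ?T U"
  show "openin (top_of_set herm) {M \<in> topspace (top_of_set herm). Phi (proj_class M) \<in> U}"
   unfolding openin_contains_ball
  proof (intro conjI ballI)
   fix M0 assume "M0 \<in> {M \<in> topspace (top_of_set herm). Phi (proj_class M) \<in> U}"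
   then have M0: "M0 \<in> herm" "Phi (proj_class M0) \<in> U" by auto
   from U M0(2) obtain Q \<epsilon> where Q: "Q \<subseteq> topspace (sym_top G K)" "sym_bounded (finsler_dist G K F) K Q" "\<epsilon> > 0"
    "{h \<in> pointed_functions (sym_top G K) K. \<forall>x\<in>Q. \<bar>h x - Phi (proj_class M0) x\<bar> < \<epsilon>} \<subseteq> U"
    unfolding openin_bounded_convergence_topology by blast
   obtain r where r: "\<And>x. x \<in> Q \<Longrightarrow> finsler_dist G K F K x + finsler_dist G K F x K \<le> r"
    using Q(2) unfolding sym_bounded_def by blast
   define \<eta> where "\<eta> = min (1 / 2) (\<epsilon> / 4)"
   have \<eta>: "\<eta> > 0" "\<eta> \<le> 1 / 2" "2 * \<eta> < \<epsilon>" using Q(3) by (auto simp: \<eta>_def min_def)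
   let ?k = "1 + exp (2 * r)"
   have k: "?k > 0" by (simp add: add_pos_pos)
   \<comment> \<open>\<open>b\<close> bounds \<open>of_matrix\<close>; thus
     \<open>norm (M - M0) < \<delta>\<close> yields the hypothesis of
     \<open>Psi_close\<close>.\<close>
   define \<delta> where "\<delta> = \<eta> * norm (of_matrix M0) / (?k * b)"
   have "\<delta> > 0" using \<eta>(1) k b(1) Ph(2)[OF M0(1)] by (simp add: \<delta>_def)
   moreover have "ball M0 \<delta> \<inter> herm \<subseteq> {M \<in> topspace (top_of_set herm). Phi (proj_class M) \<in> U}"
   proof
    fix M assume "M \<in> ball M0 \<delta> \<inter> herm"
    then have M: "norm (M - M0) < \<delta>" "M \<in> herm" by (auto simp: dist_norm norm_minus_commute)
    have "norm (of_matrix M - of_matrix M0) \<le> norm (M - M0) * b" using b(2)[of "M - M0"] by (simp add: of_matrix_simps)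
    also have "\<dots> \<le> \<delta> * b" using M(1) b(1) by simp
    finally have "?k * norm (of_matrix M - of_matrix M0) \<le> ?k * (\<delta> * b)" using k by simp
    also have "?k * (\<delta> * b) = \<eta> * norm (of_matrix M0)" using k b(1) by (simp add: \<delta>_def)
    finally have le: "?k * norm (of_matrix M - of_matrix M0) \<le> \<eta> * norm (of_matrix M0)" .
    have "\<bar>Phi (proj_class M) x - Phi (proj_class M0) x\<bar> < \<epsilon>" if x: "x \<in> Q" for x
    proof -
     have xl: "x \<in> lcosets K" using x Q(1) topspace_sym_top by blast
     have "\<bar>Psi (of_matrix M) x - Psi (of_matrix M0) x\<bar> \<le> 2 * \<eta>"
      by (rule Psi_close[OF xl r[OF x] Ph(2)[OF M0(1)] \<eta>(2) le])
     then show ?thesis using \<eta>(3) xl unfolding Ph(1)[OF M(2)] Ph(1)[OF M0(1)] by simp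
    qed
    moreover have "Phi (proj_class M) \<in> pointed_functions (sym_top G K) K"
     unfolding Ph(1)[OF M(2)] by (rule Psi_pointed[OF Ph(2)[OF M(2)]])
    ultimately have "Phi (proj_class M) \<in> U" using Q(4) by blast
    then show "M \<in> {M \<in> topspace (top_of_set herm). Phi (proj_class M) \<in> U}" using M(2) by simp
   qed
   ultimately show "\<exists>e>0. ball M0 e \<inter> herm \<subseteq> {M \<in> topspace (top_of_set herm). Phi (proj_class M) \<in> U}" by blast
  qed auto
 qed
qed

text \<open>\<open>Phi\<close> is a continuous injection of a compact space into a Hausdorff space,
  hence a homeomorphism onto its image. The image is closed and contains the embedded
  \<open>X\<close>, and continuity keeps it inside the closure, so it is the whole horofunction
  compactification.\<close>

theorem compactifications_isomorphic:
 "equivariantly_isomorphic G (lcosets K)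
   (satake_compactification G K \<tau>) (satake_embedding \<tau>) (satake_action \<tau>)
   (horo_compactification G K (finsler_dist G K F))
   (horo_embedding G K (finsler_dist G K F)) (horo_action G K)"
proof -
 let ?P = "proj_hermitian_top :: 'n cmat set topology" and ?T = "bounded_convergence_topology (sym_top G K) (finsler_dist G K F) K"
 let ?s = "satake_embedding \<tau>" and ?h = "horo_embedding G K (finsler_dist G K F)" and ?X = "lcosets K"
 let ?C = "?P closure_of (?s ` ?X)" and ?C' = "?T closure_of (?h ` ?X)"
 have img: "Phi ` ?s ` ?X = ?h ` ?X" unfolding image_image by (rule image_cong[OF refl Phi_embedding])
 have CP: "?C \<subseteq> topspace ?P" by (rule closure_of_subset_topspace)
 have sC: "?s ` ?X \<subseteq> ?C"
 proof (rule closure_of_subset, rule image_subsetI)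
  fix x assume "x \<in> ?X"
  then obtain M where "M \<in> herm" "?s x = proj_class M" by (rule satake_embedding_eq)
  then show "?s x \<in> topspace ?P" by (simp add: topspace_proj)
 qed
 have cC: "compactin ?P ?C" by (rule closedin_compact_space[OF compact_proj closedin_closure_of])
 have sub: "Phi ` ?C \<subseteq> ?C'" using continuous_map_image_closure_subset[OF Phi_continuous, of "?s ` ?X"] unfolding img .
 have "closedin ?T (Phi ` ?C)"
  by (rule compactin_imp_closedin[OF Hausdorff_bounded_convergence image_compactin[OF cC Phi_continuous]])
 moreover have "?h ` ?X \<subseteq> Phi ` ?C" using image_mono[OF sC, of Phi] unfolding img .
 ultimately have onto: "Phi ` ?C = ?C'" using closure_of_minimal sub by blast
 have tC: "topspace (subtopology ?P ?C) = ?C" by (rule topspace_subtopology_subset[OF CP])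
 have tC': "topspace (subtopology ?T ?C') = ?C'" by (rule topspace_subtopology_subset[OF closure_of_subset_topspace])
 have "homeomorphic_map (subtopology ?P ?C) (subtopology ?T ?C') Phi"
 proof (rule continuous_imp_homeomorphic_map)
  show "continuous_map (subtopology ?P ?C) (subtopology ?T ?C') Phi"
   by (rule continuous_map_into_subtopology[OF continuous_map_from_subtopology[OF Phi_continuous]])
    (use sub tC in auto)
  show "compact_space (subtopology ?P ?C)" by (rule compact_space_subtopology[OF cC])
  show "Hausdorff_space (subtopology ?T ?C')" by (rule Hausdorff_space_subtopology[OF Hausdorff_bounded_convergence])
  show "Phi ` topspace (subtopology ?P ?C) = topspace (subtopology ?T ?C')" unfolding tC tC' by (rule onto)
  show "inj_on Phi (topspace (subtopology ?P ?C))" unfolding tC by (rule inj_Phi)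
 qed
 moreover have "Phi (satake_action \<tau> g c) = horo_action G K g (Phi c)" if g: "g \<in> carrier G" and c: "c \<in> ?C" for g c
 proof -
  have "c \<in> proj_class ` herm" using subsetD[OF CP c] by (simp only: topspace_proj)
  then obtain M where M: "M \<in> herm" "c = proj_class M" by blast
  obtain M' where M': "M' \<in> herm" "satake_action \<tau> g (proj_class M) = proj_class M'"
   "\<exists>N\<in>H g. of_matrix M' = N * of_matrix M * adj N" by (rule satake_action_class[OF g M(1)])
  obtain N where N: "N \<in> H g" "of_matrix M' = N * of_matrix M * adj N" using M'(3) by blast
  have nz: "M \<noteq> 0" "M' \<noteq> 0" "of_matrix M \<noteq> 0" using M(1) M'(1) by (simp_all add: herm_iff of_matrix_eq_0)
  have ig: "inv g \<in> carrier G" using g by simp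
  have Kl: "K \<in> ?X" using lcosets_in[OF one_closed] by (simp add: one_coset)
  show ?thesis unfolding M(2) M'(2) Phi_class[OF nz(1)] Phi_class[OF nz(2)] horo_action_def
  proof (rule restrict_ext)
   fix x assume x: "x \<in> ?X"
   show "Psi (of_matrix M') x = restrict (Psi (of_matrix M)) ?X (inv g <# x) -
     restrict (Psi (of_matrix M)) ?X (inv g <# K)"
    using Psi_translate[OF g N(1) nz(3) x] translate_lcosets[OF ig x] translate_lcosets[OF ig Kl] by (simp add: N(2))
  qed
 qed
 ultimately show ?thesis
  unfolding equivariantly_isomorphic_def satake_compactification_def horo_compactification_def Let_def
  using Phi_embedding tC by (intro exI[of _ Phi]) simp
qed

end

end

theorem theorem1p1:
  fixes G :: "('g, 'e::euclidean_space) lie_struct"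
    and K :: "'g set" and \<theta> :: "'g \<Rightarrow> 'g" and \<aa> :: "'e set"
    and \<tau> :: "'g \<Rightarrow> (complex^'n^'n) set"
    and D :: "('e \<Rightarrow> real) set" and B :: "'e set"
  assumes "noncompact_symmetric_space G K \<theta> \<aa>"
    and "faithful_projective_rep G \<tau>"
    and "cartan_compatible G \<theta> \<tau>"
    and "D = dual_convex_hull \<aa> (weights G \<aa> \<tau>)"
    and "B = uminus ` polar \<aa> D"
  shows "polytope B \<and>
    (\<exists>F. invariant_finsler_metric G K F \<and> finsler_unit_ball G K \<aa> F = B) \<and>
    (\<forall>F. invariant_finsler_metric G K F \<and> finsler_unit_ball G K \<aa> F = B \<longrightarrow>
       equivariantly_isomorphic G (lcosets\<^bsub>G\<^esub> K)
         (satake_compactification G K \<tau>) (satake_embedding \<tau>) (satake_action \<tau>)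
         (horo_compactification G K (finsler_dist G K F))
         (horo_embedding G K (finsler_dist G K F)) (horo_action G K))"
proof -
  interpret satake_data G K \<theta> \<aa> \<tau> by (rule satake_data.intro[OF assms(1-3)])
  show ?thesis
  proof (rule exp_map)
    fix T r0 C0 \<alpha>
    assume T: "bounded_linear T" "inj T" "r0 > 0" "C0 \<ge> 0"
      "\<And>x. norm x \<le> r0 \<Longrightarrow> x \<in> Wc \<and> (\<exists>N\<in>H (from_coord G x). norm (N - 1 - T x) \<le> C0 * (norm x)\<^sup>2)"
      "\<And>Y. norm Y \<le> r0 \<Longrightarrow> \<alpha> Y \<in> Wc \<and> norm (\<alpha> Y - Y) \<le> C0 * (norm Y)\<^sup>2 \<and> exp (T Y) \<in> H (from_coord G (\<alpha> Y))"
      "continuous_on (cball 0 r0) \<alpha>"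
    interpret satake_exp G K \<theta> \<aa> \<tau> T r0 C0 \<alpha>
      by (rule satake_exp.intro[OF satake_data_axioms satake_exp_axioms.intro[OF T]])
    \<comment> \<open>The image of \<open>\<aa>\<close> under \<open>T\<close> is a commuting family
      of symmetric operators; its joint eigenbasis \<open>S\<close> is what the last locale
      requires.\<close>
    have sym: "adj A = A" if "A \<in> T ` \<aa>" for A using that a_symmetric by auto
    have comm: "A * A' = A' * A" if "A \<in> T ` \<aa>" "A' \<in> T ` \<aa>" for A A' using that a_commute by auto
    show ?thesis
    proof (rule commuting_symmetric_joint_eigenbasis[OF sym comm])
      fix S assume S: "onb S" "\<And>A b. A \<in> T ` \<aa> \<Longrightarrow> b \<in> S \<Longrightarrow> \<exists>r. app A b = r *\<^sub>R b"
      interpret satake_basis G K \<theta> \<aa> \<tau> T r0 C0 \<alpha> S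
        by (rule satake_basis.intro[OF satake_exp_axioms satake_basis_axioms.intro[OF S(1) S(2)[OF imageI]]])
      have B: "B = {Y \<in> \<aa>. rmax (T Y) \<le> 1}" unfolding assms(4,5) by (rule dual_ball_eq)
      show ?thesis
        unfolding B
        using polytope_dual_ball rmax_metric_invariant rmax_metric_unit_ball compactifications_isomorphic
        by (intro conjI exI[of _ rmax_metric] allI impI) (elim conjE | assumption)+
    qed
  qed
qed

end
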